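(* Let $n\ge 2$ and let $\mathfrak{B}I_n$ be the dihedral Artin braid group, with two generators $g_1,g_2$ and $m_{1,2}=n$. Then every (oriented) diagram for $\mathfrak{B}I_n$ is homotopic to the empty diagram.
   Context: Group. $\mathfrak{B}I_n$ is the group with generators $g_1,g_2$ and the single relation $g_1g_2g_1\cdots=g_2g_1g_2\cdots$ ($n$ letters on each side). The color blue is assigned to $g_1$ and green to $g_2$. Diagrams. A diagram for $\mathfrak{B}I_n$ is a finite oriented planar graph (multiple edges allowed), together with finitely many disjoint embedded oriented circles (closed edges without vertices), drawn in the plane and considered up to planar isotopy, such that every edge and circle is colored blue or green, and every vertex has degree $2n$, with incident edges alternating cyclically between blue and green, $n$ cyclically consecutive edges pointing out of the vertex and the other $n$ consecutive edges pointing into the vertex. The empty diagram has no vertices, edges or circles. Homotopy. Two diagrams are homotopic if one can be transformed into the other by finitely many of the following moves and their inverses, each replacing the part of the diagram inside a closed disc and leaving the rest unchanged. (1) Circle relation: remove an oriented circle of any color and orientation whose interior is empty. (2) Directed bridge relation: if the disc meets the diagram in exactly two disjoint oriented arcs of the same color, replace them by the other pair of disjoint arcs joining the same four boundary points, provided that the orientations at the four boundary points extend consistently to the new arcs. (3) Directed cancellation of pairs: the picture consisting of $n$ strands of alternating colors entering from the bottom into a vertex of degree $2n$, whose $n$ upper edges are exactly the $n$ lower edges of a second vertex of degree $2n$, from which $n$ strands leave at the top, with all edges oriented upwards (or all edges oriented downwards), may be replaced by $n$ parallel vertical strands with the same orientation (for either choice of the leftmost color). (For general braid groups there are additional relations attached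 to triples of generators; there are none for $\mathfrak{B}I_n$.) *)

theory Defs
  imports "HOL-Analysis.Analysis"
begin

text \<open>
  The plane is the type of complex numbers. Diagrams are only considered up to planar isotopy, so
  they are drawn with polygonal edges: a drawing is a set of directed, coloured straight segments
  \<open>(p, q, c)\<close>, running from \<open>p\<close> to \<open>q\<close>. An edge or an oriented circle is a maximal chain of segments
  through bivalent corner points; which corner points are used on it is immaterial
  (see \<open>subdivides\<close>).
\<close>

datatype colour = Blue | Green

fun other :: "colour \<Rightarrow> colour" where
  "other Blue = Green"
| "other Green = Blue"

definition alternate :: "colour \<Rightarrow> nat \<Rightarrow> colour" where
  "alternate c i = (if even i then c else other c)"

type_synonym segment = "complex \<times> complex \<times> colour"

definition support :: "segment set \<Rightarrow> complex set" where
  "support T = (\<Union>(p, q, c)\<in>T. closed_segment p q)"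

definition segments_at :: "segment set \<Rightarrow> complex \<Rightarrow> segment set" where
  "segments_at T v = {(p, q, c) \<in> T. p = v \<or> q = v}"


subsection \<open>Diagrams\<close>

definition corner_at :: "segment set \<Rightarrow> complex \<Rightarrow> bool" where
  "corner_at T v \<longleftrightarrow> (\<exists>a b c. segments_at T v = {(a, v, c), (v, b, c)})"

text \<open>
  \<open>\<theta> 0 < \<theta> 1 < \<dots> < \<theta> (2 * n - 1) < \<theta> 0 + 2 * pi\<close> are the directions of the segments at \<open>v\<close> in
  counterclockwise order, numbered from the first of the \<open>n\<close> consecutive outgoing ones.
\<close>

definition vertex_at :: "nat \<Rightarrow> segment set \<Rightarrow> complex \<Rightarrow> bool" where
  "vertex_at n T v \<longleftrightarrow>
     (\<exists>c \<theta> r. strict_mono_on {..<2 * n} \<theta> \<and> (\<forall>i<2 * n. \<theta> i < \<theta> 0 + 2 * pi) \<and>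
        (\<forall>i<2 * n. r i > (0::real)) \<and>
        segments_at T v =
          (\<lambda>i. (v, v + rcis (r i) (\<theta> i), alternate c i)) ` {..<n} \<union>
          (\<lambda>i. (v + rcis (r i) (\<theta> i), v, alternate c i)) ` {n..<2 * n})"

definition diagram :: "nat \<Rightarrow> segment set \<Rightarrow> bool" where
  "diagram n T \<longleftrightarrow>
     finite T \<and>
     (\<forall>(p, q, c)\<in>T. p \<noteq> q) \<and>
     (\<forall>(p, q, c)\<in>T. \<forall>(p', q', c')\<in>T. (p, q, c) \<noteq> (p', q', c') \<longrightarrow>
        closed_segment p q \<inter> closed_segment p' q' \<subseteq> {p, q} \<inter> {p', q'}) \<and>
     (\<forall>(p, q, c)\<in>T. \<forall>v\<in>{p, q}. corner_at T v \<or> vertex_at n T v)"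


subsection \<open>Planar isotopy\<close>

definition subdivides :: "segment set \<Rightarrow> segment set \<Rightarrow> bool" where
  "subdivides T T' \<longleftrightarrow>
     (\<exists>p q c r. (p, q, c) \<in> T \<and> r \<in> open_segment p q \<and>
        T' = (T - {(p, q, c)}) \<union> {(p, r, c), (r, q, c)})"

definition ambient_isotopy :: "(real \<Rightarrow> complex \<Rightarrow> complex) \<Rightarrow> bool" where
  "ambient_isotopy H \<longleftrightarrow>
     continuous_on ({0..1} \<times> UNIV) (\<lambda>(t, z). H t z) \<and>
     (\<forall>t\<in>{0..1}. \<exists>g. homeomorphism UNIV UNIV (H t) g) \<and>
     H 0 = id"

text \<open>
  If the final homeomorphism of an ambient isotopy carries one drawing to another one, it carries
  segments to segments once both drawings have been subdivided at the corner points of the other.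
\<close>

definition isotopic :: "segment set \<Rightarrow> segment set \<Rightarrow> bool" where
  "isotopic T T' \<longleftrightarrow>
     (\<exists>H. ambient_isotopy H \<and>
        (\<forall>(p, q, c)\<in>T. H 1 ` closed_segment p q = closed_segment (H 1 p) (H 1 q)) \<and>
        T' = (\<lambda>(p, q, c). (H 1 p, H 1 q, c)) ` T)"


subsection \<open>The moves\<close>

text \<open>
  The moves below are only applied to diagrams, so that arcs and circles do not cross themselves.
\<close>

definition oriented_circle :: "segment set \<Rightarrow> bool" where
  "oriented_circle C \<longleftrightarrow>
     (\<exists>xs c. length xs \<ge> 3 \<and> distinct xs \<and>
        C = (\<lambda>i. (xs ! i, xs ! (Suc i mod length xs), c)) ` {..<length xs})"

definition oriented_arc :: "colour \<Rightarrow> segment set \<Rightarrow> complex \<Rightarrow> complex \<Rightarrow> bool" where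
  "oriented_arc c A a b \<longleftrightarrow>
     (\<exists>xs. length xs \<ge> 2 \<and> distinct xs \<and> hd xs = a \<and> last xs = b \<and>
        A = (\<lambda>i. (xs ! i, xs ! Suc i, c)) ` {..<length xs - 1})"

definition circle_move :: "segment set \<Rightarrow> segment set \<Rightarrow> bool" where
  "circle_move T T' \<longleftrightarrow>
     (\<exists>C. oriented_circle C \<and> T = T' \<union> C \<and>
        support T' \<inter> (support C \<union> inside (support C)) = {})"

text \<open>
  \<open>A\<close> is the part of \<open>T\<close> inside the closed disc \<open>S\<close>, \<open>B\<close> that of \<open>T'\<close>, and \<open>P\<close> is the set of points
  where either of them meets the boundary of the disc.
\<close>

definition replaces_in_disc ::
  "complex set \<Rightarrow> complex set \<Rightarrow> segment set \<Rightarrow> segment set \<Rightarrow> segment set \<Rightarrow> segment set \<Rightarrow> bool" where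
  "replaces_in_disc S P A B T T' \<longleftrightarrow>
     S homeomorphic (cball 0 1 :: complex set) \<and>
     support A \<subseteq> S \<and> support A \<inter> frontier S = P \<and>
     support B \<subseteq> S \<and> support B \<inter> frontier S = P \<and>
     (\<exists>R. T = R \<union> A \<and> T' = R \<union> B \<and> support R \<inter> S \<subseteq> P)"

text \<open>
  The arcs \<open>a \<rightarrow> b\<close> and \<open>a' \<rightarrow> b'\<close> become \<open>a \<rightarrow> b'\<close> and \<open>a' \<rightarrow> b\<close>, the only other pairing in which
  each new arc runs from a point where the diagram enters the disc to one where it leaves it.
\<close>

definition bridge_move :: "segment set \<Rightarrow> segment set \<Rightarrow> bool" where
  "bridge_move T T' \<longleftrightarrow>
     (\<exists>S c a b a' b' A A' B B'.
        replaces_in_disc S {a, b, a', b'} (A \<union> A') (B \<union> B') T T' \<and>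
        oriented_arc c A a b \<and> oriented_arc c A' a' b' \<and> support A \<inter> support A' = {} \<and>
        oriented_arc c B a b' \<and> oriented_arc c B' a' b \<and> support B \<inter> support B' = {})"

text \<open>
  \<open>E 0 i\<close>, \<open>E 1 i\<close>, \<open>E 2 i\<close> (for \<open>i < n\<close>) are the edges entering the vertex \<open>v\<close> from the boundary, the
  edges from \<open>v\<close> to the vertex \<open>w\<close>, and the edges leaving \<open>w\<close>; \<open>F i\<close> are the parallel strands that
  replace them. No order needs to be prescribed on the edges: the arcs lie in a disc and are disjoint
  apart from \<open>v\<close> and \<open>w\<close>, so that in the boundary of the disc the points \<open>x i\<close> form one block and the
  points \<open>y i\<close> the other, and the disjoint strands necessarily join them from left to right. For
  the same reason the pictures with all edges upwards and with all edges downwards are both covered.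
\<close>

definition cancellation_move :: "nat \<Rightarrow> segment set \<Rightarrow> segment set \<Rightarrow> bool" where
  "cancellation_move n T T' \<longleftrightarrow>
     (\<exists>S c v w x y E F.
        replaces_in_disc S (x ` {..<n} \<union> y ` {..<n})
          (\<Union>k<3::nat. \<Union>i<n. E k i) (\<Union>i<n. F i) T T' \<and>
        v \<in> interior S \<and> w \<in> interior S \<and> v \<noteq> w \<and> vertex_at n T v \<and> vertex_at n T w \<and>
        (\<forall>i<n. oriented_arc (alternate c i) (E 0 i) (x i) v \<and>
               oriented_arc (alternate c (Suc i)) (E 1 i) v w \<and>
               oriented_arc (alternate c i) (E 2 i) w (y i) \<and>
               oriented_arc (alternate c i) (F i) (x i) (y i)) \<and>
        disjoint_family_on (\<lambda>(k, i). support (E k i) - {v, w}) ({..<3} \<times> {..<n}) \<and>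
        disjoint_family_on (\<lambda>i. support (F i)) {..<n})"

definition elementary_step :: "nat \<Rightarrow> segment set \<Rightarrow> segment set \<Rightarrow> bool" where
  "elementary_step n T T' \<longleftrightarrow>
     diagram n T \<and> diagram n T' \<and>
     (subdivides T T' \<or> isotopic T T' \<or>
      circle_move T T' \<or> bridge_move T T' \<or> cancellation_move n T T')"

definition homotopic_diagrams :: "nat \<Rightarrow> segment set \<Rightarrow> segment set \<Rightarrow> bool" where
  "homotopic_diagrams n = equivclp (elementary_step n)"

end

theory Submission
  imports Defs "HOL-Real_Asymp.Real_Asymp"
begin

text \<open>
  Add up, over all segments \<open>(p, q, c)\<close>, the angles \<open>Arg ((q - z) / (p - z))\<close> under which they are
  seen from \<open>z\<close>. As many segments enter a point as leave it, so away from the end points the sum is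
  a multiple of \<open>2 * pi\<close>; hence it is constant along every edge, and one obtains an integer height of
  the edge. At a vertex the outgoing edges have the heights \<open>h + 1, \<dots>, h + n\<close> and the incoming ones
  \<open>h + n, \<dots>, h + 1\<close>, in counterclockwise order. If the first outgoing edge of \<open>v\<close> is as low as possible,
  it must therefore reach a vertex \<open>w\<close> as its last incoming edge, and \<open>w \<noteq> v\<close> because of the colours.
  After this edge has been shrunk to a straight segment, \<open>n - 1\<close> bridges parallel to it join the
  remaining outgoing edges of \<open>v\<close> to incoming edges of \<open>w\<close>, and \<open>v\<close> and \<open>w\<close> cancel. A diagram without
  vertices consists of disjoint circles, and an innermost one can be removed.
\<close>

subsection \<open>Stars of segments\<close>

text \<open>Off the drawing the angle sum is \<open>2 * pi\<close> times a winding number; on a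
  segment it takes the value of the left-hand side. Hence heights rise counterclockwise across
  outgoing edges and fall across incoming ones. The first outgoing edge of \<open>w\<close> is not
  lower than the edge arriving there, and only the last incoming edge of \<open>w\<close> is as low
  as that. The common edge is first at \<open>v\<close> and last at \<open>w\<close>, so mirrored
  positions at the two vertices carry equal colours. Such a pair of edges crosses a parallel to the
  common edge in opposite directions, which is what a directed bridge needs. The obstacle is that an
  isotopy must carry straight segments to straight segments. Two kinds suffice: dragging one vertex
  inside a convex set while its spokes follow linearly, and similarities of the plane. So an edge is
  not straightened at once; its first vertex travels along it and absorbs one corner at a time. Most
  of the convex sets are thin lenses, whose chords touch the boundary only in their ends. Cuts and
  bridges create no vertices and dragging exchanges one for one, so the number of vertices drives
  the induction.\<close>

definition seg :: "segment \<Rightarrow> complex set" where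
  "seg s = closed_segment (fst s) (fst (snd s))"

definition ends :: "segment \<Rightarrow> complex set" where
  "ends s = {fst s, fst (snd s)}"

definition pts :: "segment set \<Rightarrow> complex set" where
  "pts T = (\<Union>s\<in>T. ends s)"

lemma seg_simp [simp]: "seg (p, q, c) = closed_segment p q"
  by (simp add: seg_def)

lemma ends_simp [simp]: "ends (p, q, c) = {p, q}"
  by (simp add: ends_def)

lemma ends_subset_seg: "ends s \<subseteq> seg s"
  by (auto simp: ends_def seg_def)

lemma compact_seg [simp]: "compact (seg s)" and closed_seg [simp]: "closed (seg s)"
  by (auto simp: seg_def)

lemma support_eq_seg: "support T = (\<Union>s\<in>T. seg s)"
  by (force simp: support_def)

lemma segments_at_eq: "segments_at T x = {s \<in> T. x \<in> ends s}"
  by (force simp: segments_at_def)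

lemma diagram_iff:
  "diagram n T \<longleftrightarrow> finite T \<and> (\<forall>s\<in>T. fst s \<noteq> fst (snd s)) \<and>
     (\<forall>s\<in>T. \<forall>s'\<in>T. s \<noteq> s' \<longrightarrow> seg s \<inter> seg s' \<subseteq> ends s \<inter> ends s') \<and>
     (\<forall>x\<in>pts T. corner_at T x \<or> vertex_at n T x)"
proof -
  have "(\<forall>(p, q, c)\<in>T. P p q c) \<longleftrightarrow> (\<forall>s\<in>T. P (fst s) (fst (snd s)) (snd (snd s)))" for P
    by (auto simp: split_beta)
  then show ?thesis
    unfolding diagram_def pts_def seg_def ends_def
    by (simp add: split_beta) (smt (verit, ccfv_threshold) UN_E UN_I insert_iff prod.collapse singletonD)
qed

lemma diagram_finite: "diagram n T \<Longrightarrow> finite T"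
  and diagram_nondeg: "diagram n T \<Longrightarrow> s \<in> T \<Longrightarrow> fst s \<noteq> fst (snd s)"
  and diagram_cross: "diagram n T \<Longrightarrow> s \<in> T \<Longrightarrow> s' \<in> T \<Longrightarrow> s \<noteq> s' \<Longrightarrow>
    seg s \<inter> seg s' \<subseteq> ends s \<inter> ends s'"
  and diagram_pts: "diagram n T \<Longrightarrow> x \<in> pts T \<Longrightarrow> corner_at T x \<or> vertex_at n T x"
  by (auto simp: diagram_iff)

text \<open>The geometric half of \<open>vertex_at\<close>. The radii are arbitrary, so only the
  cyclic order of the rays counts, and the far ends may be moved along their rays.\<close>

definition ccw :: "nat \<Rightarrow> complex \<Rightarrow> (nat \<Rightarrow> complex) \<Rightarrow> bool" where
  "ccw m x y \<longleftrightarrow>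
     (\<exists>\<theta> r. strict_mono_on {..<m} \<theta> \<and> (\<forall>i<m. \<theta> i < \<theta> 0 + 2 * pi) \<and>
        (\<forall>i<m. r i > (0::real)) \<and> (\<forall>i<m. y i = x + rcis (r i) (\<theta> i)))"

definition spoke :: "nat \<Rightarrow> complex \<Rightarrow> colour \<Rightarrow> (nat \<Rightarrow> complex) \<Rightarrow> nat \<Rightarrow> segment" where
  "spoke n x c y i = (if i < n then (x, y i, alternate c i) else (y i, x, alternate c i))"

text \<open>\<open>vertex_at\<close> with its witnesses made explicit: later statements have to say
  which numbered spoke is cut, moved or shared with another vertex.\<close>

definition spokes :: "nat \<Rightarrow> segment set \<Rightarrow> complex \<Rightarrow> colour \<Rightarrow> (nat \<Rightarrow> complex) \<Rightarrow> bool" where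
  "spokes n T x c y \<longleftrightarrow> ccw (2 * n) x y \<and> segments_at T x = spoke n x c y ` {..<2 * n}"

definition verts :: "nat \<Rightarrow> segment set \<Rightarrow> complex set" where
  "verts n T = {x. vertex_at n T x}"

lemma spoke_image_split:
  "spoke n x c y ` {..<2 * n} =
     (\<lambda>i. (x, y i, alternate c i)) ` {..<n} \<union> (\<lambda>i. (y i, x, alternate c i)) ` {n..<2 * n}"
proof -
  have "{..<2 * n} = {..<n} \<union> {n..<2 * n}" by auto
  then have "spoke n x c y ` {..<2 * n} = spoke n x c y ` {..<n} \<union> spoke n x c y ` {n..<2 * n}"
    by (simp only: image_Un)
  also have "\<dots> = (\<lambda>i. (x, y i, alternate c i)) ` {..<n} \<union> (\<lambda>i. (y i, x, alternate c i)) ` {n..<2 * n}"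
    by (intro arg_cong2[where f="(\<union>)"] image_cong) (auto simp: spoke_def)
  finally show ?thesis .
qed

lemma vertex_at_iff: "vertex_at n T x \<longleftrightarrow> (\<exists>c y. spokes n T x c y)"
proof
  assume "vertex_at n T x"
  then obtain c \<theta> r where *: "strict_mono_on {..<2 * n} \<theta>" "\<forall>i<2 * n. \<theta> i < \<theta> 0 + 2 * pi"
    "\<forall>i<2 * n. r i > (0::real)" "segments_at T x =
          (\<lambda>i. (x, x + rcis (r i) (\<theta> i), alternate c i)) ` {..<n} \<union>
          (\<lambda>i. (x + rcis (r i) (\<theta> i), x, alternate c i)) ` {n..<2 * n}"
    unfolding vertex_at_def by blast
  then have "spokes n T x c (\<lambda>i. x + rcis (r i) (\<theta> i))"
    unfolding spokes_def ccw_def spoke_image_split by blast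
  then show "\<exists>c y. spokes n T x c y" by blast
next
  assume "\<exists>c y. spokes n T x c y"
  then obtain c y \<theta> r where *: "strict_mono_on {..<2 * n} \<theta>" "\<forall>i<2 * n. \<theta> i < \<theta> 0 + 2 * pi"
    "\<forall>i<2 * n. r i > (0::real)" "\<forall>i<2 * n. y i = x + rcis (r i) (\<theta> i)"
    "segments_at T x = spoke n x c y ` {..<2 * n}"
    unfolding spokes_def ccw_def by blast
  have "segments_at T x =
          (\<lambda>i. (x, x + rcis (r i) (\<theta> i), alternate c i)) ` {..<n} \<union>
          (\<lambda>i. (x + rcis (r i) (\<theta> i), x, alternate c i)) ` {n..<2 * n}"
    unfolding *(5) spoke_image_split using *(4) by (intro arg_cong2[where f="(\<union>)"] image_cong) auto
  with * show "vertex_at n T x" unfolding vertex_at_def by blast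
qed

lemma rcis_eq_scaleD:
  assumes "rcis r a = of_real s * rcis r' b" "r > 0" "r' > 0" "s > 0"
  shows "cis a = cis b"
proof -
  have "r = s * r'" using arg_cong[OF assms(1), of norm] assms(2-4) by (simp add: norm_mult)
  then have "of_real r * cis a = of_real r * cis b" using assms(1) by (simp add: rcis_def)
  then show ?thesis using assms(2) by simp
qed

lemma cis_eq_iff: "cis a = cis b \<longleftrightarrow> (\<exists>k::int. a = b + 2 * pi * k)"
  unfolding sin_cos_eq_iff[of a b, symmetric] complex_eq_iff cis.sel by blast

lemma ccw_ne: "ccw m x y \<Longrightarrow> i < m \<Longrightarrow> y i \<noteq> x"
  unfolding ccw_def by (metis add_cancel_left_right less_irrefl rcis_eq_zero_iff)

text \<open>The arguments of a star differ by less than \<open>2 * pi\<close>, so two of them with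
  the same \<open>cis\<close> would be equal, against strict monotonicity.\<close>

lemma ccw_rays:
  assumes "ccw m x y" "i < m" "j < m" "i \<noteq> j" "s > 0"
  shows "y i - x \<noteq> of_real s * (y j - x)"
proof
  assume eq: "y i - x = of_real s * (y j - x)"
  from assms(1) obtain \<theta> r where *: "strict_mono_on {..<m} \<theta>" "\<forall>i<m. \<theta> i < \<theta> 0 + 2 * pi"
    "\<forall>i<m. r i > (0::real)" "\<forall>i<m. y i = x + rcis (r i) (\<theta> i)"
    unfolding ccw_def by blast
  have "rcis (r i) (\<theta> i) = of_real s * rcis (r j) (\<theta> j)" using eq * assms by auto
  then have "cis (\<theta> i) = cis (\<theta> j)" using rcis_eq_scaleD * assms by blast
  then obtain k :: int where k: "\<theta> i = \<theta> j + 2 * pi * k" by (auto simp: cis_eq_iff)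
  have mono: "\<theta> a < \<theta> b" if "a < b" "b < m" for a b
    using *(1) that by (auto simp: strict_mono_on_def)
  have le0: "\<theta> 0 \<le> \<theta> a" if "a < m" for a using mono[of 0 a] that by (cases "a = 0") auto
  have "\<theta> i \<noteq> \<theta> j" using mono[of i j] mono[of j i] assms by (metis less_irrefl linorder_neqE_nat)
  moreover have "\<bar>\<theta> i - \<theta> j\<bar> < 2 * pi" using le0[of i] le0[of j] *(2) assms(2,3) by (smt (verit))
  then have "\<bar>real_of_int k\<bar> * (2 * pi) < 1 * (2 * pi)" using k by (simp add: abs_mult)
  then have "\<bar>real_of_int k\<bar> < 1" using mult_less_cancel_right_pos[of "2 * pi"] pi_gt_zero by simp
  then have "k = 0" by linarith
  ultimately show False using k by simp
qed

lemma ccw_inj: "ccw m x y \<Longrightarrow> inj_on y {..<m}"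
proof (rule inj_onI)
  fix i j assume "ccw m x y" "i \<in> {..<m}" "j \<in> {..<m}" "y i = y j"
  then show "i = j" using ccw_rays[of m x y i j 1] by (cases "i = j") auto
qed

lemma ccw_scale:
  assumes "ccw m x y" "\<And>i. i < m \<Longrightarrow> \<exists>s>0. y' i - x = of_real s * (y i - x)"
  shows "ccw m x y'"
proof -
  from assms(1) obtain \<theta> r where *: "strict_mono_on {..<m} \<theta>" "\<forall>i<m. \<theta> i < \<theta> 0 + 2 * pi"
    "\<forall>i<m. r i > (0::real)" "\<forall>i<m. y i = x + rcis (r i) (\<theta> i)"
    unfolding ccw_def by blast
  obtain s where s: "\<And>i. i < m \<Longrightarrow> s i > 0 \<and> y' i - x = of_real (s i) * (y i - x)"
    using assms(2) by metis
  have "\<forall>i<m. y' i = x + rcis (s i * r i) (\<theta> i)"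
    using s * by (auto simp: rcis_def algebra_simps)
  then show ?thesis unfolding ccw_def using * s by (intro exI[of _ \<theta>] exI[of _ "\<lambda>i. s i * r i"]) auto
qed

lemma ccw_cong: "ccw m x y \<Longrightarrow> (\<And>i. i < m \<Longrightarrow> y' i = y i) \<Longrightarrow> ccw m x y'"
  by (rule ccw_scale) (auto intro!: exI[of _ 1])

lemma ccw_affine:
  assumes "ccw m x y" "\<alpha> \<noteq> 0"
  shows "ccw m (\<alpha> * x + \<beta>) (\<lambda>i. \<alpha> * y i + \<beta>)"
proof -
  from assms(1) obtain \<theta> r where *: "strict_mono_on {..<m} \<theta>" "\<forall>i<m. \<theta> i < \<theta> 0 + 2 * pi"
    "\<forall>i<m. r i > (0::real)" "\<forall>i<m. y i = x + rcis (r i) (\<theta> i)"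
    unfolding ccw_def by blast
  have "\<alpha> = rcis (norm \<alpha>) (Arg \<alpha>)" by (simp add: rcis_cmod_Arg)
  then have "\<alpha> * rcis a b = rcis (norm \<alpha> * a) (Arg \<alpha> + b)" for a b by (metis rcis_mult)
  then have "\<forall>i<m. \<alpha> * y i + \<beta> = \<alpha> * x + \<beta> + rcis (norm \<alpha> * r i) (Arg \<alpha> + \<theta> i)"
    using * by (simp add: algebra_simps)
  then show ?thesis unfolding ccw_def using * assms(2)
    by (intro exI[of _ "\<lambda>i. Arg \<alpha> + \<theta> i"] exI[of _ "\<lambda>i. norm \<alpha> * r i"])
      (auto simp: strict_mono_on_def)
qed

text \<open>The arguments of the rays vary continuously and never coincide, so their cyclic order is preserved.\<close>

lemma ccw_motion:
  fixes x :: "real \<Rightarrow> complex" and y :: "real \<Rightarrow> nat \<Rightarrow> complex"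
  assumes "ccw m (x 0) (y 0)" "continuous_on {0..1} x"
    and "\<And>i. i < m \<Longrightarrow> continuous_on {0..1} (\<lambda>t. y t i)"
    and ne: "\<And>t i. t \<in> {0..1} \<Longrightarrow> i < m \<Longrightarrow> y t i \<noteq> x t"
    and rays: "\<And>t i j s. t \<in> {0..1} \<Longrightarrow> i < m \<Longrightarrow> j < m \<Longrightarrow> i \<noteq> j \<Longrightarrow> s > 0 \<Longrightarrow>
      y t i - x t \<noteq> of_real s * (y t j - x t)"
  shows "ccw m (x 1) (y 1)"
proof -
  from assms(1) obtain \<theta> r where *: "strict_mono_on {..<m} \<theta>" "\<forall>i<m. \<theta> i < \<theta> 0 + 2 * pi"
    "\<forall>i<m. r i > (0::real)" "\<forall>i<m. y 0 i = x 0 + rcis (r i) (\<theta> i)"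
    unfolding ccw_def by blast
  have "\<exists>g. continuous_on {0..1} g \<and> (\<forall>t\<in>{0..1}. y t i - x t = exp (g t)) \<and> Im (g 0) = \<theta> i"
    if i: "i < m" for i
  proof -
    \<comment> \<open>A path that avoids 0 has a continuous logarithm over the interval, and its
      imaginary part is a continuous choice of the argument.\<close>
    have "continuous_on {0..1} (\<lambda>t. y t i - x t)" using assms(2,3) i by (intro continuous_intros) auto
    moreover have "contractible {0..1::real}" by (simp add: convex_imp_contractible)
    moreover have "\<And>t. t \<in> {0..1} \<Longrightarrow> y t i - x t \<noteq> 0" using ne i by simp
    ultimately obtain g where g: "continuous_on {0..1} g" "\<And>t. t\<in>{0..1} \<Longrightarrow> y t i - x t = exp (g t)"
      by (rule continuous_logarithm_on_contractible) blast+
    \<comment> \<open>The logarithm is fixed only up to multiples of \<open>2 * pi * \<i>\<close>;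
      it is shifted so that its imaginary part starts at the given argument
      \<open>\<theta> i\<close>.\<close>
    have "rcis (r i) (\<theta> i) = exp (g 0)" using g(2)[of 0] * i by auto
    also have "\<dots> = rcis (exp (Re (g 0))) (Im (g 0))" by (simp add: exp_eq_polar rcis_def)
    finally have "cis (\<theta> i) = cis (Im (g 0))"
      using rcis_eq_scaleD[of "r i" "\<theta> i" 1 "exp (Re (g 0))" "Im (g 0)"] * i by simp
    then obtain k :: int where k: "\<theta> i = Im (g 0) + 2 * pi * k" by (auto simp: cis_eq_iff)
    have e: "exp (complex_of_real (2 * pi * k) * \<i>) = 1" 
      using exp_integer_2pi[of "of_int k"] by (simp add: mult_ac)
    show ?thesis
      by (rule exI[of _ "\<lambda>t. g t + complex_of_real (2 * pi * k) * \<i>"])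
        (use g k e in \<open>auto intro!: continuous_intros simp: exp_add simp del: of_real_mult\<close>)
  qed
  then obtain g where g: "\<And>i. i < m \<Longrightarrow> continuous_on {0..1} (g i)"
    "\<And>i t. i < m \<Longrightarrow> t\<in>{0..1} \<Longrightarrow> y t i - x t = exp (g i t)" "\<And>i. i < m \<Longrightarrow> Im (g i 0) = \<theta> i"
    by metis
  have le0: "\<theta> 0 \<le> \<theta> a" if "a < m" for a
    using *(1) that by (cases "a = 0") (auto simp: strict_mono_on_def less_imp_le)
  \<comment> \<open>Two rays coincide exactly when their arguments differ by a multiple of
    \<open>2 * pi\<close>, so by the intermediate value theorem the difference cannot leave the open
    interval in which it starts.\<close>
  have main: "Im (g j 1) - Im (g i 1) \<in> {0<..<2*pi}" if ij: "i < j" "j < m" for i j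
  proof -
    let ?d = "\<lambda>t. Im (g j t) - Im (g i t)"
    have cont: "continuous_on {0..1} ?d" using g(1) ij by (intro continuous_intros) auto
    have d0: "?d 0 \<in> {0<..<2*pi}" using strict_mono_onD[OF *(1), of i j] *(2)[rule_format, of j] g(3)[of i] g(3)[of j] ij le0[of i] by simp
    have no: "?d t \<noteq> 0 \<and> ?d t \<noteq> 2 * pi" if t: "t \<in> {0..1}" for t
    proof -
      have "cis (Im (g j t)) \<noteq> cis (Im (g i t))"
      proof
        assume e: "cis (Im (g j t)) = cis (Im (g i t))"
        have "y t j - x t = of_real (exp (Re (g j t) - Re (g i t))) * (y t i - x t)"
          using g(2)[of j t] g(2)[of i t] ij t e
          by (simp add: exp_eq_polar[of "g _ _"] exp_diff flip: exp_of_real)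
        then show False using rays[OF t, of j i] ij by auto
      qed
      moreover have "Im (g j t) = Im (g i t) + 2 * pi \<Longrightarrow> cis (Im (g j t)) = cis (Im (g i t))"
        by (simp flip: cis_mult)
      ultimately show ?thesis by (auto simp: algebra_simps)
    qed
    show ?thesis
    proof (rule ccontr)
      assume "?d 1 \<notin> {0<..<2*pi}"
      then consider "?d 1 \<le> 0" | "?d 1 \<ge> 2 * pi" by force
      then show False
      proof cases
        case 1
        then obtain t where "0 \<le> t" "t \<le> 1" "?d t = 0" using IVT2'[of ?d 1 0 0] cont d0 by force
        then show False using no[of t] by auto
      next
        case 2
        then obtain t where "0 \<le> t" "t \<le> 1" "?d t = 2 * pi" using IVT'[of ?d 0 "2*pi" 1] cont d0 by force
        then show False using no[of t] by auto
      qed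
    qed
  qed
  have "strict_mono_on {..<m} (\<lambda>i. Im (g i 1))" using main by (auto simp: strict_mono_on_def)
  moreover have "\<forall>i<m. Im (g i 1) < Im (g 0 1) + 2 * pi" 
  proof (intro allI impI)
    fix i assume "i < m"
    then show "Im (g i 1) < Im (g 0 1) + 2 * pi" using main[of 0 i] by (cases "i = 0") auto
  qed
  moreover have "y 1 i = x 1 + rcis (exp (Re (g i 1))) (Im (g i 1))" if "i < m" for i
    using g(2)[of i 1] that by (simp add: exp_eq_polar rcis_def algebra_simps)
  ultimately show ?thesis unfolding ccw_def
    by (intro exI[of _ "\<lambda>i. Im (g i 1)"] exI[of _ "\<lambda>i. exp (Re (g i 1))"]) auto
qed

lemma card_spokes:
  assumes "spokes n T x c y" shows "card (segments_at T x) = 2 * n"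
proof -
  have "inj_on (spoke n x c y) {..<2 * n}"
  proof (rule inj_onI)
    fix i j assume ij: "i \<in> {..<2*n}" "j \<in> {..<2*n}" and e: "spoke n x c y i = spoke n x c y j"
    have "y i = y j" using e ccw_ne[of "2*n" x y] assms ij by (auto simp: spoke_def spokes_def split: if_splits)
    then show "i = j" using ccw_inj assms ij by (auto simp: spokes_def inj_on_def)
  qed
  then show ?thesis using assms by (simp add: spokes_def card_image)
qed

text \<open>Counting segments: a corner has at most two, a vertex has \<open>2 * n\<close>, which is
  at least four.\<close>

lemma corner_not_vertex:
  assumes "n \<ge> 2" "corner_at T x" shows "\<not> vertex_at n T x"
proof
  assume "vertex_at n T x"
  then have "card (segments_at T x) \<ge> 4" using card_spokes assms(1) by (auto simp: vertex_at_iff)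
  moreover obtain a b c where "segments_at T x = {(a, x, c), (x, b, c)}"
    using assms(2) by (auto simp: corner_at_def)
  then have "card (segments_at T x) \<le> 2" by (simp add: card_insert_if)
  ultimately show False by simp
qed

lemma verts_subset_pts: "n \<ge> 1 \<Longrightarrow> verts n T \<subseteq> pts T"
proof
  fix x assume "n \<ge> 1" "x \<in> verts n T"
  then obtain c y where s: "spokes n T x c y" by (auto simp: verts_def vertex_at_iff)
  then have "spoke n x c y 0 \<in> segments_at T x" using \<open>n \<ge> 1\<close> by (auto simp: spokes_def)
  then show "x \<in> pts T" by (auto simp: segments_at_eq pts_def)
qed

lemma finite_pts: "finite T \<Longrightarrow> finite (pts T)"
  by (auto simp: pts_def ends_def)

subsection \<open>Subdivision and removal of corner points\<close>

lemma homotopic_refl: "homotopic_diagrams n T T"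
  by (simp add: homotopic_diagrams_def)

lemma homotopic_sym: "homotopic_diagrams n T T' \<Longrightarrow> homotopic_diagrams n T' T"
  by (simp add: homotopic_diagrams_def equivclp_sym)

lemma homotopic_trans:
  "homotopic_diagrams n T T' \<Longrightarrow> homotopic_diagrams n T' T'' \<Longrightarrow> homotopic_diagrams n T T''"
  unfolding homotopic_diagrams_def by (rule equivclp_trans)

lemma homotopic_step: "elementary_step n T T' \<Longrightarrow> homotopic_diagrams n T T'"
  by (simp add: homotopic_diagrams_def r_into_equivclp)

lemma segments_at_Un: "segments_at (A \<union> B) x = segments_at A x \<union> segments_at B x"
  and segments_at_Diff: "segments_at (A - B) x = segments_at A x - B"
  and segments_at_insert: "segments_at (insert s A) x = (if x \<in> ends s then {s} else {}) \<union> segments_at A x"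
  and segments_at_empty: "segments_at {} x = {}"
  by (auto simp: segments_at_eq)

lemmas segments_at_simps = segments_at_Un segments_at_Diff segments_at_insert segments_at_empty

text \<open>The common way to carry a star over to a changed drawing: if the change acts on the
  segments at the vertex by a map that respects number and colour of each spoke, only the order of
  the new far ends remains to be checked.\<close>

lemma spokes_image:
  assumes "spokes n T x c y" "segments_at T' x' = F ` segments_at T x"
    "\<And>i. i < 2 * n \<Longrightarrow> F (spoke n x c y i) = spoke n x' c y' i" "ccw (2 * n) x' y'"
  shows "spokes n T' x' c y'"
  using assms by (auto simp: spokes_def image_image intro!: image_cong)

lemma spokes_in:
  assumes "spokes n T x c y" "i < 2 * n"
  shows "spoke n x c y i \<in> T" "x \<in> ends (spoke n x c y i)"
  using assms by (auto simp: spokes_def segments_at_eq)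

lemma open_segment_facts:
  fixes p q r :: complex
  assumes "r \<in> open_segment p q"
  shows "closed_segment p r \<union> closed_segment r q = closed_segment p q"
    "closed_segment p r \<inter> closed_segment r q = {r}"
    "r \<noteq> p" "r \<noteq> q" "p \<noteq> q" "p \<notin> closed_segment r q" "q \<notin> closed_segment p r"
proof -
  have r: "r \<in> closed_segment p q" "r \<noteq> p" "r \<noteq> q" using assms by (auto simp: open_segment_def)
  show "closed_segment p r \<union> closed_segment r q = closed_segment p q"
    using Un_closed_segment r(1) by blast
  show i: "closed_segment p r \<inter> closed_segment r q = {r}" using Int_closed_segment r(1) by blast
  show "r \<noteq> p" "r \<noteq> q" using r by auto
  show "p \<noteq> q" using assms by auto
  show "p \<notin> closed_segment r q" "q \<notin> closed_segment p r" using i r by auto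
qed

lemma open_segment_scale:
  fixes x y r :: complex
  assumes "r \<in> open_segment x y"
  obtains s where "s > 0" "s < 1" "r - x = of_real s * (y - x)"
proof -
  obtain u where "0 < u" "u < 1" "r = (1 - u) *\<^sub>R x + u *\<^sub>R y" using assms by (auto simp: in_segment)
  then show ?thesis using that[of u] by (simp add: scaleR_conv_of_real algebra_simps)
qed

lemma vertsI: "spokes n T x c y \<Longrightarrow> x \<in> verts n T"
  by (auto simp: verts_def vertex_at_iff)

text \<open>A vertex of \<open>T'\<close> is not a corner, so it is the image of a point of
  \<open>T\<close> that is not a corner either, hence of a vertex. This reduces counting vertices to
  following corners.\<close>

lemma verts_subset:
  assumes n: "n \<ge> 2" and T: "diagram n T"
    and corner: "\<And>x. x \<in> pts T \<Longrightarrow> corner_at T x \<Longrightarrow> f x \<in> pts T' \<Longrightarrow> corner_at T' (f x)"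
    and new: "\<And>x. x \<in> pts T' \<Longrightarrow> x \<notin> f ` pts T \<Longrightarrow> corner_at T' x"
  shows "verts n T' \<subseteq> f ` verts n T"
proof
  fix x assume x: "x \<in> verts n T'"
  then have v: "vertex_at n T' x" by (simp add: verts_def)
  have xp: "x \<in> pts T'" using verts_subset_pts n x by (metis One_nat_def Suc_leD numeral_2_eq_2 subsetD)
  have "\<not> corner_at T' x" using corner_not_vertex n v by blast
  then obtain z where z: "z \<in> pts T" "x = f z" using new xp by blast
  then have "\<not> corner_at T z" using corner xp \<open>\<not> corner_at T' x\<close> by blast
  then have "vertex_at n T z" using diagram_pts T z by blast
  then show "x \<in> f ` verts n T" using z by (auto simp: verts_def)
qed

text \<open>Distinct segments meet only in common ends, so the new point lies on no other segment
  and becomes a corner. Elsewhere a star changes at most by shortening a spoke along its ray, which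
  leaves the cyclic order alone.\<close>

lemma cut:
  assumes n2: "n \<ge> 2" and T: "diagram n T" and s: "(p, q, d) \<in> T" and r: "r \<in> open_segment p q"
    and T'_def: "T' = (T - {(p, q, d)}) \<union> {(p, r, d), (r, q, d)}"
  shows diagram_cut: "diagram n T'"
    and step_cut: "homotopic_diagrams n T T'"
    and verts_cut: "verts n T' \<subseteq> verts n T"
    and spokes_cut: "\<And>x c y. spokes n T x c y \<Longrightarrow>
      spokes n T' x c (\<lambda>i. if spoke n x c y i = (p, q, d) then r else y i)"
    and segments_at_cut: "segments_at T' r = {(p, r, d), (r, q, d)}"
proof -
  note rf = open_segment_facts[OF r]
  have rnot: "r \<notin> ends s'" if "s' \<in> T" for s'
  proof
    assume "r \<in> ends s'"
    moreover have "r \<in> seg (p, q, d)" using rf(1,2) by auto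
    ultimately have "s' \<noteq> (p,q,d) \<longrightarrow> r \<in> {p, q}"
      using diagram_cross[OF T that s] ends_subset_seg[of s'] by auto
    then show False using rf \<open>r \<in> ends s'\<close> by auto
  qed
  then have rT: "r \<notin> pts T" by (auto simp: pts_def)
  \<comment> \<open>\<open>F x\<close> replaces the cut segment by the half that remains at its end
    \<open>x\<close>.\<close>
  define F where "F x u = (if u = (p, q, d) then if x = p then (p, r, d) else (r, q, d) else u)" for x u
  have at: "segments_at T' x = F x ` segments_at T x" if "x \<in> pts T" for x
  proof -
    have xr: "x \<noteq> r" using that rT by auto
    have "segments_at T' x = (segments_at T x - {(p,q,d)}) \<union> (if x = p then {(p,r,d)} else {}) \<union>
       (if x = q then {(r,q,d)} else {})"
      using xr rf(3-5) by (simp add: T'_def segments_at_simps Un_assoc)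
    also have "\<dots> = F x ` segments_at T x"
    proof (cases "x \<in> {p, q}")
      case True
      then have i: "segments_at T x = insert (p,q,d) (segments_at T x - {(p,q,d)})"
        using s by (auto simp: segments_at_eq)
      have "F x ` (segments_at T x - {(p,q,d)}) = segments_at T x - {(p,q,d)}"
        by (auto simp: F_def image_iff)
      then have "F x ` segments_at T x = insert (F x (p,q,d)) (segments_at T x - {(p,q,d)})"
        by (subst i) (simp only: image_insert)
      then show ?thesis using True rf by (auto simp: F_def)
    next
      case False
      then have "(p,q,d) \<notin> segments_at T x" by (auto simp: segments_at_eq)
      moreover from this have "F x ` segments_at T x = id ` segments_at T x"
        by (intro image_cong) (auto simp: F_def)
      ultimately show ?thesis using False by auto
    qed
    finally show ?thesis .
  qed
  have "segments_at T r = {}" using rnot by (auto simp: segments_at_eq)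
  then show sr: "segments_at T' r = {(p, r, d), (r, q, d)}"
    by (simp add: T'_def segments_at_simps insert_commute)
  then have cr: "corner_at T' r" unfolding corner_at_def by blast
  show sp: "spokes n T' x c (\<lambda>i. if spoke n x c y i = (p, q, d) then r else y i)"
    if sp: "spokes n T x c y" for x c y
  proof (rule spokes_image[OF sp])
    have ne: "x \<noteq> y i" if "i < 2 * n" for i using ccw_ne[of "2*n" x y i] sp that by (auto simp: spokes_def)
    have "x \<in> pts T" using spokes_in[OF sp, of 0] n2 by (auto simp: pts_def)
    then show "segments_at T' x = F x ` segments_at T x" by (rule at)
    show "F x (spoke n x c y i) = spoke n x c (\<lambda>i. if spoke n x c y i = (p, q, d) then r else y i) i"
      if "i < 2 * n" for i
      using ne[OF that] rf(5) by (cases "i < n") (simp_all add: F_def spoke_def)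
    show "ccw (2 * n) x (\<lambda>i. if spoke n x c y i = (p, q, d) then r else y i)"
    proof (rule ccw_scale)
      show "ccw (2 * n) x y" using sp by (simp add: spokes_def)
      fix i assume "i < 2 * n"
      show "\<exists>s>0. (if spoke n x c y i = (p, q, d) then r else y i) - x = complex_of_real s * (y i - x)"
      proof (cases "spoke n x c y i = (p, q, d)")
        case True
        then have "r \<in> open_segment x (y i)"
          using r by (auto simp: spoke_def open_segment_commute split: if_splits)
        then show ?thesis using True by (auto elim: open_segment_scale)
      qed (auto intro!: exI[of _ 1])
    qed
  qed
  have co: "corner_at T' x" if c: "corner_at T x" and x: "x \<in> pts T" for x
  proof -
    obtain a b c where abc: "segments_at T x = {(a, x, c), (x, b, c)}" using c by (auto simp: corner_at_def)
    then have "(a,x,c) \<in> T" "(x,b,c) \<in> T" by (auto simp: segments_at_eq)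
    then have "a \<noteq> x" "b \<noteq> x" using diagram_nondeg[OF T, of "(a,x,c)"] diagram_nondeg[OF T, of "(x,b,c)"] by auto
    then have "\<exists>a' b'. F x (a,x,c) = (a',x,c) \<and> F x (x,b,c) = (x,b',c)" using rf by (auto simp: F_def)
    then obtain a' b' where "F x (a,x,c) = (a',x,c)" "F x (x,b,c) = (x,b',c)" by blast
    then have "segments_at T' x = {(a', x, c), (x, b', c)}" unfolding at[OF x] abc by simp
    then show ?thesis unfolding corner_at_def by blast
  qed
  have pT': "pts T' \<subseteq> insert r (pts T)" using s by (force simp: pts_def T'_def)
  show "verts n T' \<subseteq> verts n T"
    using verts_subset[OF n2 T, of "\<lambda>x. x" T'] co cr pT' by auto
  have sub: "seg (p,r,d) \<subseteq> seg (p,q,d)" "seg (r,q,d) \<subseteq> seg (p,q,d)" using rf(1) by auto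
  have cross1: "seg s' \<inter> seg t \<subseteq> ends s' \<inter> ends t"
    if "s' \<in> T" "s' \<noteq> (p,q,d)" "t \<in> {(p,r,d),(r,q,d)}" for s' t
  proof
    fix x assume x: "x \<in> seg s' \<inter> seg t"
    then have "x \<in> ends s' \<inter> {p,q}" using diagram_cross[OF T that(1) s that(2)] sub that(3) by auto
    then show "x \<in> ends s' \<inter> ends t" using x that(3) rf by auto
  qed
  have cross2: "seg (p,r,d) \<inter> seg (r,q,d) \<subseteq> ends (p,r,d) \<inter> ends (r,q,d)" using rf by auto
  show D: "diagram n T'"
    unfolding diagram_iff
  proof (intro conjI ballI impI)
    show "finite T'" using T by (simp add: T'_def diagram_finite)
    show "fst s \<noteq> fst (snd s)" if "s \<in> T'" for s
      using that diagram_nondeg[OF T, of s] rf(3,4) by (auto simp: T'_def)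
    show "seg s1 \<inter> seg s2 \<subseteq> ends s1 \<inter> ends s2" if st: "s1 \<in> T'" "s2 \<in> T'" "s1 \<noteq> s2" for s1 s2
    proof -
      consider "s1 \<in> T - {(p,q,d)}" "s2 \<in> T - {(p,q,d)}" | "s1 \<in> T - {(p,q,d)}" "s2 \<in> {(p,r,d),(r,q,d)}"
        | "s2 \<in> T - {(p,q,d)}" "s1 \<in> {(p,r,d),(r,q,d)}" | "s1 \<in> {(p,r,d),(r,q,d)}" "s2 \<in> {(p,r,d),(r,q,d)}"
        using st unfolding T'_def by blast
      then show ?thesis
      proof cases
        case 1 then show ?thesis using diagram_cross[OF T] that(3) by blast
      next
        case 2 then show ?thesis using cross1[of s1 s2] by blast
      next
        case 3 then show ?thesis using cross1[of s2 s1] by blast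
      next
        case 4 then show ?thesis using cross2 that(3) by auto
      qed
    qed
    show "corner_at T' x \<or> vertex_at n T' x" if "x \<in> pts T'" for x
    proof (cases "x = r")
      case False
      then have x: "x \<in> pts T" using that pT' by auto
      then show ?thesis using diagram_pts[OF T x] co[of x] sp unfolding vertex_at_iff by blast
    qed (use cr in auto)
  qed
  have "subdivides T T'" unfolding subdivides_def using s r T'_def by blast
  then show "homotopic_diagrams n T T'" using T D by (auto intro!: homotopic_step simp: elementary_step_def)
qed

text \<open>The inverse of \<open>cut\<close>. Since \<open>r\<close> is a corner, exactly the two
  merged segments end there, so nothing is left dangling.\<close>

lemma merge:
  assumes n2: "n \<ge> 2" and T': "diagram n T'" and s: "(p, r, d) \<in> T'" "(r, q, d) \<in> T'"
    and cr: "corner_at T' r" and r: "r \<in> open_segment p q"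
    and T_def: "T = (T' - {(p, r, d), (r, q, d)}) \<union> {(p, q, d)}"
  shows diagram_merge: "diagram n T"
    and step_merge: "homotopic_diagrams n T' T"
    and verts_merge: "verts n T \<subseteq> verts n T'"
    and spokes_merge: "\<And>x c y. spokes n T' x c y \<Longrightarrow>
      spokes n T x c (\<lambda>i. if spoke n x c y i = (p, r, d) then q
         else if spoke n x c y i = (r, q, d) then p else y i)"
proof -
  note rf = open_segment_facts[OF r]
  have rne: "(p,r,d) \<noteq> (r,q,d)" using rf by auto
  have sr: "segments_at T' r = {(p, r, d), (r, q, d)}"
  proof -
    obtain a b c where abc: "segments_at T' r = {(a, r, c), (r, b, c)}" using cr by (auto simp: corner_at_def)
    have "(p, r, d) \<in> segments_at T' r" "(r, q, d) \<in> segments_at T' r" using s by (auto simp: segments_at_eq)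
    then show ?thesis using rf abc by auto
  qed
  have rnot: "r \<notin> ends s'" if "s' \<in> T'" "s' \<notin> {(p, r, d), (r, q, d)}" for s'
    using that sr by (auto simp: segments_at_eq)
  have pq: "seg (p,q,d) = seg (p,r,d) \<union> seg (r,q,d)" using rf by auto
  \<comment> \<open>A segment already joining \<open>p\<close> to \<open>q\<close> would run over
    the one from \<open>p\<close> to \<open>r\<close>. Its absence makes \<open>T'\<close> the exact
    subdivision of \<open>T\<close>.\<close>
  have new: "(p,q,e) \<notin> T'" for e
  proof
    assume "(p,q,e) \<in> T'"
    then have "seg (p,q,e) \<inter> seg (p,r,d) \<subseteq> ends (p,q,e) \<inter> ends (p,r,d)"
      using diagram_cross[OF T' _ s(1)] rf by blast
    then show False using rf by auto
  qed
  define F where "F u = (if u = (p, r, d) \<or> u = (r, q, d) then (p, q, d) else u)" for u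
  have at: "segments_at T x = F ` segments_at T' x" if "x \<noteq> r" for x
  proof -
    have 1: "segments_at T x = (segments_at T' x - {(p,r,d),(r,q,d)}) \<union> (if x \<in> {p,q} then {(p,q,d)} else {})"
      using that by (simp add: T_def segments_at_simps)
    have 2: "F ` (segments_at T' x - {(p,r,d),(r,q,d)}) = segments_at T' x - {(p,r,d),(r,q,d)}"
      by (auto simp: F_def image_iff)
    have 3: "segments_at T' x \<inter> {(p,r,d),(r,q,d)} = (if x = p then {(p,r,d)} else if x = q then {(r,q,d)} else {})"
      using that s rf by (auto simp: segments_at_eq)
    have 4: "F ` (segments_at T' x \<inter> {(p,r,d),(r,q,d)}) = (if x \<in> {p,q} then {(p,q,d)} else {})"
      unfolding 3 by (auto simp: F_def)
    have "F ` segments_at T' x = F ` (segments_at T' x - {(p,r,d),(r,q,d)}) \<union> F ` (segments_at T' x \<inter> {(p,r,d),(r,q,d)})"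
      by (metis Un_Diff_Int image_Un)
    then show ?thesis unfolding 1 2 4 ..
  qed
  have nv: "\<not> vertex_at n T' r" using corner_not_vertex n2 cr by blast
  show sp: "spokes n T x c (\<lambda>i. if spoke n x c y i = (p, r, d) then q
         else if spoke n x c y i = (r, q, d) then p else y i)"
    if sp: "spokes n T' x c y" for x c y
  proof (rule spokes_image[OF sp])
    have xr: "x \<noteq> r" using nv sp by (auto simp: vertex_at_iff)
    then show "segments_at T x = F ` segments_at T' x" by (rule at)
    show "F (spoke n x c y i) = spoke n x c (\<lambda>i. if spoke n x c y i = (p, r, d) then q
         else if spoke n x c y i = (r, q, d) then p else y i) i" if "i < 2 * n" for i
      using xr rf by (auto simp: F_def spoke_def)
    show "ccw (2 * n) x (\<lambda>i. if spoke n x c y i = (p, r, d) then q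
         else if spoke n x c y i = (r, q, d) then p else y i)"
    proof (rule ccw_scale)
      show "ccw (2 * n) x y" using sp by (simp add: spokes_def)
      \<comment> \<open>The merged spoke is the old one stretched by \<open>1 / u\<close> as seen
        from \<open>p\<close>, and by \<open>1 / (1 - u)\<close> as seen from
        \<open>q\<close>.\<close>
      obtain u where u: "0 < u" "u < 1" "r - p = of_real u * (q - p)" using open_segment_scale r by blast
      have p': "q - p = of_real (1 / u) * (r - p)" using u by simp
      have "p - q = of_real (1 / (1 - u)) * (r - q)"
      proof -
        have "r - q = of_real (1 - u) * (p - q)" using u(3) by (simp add: algebra_simps)
        then show ?thesis using u by simp
      qed
      fix i assume i: "i < 2 * n"
      consider "spoke n x c y i = (p, r, d)" | "spoke n x c y i \<noteq> (p,r,d)" "spoke n x c y i = (r,q,d)"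
        | "spoke n x c y i \<noteq> (p,r,d)" "spoke n x c y i \<noteq> (r,q,d)" by blast
      then show "\<exists>s>0. (if spoke n x c y i = (p, r, d) then q
         else if spoke n x c y i = (r, q, d) then p else y i) - x = complex_of_real s * (y i - x)"
      proof cases
        case 1
        then have "x = p" "y i = r" using xr by (auto simp: spoke_def split: if_splits)
        then show ?thesis using 1 p' u by (intro exI[of _ "1/u"]) simp
      next
        case 2
        then have "x = q" "y i = r" using xr by (auto simp: spoke_def split: if_splits)
        then show ?thesis using 2 \<open>p - q = _\<close> u by (intro exI[of _ "1/(1-u)"]) auto
      next
        case 3
        then show ?thesis by (intro exI[of _ 1]) auto
      qed
    qed
  qed
  have co: "corner_at T x" if c: "corner_at T' x" and x: "x \<noteq> r" for x
  proof -
    obtain a b c where abc: "segments_at T' x = {(a, x, c), (x, b, c)}" using c by (auto simp: corner_at_def)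
    have "\<exists>a' b'. F (a,x,c) = (a',x,c) \<and> F (x,b,c) = (x,b',c)" using x rf by (auto simp: F_def)
    then obtain a' b' where "F (a,x,c) = (a',x,c)" "F (x,b,c) = (x,b',c)" by blast
    then have "segments_at T x = {(a', x, c), (x, b', c)}" unfolding at[OF x] abc by simp
    then show ?thesis unfolding corner_at_def by blast
  qed
  have pT': "pts T \<subseteq> pts T' - {r}" using s rf rnot by (auto simp: pts_def T_def intro: bexI[of _ "(p, r, d)"] bexI[of _ "(r, q, d)"])
  show "verts n T \<subseteq> verts n T'"
    using verts_subset[OF n2 T', of "\<lambda>x. x" T] co pT' by auto
  have cross1: "seg s' \<inter> seg (p,q,d) \<subseteq> ends s' \<inter> ends (p,q,d)"
    if "s' \<in> T'" "s' \<notin> {(p,r,d),(r,q,d)}" for s'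
    using diagram_cross[OF T' that(1) s(1)] diagram_cross[OF T' that(1) s(2)] that rnot[OF that]
    unfolding pq by auto
  show D: "diagram n T"
    unfolding diagram_iff
  proof (intro conjI ballI impI)
    show "finite T" using T' by (simp add: T_def diagram_finite)
    show "fst s \<noteq> fst (snd s)" if "s \<in> T" for s
      using that diagram_nondeg[OF T', of s] rf(5) by (auto simp: T_def)
    show "seg s1 \<inter> seg s2 \<subseteq> ends s1 \<inter> ends s2" if st: "s1 \<in> T" "s2 \<in> T" "s1 \<noteq> s2" for s1 s2
    proof -
      consider "s1 \<in> T'" "s2 \<in> T'" | "s1 \<in> T'" "s1 \<notin> {(p,r,d),(r,q,d)}" "s2 = (p,q,d)"
        | "s2 \<in> T'" "s2 \<notin> {(p,r,d),(r,q,d)}" "s1 = (p,q,d)"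
        using st unfolding T_def by blast
      then show ?thesis
      proof cases
        case 1 then show ?thesis using diagram_cross[OF T'] that(3) by blast
      next
        case 2 then show ?thesis using cross1[of s1] by blast
      next
        case 3 then show ?thesis using cross1[of s2] by blast
      qed
    qed
    show "corner_at T x \<or> vertex_at n T x" if "x \<in> pts T" for x
      using that pT' diagram_pts[OF T', of x] co[of x] sp unfolding vertex_at_iff by blast
  qed
  have "T' = (T - {(p, q, d)}) \<union> {(p, r, d), (r, q, d)}" using new s rf by (auto simp: T_def)
  then have "subdivides T T'" unfolding subdivides_def using r T_def by blast
  then show "homotopic_diagrams n T' T"
    using T' D by (auto intro!: homotopic_sym[OF homotopic_step] simp: elementary_step_def)
qed

subsection \<open>Ambient isotopies and local replacement\<close>

definition transport :: "(complex \<Rightarrow> complex) \<Rightarrow> segment set \<Rightarrow> segment set" where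
  "transport f T = (\<lambda>(p, q, c). (f p, f q, c)) ` T"

text \<open>The map need not be affine. It is enough that it is injective, straight on each segment
  and order preserving at the vertices; corners then take care of themselves.\<close>

lemma transport:
  assumes n2: "n \<ge> 2" and T: "diagram n T" and f: "inj f"
    and seg: "\<And>p q c. (p, q, c) \<in> T \<Longrightarrow> f ` closed_segment p q = closed_segment (f p) (f q)"
    and ccw: "\<And>x c y. spokes n T x c y \<Longrightarrow> ccw (2 * n) (f x) (\<lambda>i. f (y i))"
  shows diagram_transport: "diagram n (transport f T)"
    and verts_transport: "verts n (transport f T) \<subseteq> f ` verts n T"
    and spokes_transport: "\<And>x c y. spokes n T x c y \<Longrightarrow> spokes n (transport f T) (f x) c (\<lambda>i. f (y i))"
proof -
  define F :: "segment \<Rightarrow> segment" where "F = (\<lambda>(p, q, c). (f p, f q, c))"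
  have tr: "transport f T = F ` T" by (simp add: transport_def F_def)
  have F: "seg (F s) = f ` seg s" if "s \<in> T" for s using seg that by (cases s) (auto simp: F_def)
  have E: "ends (F s) = f ` ends s" for s by (cases s) (auto simp: F_def)
  have at: "segments_at (transport f T) (f x) = F ` segments_at T x" for x
  proof -
    have "segments_at (F ` T) (f x) = F ` {s \<in> T. f x \<in> ends (F s)}" unfolding segments_at_eq by blast
    then show ?thesis by (simp add: tr E inj_image_mem_iff[OF f] segments_at_eq)
  qed
  have pts: "pts (transport f T) = f ` pts T" by (simp add: pts_def tr E image_UN)
  show sp: "spokes n (transport f T) (f x) c (\<lambda>i. f (y i))" if "spokes n T x c y" for x c y
    using that by (rule spokes_image) (use at ccw[OF that] in \<open>auto simp: F_def spoke_def\<close>)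
  have co: "corner_at (transport f T) (f x)" if "corner_at T x" for x
  proof -
    obtain a b c where "segments_at T x = {(a, x, c), (x, b, c)}" using \<open>corner_at T x\<close> by (auto simp: corner_at_def)
    then have "segments_at (transport f T) (f x) = {(f a, f x, c), (f x, f b, c)}"
      unfolding at by (simp add: F_def)
    then show ?thesis unfolding corner_at_def by blast
  qed
  show "verts n (transport f T) \<subseteq> f ` verts n T"
    by (rule verts_subset[OF n2 T]) (use co pts in auto)
  show "diagram n (transport f T)"
    unfolding diagram_iff
  proof (intro conjI ballI impI)
    show "finite (transport f T)" using T by (simp add: tr diagram_finite)
    show "fst s \<noteq> fst (snd s)" if "s \<in> transport f T" for s
    proof -
      obtain t where "t \<in> T" "s = F t" using \<open>s \<in> transport f T\<close> by (auto simp: tr)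
      then show ?thesis using diagram_nondeg[OF T, of t] f by (cases t) (simp add: F_def inj_eq)
    qed
    show "seg s1 \<inter> seg s2 \<subseteq> ends s1 \<inter> ends s2"
      if st: "s1 \<in> transport f T" "s2 \<in> transport f T" "s1 \<noteq> s2" for s1 s2
    proof -
      obtain t1 t2 where t: "s1 = F t1" "s2 = F t2" "t1 \<in> T" "t2 \<in> T" "t1 \<noteq> t2" using st unfolding tr by blast
      have "seg s1 \<inter> seg s2 = f ` (seg t1 \<inter> seg t2)" using t F f by (simp add: image_Int)
      also have "\<dots> \<subseteq> f ` (ends t1 \<inter> ends t2)" using diagram_cross[OF T] t by (intro image_mono) blast
      also have "\<dots> \<subseteq> ends s1 \<inter> ends s2" using t E by auto
      finally show ?thesis .
    qed
    show "corner_at (transport f T) x \<or> vertex_at n (transport f T) x" if x: "x \<in> pts (transport f T)" for x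
    proof -
      obtain z where z: "x = f z" "z \<in> pts T" using x unfolding pts by blast
      then show ?thesis using diagram_pts[OF T z(2)] co[of z] sp unfolding vertex_at_iff by blast
    qed
  qed
qed

text \<open>The bookkeeping shared by bridges and cancellations. All ends of the new part become
  corners, and since the old part touches \<open>R\<close> only in ends of the new one, every other
  point of \<open>R\<close> keeps its star. Vertices can only disappear, namely those on
  \<open>A\<close>.\<close>

lemma replace:
  assumes n2: "n \<ge> 2" and T: "diagram n (R \<union> A)" and RA: "R \<inter> A = {}"
    and B: "finite B" "\<And>s. s \<in> B \<Longrightarrow> fst s \<noteq> fst (snd s)"
      "\<And>s t. s \<in> B \<Longrightarrow> t \<in> B \<Longrightarrow> s \<noteq> t \<Longrightarrow> seg s \<inter> seg t \<subseteq> ends s \<inter> ends t"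
      "\<And>s t. s \<in> R \<Longrightarrow> t \<in> B \<Longrightarrow> seg s \<inter> seg t \<subseteq> ends s \<inter> ends t"
    and corner: "\<And>x. x \<in> pts B \<Longrightarrow> corner_at (R \<union> B) x"
    and pts: "pts A \<inter> pts R \<subseteq> pts B"
  shows diagram_replace: "diagram n (R \<union> B)"
    and verts_replace: "verts n (R \<union> B) \<subseteq> verts n (R \<union> A) - pts A"
    and segments_at_replace: "\<And>x. x \<in> pts R \<Longrightarrow> x \<notin> pts B \<Longrightarrow> segments_at (R \<union> B) x = segments_at (R \<union> A) x"
proof -
  show at: "segments_at (R \<union> B) x = segments_at (R \<union> A) x" if "x \<in> pts R" "x \<notin> pts B" for x
  proof -
    have "x \<notin> pts A" using that pts by auto
    then have "segments_at A x = {}" "segments_at B x = {}" using that(2) unfolding segments_at_eq pts_def by blast+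
    then show ?thesis by (simp add: segments_at_Un)
  qed
  have pU: "pts (R \<union> B) = pts R \<union> pts B" for B by (auto simp: pts_def)
  have vt: "vertex_at n (R \<union> B) x \<longleftrightarrow> vertex_at n (R \<union> A) x" if "x \<in> pts R" "x \<notin> pts B" for x
    using at[OF that] by (simp add: vertex_at_def)
  have ct: "corner_at (R \<union> B) x \<longleftrightarrow> corner_at (R \<union> A) x" if "x \<in> pts R" "x \<notin> pts B" for x
    using at[OF that] by (simp add: corner_at_def)
  show "verts n (R \<union> B) \<subseteq> verts n (R \<union> A) - pts A"
  proof
    fix x assume x: "x \<in> verts n (R \<union> B)"
    then have "x \<in> pts (R \<union> B)" using verts_subset_pts[of n "R \<union> B"] n2 by auto
    moreover have "x \<notin> pts B" using x corner corner_not_vertex n2 by (auto simp: verts_def)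
    ultimately have *: "x \<in> pts R" "x \<notin> pts B" by (auto simp: pU)
    then show "x \<in> verts n (R \<union> A) - pts A" using vt x pts by (auto simp: verts_def)
  qed
  show "diagram n (R \<union> B)"
    unfolding diagram_iff
  proof (intro conjI ballI impI)
    show "finite (R \<union> B)" using diagram_finite[OF T] B by auto
    show "fst s \<noteq> fst (snd s)" if "s \<in> R \<union> B" for s using that diagram_nondeg[OF T] B(2) by blast
    show "seg s \<inter> seg t \<subseteq> ends s \<inter> ends t" if st: "s \<in> R \<union> B" "t \<in> R \<union> B" "s \<noteq> t" for s t
    proof -
      consider "s \<in> R" "t \<in> R" | "s \<in> R" "t \<in> B" | "t \<in> R" "s \<in> B" | "s \<in> B" "t \<in> B" using st by auto
      then show ?thesis
      proof cases
        case 1 then show ?thesis using diagram_cross[OF T] st by blast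
      next
        case 2 then show ?thesis using B(4) by blast
      next
        case 3 then show ?thesis using B(4)[of t s] by blast
      next
        case 4 then show ?thesis using B(3) st by blast
      qed
    qed
    show "corner_at (R \<union> B) x \<or> vertex_at n (R \<union> B) x" if "x \<in> pts (R \<union> B)" for x
      using that corner ct[of x] vt[of x] diagram_pts[OF T, of x] pU by blast
  qed
qed

subsection \<open>Pushing a point inside a convex set\<close>

definition minkowski :: "complex set \<Rightarrow> complex \<Rightarrow> real" where
  "minkowski C z = Inf {s. 0 \<le> s \<and> z \<in> scaleR s ` C}"

context
  fixes C :: "complex set"
  assumes C: "compact C" "convex C" "0 \<in> interior C"
begin

lemma minkowski_mono_aux:
  assumes "z \<in> scaleR s ` C" "0 \<le> s" "s \<le> t"
  shows "z \<in> scaleR t ` C"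
proof (cases "t = 0")
  case False
  then have t: "t > 0" using assms by simp
  obtain c where c: "c \<in> C" "z = s *\<^sub>R c" using assms(1) by auto
  have "0 \<in> C" using C(3) interior_subset by blast
  then have "(s / t) *\<^sub>R c + (1 - s / t) *\<^sub>R 0 \<in> C"
    using C(2) c(1) assms t unfolding convex_alt by (metis add.commute divide_le_eq_1_pos divide_nonneg_pos)
  then have "(s / t) *\<^sub>R c \<in> C" by simp
  moreover have "z = t *\<^sub>R ((s / t) *\<^sub>R c)" using c t by simp
  ultimately show ?thesis by blast
qed (use assms in auto)

lemma minkowski_radius: obtains r where "r > 0" "\<And>z s. norm z \<le> s * r \<Longrightarrow> 0 \<le> s \<Longrightarrow> z \<in> scaleR s ` C"
proof -
  obtain r where r: "r > 0" "cball 0 r \<subseteq> C" using C(3) mem_interior_cball by blast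
  show ?thesis
  proof
    show "r > 0" by (rule r)
    fix z :: complex and s :: real assume z: "norm z \<le> s * r" "0 \<le> s"
    have "0 \<in> C" using C(3) interior_subset by blast
    show "z \<in> scaleR s ` C"
    proof (cases "s = 0")
      case True then show ?thesis using z \<open>0 \<in> C\<close> by auto
    next
      case False
      then have s: "s > 0" using z by simp
      then have "norm (z /\<^sub>R s) \<le> r" using z by (simp add: field_simps)
      then have "z /\<^sub>R s \<in> C" using r by auto
      then show ?thesis using s by (intro image_eqI[of _ _ "z /\<^sub>R s"]) auto
    qed
  qed
qed

text \<open>The infimum is attained by compactness: \<open>z / s\<close> lies in \<open>C\<close>
  for every \<open>s\<close> above a positive infimum, and the limit stays in \<open>C\<close>. If
  the infimum is 0, boundedness of \<open>C\<close> forces \<open>z = 0\<close>.\<close>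

lemma minkowski_le_iff:
  assumes "0 \<le> s" shows "minkowski C z \<le> s \<longleftrightarrow> z \<in> scaleR s ` C"
proof -
  define A where "A = {s. 0 \<le> s \<and> z \<in> scaleR s ` C}"
  obtain r where r: "r > 0" "\<And>z s. norm z \<le> s * r \<Longrightarrow> 0 \<le> s \<Longrightarrow> z \<in> scaleR s ` C"
    using minkowski_radius by blast
  have "norm z / r \<in> A" using r(1) r(2)[of z "norm z / r"] by (simp add: A_def)
  then have ne: "A \<noteq> {}" by blast
  have bdd: "bdd_below A" by (rule bdd_belowI[of _ 0]) (simp add: A_def)
  have m: "minkowski C z = Inf A" by (simp add: minkowski_def A_def)
  have m0: "Inf A \<ge> 0" using ne by (rule cInf_greatest) (simp add: A_def)
  have above: "z \<in> scaleR t ` C" if "t > Inf A" for t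
  proof -
    have "\<exists>s\<in>A. s < t" using that by (simp only: cInf_less_iff[OF ne bdd])
    then obtain s where "0 \<le> s" "z \<in> scaleR s ` C" "s < t" unfolding A_def by blast
    then show ?thesis using minkowski_mono_aux[of z s t] by simp
  qed
  obtain B where B: "\<And>c. c \<in> C \<Longrightarrow> norm c \<le> B" using compact_imp_bounded[OF C(1)] unfolding bounded_iff by blast
  have at: "z \<in> scaleR (Inf A) ` C"
  proof (cases "Inf A = 0")
    case True
    have "norm z \<le> t * B" if t: "t > 0" for t
    proof -
      have "z \<in> scaleR t ` C" using above[of t] t by (simp only: True)
      then obtain c where "c \<in> C" "z = t *\<^sub>R c" by blast
      then show ?thesis using B[of c] t by simp
    qed
    note le = this
    have "norm z \<le> 0"
    proof (rule ccontr)
      assume a: "\<not> norm z \<le> 0"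
      then have "B > 0" using le[of 1] by linarith
      then show False using le[of "norm z / (2 * B)"] a by (simp add: field_simps)
    qed
    moreover have "0 \<in> C" using C(3) interior_subset by blast
    ultimately have "z \<in> scaleR 0 ` C" by (simp add: image_iff) blast
    then show ?thesis by (simp only: True)
  next
    case False
    then have p: "Inf A > 0" using m0 by simp
    let ?t = "\<lambda>k::nat. Inf A + inverse (real (Suc k))"
    have "(\<lambda>k. z /\<^sub>R ?t k) \<longlonglongrightarrow> z /\<^sub>R (Inf A + 0)"
      using p by (intro tendsto_intros LIMSEQ_inverse_real_of_nat) auto
    moreover have "z /\<^sub>R ?t k \<in> C" for k
    proof -
      have t: "?t k > Inf A" "?t k > 0" using p by (auto simp: add_pos_pos)
      obtain c where "c \<in> C" "z = ?t k *\<^sub>R c" using above[OF t(1)] by blast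
      then show ?thesis using t(2) by simp
    qed
    ultimately have "z /\<^sub>R Inf A \<in> C"
      using C(1) compact_imp_closed closed_sequentially by (metis (no_types, lifting) add_0_right)
    then show ?thesis using p by (intro image_eqI[of _ _ "z /\<^sub>R Inf A"]) auto
  qed
  show ?thesis
  proof
    assume "minkowski C z \<le> s"
    then show "z \<in> scaleR s ` C" using at minkowski_mono_aux m m0 by metis
  next
    assume "z \<in> scaleR s ` C"
    then show "minkowski C z \<le> s" unfolding m using assms bdd by (intro cInf_lower) (auto simp: A_def)
  qed
qed

lemma minkowski_nonneg: "0 \<le> minkowski C z"
proof (rule ccontr)
  assume "\<not> 0 \<le> minkowski C z"
  obtain r where r: "r > 0" "\<And>z s. norm z \<le> s * r \<Longrightarrow> 0 \<le> s \<Longrightarrow> z \<in> scaleR s ` C"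
    using minkowski_radius by blast
  have "norm z / r \<in> {s. 0 \<le> s \<and> z \<in> scaleR s ` C}" using r(1) r(2)[of z "norm z / r"] by simp
  then have "minkowski C z \<ge> 0" unfolding minkowski_def by (intro cInf_greatest) blast+
  then show False using \<open>\<not> _\<close> by simp
qed

lemma minkowski_scale:
  assumes "0 \<le> s" shows "minkowski C (s *\<^sub>R z) = s * minkowski C z"
proof (cases "s = 0")
  case True
  have "0 \<in> C" using C(3) interior_subset by blast
  then have "minkowski C 0 \<le> 0" by (subst minkowski_le_iff) auto
  then show ?thesis using minkowski_nonneg[of 0] True by simp
next
  case False
  then have s: "s > 0" using assms by simp
  have iff: "minkowski C (s *\<^sub>R z) \<le> t \<longleftrightarrow> s * minkowski C z \<le> t" if "t \<ge> 0" for t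
  proof -
    have "s *\<^sub>R z \<in> scaleR t ` C \<longleftrightarrow> z \<in> scaleR (t / s) ` C"
    proof
      assume "s *\<^sub>R z \<in> scaleR t ` C"
      then obtain c where c: "c \<in> C" "s *\<^sub>R z = t *\<^sub>R c" by auto
      have "z = (1 / s) *\<^sub>R (s *\<^sub>R z)" using s by simp
      then have "z = (t / s) *\<^sub>R c" unfolding c(2) by simp
      then show "z \<in> scaleR (t / s) ` C" using c by blast
    next
      assume "z \<in> scaleR (t / s) ` C"
      then show "s *\<^sub>R z \<in> scaleR t ` C" using s by auto
    qed
    then show ?thesis using minkowski_le_iff[of t "s *\<^sub>R z"] minkowski_le_iff[of "t/s" z] that s
      by (simp add: field_simps)
  qed
  show ?thesis using iff[of "s * minkowski C z"] iff[of "minkowski C (s *\<^sub>R z)"] s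
    minkowski_nonneg[of z] minkowski_nonneg[of "s *\<^sub>R z"] by force
qed

text \<open>With gauges \<open>?a\<close> and \<open>?b\<close>, the sum is \<open>?a + ?b\<close>
  times a convex combination of two points of \<open>C\<close>.\<close>

lemma minkowski_triangle: "minkowski C (x + y) \<le> minkowski C x + minkowski C y"
proof -
  let ?a = "minkowski C x" and ?b = "minkowski C y"
  have ab: "?a \<ge> 0" "?b \<ge> 0" by (simp_all add: minkowski_nonneg)
  obtain c d where c: "c \<in> C" "x = ?a *\<^sub>R c" and d: "d \<in> C" "y = ?b *\<^sub>R d"
    using minkowski_le_iff[of ?a x] minkowski_le_iff[of ?b y] ab by auto
  show ?thesis
  proof (cases "?a + ?b = 0")
    case True
    then have "?a = 0" "?b = 0" using ab by linarith+
    then have "x + y = 0" using c d by simp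
    then show ?thesis using ab minkowski_scale[of 0 0] by simp
  next
    case False
    then have p: "?a + ?b > 0" using ab by simp
    have "(?a / (?a + ?b)) *\<^sub>R c + (?b / (?a + ?b)) *\<^sub>R d \<in> C"
      using C(2) c(1) d(1) ab p unfolding convex_def
      by (metis add_divide_distrib divide_nonneg_pos divide_self False)
    moreover have "x + y = (?a + ?b) *\<^sub>R ((?a / (?a + ?b)) *\<^sub>R c + (?b / (?a + ?b)) *\<^sub>R d)"
      using p c(2) d(2) by (simp add: scaleR_add_right)
    ultimately show ?thesis by (subst minkowski_le_iff) (use ab in auto)
  qed
qed

text \<open>A disc of radius \<open>r\<close> in \<open>C\<close> bounds the gauge by
  \<open>norm z / r\<close>; with the triangle inequality this is a Lipschitz condition.\<close>

lemma continuous_minkowski: "continuous_on A (minkowski C)"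
proof -
  obtain r where r: "r > 0" "\<And>z s. norm z \<le> s * r \<Longrightarrow> 0 \<le> s \<Longrightarrow> z \<in> scaleR s ` C"
    using minkowski_radius by blast
  have le: "minkowski C z \<le> norm z / r" for z
    using r(1) r(2)[of z "norm z / r"] by (simp add: minkowski_le_iff)
  have *: "minkowski C x - minkowski C y \<le> norm (x - y) / r" for x y
    using minkowski_triangle[of "x - y" y] le[of "x - y"] by simp
  then have "dist (minkowski C x) (minkowski C y) \<le> (1 / r) * dist x y" for x y
    using *[of x y] *[of y x] norm_minus_commute[of x y] by (simp add: dist_norm abs_le_iff)
  then have "(1 / r)-lipschitz_on A (minkowski C)" using r(1) by (auto intro!: lipschitz_onI)
  then show ?thesis by (rule lipschitz_on_continuous_on)
qed

lemma minkowski_le_1: "minkowski C z \<le> 1 \<longleftrightarrow> z \<in> C"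
  using minkowski_le_iff[of 1 z] by (simp add: scaleR_one[abs_def] image_iff)

text \<open>An interior point can be stretched by some factor \<open>1 + t\<close> without leaving
  \<open>C\<close>, so its gauge is at most \<open>1 / (1 + t)\<close>. Conversely, the points of
  gauge below 1 form an open subset of \<open>C\<close>.\<close>

lemma minkowski_less_1: "minkowski C z < 1 \<longleftrightarrow> z \<in> interior C"
proof
  have "open {z. minkowski C z < 1}"
    using continuous_minkowski[of UNIV] by (intro open_Collect_less continuous_intros) auto
  moreover have "{z. minkowski C z < 1} \<subseteq> C" using minkowski_le_1 by force
  ultimately show "minkowski C z < 1 \<Longrightarrow> z \<in> interior C" by (metis interior_maximal mem_Collect_eq subsetD)
next
  assume "z \<in> interior C"
  then obtain e where e: "e > 0" "cball z e \<subseteq> C" using mem_interior_cball by blast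
  define t where "t = e / (norm z + 1)"
  have t: "t > 0" "t * norm z \<le> e" using e
    by (auto simp: t_def field_simps add_pos_nonneg mult_left_mono intro: add_nonneg_pos)
  have "(1 + t) *\<^sub>R z \<in> cball z e" using t by (simp add: dist_norm algebra_simps)
  then have "minkowski C ((1 + t) *\<^sub>R z) \<le> 1" using e(2) minkowski_le_1 by blast
  then have "(1 + t) * minkowski C z \<le> 1" using minkowski_scale[of "1 + t" z] t by simp
  then have "minkowski C z \<le> 1 / (1 + t)" using t by (simp add: field_simps)
  also have "\<dots> < 1" using t by simp
  finally show "minkowski C z < 1" .
qed

end

text \<open>The function that grows linearly from \<open>0\<close> at \<open>v\<close> to \<open>1\<close> on the frontier of \<open>Q\<close>.\<close>

definition gauge_at :: "complex set \<Rightarrow> complex \<Rightarrow> complex \<Rightarrow> real" where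
  "gauge_at Q v z = minkowski ((\<lambda>x. x - v) ` Q) (z - v)"

text \<open>Affine on each segment from \<open>v\<close> to the frontier of \<open>Q\<close>, so that a star around \<open>v\<close> whose far ends lie on
  the frontier becomes a star around \<open>w\<close>, and the identity outside \<open>Q\<close>.\<close>

definition push :: "complex set \<Rightarrow> complex \<Rightarrow> complex \<Rightarrow> complex \<Rightarrow> complex" where
  "push Q v w z = z + max 0 (1 - gauge_at Q v z) *\<^sub>R (w - v)"

lemma gauge_at:
  assumes Q: "compact Q" "convex Q" and v: "v \<in> interior Q"
  shows gauge_at_nonneg: "0 \<le> gauge_at Q v z"
    and gauge_at_scale: "\<And>s. 0 \<le> s \<Longrightarrow> gauge_at Q v (v + s *\<^sub>R (z - v)) = s * gauge_at Q v z"
    and continuous_gauge_at: "\<And>A. continuous_on A (gauge_at Q v)"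
    and gauge_at_less_1: "gauge_at Q v z < 1 \<longleftrightarrow> z \<in> interior Q"
    and gauge_at_eq_1: "gauge_at Q v z = 1 \<longleftrightarrow> z \<in> frontier Q"
    and gauge_at_eq_0: "gauge_at Q v z = 0 \<longleftrightarrow> z = v"
proof -
  let ?C = "(\<lambda>x. x - v) ` Q"
  have C: "compact ?C" "convex ?C" "0 \<in> interior ?C"
    using Q v by (auto simp: compact_translation_subtract convex_translation_subtract interior_translation_subtract)
  show "0 \<le> gauge_at Q v z" unfolding gauge_at_def by (rule minkowski_nonneg[OF C])
  show sc: "0 \<le> s \<Longrightarrow> gauge_at Q v (v + s *\<^sub>R (z - v)) = s * gauge_at Q v z" for s
    unfolding gauge_at_def using minkowski_scale[OF C] by simp
  show "continuous_on A (gauge_at Q v)" for A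
    unfolding gauge_at_def by (rule continuous_on_compose2[OF continuous_minkowski[OF C, of UNIV]]) (auto intro: continuous_intros)
  show l: "gauge_at Q v z < 1 \<longleftrightarrow> z \<in> interior Q"
    unfolding gauge_at_def minkowski_less_1[OF C] by (auto simp: interior_translation_subtract)
  have "gauge_at Q v z \<le> 1 \<longleftrightarrow> z \<in> Q"
    unfolding gauge_at_def minkowski_le_1[OF C] by auto
  then show "gauge_at Q v z = 1 \<longleftrightarrow> z \<in> frontier Q"
    using l Q(1) by (auto simp: frontier_def compact_imp_closed)
  have "minkowski ?C (z - v) \<le> 0 \<longleftrightarrow> z - v \<in> scaleR 0 ` ?C" by (rule minkowski_le_iff[OF C]) simp
  moreover have "Q \<noteq> {}" using v interior_subset by blast
  ultimately show "gauge_at Q v z = 0 \<longleftrightarrow> z = v"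
    using minkowski_nonneg[OF C, of "z - v"] by (auto simp: gauge_at_def)
qed

lemma push_id: "compact Q \<Longrightarrow> convex Q \<Longrightarrow> v \<in> interior Q \<Longrightarrow> z \<notin> interior Q \<Longrightarrow> push Q v w z = z"
  using gauge_at_less_1[of Q v z] by (simp add: push_def)

text \<open>On the ray from \<open>v\<close> to a frontier point the gauge equals the parameter
  \<open>s\<close>, so the displacement \<open>(1 - s)\<close> times \<open>w - v\<close> is affine
  in \<open>s\<close>.\<close>

lemma push_ray:
  assumes Q: "compact Q" "convex Q" and v: "v \<in> interior Q" and b: "b \<in> frontier Q" and s: "0 \<le> s" "s \<le> 1"
  shows "push Q v w (v + s *\<^sub>R (b - v)) = w + s *\<^sub>R (b - w)"
proof -
  have "gauge_at Q v (v + s *\<^sub>R (b - v)) = s"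
    using gauge_at_scale[OF Q v] gauge_at_eq_1[OF Q v] b s by simp
  then show ?thesis using s by (simp add: push_def algebra_simps)
qed

lemma gauge_at_ray:
  assumes Q: "compact Q" "convex Q" and v: "v \<in> interior Q" and z: "z \<noteq> v"
  obtains b where "b \<in> frontier Q" "z = v + gauge_at Q v z *\<^sub>R (b - v)"
proof -
  let ?g = "gauge_at Q v z"
  have g: "?g > 0" using gauge_at_nonneg[OF Q v, of z] gauge_at_eq_0[OF Q v] z by (simp add: less_le)
  define b where "b = v + (1 / ?g) *\<^sub>R (z - v)"
  have "gauge_at Q v b = 1" unfolding b_def using g gauge_at_scale[OF Q v, of "1 / ?g" z] by simp
  then have "b \<in> frontier Q" using gauge_at_eq_1[OF Q v] by simp
  moreover have "z = v + ?g *\<^sub>R (b - v)" using g by (simp add: b_def)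
  ultimately show ?thesis using that by blast
qed

text \<open>\<open>push\<close> keeps the frontier point and the parameter of each ray and only
  replaces the origin \<open>v\<close> by \<open>w\<close>; exchanging the roles of the origins
  undoes it.\<close>

lemma push_push:
  assumes Q: "compact Q" "convex Q" and v: "v \<in> interior Q" "w \<in> interior Q"
  shows "push Q w v (push Q v w z) = z"
proof (cases "z \<in> interior Q \<and> z \<noteq> v")
  case False
  then consider "z \<notin> interior Q" | "z = v" by blast
  then show ?thesis
  proof cases
    case 1 then show ?thesis using push_id Q v by simp
  next
    case 2
    have "gauge_at Q v v = 0" "gauge_at Q w w = 0" using gauge_at_eq_0 Q v by auto
    then show ?thesis using 2 by (simp add: push_def)
  qed
next
  case True
  obtain b where b: "b \<in> frontier Q" "z = v + gauge_at Q v z *\<^sub>R (b - v)"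
    using gauge_at_ray[OF Q v(1)] True by blast
  have g: "0 \<le> gauge_at Q v z" "gauge_at Q v z \<le> 1"
    using gauge_at_nonneg[OF Q v(1)] gauge_at_less_1[OF Q v(1), of z] True by auto
  have "push Q v w z = w + gauge_at Q v z *\<^sub>R (b - w)"
    using push_ray[OF Q v(1) b(1) g, of w] b(2) by simp
  then have "push Q w v (push Q v w z) = v + gauge_at Q v z *\<^sub>R (b - v)"
    using push_ray[OF Q v(2) b(1) g, of v] by simp
  then show ?thesis using b(2) by simp
qed

lemma continuous_push:
  assumes Q: "compact Q" "convex Q" and v: "v \<in> interior Q"
  shows "continuous_on A (push Q v w)"
  unfolding push_def using continuous_gauge_at[OF Q v] by (intro continuous_intros) auto

lemma push_homeomorphism:
  assumes Q: "compact Q" "convex Q" and v: "v \<in> interior Q" "w \<in> interior Q"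
  shows "homeomorphism UNIV UNIV (push Q v w) (push Q w v)"
  unfolding homeomorphism_def
  using push_push[OF Q v] push_push[OF Q v(2,1)] continuous_push[OF Q] v
  by (auto simp: surj_def) metis+

lemma interior_segment:
  fixes Q :: "complex set"
  assumes "convex Q" "v \<in> interior Q" "w \<in> interior Q" "t \<in> {0..1}"
  shows "v + t *\<^sub>R (w - v) \<in> interior Q"
proof -
  have "(1 - t) *\<^sub>R v + t *\<^sub>R w \<in> interior Q"
    using convex_interior[OF assms(1)] assms(2-4) unfolding convex_alt by auto
  then show ?thesis by (simp add: algebra_simps)
qed

text \<open>The target runs straight from \<open>v\<close> to \<open>w\<close> and stays in the
  interior by convexity, so each stage is a homeomorphism; at time 0 the displacement
  vanishes.\<close>

lemma push_isotopy:
  assumes Q: "compact Q" "convex Q" and v: "v \<in> interior Q" "w \<in> interior Q"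
  shows "ambient_isotopy (\<lambda>t. push Q v (v + t *\<^sub>R (w - v)))"
proof -
  have "continuous_on ({0..1} \<times> UNIV) (\<lambda>(t, z). push Q v (v + t *\<^sub>R (w - v)) z)"
    unfolding push_def case_prod_beta
    by (intro continuous_intros continuous_on_compose2[OF continuous_gauge_at[OF Q v(1), of UNIV]]) auto
  moreover have "\<exists>g. homeomorphism UNIV UNIV (push Q v (v + t *\<^sub>R (w - v))) g" if "t \<in> {0..1}" for t
    using push_homeomorphism[OF Q v(1) interior_segment[OF Q(2) v that]] by blast
  moreover have "push Q v (v + 0 *\<^sub>R (w - v)) = id" by (auto simp: push_def)
  ultimately show ?thesis unfolding ambient_isotopy_def by blast
qed

subsection \<open>Sliding a vertex\<close>

lemma ends_spoke [simp]: "ends (spoke n x c y i) = {x, y i}"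
  by (auto simp: spoke_def)

lemma seg_spoke [simp]: "seg (spoke n x c y i) = closed_segment x (y i)"
  by (auto simp: spoke_def closed_segment_commute)

lemma spoke_cong: "y i = y' i \<Longrightarrow> spoke n x c y i = spoke n x c y' i"
  by (simp add: spoke_def)

lemma spokes_cong:
  assumes "spokes n T x c y" "\<And>i. i < 2 * n \<Longrightarrow> y' i = y i"
  shows "spokes n T x c y'"
  using assms(1)
  by (rule spokes_image[where F="\<lambda>s. s"])
    (use assms ccw_cong[of "2*n" x y y'] in \<open>auto simp: spokes_def spoke_def\<close>)

lemma spokes_ne: "spokes n T x c y \<Longrightarrow> i < 2 * n \<Longrightarrow> y i \<noteq> x"
  using ccw_ne by (auto simp: spokes_def)

lemma spokes_inj: "spokes n T x c y \<Longrightarrow> i < 2 * n \<Longrightarrow> j < 2 * n \<Longrightarrow> y i = y j \<Longrightarrow> i = j"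
  using ccw_inj[of "2*n" x y] by (auto simp: spokes_def inj_on_def)

lemma spoke_eqD: "spoke n x c y i = spoke n x' c' y' j \<Longrightarrow> {x, y i} = {x', y' j}"
  by (metis ends_spoke)

lemma spokes_star:
  assumes "spokes n T x c y" "s \<in> T" "x \<in> ends s"
  obtains i where "i < 2 * n" "s = spoke n x c y i"
proof -
  have "s \<in> spoke n x c y ` {..<2 * n}" using assms by (auto simp: spokes_def segments_at_eq)
  then show ?thesis using that by auto
qed

text \<open>Shortens the spokes of \<open>v\<close> one at a time; \<open>e i = y i\<close> means
  that spoke \<open>i\<close> stays whole. The last clause follows the star of any other vertex: a
  spoke shared with \<open>v\<close> ends, after a genuine cut, in the new corner
  \<open>e i\<close>, and otherwise still in \<open>v\<close>.\<close>

lemma star_cut_aux: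
  assumes n2: "n \<ge> 2" and T: "diagram n T" and sp: "spokes n T v c y"
    and e: "\<And>i. i < 2 * n \<Longrightarrow> e i = y i \<or> e i \<in> open_segment v (y i)"
  shows "k \<le> 2 * n \<Longrightarrow> \<exists>T'. homotopic_diagrams n T T' \<and> diagram n T' \<and> verts n T' \<subseteq> verts n T \<and>
     spokes n T' v c (\<lambda>i. if i < k then e i else y i) \<and>
     (\<forall>s\<in>T. v \<notin> ends s \<longrightarrow> s \<in> T') \<and>
     (\<forall>s\<in>T'. v \<notin> ends s \<longrightarrow> s \<in> T \<or> (\<exists>i<2 * n. ends s = {e i, y i})) \<and>
     (\<forall>x c' y'. x \<noteq> v \<longrightarrow> spokes n T x c' y' \<longrightarrow> (\<exists>y''. spokes n T' x c' y'' \<and>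
        (\<forall>j<2 * n. (v \<notin> ends (spoke n x c' y' j) \<longrightarrow> y'' j = y' j) \<and>
          (\<forall>i<2 * n. spoke n x c' y' j = spoke n v c y i \<longrightarrow> y'' j = (if i < k \<and> e i \<noteq> y i then e i else v)))))"
proof (induction k)
  case 0
  have "(\<forall>j<2 * n. (v \<notin> ends (spoke n x c' y' j) \<longrightarrow> y' j = y' j) \<and>
          (\<forall>i<2 * n. spoke n x c' y' j = spoke n v c y i \<longrightarrow> y' j = v))"
    if "x \<noteq> v" "spokes n T x c' y'" for x c' y'
    using that spoke_eqD[of n x c' y' _ v c y] by (auto simp: doubleton_eq_iff)
  then show ?case using T sp homotopic_refl[of n T]
    by (intro exI[of _ T]) (simp, blast)
next
  case (Suc k)
  then have "k \<le> 2 * n" by simp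
  from Suc.IH[OF this] obtain T1 where T1: "homotopic_diagrams n T T1" "diagram n T1" "verts n T1 \<subseteq> verts n T"
     "spokes n T1 v c (\<lambda>i. if i < k then e i else y i)" "\<forall>s\<in>T. v \<notin> ends s \<longrightarrow> s \<in> T1"
     "\<forall>s\<in>T1. v \<notin> ends s \<longrightarrow> s \<in> T \<or> (\<exists>i<2 * n. ends s = {e i, y i})"
     "\<forall>x c' y'. x \<noteq> v \<longrightarrow> spokes n T x c' y' \<longrightarrow> (\<exists>y''. spokes n T1 x c' y'' \<and>
        (\<forall>j<2 * n. (v \<notin> ends (spoke n x c' y' j) \<longrightarrow> y'' j = y' j) \<and>
          (\<forall>i<2 * n. spoke n x c' y' j = spoke n v c y i \<longrightarrow> y'' j = (if i < k \<and> e i \<noteq> y i then e i else v))))"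
    by (elim exE conjE) (rule that)
  have T1a: "\<And>s. s \<in> T \<Longrightarrow> v \<notin> ends s \<Longrightarrow> s \<in> T1" using T1(5) by blast
  have T1b: "\<And>s. s \<in> T1 \<Longrightarrow> v \<notin> ends s \<Longrightarrow> s \<in> T \<or> (\<exists>i<2 * n. ends s = {e i, y i})"
    using T1(6) by blast
  have T1c: "\<exists>y''. spokes n T1 x c' y'' \<and>
        (\<forall>j<2 * n. (v \<notin> ends (spoke n x c' y' j) \<longrightarrow> y'' j = y' j) \<and>
          (\<forall>i<2 * n. spoke n x c' y' j = spoke n v c y i \<longrightarrow> y'' j = (if i < k \<and> e i \<noteq> y i then e i else v)))"
    if "x \<noteq> v" "spokes n T x c' y'" for x c' y'
    using T1(7) that by blast
  have k: "k < 2 * n" using Suc.prems by simp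
  define yk where "yk i = (if i < k then e i else y i)" for i
  have yk: "spokes n T1 v c yk" using T1(4) by (simp add: yk_def[abs_def])
  show ?case
  proof (cases "e k = y k")
    case True
    have 1: "(i < k \<and> e i \<noteq> y i) = (i < Suc k \<and> e i \<noteq> y i)" for i
      using True by (auto simp: less_Suc_eq)
    have 2: "spokes n T1 v c (\<lambda>i. if i < Suc k then e i else y i)"
      using yk by (rule spokes_cong) (use True in \<open>auto simp: yk_def less_Suc_eq\<close>)
    show ?thesis
      using T1(1-3,5-7) 2 unfolding 1 by (intro exI[of _ T1] conjI)
  next
    case False
    define s where "s = spoke n v c yk k"
    have s': "s = spoke n v c y k" by (simp add: s_def yk_def spoke_def)
    obtain p q d where pqd: "s = (p, q, d)" by (cases s)
    have sT1: "(p, q, d) \<in> T1" using spokes_in(1)[OF yk k] s_def pqd by simp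
    have r: "e k \<in> open_segment p q"
      using e[OF k] False s' pqd by (auto simp: spoke_def open_segment_commute split: if_splits)
    have "ends s = {v, y k}" by (simp add: s')
    then have ends: "{p, q} = {v, y k}" by (simp add: pqd)
    define T2 where "T2 = (T1 - {(p, q, d)}) \<union> {(p, e k, d), (e k, q, d)}"
    note cut = cut[OF n2 T1(2) sT1 r T2_def]
    have ne: "e i \<noteq> v" if "i < 2 * n" for i
      using e[OF that] spokes_ne[OF sp that] by (auto simp: open_segment_def)
    show ?thesis
    proof (intro exI[of _ T2] conjI)
      show "homotopic_diagrams n T T2" using homotopic_trans[OF T1(1) cut(2)] .
      show "diagram n T2" by (rule cut(1))
      show "verts n T2 \<subseteq> verts n T" using cut(3) T1(3) by blast
      show "spokes n T2 v c (\<lambda>i. if i < Suc k then e i else y i)"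
      proof (rule spokes_cong[OF cut(4)[OF yk]])
        fix i assume i: "i < 2 * n"
        have "spoke n v c yk i = (p, q, d) \<longleftrightarrow> i = k"
        proof
          assume "spoke n v c yk i = (p, q, d)"
          then have "spoke n v c yk i = spoke n v c yk k" using s_def pqd by simp
          then have "yk i = yk k" using spokes_ne[OF yk] i k spoke_eqD by (metis doubleton_eq_iff)
          then show "i = k" using spokes_inj[OF yk i k] by simp
        qed (use s_def pqd in simp)
        then show "(if i < Suc k then e i else y i) = (if spoke n v c yk i = (p, q, d) then e k else yk i)"
          by (auto simp: yk_def)
      qed
      show "\<forall>t\<in>T. v \<notin> ends t \<longrightarrow> t \<in> T2"
      proof (intro ballI impI)
        fix t assume t: "t \<in> T" "v \<notin> ends t"
        then have "t \<noteq> (p,q,d)" using ends by auto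
        then show "t \<in> T2" using T1a[OF t] by (simp add: T2_def)
      qed
      show "\<forall>t\<in>T2. v \<notin> ends t \<longrightarrow> t \<in> T \<or> (\<exists>i<2 * n. ends t = {e i, y i})"
      proof (intro ballI impI)
        fix t assume t: "t \<in> T2" "v \<notin> ends t"
        consider "t \<in> T1" | "t = (p, e k, d)" | "t = (e k, q, d)" using t(1) unfolding T2_def by blast
        then show "t \<in> T \<or> (\<exists>i<2 * n. ends t = {e i, y i})"
        proof cases
          case 1 then show ?thesis using T1b t by blast
        next
          case 2
          then have "p = y k" using t ends by auto
          then show ?thesis using 2 k by auto
        next
          case 3
          then have "q = y k" using t ends by auto
          then show ?thesis using 3 k by auto
        qed
      qed
      show "\<forall>x c' y'. x \<noteq> v \<longrightarrow> spokes n T x c' y' \<longrightarrow> (\<exists>y''. spokes n T2 x c' y'' \<and>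
        (\<forall>j<2 * n. (v \<notin> ends (spoke n x c' y' j) \<longrightarrow> y'' j = y' j) \<and>
          (\<forall>i<2 * n. spoke n x c' y' j = spoke n v c y i \<longrightarrow> y'' j = (if i < Suc k \<and> e i \<noteq> y i then e i else v))))"
      proof (intro allI impI)
        fix x c' y' assume x: "x \<noteq> v" and sx: "spokes n T x c' y'"
        obtain y1 where y1: "spokes n T1 x c' y1"
          "\<And>j. j < 2 * n \<Longrightarrow> v \<notin> ends (spoke n x c' y' j) \<Longrightarrow> y1 j = y' j"
          "\<And>j i. j < 2 * n \<Longrightarrow> i < 2 * n \<Longrightarrow> spoke n x c' y' j = spoke n v c y i \<Longrightarrow>
             y1 j = (if i < k \<and> e i \<noteq> y i then e i else v)" using T1c[OF x sx] by blast
        let ?y2 = "\<lambda>j. if spoke n x c' y1 j = (p, q, d) then e k else y1 j"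
        have "?y2 j = y' j" if "j < 2 * n" "v \<notin> ends (spoke n x c' y' j)" for j
        proof -
          have "spoke n x c' y1 j = spoke n x c' y' j" using y1(2)[OF that] by (rule spoke_cong)
          have "spoke n x c' y1 j \<noteq> (p,q,d)"
          proof
            assume "spoke n x c' y1 j = (p,q,d)"
            then have "ends (spoke n x c' y' j) = {p, q}" using \<open>spoke n x c' y1 j = spoke n x c' y' j\<close>
              by (metis ends_simp)
            then show False using that(2) ends by simp
          qed
          then show ?thesis using y1(2)[OF that] by simp
        qed
        moreover have "?y2 j = (if i < Suc k \<and> e i \<noteq> y i then e i else v)"
          if j: "j < 2 * n" and i: "i < 2 * n" and eq: "spoke n x c' y' j = spoke n v c y i" for i j
        proof -
          have yj: "y' j = v" using spoke_eqD[OF eq] x by (auto simp: doubleton_eq_iff)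
          consider "i < k" "e i \<noteq> y i" | "i = k" | "\<not> (i < k \<and> e i \<noteq> y i)" "i \<noteq> k" by blast
          then show ?thesis
          proof cases
            case 1
            then have "y1 j = e i" using y1(3)[OF j i eq] by simp
            moreover have "spoke n x c' y1 j \<noteq> (p,q,d)"
            proof
              assume "spoke n x c' y1 j = (p,q,d)"
              then have "{x, y1 j} = {v, y k}" using ends_spoke[of n x c' y1 j] ends by simp
              then show False using \<open>y1 j = e i\<close> ne[OF i] x by auto
            qed
            ultimately show ?thesis using 1 by simp
          next
            case 2
            then have "y1 j = v" using y1(3)[OF j i eq] by simp
            then have "spoke n x c' y1 j = spoke n x c' y' j" using yj by (intro spoke_cong) simp
            then have "spoke n x c' y1 j = (p,q,d)" using eq 2 s' pqd by simp
            then show ?thesis using 2 False by simp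
          next
            case 3
            then have "y1 j = v" using y1(3)[OF j i eq] by auto
            then have "spoke n x c' y1 j = spoke n v c y i" using yj eq spoke_cong by metis
            moreover have "spoke n v c y i \<noteq> spoke n v c y k"
            proof
              assume "spoke n v c y i = spoke n v c y k"
              then have "y i = y k" using spokes_ne[OF sp] i k spoke_eqD by (metis doubleton_eq_iff)
              then show False using spokes_inj[OF sp i k] 3 by simp
            qed
            ultimately have "spoke n x c' y1 j \<noteq> (p,q,d)" using s' pqd by simp
            then show ?thesis using 3 \<open>y1 j = v\<close> by (auto simp: less_Suc_eq)
          qed
        qed
        ultimately show "\<exists>y''. spokes n T2 x c' y'' \<and>
          (\<forall>j<2 * n. (v \<notin> ends (spoke n x c' y' j) \<longrightarrow> y'' j = y' j) \<and>
          (\<forall>i<2 * n. spoke n x c' y' j = spoke n v c y i \<longrightarrow> y'' j = (if i < Suc k \<and> e i \<noteq> y i then e i else v)))"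
          using cut(4)[OF y1(1)] by (intro exI[of _ ?y2]) blast
      qed
    qed
  qed
qed

lemma star_cut:
  assumes "n \<ge> 2" "diagram n T" "spokes n T v c y"
    and "\<And>i. i < 2 * n \<Longrightarrow> e i = y i \<or> e i \<in> open_segment v (y i)"
  obtains T' where "homotopic_diagrams n T T'" "diagram n T'" "verts n T' \<subseteq> verts n T"
     "spokes n T' v c e" "\<And>s. s \<in> T \<Longrightarrow> v \<notin> ends s \<Longrightarrow> s \<in> T'"
     "\<And>s. s \<in> T' \<Longrightarrow> v \<notin> ends s \<Longrightarrow> s \<in> T \<or> (\<exists>i<2 * n. ends s = {e i, y i})"
     "\<And>x c' y'. x \<noteq> v \<Longrightarrow> spokes n T x c' y' \<Longrightarrow> \<exists>y''. spokes n T' x c' y'' \<and>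
        (\<forall>j<2 * n. (v \<notin> ends (spoke n x c' y' j) \<longrightarrow> y'' j = y' j) \<and>
          (\<forall>i<2 * n. spoke n x c' y' j = spoke n v c y i \<longrightarrow> y'' j = (if e i \<noteq> y i then e i else v)))"
proof -
  have "\<exists>T'. homotopic_diagrams n T T' \<and> diagram n T' \<and> verts n T' \<subseteq> verts n T \<and>
     spokes n T' v c (\<lambda>i. if i < 2 * n then e i else y i) \<and>
     (\<forall>s\<in>T. v \<notin> ends s \<longrightarrow> s \<in> T') \<and>
     (\<forall>s\<in>T'. v \<notin> ends s \<longrightarrow> s \<in> T \<or> (\<exists>i<2 * n. ends s = {e i, y i})) \<and>
     (\<forall>x c' y'. x \<noteq> v \<longrightarrow> spokes n T x c' y' \<longrightarrow> (\<exists>y''. spokes n T' x c' y'' \<and>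
        (\<forall>j<2 * n. (v \<notin> ends (spoke n x c' y' j) \<longrightarrow> y'' j = y' j) \<and>
          (\<forall>i<2 * n. spoke n x c' y' j = spoke n v c y i \<longrightarrow>
             y'' j = (if i < 2 * n \<and> e i \<noteq> y i then e i else v)))))"
    by (rule star_cut_aux[OF assms]) auto
  then obtain T' where T': "homotopic_diagrams n T T'" "diagram n T'" "verts n T' \<subseteq> verts n T"
     "spokes n T' v c (\<lambda>i. if i < 2 * n then e i else y i)" "\<forall>s\<in>T. v \<notin> ends s \<longrightarrow> s \<in> T'"
     "\<forall>s\<in>T'. v \<notin> ends s \<longrightarrow> s \<in> T \<or> (\<exists>i<2 * n. ends s = {e i, y i})"
     "\<forall>x c' y'. x \<noteq> v \<longrightarrow> spokes n T x c' y' \<longrightarrow> (\<exists>y''. spokes n T' x c' y'' \<and>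
        (\<forall>j<2 * n. (v \<notin> ends (spoke n x c' y' j) \<longrightarrow> y'' j = y' j) \<and>
          (\<forall>i<2 * n. spoke n x c' y' j = spoke n v c y i \<longrightarrow> y'' j = (if i < 2 * n \<and> e i \<noteq> y i then e i else v))))"
    by (elim exE conjE) (rule that)
  show ?thesis
  proof (rule that[OF T'(1-3)])
    show "spokes n T' v c e" using T'(4) by (rule spokes_cong) simp
    show "s \<in> T'" if "s \<in> T" "v \<notin> ends s" for s using T'(5) that by blast
    show "s \<in> T \<or> (\<exists>i<2 * n. ends s = {e i, y i})" if "s \<in> T'" "v \<notin> ends s" for s
      using T'(6) that by blast
    fix x c' y' assume "x \<noteq> v" "spokes n T x c' y'"
    with T'(7) obtain y'' where "spokes n T' x c' y''"
      "\<forall>j<2 * n. (v \<notin> ends (spoke n x c' y' j) \<longrightarrow> y'' j = y' j) \<and>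
          (\<forall>i<2 * n. spoke n x c' y' j = spoke n v c y i \<longrightarrow> y'' j = (if i < 2 * n \<and> e i \<noteq> y i then e i else v))"
      by blast
    then show "\<exists>y''. spokes n T' x c' y'' \<and>
        (\<forall>j<2 * n. (v \<notin> ends (spoke n x c' y' j) \<longrightarrow> y'' j = y' j) \<and>
          (\<forall>i<2 * n. spoke n x c' y' j = spoke n v c y i \<longrightarrow> y'' j = (if e i \<noteq> y i then e i else v)))"
      by (intro exI[of _ y'']) simp
  qed
qed

text \<open>Frontier points have gauge 1 as seen from \<open>v\<close>, and the gauge is linear on
  rays; hence a ray from an inner point meets the frontier only once.\<close>

lemma interior_ray:
  fixes Q :: "complex set"
  assumes Q: "convex Q" and v: "v \<in> interior Q" and b: "b \<in> frontier Q" "b' \<in> frontier Q" "b \<noteq> b'" "s > 0"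
    "compact Q"
  shows "b - v \<noteq> of_real s * (b' - v)"
proof
  assume eq: "b - v = of_real s * (b' - v)"
  then have "b = v + s *\<^sub>R (b' - v)" by (simp add: scaleR_conv_of_real algebra_simps)
  then have "gauge_at Q v b = s * gauge_at Q v b'" using gauge_at_scale[OF b(5) Q v, of s b'] b(4) by simp
  moreover have "gauge_at Q v b = 1" "gauge_at Q v b' = 1"
    using b(1,2) gauge_at_eq_1[OF b(5) Q v] by blast+
  ultimately have "s = 1" by simp
  then show False using eq b by simp
qed

lemma segment_image_affine:
  fixes v w b :: complex
  assumes "\<And>s. 0 \<le> s \<Longrightarrow> s \<le> 1 \<Longrightarrow> f (v + s *\<^sub>R (b - v)) = w + s *\<^sub>R (b' - w)"
  shows "f ` closed_segment v b = closed_segment w b'"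
proof -
  have *: "closed_segment p q = (\<lambda>s. p + s *\<^sub>R (q - p)) ` {0..1}" for p q :: complex
  proof -
    have "(1 - u) *\<^sub>R p + u *\<^sub>R q = p + u *\<^sub>R (q - p)" for u by (simp add: algebra_simps)
    then show ?thesis unfolding closed_segment_def by auto
  qed
  show ?thesis unfolding * image_image by (rule image_cong) (use assms in auto)
qed

text \<open>The spokes of \<open>v\<close> end on the frontier of \<open>Q\<close> and nothing else
  enters the interior, so \<open>push\<close> is straight on every segment: on the spokes by
  \<open>push_ray\<close>, on all others because it fixes them. What needs an argument is the cyclic
  order at the vertices, which comes from \<open>ccw_motion\<close>.\<close>

lemma push_slide:
  assumes n2: "n \<ge> 2" and T: "diagram n T" and sp: "spokes n T v c e"
    and Q: "compact Q" "convex Q" and v: "v \<in> interior Q" "v' \<in> interior Q"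
    and e_all: "\<forall>i<2 * n. e i \<in> frontier Q"
    and out_all: "\<forall>s\<in>T. v \<notin> ends s \<longrightarrow> seg s \<inter> interior Q = {}"
  shows "diagram n (transport (push Q v v') T)"
    and "homotopic_diagrams n T (transport (push Q v v') T)"
    and "verts n (transport (push Q v v') T) \<subseteq> push Q v v' ` verts n T"
    and "\<And>x c y. spokes n T x c y \<Longrightarrow> spokes n (transport (push Q v v') T) (push Q v v' x) c (\<lambda>i. push Q v v' (y i))"
    and "\<And>x. x \<in> pts T \<Longrightarrow> x \<in> interior Q \<Longrightarrow> x = v"
proof -
  let ?f = "push Q v v'"
  note e = e_all[rule_format] and out = out_all[rule_format]
  note hom = push_homeomorphism[OF Q v]
  have inj: "inj ?f" using push_push[OF Q v] by (metis injI)
  have fr: "b \<notin> interior Q" if "b \<in> frontier Q" for b using that by (simp add: frontier_def)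
  show pin: "x = v" if x: "x \<in> pts T" "x \<in> interior Q" for x
  proof -
    obtain s where s: "s \<in> T" "x \<in> ends s" using x by (auto simp: pts_def)
    show ?thesis
    proof (cases "v \<in> ends s")
      case True
      then obtain i where "i < 2 * n" "s = spoke n v c e i" using spokes_star[OF sp s(1)] by blast
      then show ?thesis using s(2) e[of i] fr[of "e i"] x by auto
    next
      case False
      then show ?thesis using out[OF s(1)] s(2) ends_subset_seg x by blast
    qed
  qed
  have fv: "?f v = v'" using push_ray[OF Q v(1), of "e 0" 0 v'] e n2 by simp
  have fo: "?f x = x" if "x \<notin> interior Q" for x using push_id[OF Q v(1) that] .
  have ray: "?f ` closed_segment v b = closed_segment v' b" if "b \<in> frontier Q" for b
    by (rule segment_image_affine) (rule push_ray[OF Q v(1) that])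
  have img: "?f ` closed_segment p q = closed_segment (?f p) (?f q)" if pq: "(p, q, d) \<in> T" for p q d
  proof (cases "v \<in> ends (p, q, d)")
    case True
    then obtain i where i: "i < 2 * n" "(p, q, d) = spoke n v c e i" using spokes_star[OF sp pq] by blast
    have b: "e i \<in> frontier Q" using e i by blast
    have "(p = v \<and> q = e i) \<or> (q = v \<and> p = e i)" using i(2) by (auto simp: spoke_def split: if_splits)
    then show ?thesis using ray[OF b] fv fo[OF fr[OF b]] by (auto simp: closed_segment_commute)
  next
    case False
    then have "closed_segment p q \<inter> interior Q = {}" using out[OF pq] by simp
    then have "?f z = z" if "z \<in> closed_segment p q" for z using fo that by blast
    then show ?thesis by (simp add: image_def)
  qed
  have ccw: "ccw (2 * n) (?f x) (\<lambda>i. ?f (y i))" if sx: "spokes n T x d y" for x d y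
  proof (cases "x = v")
    case True
    have yf: "y i \<in> frontier Q" if i: "i < 2 * n" for i
    proof -
      have "v \<in> ends (spoke n x d y i)" using True by simp
      then obtain j where j: "j < 2 * n" "spoke n x d y i = spoke n v c e j"
        using spokes_star[OF sp spokes_in(1)[OF sx i]] by blast
      then have "y i = e j" using spoke_eqD[OF j(2)] True spokes_ne[OF sx i] by (auto simp: doubleton_eq_iff)
      then show ?thesis using e j by simp
    qed
    \<comment> \<open>While \<open>v\<close> moves inside \<open>Q\<close>, its spokes end in fixed
      distinct points of the frontier, so no two of them ever share a ray.\<close>
    have "ccw (2 * n) (v + 1 *\<^sub>R (v' - v)) y"
    proof (rule ccw_motion[of "2*n" "\<lambda>t. v + t *\<^sub>R (v' - v)" "\<lambda>_. y"])
      show "ccw (2 * n) (v + 0 *\<^sub>R (v' - v)) y" using sx True by (simp add: spokes_def)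
      show "continuous_on {0..1} (\<lambda>t. v + t *\<^sub>R (v' - v))" by (intro continuous_intros)
      show "continuous_on {0..1} (\<lambda>t. y i)" for i by (intro continuous_intros)
      fix t :: real assume t: "t \<in> {0..1}"
      note vt = interior_segment[OF Q(2) v t]
      show "y i \<noteq> v + t *\<^sub>R (v' - v)" if "i < 2 * n" for i using fr[OF yf[OF that]] vt by metis
      show "y i - (v + t *\<^sub>R (v' - v)) \<noteq> of_real s * (y j - (v + t *\<^sub>R (v' - v)))"
        if "i < 2 * n" "j < 2 * n" "i \<noteq> j" "s > 0" for i j s
        using interior_ray[OF Q(2) vt yf yf _ _ Q(1)] spokes_inj[OF sx] that by blast
    qed
    then have "ccw (2 * n) v' y" by simp
    then show ?thesis using True fv fo fr yf by (auto intro: ccw_cong)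
  next
    case False
    have xp: "x \<in> pts T" using spokes_in[OF sx, of 0] n2 unfolding pts_def by fastforce
    then have xo: "x \<notin> interior Q" using False pin by blast
    have yp: "y i \<in> pts T" if "i < 2 * n" for i
      using spokes_in(1)[OF sx that] by (auto simp: pts_def intro!: bexI[of _ "spoke n x d y i"])
    \<comment> \<open>At another vertex at most one spoke moves, the one ending in
      \<open>v\<close>.\<close>
    let ?y = "\<lambda>t i. if y i = v then v + t *\<^sub>R (v' - v) else y i"
    have "ccw (2 * n) x (?y 1)"
    proof (rule ccw_motion[of "2*n" "\<lambda>_. x" "?y"])
      show "ccw (2 * n) x (?y 0)" using sx by (auto simp: spokes_def intro: ccw_cong)
      show "continuous_on {0..1} (\<lambda>t. x)" by (intro continuous_intros)
      show "continuous_on {0..1} (\<lambda>t. ?y t i)" for i by (cases "y i = v") (auto intro!: continuous_intros)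
      fix t :: real assume t: "t \<in> {0..1}"
      note vt = interior_segment[OF Q(2) v t]
      show "?y t i \<noteq> x" if "i < 2 * n" for i using vt xo spokes_ne[OF sx that] by auto
      \<comment> \<open>Here \<open>x\<close> is the frontier end of a spoke of \<open>v\<close>. If
        the moving ray met the ray of \<open>y j\<close>, then points of the spoke to
        \<open>y j\<close> close to \<open>x\<close> would lie between \<open>x\<close> and an inner
        point of \<open>Q\<close>, hence in the interior, which that spoke avoids.\<close>
      have key: "v + t *\<^sub>R (v' - v) - x \<noteq> of_real s * (y j - x)"
        if i: "i < 2 * n" "j < 2 * n" "i \<noteq> j" "s > 0" "y i = v" for i j s
      proof
        assume eq: "v + t *\<^sub>R (v' - v) - x = of_real s * (y j - x)"
        have "v \<in> ends (spoke n x d y i)" using i by simp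
        then obtain l where l: "l < 2 * n" "spoke n x d y i = spoke n v c e l"
          using spokes_star[OF sp spokes_in(1)[OF sx i(1)]] by blast
        then have "x = e l" using spoke_eqD[OF l(2)] False by (auto simp: doubleton_eq_iff)
        then have xf: "x \<in> closure Q" using e l by (auto simp: frontier_def)
        have yj: "y j \<noteq> v" using spokes_inj[OF sx, of i j] i by auto
        have disj: "closed_segment x (y j) \<inter> interior Q = {}"
          using out[OF spokes_in(1)[OF sx i(2)]] yj False by simp
        \<comment> \<open>This choice keeps both parameters at most 1: \<open>u\<close> on the
          moving segment and \<open>u * s\<close> on the segment to \<open>y j\<close>.\<close>
        define u where "u = min 1 (1 / s)"
        have u: "0 < u" "u \<le> 1" "u * s \<le> 1" using i(4) by (auto simp: u_def min_def field_simps)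
        have "(v + t *\<^sub>R (v' - v)) - u' *\<^sub>R ((v + t *\<^sub>R (v' - v)) - x) \<in> interior Q" if "0 \<le> u'" "u' < 1" for u'
        proof (cases "u' = 0")
          case False
          have "rel_interior Q = interior Q" using v(1) by (intro rel_interior_nonempty_interior) auto
          then show ?thesis using mem_interior_closure_convex_shrink[OF Q(2) vt xf, of "1 - u'"] that False
            by (simp add: algebra_simps)
        qed (use vt in simp)
        from this[of "1 - u"] have "x + u *\<^sub>R ((v + t *\<^sub>R (v' - v)) - x) \<in> interior Q"
          using u by (simp add: algebra_simps)
        moreover have "x + u *\<^sub>R ((v + t *\<^sub>R (v' - v)) - x) = x + (u * s) *\<^sub>R (y j - x)"
          unfolding eq by (simp add: scaleR_conv_of_real)
        moreover have "x + (u * s) *\<^sub>R (y j - x) \<in> closed_segment x (y j)"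
          using u i(4) by (auto simp: in_segment algebra_simps intro!: exI[of _ "u * s"])
        ultimately show False using disj by auto
      qed
      show "?y t i - x \<noteq> of_real s * (?y t j - x)"
        if i: "i < 2 * n" "j < 2 * n" "i \<noteq> j" "s > 0" for i j s
      proof -
        consider "y i = v" "y j \<noteq> v" | "y i \<noteq> v" "y j = v" | "y i \<noteq> v" "y j \<noteq> v"
          using spokes_inj[OF sx, of i j] i by metis
        then show ?thesis
        proof cases
          case 1 then show ?thesis using key[OF i] by simp
        next
          case 2
          show ?thesis
          proof
            assume "?y t i - x = of_real s * (?y t j - x)"
            then have "v + t *\<^sub>R (v' - v) - x = of_real (1 / s) * (y i - x)" using 2 i(4) by simp
            then show False using key[of j i "1/s"] i 2 by simp
          qed
        next
          case 3 then show ?thesis using ccw_rays[of "2*n" x y i j s] sx i by (simp add: spokes_def)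
        qed
      qed
    qed
    then have "ccw (2 * n) x (\<lambda>i. ?f (y i))"
      by (rule ccw_cong) (use fv fo pin yp in auto)
    then show ?thesis using fo[OF xo] by simp
  qed
  note tr = transport[OF n2 T inj img ccw]
  show D: "diagram n (transport ?f T)" by (rule tr(1))
  show "verts n (transport ?f T) \<subseteq> ?f ` verts n T" by (rule tr(2))
  show "\<And>x c y. spokes n T x c y \<Longrightarrow> spokes n (transport ?f T) (?f x) c (\<lambda>i. ?f (y i))" by (rule tr(3))
  have "\<forall>(p, q, d)\<in>T. ?f ` closed_segment p q = closed_segment (?f p) (?f q)"
  proof (rule ballI, clarify)
    fix p q d assume "(p, q, d) \<in> T"
    then show "?f ` closed_segment p q = closed_segment (?f p) (?f q)" by (rule img)
  qed
  then have "isotopic T (transport ?f T)"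
    unfolding isotopic_def
    by (intro exI[of _ "\<lambda>t. push Q v (v + t *\<^sub>R (v' - v))"]) (simp add: transport_def push_isotopy[OF Q v])
  then show "homotopic_diagrams n T (transport ?f T)"
    using T D by (intro homotopic_step) (simp add: elementary_step_def)
qed


text \<open>The point where the segment from an inner point \<open>v\<close> to an outer point \<open>y\<close> leaves \<open>Q\<close>.\<close>

definition exit_point :: "complex set \<Rightarrow> complex \<Rightarrow> complex \<Rightarrow> complex" where
  "exit_point Q v y = v + (1 / gauge_at Q v y) *\<^sub>R (y - v)"

lemma exit_point:
  assumes Q: "compact Q" "convex Q" and v: "v \<in> interior Q" and y: "y \<notin> interior Q"
  shows exit_point_frontier: "exit_point Q v y \<in> frontier Q"
    and exit_point_open: "exit_point Q v y = y \<or> exit_point Q v y \<in> open_segment v y"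
    and exit_point_closed: "exit_point Q v y \<in> closed_segment v y"
    and exit_point_eq: "y \<in> frontier Q \<Longrightarrow> exit_point Q v y = y"
proof -
  let ?g = "gauge_at Q v y"
  have g: "?g \<ge> 1" using gauge_at_less_1[OF Q v, of y] y by simp
  show "exit_point Q v y \<in> frontier Q"
    using gauge_at_eq_1[OF Q v, of "exit_point Q v y"] gauge_at_scale[OF Q v, of "1 / ?g" y] g
    by (simp add: exit_point_def)
  show "exit_point Q v y = y" if "y \<in> frontier Q"
    using gauge_at_eq_1[OF Q v, of y] that by (simp add: exit_point_def)
  show o: "exit_point Q v y = y \<or> exit_point Q v y \<in> open_segment v y"
  proof (cases "?g = 1")
    case False
    then have "1 / ?g < 1" "0 < 1 / ?g" using g by auto
    moreover have "exit_point Q v y = (1 - 1 / ?g) *\<^sub>R v + (1 / ?g) *\<^sub>R y"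
      by (simp add: exit_point_def algebra_simps)
    moreover have "v \<noteq> y" using v y by blast
    ultimately show ?thesis unfolding in_segment by metis
  qed (simp add: exit_point_def)
  show "exit_point Q v y \<in> closed_segment v y" using o by (auto simp: open_segment_def)
qed

text \<open>Each spoke is cut where it leaves \<open>Q\<close>, and then \<open>push_slide\<close>
  applies. A spoke with \<open>e i = y i\<close> is not cut; its far end simply sees
  \<open>v'\<close> in place of \<open>v\<close>.\<close>

lemma slide:
  assumes n2: "n \<ge> 2" and T: "diagram n T" and sp: "spokes n T v c y"
    and Q: "compact Q" "convex Q" and v: "v \<in> interior Q" "v' \<in> interior Q"
    and y: "\<And>i. i < 2 * n \<Longrightarrow> y i \<notin> interior Q"
    and out: "\<And>s. s \<in> T \<Longrightarrow> v \<notin> ends s \<Longrightarrow> seg s \<inter> interior Q = {}"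
    and e: "\<And>i. e i = exit_point Q v (y i)"
  obtains T' where "homotopic_diagrams n T T'" "diagram n T'" "verts n T' \<subseteq> insert v' (verts n T - {v})"
    "spokes n T' v' c e"
    "\<And>s. s \<in> T \<Longrightarrow> v \<notin> ends s \<Longrightarrow> s \<in> T'"
    "\<And>s. s \<in> T' \<Longrightarrow> v' \<notin> ends s \<Longrightarrow> s \<in> T \<and> v \<notin> ends s \<or> (\<exists>i<2 * n. ends s = {e i, y i})"
    "\<And>x c' y'. x \<noteq> v \<Longrightarrow> spokes n T x c' y' \<Longrightarrow> \<exists>y''. spokes n T' x c' y'' \<and>
        (\<forall>j<2 * n. (v \<notin> ends (spoke n x c' y' j) \<longrightarrow> y'' j = y' j) \<and>
          (\<forall>i<2 * n. spoke n x c' y' j = spoke n v c y i \<longrightarrow> y'' j = (if e i \<noteq> y i then e i else v')))"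
proof -
  let ?g = "\<lambda>i. gauge_at Q v (y i)"
  have e_def: "e i = v + (1 / ?g i) *\<^sub>R (y i - v)" for i by (simp add: e exit_point_def)
  have g: "?g i \<ge> 1" if "i < 2 * n" for i using gauge_at_less_1[OF Q v(1), of "y i"] y[OF that] by simp
  have e_fr: "e i \<in> frontier Q" if "i < 2 * n" for i
    using exit_point_frontier[OF Q v(1) y[OF that]] e by simp
  have e_open: "e i = y i \<or> e i \<in> open_segment v (y i)" if "i < 2 * n" for i
    using exit_point_open[OF Q v(1) y[OF that]] e by simp
  \<comment> \<open>Along the outer piece the gauge grows linearly from 1, its value on the
    frontier, so the piece never enters the interior.\<close>
  have tail: "closed_segment (e i) (y i) \<inter> interior Q = {}" if i: "i < 2 * n" for i
  proof -
    have "z \<notin> interior Q" if z: "z \<in> closed_segment (e i) (y i)" for z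
    proof -
      obtain u where u: "0 \<le> u" "u \<le> 1" "z = (1 - u) *\<^sub>R e i + u *\<^sub>R y i" using z by (auto simp: in_segment)
      then have "z = v + ((1 - u) / ?g i + u) *\<^sub>R (y i - v)" by (simp add: e_def algebra_simps)
      moreover have "0 \<le> (1 - u) / ?g i + u" using u g[OF i] by simp
      ultimately have "gauge_at Q v z = ((1 - u) / ?g i + u) * ?g i" using gauge_at_scale[OF Q v(1)] by simp
      also have "\<dots> = (1 - u) + u * ?g i" using g[OF i] by (simp add: field_simps)
      also have "\<dots> \<ge> 1" using mult_left_mono[OF g[OF i] u(1)] by simp
      finally show ?thesis using gauge_at_less_1[OF Q v(1), of z] by simp
    qed
    then show ?thesis by blast
  qed
  show ?thesis
  proof (rule star_cut[OF n2 T sp, of e])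
    fix T1 assume T1: "homotopic_diagrams n T T1" "diagram n T1" "verts n T1 \<subseteq> verts n T"
     "spokes n T1 v c e" "\<And>s. s \<in> T \<Longrightarrow> v \<notin> ends s \<Longrightarrow> s \<in> T1"
     "\<And>s. s \<in> T1 \<Longrightarrow> v \<notin> ends s \<Longrightarrow> s \<in> T \<or> (\<exists>i<2 * n. ends s = {e i, y i})"
     "\<And>x c' y'. x \<noteq> v \<Longrightarrow> spokes n T x c' y' \<Longrightarrow> \<exists>y''. spokes n T1 x c' y'' \<and>
        (\<forall>j<2 * n. (v \<notin> ends (spoke n x c' y' j) \<longrightarrow> y'' j = y' j) \<and>
          (\<forall>i<2 * n. spoke n x c' y' j = spoke n v c y i \<longrightarrow> y'' j = (if e i \<noteq> y i then e i else v)))"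
    have out1: "seg s \<inter> interior Q = {}" if s: "s \<in> T1" "v \<notin> ends s" for s
    proof (cases "s \<in> T")
      case True
      then show ?thesis using out s by blast
    next
      case False
      then obtain i where i: "i < 2 * n" "ends s = {e i, y i}" using T1(6) s by blast
      then have "seg s = closed_segment (e i) (y i)"
        by (cases s) (auto simp: doubleton_eq_iff closed_segment_commute)
      then show ?thesis using tail i by simp
    qed
    let ?f = "push Q v v'"
    define T' where "T' = transport ?f T1"
    have "\<forall>i<2 * n. e i \<in> frontier Q" "\<forall>s\<in>T1. v \<notin> ends s \<longrightarrow> seg s \<inter> interior Q = {}"
      using e_fr out1 by blast+
    note ps = push_slide[OF n2 T1(2,4) Q v this, folded T'_def]
    have fv: "?f v = v'" using push_ray[OF Q v(1) e_fr, of 0 0 v'] n2 by simp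
    have fo: "?f x = x" if "x \<in> pts T1" "x \<noteq> v" for x using ps(5) push_id[OF Q v(1)] that by blast
    have e_out: "e i \<notin> interior Q" if "i < 2 * n" for i using e_fr[OF that] by (simp add: frontier_def)
    have y_pts: "y' j \<in> pts T1" "x \<in> pts T1" if "spokes n T1 x c' y'" "j < 2 * n" for x c' y' j
      using spokes_in(1)[OF that] unfolding pts_def by fastforce+
    have fs: "?f p = p \<and> ?f q = q" if "(p, q, d) \<in> T1" "v \<notin> ends (p, q, d)" for p q d
    proof -
      have "p \<in> pts T1" "q \<in> pts T1" using that(1) unfolding pts_def by force+
      then show ?thesis using fo that(2) by auto
    qed
    show ?thesis
    proof (rule that[of T'])
      show "homotopic_diagrams n T T'" using homotopic_trans[OF T1(1) ps(2)] .
      show "diagram n T'" by (rule ps(1))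
      show "verts n T' \<subseteq> insert v' (verts n T - {v})"
      proof
        fix x assume "x \<in> verts n T'"
        then obtain z where z: "z \<in> verts n T1" "x = ?f z" using ps(3) by blast
        then have "z \<in> pts T1" using verts_subset_pts[of n T1] n2 by auto
        then show "x \<in> insert v' (verts n T - {v})" using z fv fo[of z] T1(3) by (cases "z = v") auto
      qed
      have "spokes n T' v' c (\<lambda>i. ?f (e i))" using ps(4)[OF T1(4)] fv by simp
      then show "spokes n T' v' c e"
        by (rule spokes_cong) (use push_id[OF Q v(1) e_out] in simp)
      show "s \<in> T'" if s: "s \<in> T" "v \<notin> ends s" for s
      proof -
        obtain p q d where pqd: "s = (p, q, d)" by (cases s)
        have "(p, q, d) \<in> T1" using T1(5)[OF s] pqd by simp
        then show ?thesis using fs[of p q d] s(2) unfolding T'_def transport_def pqd by force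
      qed
      show "s \<in> T \<and> v \<notin> ends s \<or> (\<exists>i<2 * n. ends s = {e i, y i})" if s: "s \<in> T'" "v' \<notin> ends s" for s
      proof -
        obtain p q d where pqd: "(p, q, d) \<in> T1" "s = (?f p, ?f q, d)"
          using s(1) by (auto simp: T'_def transport_def)
        then have "v \<notin> ends (p, q, d)" using s(2) fv by auto
        moreover from this have "s = (p, q, d)" using fs[OF pqd(1)] pqd(2) by simp
        ultimately show ?thesis using T1(6)[OF pqd(1)] by simp
      qed
      fix x c' y' assume x: "x \<noteq> v" and sx: "spokes n T x c' y'"
      obtain y1 where y1: "spokes n T1 x c' y1"
        and y1a: "\<And>j. j < 2 * n \<Longrightarrow> v \<notin> ends (spoke n x c' y' j) \<Longrightarrow> y1 j = y' j"
        and y1b: "\<And>j i. j < 2 * n \<Longrightarrow> i < 2 * n \<Longrightarrow> spoke n x c' y' j = spoke n v c y i \<Longrightarrow>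
               y1 j = (if e i \<noteq> y i then e i else v)" using T1(7)[OF x sx] by blast
      have "?f x = x" using fo[OF y_pts(2)[OF y1, of 0]] n2 x by simp
      then have sp'': "spokes n T' x c' (\<lambda>j. ?f (y1 j))" using ps(4)[OF y1] by simp
      have "?f (y1 j) = y' j" if "j < 2 * n" "v \<notin> ends (spoke n x c' y' j)" for j
        using y1a[OF that] fo[OF y_pts(1)[OF y1 that(1)]] that(2) by auto
      moreover have "?f (y1 j) = (if e i \<noteq> y i then e i else v')"
        if "j < 2 * n" "i < 2 * n" "spoke n x c' y' j = spoke n v c y i" for i j
        using y1b[OF that] fv push_id[OF Q v(1) e_out[OF that(2)]] by simp
      ultimately show "\<exists>y''. spokes n T' x c' y'' \<and>
          (\<forall>j<2 * n. (v \<notin> ends (spoke n x c' y' j) \<longrightarrow> y'' j = y' j) \<and>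
            (\<forall>i<2 * n. spoke n x c' y' j = spoke n v c y i \<longrightarrow> y'' j = (if e i \<noteq> y i then e i else v')))"
        using sp'' by (intro exI[of _ "\<lambda>j. ?f (y1 j)"]) blast
    qed
  qed (use e_open in auto)
qed

text \<open>\<open>exp (t * Ln \<alpha>)\<close> is a path of nonzero factors from 1 to
  \<open>\<alpha>\<close>, so every stage of the isotopy is an invertible similarity. It serves to
  place two adjacent vertices at 0 and 1.\<close>

lemma affine_homotopic:
  assumes n2: "n \<ge> 2" and T: "diagram n T" and \<alpha>: "\<alpha> \<noteq> 0"
    and f: "f = (\<lambda>z. \<alpha> * z + \<beta>)"
  shows "diagram n (transport f T)" and "homotopic_diagrams n T (transport f T)"
    and "card (verts n (transport f T)) \<le> card (verts n T)"
    and "\<And>x c y. spokes n T x c y \<Longrightarrow> spokes n (transport f T) (f x) c (\<lambda>i. f (y i))"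
proof -
  have inj: "inj f" using \<alpha> by (auto simp: f inj_def)
  have img: "f ` closed_segment p q = closed_segment (f p) (f q)" for p q
    by (rule segment_image_affine) (simp add: f scaleR_conv_of_real algebra_simps)
  have ccw: "ccw (2 * n) (f x) (\<lambda>i. f (y i))" if "spokes n T x c y" for x c y
    using that ccw_affine[of "2 * n" x y \<alpha> \<beta>] \<alpha> by (simp add: spokes_def f)
  note tr = transport[OF n2 T inj img ccw]
  show D: "diagram n (transport f T)" by (rule tr(1))
  show "\<And>x c y. spokes n T x c y \<Longrightarrow> spokes n (transport f T) (f x) c (\<lambda>i. f (y i))" by (rule tr(3))
  have fin: "finite (verts n T)"
    using finite_subset[OF verts_subset_pts finite_pts[OF diagram_finite[OF T]]] n2 by simp
  show "card (verts n (transport f T)) \<le> card (verts n T)" using surj_card_le[OF fin tr(2)] .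
  define H where "H t z = exp (of_real t * Ln \<alpha>) * z + of_real t * \<beta>" for t :: real and z :: complex
  have "ambient_isotopy H"
    unfolding ambient_isotopy_def
  proof (intro conjI ballI)
    show "continuous_on ({0..1} \<times> UNIV) (\<lambda>(t, z). H t z)"
      unfolding H_def case_prod_beta by (intro continuous_intros)
    show "H 0 = id" by (auto simp: H_def)
    fix t :: real
    let ?a = "exp (of_real t * Ln \<alpha>)"
    have "homeomorphism UNIV UNIV (H t) (\<lambda>z. (z - of_real t * \<beta>) / ?a)"
      unfolding homeomorphism_def H_def
      by (auto intro!: continuous_intros simp: surj_def) (metis add.commute diff_add_cancel exp_not_eq_zero nonzero_mult_div_cancel_left times_divide_eq_right, metis add_diff_cancel_right' exp_not_eq_zero nonzero_mult_div_cancel_left)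
    then show "\<exists>g. homeomorphism UNIV UNIV (H t) g" by blast
  qed
  moreover have "H 1 = f" using \<alpha> by (auto simp: H_def f)
  ultimately have "isotopic T (transport f T)"
    unfolding isotopic_def using img by (intro exI[of _ H]) (auto simp: transport_def)
  then show "homotopic_diagrams n T (transport f T)"
    using T D by (intro homotopic_step) (simp add: elementary_step_def)
qed

subsection \<open>Lenses around a segment\<close>

text \<open>For \<open>h \<ge> 0\<close> the set where this is at most 0 is the intersection of the
  two discs with centres \<open>L / 2 + \<i> * h\<close> and \<open>L / 2 - \<i> * h\<close> whose
  boundaries pass through 0 and \<open>L\<close>: a lens with these tips, the thinner the larger
  \<open>h\<close> is.\<close>

definition lens_fun :: "real \<Rightarrow> real \<Rightarrow> complex \<Rightarrow> real" where
  "lens_fun L h u = (Re u)\<^sup>2 + (Im u)\<^sup>2 - L * Re u + 2 * h * \<bar>Im u\<bar>"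

text \<open>The squares contribute a strict gain, \<open>t * (1 - t)\<close> times the squared
  distance of \<open>a\<close> and \<open>b\<close>; the absolute value is convex and the remaining
  term is linear.\<close>

lemma lens_fun_strict:
  assumes "a \<noteq> b" "0 < t" "t < 1" "lens_fun L h a \<le> 0" "lens_fun L h b \<le> 0" "h \<ge> 0"
  shows "lens_fun L h ((1 - t) *\<^sub>R a + t *\<^sub>R b) < 0"
proof -
  have sq: "((1 - t) * x + t * y)\<^sup>2 = (1 - t) * x\<^sup>2 + t * y\<^sup>2 - t * (1 - t) * (x - y)\<^sup>2" for x y
    by (simp add: power2_eq_square algebra_simps)
  have ab: "\<bar>(1 - t) * Im a + t * Im b\<bar> \<le> (1 - t) * \<bar>Im a\<bar> + t * \<bar>Im b\<bar>"
    using abs_triangle_ineq[of "(1 - t) * Im a" "t * Im b"] assms(2,3) by (simp add: abs_mult)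
  have "(Re a - Re b)\<^sup>2 + (Im a - Im b)\<^sup>2 > 0"
    using assms(1) by (simp add: complex_eq_iff sum_power2_gt_zero_iff)
  then have "t * (1 - t) * ((Re a - Re b)\<^sup>2 + (Im a - Im b)\<^sup>2) > 0" using assms(2,3) by simp
  moreover have "2 * h * \<bar>(1 - t) * Im a + t * Im b\<bar> \<le> 2 * h * ((1 - t) * \<bar>Im a\<bar> + t * \<bar>Im b\<bar>)"
    using ab assms(6) by (intro mult_left_mono) auto
  moreover have "(1 - t) * lens_fun L h a + t * lens_fun L h b \<le> 0"
    using assms(2-5) by (intro add_nonpos_nonpos mult_nonneg_nonpos) auto
  moreover have "(1 - t) * lens_fun L h a + t * lens_fun L h b =
      ((1 - t) * (Re a)\<^sup>2 + t * (Re b)\<^sup>2) + ((1 - t) * (Im a)\<^sup>2 + t * (Im b)\<^sup>2)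
      - L * ((1 - t) * Re a + t * Re b) + 2 * h * ((1 - t) * \<bar>Im a\<bar> + t * \<bar>Im b\<bar>)"
    by (simp add: lens_fun_def algebra_simps)
  moreover have "lens_fun L h ((1 - t) *\<^sub>R a + t *\<^sub>R b) =
      ((1 - t) * (Re a)\<^sup>2 + t * (Re b)\<^sup>2) + ((1 - t) * (Im a)\<^sup>2 + t * (Im b)\<^sup>2)
      - t * (1 - t) * ((Re a - Re b)\<^sup>2 + (Im a - Im b)\<^sup>2)
      - L * ((1 - t) * Re a + t * Re b) + 2 * h * \<bar>(1 - t) * Im a + t * Im b\<bar>"
    by (simp only: lens_fun_def plus_complex.sel scaleR_complex.sel sq) (simp only: distrib_left)
  ultimately show ?thesis by linarith
qed

text \<open>Most of this comes from dropping nonnegative terms in the defining inequality. The slope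
  \<open>L / (2 * h)\<close> at the tip 0 and the half-width \<open>L\<^sup>2 / (2 * h)\<close> both
  shrink as \<open>h\<close> grows.\<close>

lemma lens_fun_bounds:
  assumes "lens_fun L h u \<le> 0" "h > 0" "L > 0"
  shows "0 \<le> Re u" "Re u \<le> L" "2 * h * \<bar>Im u\<bar> \<le> L * Re u" "\<bar>Im u\<bar> \<le> L\<^sup>2 / (2 * h)" "u \<noteq> 0 \<Longrightarrow> 0 < Re u"
proof -
  have a: "(Re u)\<^sup>2 + (Im u)\<^sup>2 + 2 * h * \<bar>Im u\<bar> \<le> L * Re u" using assms(1) by (simp add: lens_fun_def)
  have b: "2 * h * \<bar>Im u\<bar> \<ge> 0" using assms(2) by simp
  have sq: "(Re u)\<^sup>2 \<ge> 0" "(Im u)\<^sup>2 \<ge> 0" by simp_all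
  have "L * Re u \<ge> 0" using a b sq by linarith
  then show 1: "0 \<le> Re u" using assms(3) by (simp add: zero_le_mult_iff)
  show 3: "2 * h * \<bar>Im u\<bar> \<le> L * Re u" using a sq by linarith
  have "(Re u)\<^sup>2 \<le> L * Re u" using a b sq by linarith
  then have "Re u * Re u \<le> L * Re u" by (simp add: power2_eq_square)
  then show 2: "Re u \<le> L" using 1 assms(3) by (cases "Re u = 0") auto
  have "2 * h * \<bar>Im u\<bar> \<le> L * L" using 3 mult_left_mono[OF 2, of L] assms(3) by linarith
  then show "\<bar>Im u\<bar> \<le> L\<^sup>2 / (2 * h)" using assms(2) by (simp add: field_simps power2_eq_square)
  show "0 < Re u" if "u \<noteq> 0"
  proof (rule ccontr)
    assume "\<not> 0 < Re u"
    then have "Re u = 0" using 1 by simp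
    then have "Im u = 0" using 3 assms(2) by (simp add: mult_le_0_iff)
    then show False using that \<open>Re u = 0\<close> by (simp add: complex_eq_iff)
  qed
qed

text \<open>The tips are \<open>w\<close> and a point slightly beyond \<open>v\<close>. A segment
  off the axis has positive distance from it, and one that starts at \<open>w\<close> does not leave
  in the direction of the axis; so a thin lens meets neither outside \<open>w\<close>. These are
  finitely many conditions, each valid for all large \<open>h\<close>.\<close>

lemma lens_exists:
  fixes v w :: complex
  assumes vw: "v \<noteq> w" and S: "finite S" "\<And>s. s \<in> S \<Longrightarrow> seg s \<inter> closed_segment v w \<subseteq> {w} \<inter> ends s"
    and Y: "finite Y" "Y \<inter> closed_segment v w \<subseteq> {w}" and \<tau>: "\<tau> > 0"
  obtains Q where "compact Q" "convex Q" "\<And>a b. a \<in> Q \<Longrightarrow> b \<in> Q \<Longrightarrow> open_segment a b \<subseteq> interior Q"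
    "v \<in> interior Q" "open_segment v w \<subseteq> interior Q" "w \<in> frontier Q"
    "\<And>s. s \<in> S \<Longrightarrow> seg s \<inter> Q \<subseteq> {w}" "Y \<inter> Q \<subseteq> {w}"
    "\<And>z. z \<in> Q \<Longrightarrow> z \<noteq> w \<Longrightarrow> 0 < Re ((z - w) / (v - w))"
    "\<And>z. z \<in> Q \<Longrightarrow> \<bar>Im ((z - w) / (v - w))\<bar> \<le> \<tau> * Re ((z - w) / (v - w))"
proof -
  define D where "D = v - w"
  have D: "D \<noteq> 0" using vw by (simp add: D_def)
  \<comment> \<open>The coordinate in which \<open>w\<close> is 0 and \<open>v\<close> is 1.\<close>
  define \<phi> where "\<phi> z = (z - w) / D" for z
  have z\<phi>: "z = w + \<phi> z * D" for z using D by (simp add: \<phi>_def)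
  have \<phi>v: "\<phi> v = 1" and \<phi>w: "\<phi> w = 0" using D by (auto simp: \<phi>_def D_def)
  have \<phi>lin: "\<phi> ((1 - t) *\<^sub>R a + t *\<^sub>R b) = (1 - t) *\<^sub>R \<phi> a + t *\<^sub>R \<phi> b" for t a b
    using D by (simp add: \<phi>_def field_simps scaleR_conv_of_real)
  have \<phi>inj: "\<phi> a = \<phi> b \<Longrightarrow> a = b" for a b using z\<phi> by metis
  have vS: "v \<notin> seg s" if "s \<in> S" for s using S(2)[OF that] vw by auto
  have vY: "v \<notin> Y" using Y vw by auto
  have "open (- ((\<Union>s\<in>S. seg s) \<union> Y))" using S(1) Y(1) by (intro open_Compl closed_Un closed_UN finite_imp_closed) auto
  moreover have "v \<in> - ((\<Union>s\<in>S. seg s) \<union> Y)" using vS vY by auto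
  ultimately obtain r where r: "r > 0" "ball v r \<subseteq> - ((\<Union>s\<in>S. seg s) \<union> Y)" using open_contains_ball by blast
  \<comment> \<open>The axis overshoots \<open>v\<close> by half the radius of a disc free of
    obstacles, measured in units of \<open>norm D\<close>; this puts \<open>v\<close> into the
    interior.\<close>
  define L where "L = 1 + r / (2 * norm D)"
  have L: "L > 1" using r D by (simp add: L_def)
  then have L0: "L > 0" by simp
  define K where "K = (\<lambda>x. w + of_real x * D) ` {0..L}"
  have K_in: "x \<in> closed_segment v w \<or> x \<in> ball v r" if xK: "x \<in> K" for x
  proof -
    obtain t where t: "0 \<le> t" "t \<le> L" "x = w + of_real t * D" using xK by (auto simp: K_def)
    show ?thesis
    proof (cases "t \<le> 1")
      case True
      have "x = (1 - (1 - t)) *\<^sub>R v + (1 - t) *\<^sub>R w"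
        using t(3) by (simp add: D_def scaleR_conv_of_real algebra_simps)
      then show ?thesis using t True unfolding in_segment by (intro disjI1 exI[of _ "1 - t"]) auto
    next
      case False
      have "x - v = of_real (t - 1) * D" using t(3) by (simp add: D_def algebra_simps)
      then have "norm (x - v) = (t - 1) * norm D" using False by (simp add: norm_mult del: of_real_diff)
      also have "\<dots> \<le> (r / (2 * norm D)) * norm D" using t(2) by (intro mult_right_mono) (auto simp: L_def)
      also have "\<dots> < r" using r D by simp
      finally show ?thesis by (simp add: dist_norm norm_minus_commute)
    qed
  qed
  have cK: "compact K" unfolding K_def by (intro compact_continuous_image continuous_intros) auto
  define q where "q h = {z. lens_fun L h (\<phi> z) \<le> 0}" for h
  have near: "\<exists>b\<in>K. dist z b \<le> norm D * (L\<^sup>2 / (2 * h))" if z: "z \<in> q h" "h > 0" for z h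
  proof -
    have zl: "lens_fun L h (\<phi> z) \<le> 0" using z by (simp add: q_def)
    note lb = lens_fun_bounds[OF zl z(2) L0]
    have "z - (w + of_real (Re (\<phi> z)) * D) = \<i> * of_real (Im (\<phi> z)) * D"
      by (subst z\<phi>[of z], subst complex_eq[of "\<phi> z"]) (simp add: algebra_simps)
    then have "dist z (w + of_real (Re (\<phi> z)) * D) = \<bar>Im (\<phi> z)\<bar> * norm D" by (simp add: dist_norm norm_mult)
    also have "\<dots> \<le> norm D * (L\<^sup>2 / (2 * h))" using mult_left_mono[OF lb(4), of "norm D"] by (simp add: mult.commute)
    finally show ?thesis using lb L unfolding K_def by (intro bexI[of _ "w + of_real (Re (\<phi> z)) * D"]) auto
  qed
  have ev1: "eventually (\<lambda>h. seg s \<inter> q h \<subseteq> {w}) at_top" if s: "s \<in> S" for s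
  proof (cases "w \<in> seg s")
    case False
    have "seg s \<inter> K = {}" using S(2)[OF s] K_in r(2) s False by (auto, blast)
    then obtain \<delta> where \<delta>: "\<delta> > 0" "\<And>x y. x \<in> seg s \<Longrightarrow> y \<in> K \<Longrightarrow> \<delta> \<le> dist x y"
      using separate_compact_closed[OF compact_seg compact_imp_closed[OF cK], of s] by auto
    have "((\<lambda>h. norm D * (L\<^sup>2 / (2 * h))) \<longlongrightarrow> 0) at_top" by real_asymp
    then have "eventually (\<lambda>h. norm D * (L\<^sup>2 / (2 * h)) < \<delta>) at_top" using \<delta>(1) by (rule order_tendstoD)
    then show ?thesis using eventually_gt_at_top[of 0]
    proof eventually_elim
      case (elim h)
      have "z \<notin> q h" if "z \<in> seg s" for z using near[of z h] elim \<delta>(2)[OF that] by force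
      then show ?case by blast
    qed
  next
    case True
    then have "w \<in> ends s" using S(2)[OF s] by auto
    then obtain p where p: "seg s = closed_segment w p" by (cases s) (auto simp: closed_segment_commute)
    let ?P = "\<phi> p"
    \<comment> \<open>Otherwise the segment would leave \<open>w\<close> along the axis and share
      more than \<open>w\<close> with the segment from \<open>v\<close>.\<close>
    have notpos: "\<not> (Im ?P = 0 \<and> Re ?P > 0)"
    proof
      assume a: "Im ?P = 0 \<and> Re ?P > 0"
      then have pe: "p = w + of_real (Re ?P) * D" using z\<phi>[of p] by (simp add: complex_eq_iff)
      define m where "m = min 1 (Re ?P)"
      have m: "0 < m" "m \<le> 1" "m \<le> Re ?P" using a by (auto simp: m_def)
      have "w + of_real m * D = (1 - m / Re ?P) *\<^sub>R w + (m / Re ?P) *\<^sub>R p"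
        using a by (subst pe) (simp add: scaleR_conv_of_real algebra_simps)
      then have "w + of_real m * D \<in> seg s" unfolding p in_segment using m a by (intro exI[of _ "m / Re ?P"]) auto
      moreover have "w + of_real m * D = (1 - (1 - m)) *\<^sub>R v + (1 - m) *\<^sub>R w"
        by (simp add: D_def scaleR_conv_of_real algebra_simps)
      then have "w + of_real m * D \<in> closed_segment v w"
        using m unfolding in_segment by (intro exI[of _ "1 - m"]) auto
      ultimately have "w + of_real m * D = w" using S(2)[OF s] by blast
      then show False using m D by simp
    qed
    have "eventually (\<lambda>h. L * Re ?P < 2 * h * \<bar>Im ?P\<bar> \<or> Re ?P \<le> 0) at_top"
    proof (cases "Re ?P \<le> 0")
      case False
      then have "\<bar>Im ?P\<bar> > 0" using notpos by auto
      have "eventually (\<lambda>h. h > L * Re ?P / (2 * \<bar>Im ?P\<bar>)) at_top" by (rule eventually_gt_at_top)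
      then show ?thesis by eventually_elim (use \<open>\<bar>Im ?P\<bar> > 0\<close> in \<open>simp add: field_simps\<close>)
    qed auto
    then show ?thesis using eventually_gt_at_top[of 0]
    proof eventually_elim
      case (elim h)
      have "z = w" if z: "z \<in> seg s" "z \<in> q h" for z
      proof (rule ccontr)
        assume "z \<noteq> w"
        obtain t where t: "0 \<le> t" "t \<le> 1" "z = (1 - t) *\<^sub>R w + t *\<^sub>R p" using z(1) by (auto simp: p in_segment)
        then have \<phi>z: "\<phi> z = t *\<^sub>R ?P" using \<phi>lin[of t w p] \<phi>w by simp
        have "t > 0" using t \<open>z \<noteq> w\<close> by (cases "t = 0") auto
        have zl: "lens_fun L h (\<phi> z) \<le> 0" using z by (simp add: q_def)
        have ne: "\<phi> z \<noteq> 0" using \<open>z \<noteq> w\<close> \<phi>inj \<phi>w by metis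
        note lb = lens_fun_bounds[OF zl]
        have "0 < t * Re ?P" using lb(5) ne elim L \<phi>z by simp
        then have "Re ?P > 0" using \<open>t > 0\<close> by (simp add: zero_less_mult_iff)
        then have 1: "L * Re ?P < 2 * h * \<bar>Im ?P\<bar>" using elim by simp
        have "2 * h * (t * \<bar>Im ?P\<bar>) \<le> L * (t * Re ?P)" using lb(3) elim L \<phi>z \<open>t > 0\<close> by (simp add: abs_mult)
        then have "t * (2 * h * \<bar>Im ?P\<bar>) \<le> t * (L * Re ?P)" by (simp add: algebra_simps)
        then show False using 1 \<open>t > 0\<close> by simp
      qed
      then show ?case by blast
    qed
  qed
  have ev2: "eventually (\<lambda>h. y \<in> q h \<longrightarrow> y = w) at_top" if y: "y \<in> Y" for y
  proof (cases "Im (\<phi> y) = 0")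
    case False
    have "eventually (\<lambda>h. h > L * Re (\<phi> y) / (2 * \<bar>Im (\<phi> y)\<bar>)) at_top" by (rule eventually_gt_at_top)
    then show ?thesis using eventually_gt_at_top[of 0]
    proof eventually_elim
      case (elim h)
      then have "L * Re (\<phi> y) < 2 * h * \<bar>Im (\<phi> y)\<bar>" using False by (simp add: field_simps)
      then show ?case using lens_fun_bounds(3)[of L h "\<phi> y"] elim L by (auto simp: q_def)
    qed
  next
    case True
    show ?thesis using eventually_gt_at_top[of 0]
    proof eventually_elim
      case (elim h)
      show ?case
      proof
        assume "y \<in> q h"
        then have "0 \<le> Re (\<phi> y)" "Re (\<phi> y) \<le> L"
          using lens_fun_bounds(1,2)[of L h "\<phi> y"] elim L by (auto simp: q_def)
        moreover have "y = w + of_real (Re (\<phi> y)) * D" using z\<phi>[of y] True by (simp add: complex_eq_iff)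
        ultimately have "y \<in> K" by (auto simp: K_def)
        then show "y = w" using K_in[of y] r(2) y Y(2) by auto
      qed
    qed
  qed
  \<comment> \<open>The condition \<open>h > L / (2 * \<tau>)\<close> makes the slope
    \<open>L / (2 * h)\<close> at the tip \<open>w\<close> smaller than
    \<open>\<tau>\<close>.\<close>
  have "eventually (\<lambda>h. (\<forall>s\<in>S. seg s \<inter> q h \<subseteq> {w}) \<and> (\<forall>y\<in>Y. y \<in> q h \<longrightarrow> y = w) \<and> h > L / (2 * \<tau>) \<and> h > 0) at_top"
    using ev1 ev2 S(1) Y(1) by (intro eventually_conj eventually_ball_finite ballI eventually_gt_at_top) auto
  then obtain h where h: "\<And>s. s \<in> S \<Longrightarrow> seg s \<inter> q h \<subseteq> {w}" "\<And>y. y \<in> Y \<Longrightarrow> y \<in> q h \<Longrightarrow> y = w"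
    "h > L / (2 * \<tau>)" "h > 0"
    using eventually_happens'[OF trivial_limit_at_top_linorder] by blast
  let ?G = "\<lambda>z. lens_fun L h (\<phi> z)"
  have contG: "continuous_on UNIV ?G"
    unfolding lens_fun_def \<phi>_def using D by (intro continuous_intros) auto
  have open_lt: "open {z. ?G z < 0}" using contG by (intro open_Collect_less) (auto intro: continuous_intros)
  have int: "{z. ?G z < 0} \<subseteq> interior (q h)"
    using open_lt by (intro interior_maximal) (auto simp: q_def)
  have strict: "open_segment a b \<subseteq> interior (q h)" if ab: "a \<in> q h" "b \<in> q h" for a b
  proof
    fix z assume "z \<in> open_segment a b"
    then obtain t where t: "a \<noteq> b" "0 < t" "t < 1" "z = (1 - t) *\<^sub>R a + t *\<^sub>R b" by (auto simp: in_segment)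
    then have "?G z < 0" using lens_fun_strict[of "\<phi> a" "\<phi> b" t L h] \<phi>inj[of a b] ab h(4) \<phi>lin by (auto simp: q_def)
    then show "z \<in> interior (q h)" using int by blast
  qed
  have w_q: "w \<in> q h" by (simp add: q_def \<phi>w lens_fun_def)
  show ?thesis
  proof (rule that[of "q h"])
    show "compact (q h)"
    proof -
      have "closed (q h)" unfolding q_def using contG by (intro closed_Collect_le) (auto intro: continuous_intros)
      moreover have "q h \<subseteq> (\<lambda>u. w + u * D) ` cbox (Complex 0 (- (L\<^sup>2 / (2 * h)))) (Complex L (L\<^sup>2 / (2 * h)))"
      proof
        fix z assume "z \<in> q h"
        then have "\<phi> z \<in> cbox (Complex 0 (- (L\<^sup>2 / (2 * h)))) (Complex L (L\<^sup>2 / (2 * h)))"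
          using lens_fun_bounds[of L h "\<phi> z"] h(4) L by (auto simp: q_def in_cbox_complex_iff abs_le_iff)
        then show "z \<in> (\<lambda>u. w + u * D) ` cbox (Complex 0 (- (L\<^sup>2 / (2 * h)))) (Complex L (L\<^sup>2 / (2 * h)))"
          using z\<phi>[of z] by blast
      qed
      moreover have "compact ((\<lambda>u. w + u * D) ` cbox (Complex 0 (- (L\<^sup>2 / (2 * h)))) (Complex L (L\<^sup>2 / (2 * h))))"
        by (intro compact_continuous_image continuous_intros compact_cbox)
      ultimately show ?thesis by (meson bounded_subset compact_eq_bounded_closed)
    qed
    show "open_segment a b \<subseteq> interior (q h)" if "a \<in> q h" "b \<in> q h" for a b using strict that .
    show "convex (q h)"
      unfolding convex_contains_open_segment using strict interior_subset by blast
    show "v \<in> interior (q h)" using int L by (auto simp: \<phi>v lens_fun_def)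
    show "open_segment v w \<subseteq> interior (q h)"
    proof
      fix z assume "z \<in> open_segment v w"
      then obtain t where t: "0 < t" "t < 1" "z = (1 - t) *\<^sub>R v + t *\<^sub>R w" by (auto simp: in_segment)
      then have "\<phi> z = of_real (1 - t)" using \<phi>lin[of t v w] \<phi>v \<phi>w by (simp add: scaleR_conv_of_real)
      then have ri: "Re (\<phi> z) = 1 - t" "Im (\<phi> z) = 0" by (simp_all del: of_real_diff)
      have "?G z = (1 - t) * ((1 - t) - L)" unfolding lens_fun_def ri by (simp add: power2_eq_square algebra_simps)
      also have "\<dots> < 0" using t L by (intro mult_pos_neg) auto
      finally show "z \<in> interior (q h)" using int by blast
    qed
    show "w \<in> frontier (q h)"
    proof -
      have "w \<notin> interior (q h)"
      proof
        assume "w \<in> interior (q h)"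
        then obtain \<delta> where \<delta>: "\<delta> > 0" "cball w \<delta> \<subseteq> q h" using mem_interior_cball by blast
        define z where "z = w - of_real (\<delta> / norm D) * D"
        have "z \<in> cball w \<delta>" using \<delta> D by (simp add: z_def dist_norm norm_mult norm_divide)
        then have "lens_fun L h (\<phi> z) \<le> 0" using \<delta> by (auto simp: q_def)
        then have "0 \<le> Re (\<phi> z)" using lens_fun_bounds(1) h(4) L by force
        moreover have "\<phi> z = - of_real (\<delta> / norm D)" using D by (simp add: z_def \<phi>_def)
        ultimately show False using \<delta> D by (simp add: divide_le_0_iff)
      qed
      then show ?thesis using w_q closure_subset by (auto simp: frontier_def)
    qed
    show "seg s \<inter> q h \<subseteq> {w}" if "s \<in> S" for s using h(1)[OF that] .
    show "Y \<inter> q h \<subseteq> {w}" using h(2) by blast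
    fix z assume z: "z \<in> q h"
    then have zl: "lens_fun L h (\<phi> z) \<le> 0" by (simp add: q_def)
    note lb = lens_fun_bounds[OF zl h(4) L0]
    show "0 < Re ((z - w) / (v - w))" if "z \<noteq> w"
      using lb(5) L \<phi>inj[of z w] that \<phi>w by (auto simp: \<phi>_def D_def)
    have "L \<le> 2 * h * \<tau>" using h(3) \<tau> by (simp add: field_simps)
    then have "L * Re (\<phi> z) \<le> 2 * h * \<tau> * Re (\<phi> z)" using lb(1) L by (intro mult_right_mono) auto
    then have "2 * h * \<bar>Im (\<phi> z)\<bar> \<le> 2 * h * (\<tau> * Re (\<phi> z))" using lb(3) L by (simp add: algebra_simps)
    then show "\<bar>Im ((z - w) / (v - w))\<bar> \<le> \<tau> * Re ((z - w) / (v - w))"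
      using h(4) by (simp add: \<phi>_def D_def)
  qed
qed

subsection \<open>Shortening the edge between two vertices\<close>

text \<open>The lens around the spoke from \<open>v\<close> to \<open>w\<close>. Segments away from
  \<open>v\<close> can be kept out of its interior, but the other spokes start inside, so for them
  only the far ends can be asked to stay out.\<close>

lemma diagram_lens:
  assumes T: "diagram n T" and sp: "spokes n T v c y" and i0: "i0 < 2 * n" "y i0 = w" and \<tau>: "\<tau> > 0"
  obtains Q where "compact Q" "convex Q" "\<And>a b. a \<in> Q \<Longrightarrow> b \<in> Q \<Longrightarrow> open_segment a b \<subseteq> interior Q"
    "v \<in> interior Q" "open_segment v w \<subseteq> interior Q" "w \<in> frontier Q"
    "\<And>s. s \<in> T \<Longrightarrow> v \<notin> ends s \<Longrightarrow> seg s \<inter> interior Q = {}"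
    "\<And>j. j < 2 * n \<Longrightarrow> y j \<notin> interior Q"
    "\<And>z. z \<in> Q \<Longrightarrow> z \<noteq> w \<Longrightarrow> 0 < Re ((z - w) / (v - w))"
    "\<And>z. z \<in> Q \<Longrightarrow> \<bar>Im ((z - w) / (v - w))\<bar> \<le> \<tau> * Re ((z - w) / (v - w))"
proof -
  let ?S = "{s \<in> T. v \<notin> ends s}" and ?Y = "y ` {..<2 * n}"
  have vw: "v \<noteq> w" using spokes_ne[OF sp i0(1)] i0 by simp
  have e1: "spoke n v c y i0 \<in> T" using spokes_in[OF sp i0(1)] by simp
  have S: "seg s \<inter> closed_segment v w \<subseteq> {w} \<inter> ends s" if "s \<in> ?S" for s
  proof -
    have "s \<noteq> spoke n v c y i0" using that ends_spoke[of n v c y i0] by auto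
    then have "seg s \<inter> seg (spoke n v c y i0) \<subseteq> ends s \<inter> ends (spoke n v c y i0)"
      using diagram_cross[OF T _ e1] that by blast
    then show ?thesis using that i0 by auto
  qed
  have Y: "?Y \<inter> closed_segment v w \<subseteq> {w}"
  proof
    fix z assume z: "z \<in> ?Y \<inter> closed_segment v w"
    then obtain j where j: "j < 2 * n" "z = y j" by auto
    show "z \<in> {w}"
    proof (cases "j = i0")
      case False
      have "spoke n v c y j \<noteq> spoke n v c y i0"
        using spoke_eqD[of n v c y j v c y i0] spokes_inj[OF sp j(1) i0(1)] False
          spokes_ne[OF sp j(1)] by (auto simp: doubleton_eq_iff)
      then have "seg (spoke n v c y j) \<inter> seg (spoke n v c y i0) \<subseteq> ends (spoke n v c y j) \<inter> ends (spoke n v c y i0)"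
        using diagram_cross[OF T spokes_in(1)[OF sp j(1)] e1] by blast
      then show ?thesis using z j i0 spokes_ne[OF sp j(1)] by auto
    qed (use j i0 in simp)
  qed
  have fin: "finite ?S" "finite ?Y" using diagram_finite[OF T] by auto
  obtain Q where Q: "compact Q" "convex Q" "\<And>a b. a \<in> Q \<Longrightarrow> b \<in> Q \<Longrightarrow> open_segment a b \<subseteq> interior Q"
    "v \<in> interior Q" "open_segment v w \<subseteq> interior Q" "w \<in> frontier Q"
    "\<And>s. s \<in> ?S \<Longrightarrow> seg s \<inter> Q \<subseteq> {w}" "?Y \<inter> Q \<subseteq> {w}"
    "\<And>z. z \<in> Q \<Longrightarrow> z \<noteq> w \<Longrightarrow> 0 < Re ((z - w) / (v - w))"
    "\<And>z. z \<in> Q \<Longrightarrow> \<bar>Im ((z - w) / (v - w))\<bar> \<le> \<tau> * Re ((z - w) / (v - w))"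
    by (rule lens_exists[OF vw fin(1) S fin(2) Y \<tau>]) (assumption | rule that | blast)+
  have w: "w \<notin> interior Q" using Q(6) by (simp add: frontier_def)
  show ?thesis
  proof (rule that[OF Q(1-6) _ _ Q(9,10)])
    show "seg s \<inter> interior Q = {}" if "s \<in> T" "v \<notin> ends s" for s
      using Q(7)[of s] that w interior_subset[of Q] by blast
    show "y j \<notin> interior Q" if "j < 2 * n" for j
      using Q(8) that w interior_subset[of Q] by blast
  qed
qed

text \<open>Inside a narrow lens with tip \<open>w\<close>, all segments at a point \<open>v'\<close> close to \<open>w\<close> except the one to \<open>w\<close>
  point backwards; choosing \<open>v'\<close> on the chord from \<open>w\<close> to \<open>e i1\<close> makes these two segments opposite.\<close>

lemma normalise:
  assumes n2: "n \<ge> 2" and T: "diagram n T" and sp: "spokes n T v c y" and i0: "i0 < 2 * n" "y i0 = w"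
    and i1: "i1 < 2 * n" "i1 \<noteq> i0" and \<tau>: "\<tau> > 0"
  obtains T' v' e s where "homotopic_diagrams n T T'" "diagram n T'" "verts n T' \<subseteq> insert v' (verts n T - {v})"
    "spokes n T' v' c e" "e i0 = w" "s > 0" "e i1 - v' = - of_real s * (w - v')"
    "\<And>j. j < 2 * n \<Longrightarrow> j \<noteq> i0 \<Longrightarrow> Re ((e j - v') / (w - v')) < 0"
    "0 < Re ((v' - w) / (v - w))" "\<bar>Im ((v' - w) / (v - w))\<bar> \<le> \<tau> * Re ((v' - w) / (v - w))"
    "\<And>x c' y'. x \<noteq> v \<Longrightarrow> spokes n T x c' y' \<Longrightarrow> \<exists>y''. spokes n T' x c' y'' \<and>
        (\<forall>j<2 * n. (v \<notin> ends (spoke n x c' y' j) \<longrightarrow> y'' j = y' j) \<and>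
           (spoke n x c' y' j = spoke n v c y i0 \<longrightarrow> y'' j = v'))"
proof -
  obtain Q where Q: "compact Q" "convex Q" and strict: "\<And>a b. a \<in> Q \<Longrightarrow> b \<in> Q \<Longrightarrow> open_segment a b \<subseteq> interior Q"
    and v: "v \<in> interior Q" and "open_segment v w \<subseteq> interior Q" and w: "w \<in> frontier Q"
    and out: "\<And>s. s \<in> T \<Longrightarrow> v \<notin> ends s \<Longrightarrow> seg s \<inter> interior Q = {}"
    and yo: "\<And>j. j < 2 * n \<Longrightarrow> y j \<notin> interior Q"
    and pos: "\<And>z. z \<in> Q \<Longrightarrow> z \<noteq> w \<Longrightarrow> 0 < Re ((z - w) / (v - w))"
    and cone: "\<And>z. z \<in> Q \<Longrightarrow> \<bar>Im ((z - w) / (v - w))\<bar> \<le> min \<tau> (1/2) * Re ((z - w) / (v - w))"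
    using diagram_lens[OF T sp i0, of "min \<tau> (1/2)"] \<tau> by auto
  have vw: "v \<noteq> w" using spokes_ne[OF sp i0(1)] i0 by simp
  have frQ: "z \<in> Q" if "z \<in> frontier Q" for z using that Q(1) by (simp add: frontier_def compact_imp_closed)
  define e where "e j = exit_point Q v (y j)" for j
  have e_fr: "e j \<in> frontier Q" if "j < 2 * n" for j using exit_point_frontier[OF Q v yo[OF that]] by (simp add: e_def)
  have e0: "e i0 = w" using exit_point_eq[OF Q v yo[OF i0(1)]] w i0(2) by (simp add: e_def)
  have e_ne: "e j \<noteq> w" if j: "j < 2 * n" "j \<noteq> i0" for j
  proof
    assume "e j = w"
    have c: "e j \<in> closed_segment v (y j)" using exit_point_closed[OF Q v yo[OF j(1)]] by (simp add: e_def)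
    have "spoke n v c y j \<noteq> spoke n v c y i0"
      using spoke_eqD[of n v c y j v c y i0] spokes_inj[OF sp j(1) i0(1)] j(2)
        spokes_ne[OF sp j(1)] by (auto simp: doubleton_eq_iff)
    then have "seg (spoke n v c y j) \<inter> seg (spoke n v c y i0) \<subseteq> ends (spoke n v c y j) \<inter> ends (spoke n v c y i0)"
      using diagram_cross[OF T spokes_in(1)[OF sp j(1)] spokes_in(1)[OF sp i0(1)]] by blast
    moreover have "w \<in> seg (spoke n v c y j) \<inter> seg (spoke n v c y i0)" using c \<open>e j = w\<close> i0 by simp
    ultimately have "w = y j" using vw by auto
    then show False using spokes_inj[OF sp j(1) i0(1)] j(2) i0(2) by simp
  qed
  define B where "B = e i1"
  have B: "B \<in> Q" "B \<noteq> w" using e_fr[OF i1(1)] e_ne[OF i1] frQ by (auto simp: B_def)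
  define \<phi> where "\<phi> z = (z - w) / (v - w)" for z
  \<comment> \<open>With slopes at most \<open>1/2\<close>, the product of the imaginary parts is at
    most a quarter of that of the real parts; so any two points of the lens appear from
    \<open>w\<close> under an acute angle.\<close>
  have inner: "0 < Re (\<phi> a * cnj (\<phi> B))" if a: "a \<in> Q" "a \<noteq> w" for a
  proof -
    have half: "\<bar>Im (\<phi> z)\<bar> \<le> (1/2) * Re (\<phi> z)" if "z \<in> Q" "z \<noteq> w" for z
      using pos[OF that] order_trans[OF cone[OF that(1)] mult_right_mono[of "min \<tau> (1/2)" "1/2"]]
      unfolding \<phi>_def by auto
    have a': "0 < Re (\<phi> a)" and b': "0 < Re (\<phi> B)"
      using pos[OF a] pos[OF B] by (simp_all add: \<phi>_def)
    have "\<bar>Im (\<phi> a) * Im (\<phi> B)\<bar> \<le> ((1/2) * Re (\<phi> a)) * ((1/2) * Re (\<phi> B))"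
      unfolding abs_mult using a' b' half[OF a] half[OF B] by (intro mult_mono) auto
    moreover have "Re (\<phi> a) * Re (\<phi> B) > 0" using a' b' by simp
    ultimately show ?thesis by (simp add: abs_le_iff)
  qed
  \<comment> \<open>For small \<open>\<kappa>\<close> the point \<open>v'\<close> on the chord is so
    close to \<open>w\<close> that all other ends \<open>e j\<close>, projected to the direction of
    the chord, lie beyond it.\<close>
  have "eventually (\<lambda>\<kappa>. \<forall>j\<in>{..<2*n} - {i0}. \<kappa> * (norm (\<phi> B))\<^sup>2 < Re (\<phi> (e j) * cnj (\<phi> B))) (at_right (0::real))"
  proof (intro eventually_ball_finite ballI)
    fix j assume j: "j \<in> {..<2*n} - {i0}"
    have "((\<lambda>\<kappa>. \<kappa> * (norm (\<phi> B))\<^sup>2) \<longlongrightarrow> 0 * (norm (\<phi> B))\<^sup>2) (at_right 0)" by (intro tendsto_intros)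
    then show "eventually (\<lambda>\<kappa>. \<kappa> * (norm (\<phi> B))\<^sup>2 < Re (\<phi> (e j) * cnj (\<phi> B))) (at_right (0::real))"
      using inner[of "e j"] e_fr[of j] e_ne[of j] frQ j by (intro order_tendstoD) auto
  qed auto
  moreover have "eventually (\<lambda>\<kappa>. 0 < \<kappa> \<and> \<kappa> < 1) (at_right (0::real))"
    by (rule eventually_mono[OF eventually_at_right_real[OF zero_less_one]]) simp
  ultimately have "eventually (\<lambda>\<kappa>. (\<forall>j\<in>{..<2*n} - {i0}. \<kappa> * (norm (\<phi> B))\<^sup>2 < Re (\<phi> (e j) * cnj (\<phi> B))) \<and>
      0 < \<kappa> \<and> \<kappa> < 1) (at_right (0::real))" by (rule eventually_conj)
  then obtain \<kappa> :: real where \<kappa>: "\<And>j. j < 2 * n \<Longrightarrow> j \<noteq> i0 \<Longrightarrow> \<kappa> * (norm (\<phi> B))\<^sup>2 < Re (\<phi> (e j) * cnj (\<phi> B))"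
    "0 < \<kappa>" "\<kappa> < 1"
    using eventually_happens'[OF trivial_limit_at_right_real] by blast
  define v' where "v' = (1 - \<kappa>) *\<^sub>R w + \<kappa> *\<^sub>R B"
  have "v' \<in> open_segment w B" unfolding in_segment v'_def using \<kappa>(2,3) B by (intro conjI exI[of _ \<kappa>]) auto
  then have v': "v' \<in> interior Q" using strict[OF frQ[OF w] B(1)] by blast
  have v'w: "v' - w = of_real \<kappa> * (B - w)" by (simp add: v'_def scaleR_conv_of_real algebra_simps)
  have \<phi>v': "\<phi> v' = of_real \<kappa> * \<phi> B" unfolding \<phi>_def v'w by simp
  obtain T' where T': "homotopic_diagrams n T T'" "diagram n T'" "verts n T' \<subseteq> insert v' (verts n T - {v})"
    "spokes n T' v' c e"
    and sps: "\<And>x c' y'. x \<noteq> v \<Longrightarrow> spokes n T x c' y' \<Longrightarrow> \<exists>y''. spokes n T' x c' y'' \<and>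
        (\<forall>j<2 * n. (v \<notin> ends (spoke n x c' y' j) \<longrightarrow> y'' j = y' j) \<and>
          (\<forall>i<2 * n. spoke n x c' y' j = spoke n v c y i \<longrightarrow> y'' j = (if e i \<noteq> y i then e i else v')))"
    by (rule slide[OF n2 T sp Q v v' yo out e_def]) (assumption | rule that | blast)+ 
  show ?thesis
  proof (rule that[of T' v' e "(1 - \<kappa>) / \<kappa>", OF T' e0])
    show "0 < (1 - \<kappa>) / \<kappa>" using \<kappa> by simp
    \<comment> \<open>\<open>v'\<close> divides the chord from \<open>w\<close> to \<open>B\<close>
      in the ratio \<open>\<kappa>\<close> to \<open>1 - \<kappa>\<close>, hence the factor
      \<open>(1 - \<kappa>) / \<kappa>\<close>.\<close>
    have "B - v' = of_real (1 - \<kappa>) * (B - w)" "w - v' = - of_real \<kappa> * (B - w)"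
      by (simp_all add: v'_def scaleR_conv_of_real algebra_simps)
    then show "e i1 - v' = - of_real ((1 - \<kappa>) / \<kappa>) * (w - v')" using \<kappa> by (simp add: B_def field_simps)
    have v'Q: "v' \<in> Q" "v' \<noteq> w" using v' interior_subset w by (auto simp: frontier_def)
    show "0 < Re ((v' - w) / (v - w))" using pos[OF v'Q] .
    show "\<bar>Im ((v' - w) / (v - w))\<bar> \<le> \<tau> * Re ((v' - w) / (v - w))"
      using pos[OF v'Q] by (intro order_trans[OF cone[OF v'Q(1)]] mult_right_mono) auto
    show "Re ((e j - v') / (w - v')) < 0" if j: "j < 2 * n" "j \<noteq> i0" for j
    proof -
      have vw0: "v - w \<noteq> 0" using vw by simp
      have "(e j - v') / (w - v') = (\<phi> (e j) - of_real \<kappa> * \<phi> B) / (- of_real \<kappa> * \<phi> B)"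
      proof -
        have z\<phi>: "z - w = \<phi> z * (v - w)" for z using vw0 by (simp add: \<phi>_def)
        have "e j - v' = (e j - w) - (v' - w)" "w - v' = - (v' - w)" by simp_all
        then have "e j - v' = (\<phi> (e j) - \<phi> v') * (v - w)" "w - v' = - \<phi> v' * (v - w)"
          unfolding z\<phi>[of "e j"] z\<phi>[of v'] by (simp_all add: algebra_simps)
        then show ?thesis using vw0 by (simp add: \<phi>v')
      qed
      moreover have "Re ((\<phi> (e j) - of_real \<kappa> * \<phi> B) * cnj (- of_real \<kappa> * \<phi> B)) < 0"
      proof -
        have "Re ((\<phi> (e j) - of_real \<kappa> * \<phi> B) * cnj (- of_real \<kappa> * \<phi> B)) =
            - \<kappa> * (Re (\<phi> (e j) * cnj (\<phi> B)) - \<kappa> * (norm (\<phi> B))\<^sup>2)"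
          unfolding cmod_power2 by (simp add: algebra_simps power2_eq_square)
        then show ?thesis using \<kappa>(1)[OF j] \<kappa>(2) by (simp add: mult_pos_neg)
      qed
      ultimately show ?thesis using Re_complex_div_lt_0 by metis
    qed
    fix x c' y' assume x: "x \<noteq> v" "spokes n T x c' y'"
    then show "\<exists>y''. spokes n T' x c' y'' \<and>
        (\<forall>j<2 * n. (v \<notin> ends (spoke n x c' y' j) \<longrightarrow> y'' j = y' j) \<and>
           (spoke n x c' y' j = spoke n v c y i0 \<longrightarrow> y'' j = v'))"
      using sps[OF x] i0 e0 by fastforce
  qed
qed

text \<open>\<open>cs\<close> lists the corner points of the edge from \<open>v\<close> to \<open>w\<close>, followed by \<open>w\<close>. This edge is the first
  outgoing one of \<open>v\<close> and the last incoming one of \<open>w\<close>.\<close>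

definition linked :: "nat \<Rightarrow> segment set \<Rightarrow> complex \<Rightarrow> colour \<Rightarrow> (nat \<Rightarrow> complex) \<Rightarrow>
    complex \<Rightarrow> colour \<Rightarrow> (nat \<Rightarrow> complex) \<Rightarrow> complex list \<Rightarrow> bool" where
  "linked n T v c y w c' y' cs \<longleftrightarrow> diagram n T \<and> spokes n T v c y \<and> spokes n T w c' y' \<and> v \<noteq> w \<and>
     cs \<noteq> [] \<and> distinct cs \<and> y 0 = hd cs \<and> last cs = w \<and>
     (\<forall>i. Suc i < length cs \<longrightarrow> (cs ! i, cs ! Suc i, alternate c 0) \<in> T \<and> cs ! i \<notin> verts n T) \<and>
     spoke n w c' y' (2 * n - 1) = (last (v # butlast cs), w, alternate c 0)"

text \<open>The vertex is moved to the extension of the segment from \<open>c1\<close> to \<open>c2\<close> beyond \<open>c1\<close>; then \<open>c1\<close> lies on a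
  straight edge and can be removed.\<close>

lemma linked_step:
  assumes n2: "n \<ge> 2" and l: "linked n T v c y w c' y' (c1 # c2 # cs)"
  obtains T' v' e e' where "homotopic_diagrams n T T'" "linked n T' v' c e w c' e' (c2 # cs)"
    "verts n T' \<subseteq> insert v' (verts n T - {v})"
proof -
  let ?d = "alternate c 0"
  from l have T: "diagram n T" and sp: "spokes n T v c y" and spw: "spokes n T w c' y'" and vw: "v \<noteq> w"
    and dist: "distinct (c1 # c2 # cs)" and y0: "y 0 = c1" and lw: "last (c2 # cs) = w"
    and path: "\<And>i. Suc i < length (c1 # c2 # cs) \<Longrightarrow>
       ((c1 # c2 # cs) ! i, (c1 # c2 # cs) ! Suc i, ?d) \<in> T \<and> (c1 # c2 # cs) ! i \<notin> verts n T"
    and fin: "spoke n w c' y' (2 * n - 1) = (last (v # c1 # butlast (c2 # cs)), w, ?d)"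
    by (auto simp: linked_def)
  have s2: "(c1, c2, ?d) \<in> T" and c1v: "c1 \<notin> verts n T" using path[of 0] by auto
  have path': "((c2 # cs) ! i, (c2 # cs) ! Suc i, ?d) \<in> T" "(c2 # cs) ! i \<notin> verts n T"
    if "Suc i < length (c2 # cs)" for i using path[of "Suc i"] that by auto
  have n0: "0 < 2 * n" using n2 by simp
  have s1: "(v, c1, ?d) \<in> T" using spokes_in(1)[OF sp n0] n2 y0 by (simp add: spoke_def)
  have vv: "v \<in> verts n T" using sp by (rule vertsI)
  have wv: "w \<in> verts n T" using spw by (rule vertsI)
  have ne: "v \<noteq> c1" "c1 \<noteq> c2" using spokes_ne[OF sp n0] y0 dist by auto
  have in_cs: "x \<noteq> v" if x: "x \<in> set (c2 # cs)" for x
  proof -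
    obtain i where i: "i < length (c2 # cs)" "x = (c2 # cs) ! i" using x by (metis in_set_conv_nth)
    show ?thesis
    proof (cases "Suc i < length (c2 # cs)")
      case True then show ?thesis using path'(2) i vv by metis
    next
      case False
      then have "x = last (c2 # cs)" using i by (metis Suc_lessI diff_Suc_1 last_conv_nth list.distinct(1))
      then show ?thesis using lw vw by simp
    qed
  qed
  have c1p: "c1 \<in> pts T" using s2 by (force simp: pts_def)
  have star1: "segments_at T c1 = {(v, c1, ?d), (c1, c2, ?d)}"
  proof -
    have "corner_at T c1" using diagram_pts[OF T c1p] c1v by (auto simp: verts_def)
    then obtain a b d where abd: "segments_at T c1 = {(a, c1, d), (c1, b, d)}" by (auto simp: corner_at_def)
    have "(v, c1, ?d) \<in> segments_at T c1" "(c1, c2, ?d) \<in> segments_at T c1" using s1 s2 by (auto simp: segments_at_eq)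
    then show ?thesis using abd ne by auto
  qed
  have c1s: "c1 \<notin> ends s" if "s \<in> T" "s \<noteq> (v, c1, ?d)" "s \<noteq> (c1, c2, ?d)" for s
    using star1 that by (auto simp: segments_at_eq)
  have c1seg: "c1 \<notin> seg s" if s: "s \<in> T" "s \<noteq> (v, c1, ?d)" "s \<noteq> (c1, c2, ?d)" for s
    using diagram_cross[OF T s(1) s2] s c1s[OF s] by auto
  have vc2: "v \<noteq> c2" using in_cs[of c2] by simp
  \<comment> \<open>A disc around \<open>c1\<close> that avoids this set meets only the two segments
    at \<open>c1\<close> and contains neither of their other ends.\<close>
  let ?far = "(\<Union>s\<in>T - {(v, c1, ?d), (c1, c2, ?d)}. seg s) \<union> {v, c2}"
  have "open (- ?far)" using diagram_finite[OF T] by (intro open_Compl closed_Un closed_UN finite_imp_closed) auto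
  moreover have "c1 \<in> - ?far" using c1seg ne by auto
  ultimately obtain \<rho> where \<rho>: "\<rho> > 0" "cball c1 \<rho> \<subseteq> - ?far" using open_contains_cball by blast
  have away: "seg s \<inter> cball c1 \<rho> = {}" if "s \<in> T" "s \<noteq> (v, c1, ?d)" "s \<noteq> (c1, c2, ?d)" for s
    using \<rho>(2) that by blast
  obtain Q where Q: "compact Q" "convex Q"
    and v: "v \<in> interior Q" and vc: "open_segment v c1 \<subseteq> interior Q" and cQ: "c1 \<in> frontier Q"
    and out: "\<And>s. s \<in> T \<Longrightarrow> v \<notin> ends s \<Longrightarrow> seg s \<inter> interior Q = {}"
    and yo: "\<And>j. j < 2 * n \<Longrightarrow> y j \<notin> interior Q"
    by (rule diagram_lens[OF T sp n0 y0 zero_less_one]) (assumption | rule that | blast)+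
  \<comment> \<open>A preliminary slide along the spoke brings the vertex to distance at most
    \<open>\<rho> / 2\<close> from \<open>c1\<close>, so that the second slide takes place inside
    the disc.\<close>
  define \<kappa> where "\<kappa> = min (1/2) (\<rho> / (2 * norm (v - c1)))"
  have \<kappa>: "0 < \<kappa>" "\<kappa> < 1" "\<kappa> * norm (v - c1) < \<rho>"
    using \<rho>(1) ne by (auto simp: \<kappa>_def min_def field_simps)
  define v1 where "v1 = (1 - \<kappa>) *\<^sub>R c1 + \<kappa> *\<^sub>R v"
  have v1c: "v1 - c1 = \<kappa> *\<^sub>R (v - c1)" by (simp add: v1_def algebra_simps)
  have "v1 \<in> open_segment c1 v" unfolding in_segment v1_def using \<kappa> ne by (intro conjI exI[of _ \<kappa>]) auto
  then have v1: "v1 \<in> interior Q" using vc by (auto simp: open_segment_commute)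
  define e where "e j = exit_point Q v (y j)" for j
  have e0: "e 0 = c1" using exit_point_eq[OF Q v yo[OF n0]] cQ y0 by (simp add: e_def)
  have e_seg: "e j \<in> closed_segment v (y j)" if "j < 2 * n" for j
    using exit_point_closed[OF Q v yo[OF that]] by (simp add: e_def)
  have spoke_ne: "spoke n v c y j \<noteq> (v, c1, ?d) \<and> spoke n v c y j \<noteq> (c1, c2, ?d)" if j: "j < 2 * n" "j \<noteq> 0" for j
  proof -
    have "y j \<noteq> c1" using spokes_inj[OF sp j(1) n0] j y0 by auto
    moreover have "ends (spoke n v c y j) = {v, y j}" by simp
    ultimately show ?thesis using ne vc2 by (metis doubleton_eq_iff ends_simp)
  qed
  have spoke_away: "closed_segment v (y j) \<inter> cball c1 \<rho> = {}" if "j < 2 * n" "j \<noteq> 0" for j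
    using away[OF spokes_in(1)[OF sp that(1)]] spoke_ne[OF that] by simp
  obtain T1 where T1: "homotopic_diagrams n T T1" "diagram n T1" "verts n T1 \<subseteq> insert v1 (verts n T - {v})"
    "spokes n T1 v1 c e" and T1a: "\<And>s. s \<in> T \<Longrightarrow> v \<notin> ends s \<Longrightarrow> s \<in> T1"
    and T1b: "\<And>s. s \<in> T1 \<Longrightarrow> v1 \<notin> ends s \<Longrightarrow> s \<in> T \<and> v \<notin> ends s \<or> (\<exists>i<2 * n. ends s = {e i, y i})"
    and T1c: "\<And>x c' y'. x \<noteq> v \<Longrightarrow> spokes n T x c' y' \<Longrightarrow> \<exists>y''. spokes n T1 x c' y'' \<and>
        (\<forall>j<2 * n. (v \<notin> ends (spoke n x c' y' j) \<longrightarrow> y'' j = y' j) \<and>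
          (\<forall>i<2 * n. spoke n x c' y' j = spoke n v c y i \<longrightarrow> y'' j = (if e i \<noteq> y i then e i else v1)))"
    by (rule slide[OF n2 T sp Q v v1 yo out e_def]) (assumption | rule that | blast)+
  have keep1: "s \<in> T1 \<and> v1 \<notin> ends s" if "s \<in> T" "v \<notin> ends s" for s
    using T1a[OF that] out[OF that] v1 ends_subset_seg[of s] by auto
  \<comment> \<open>the half disc at \<open>c1\<close> on the side of \<open>v\<close>, away from \<open>c2\<close>\<close>
  define u where "u = sgn (v - c1) - sgn (c2 - c1)"
  have col: "sgn (v - c1) \<noteq> sgn (c2 - c1)"
  proof
    assume eq: "sgn (v - c1) = sgn (c2 - c1)"
    have "v - c1 = norm (v - c1) *\<^sub>R sgn (v - c1)" using ne by (simp add: sgn_div_norm)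
    also have "\<dots> = (norm (v - c1) / norm (c2 - c1)) *\<^sub>R (c2 - c1)" unfolding eq using ne by (simp add: sgn_div_norm divide_inverse)
    finally obtain r where r: "v - c1 = r *\<^sub>R (c2 - c1)" "r > 0" using ne by fastforce
    define m where "m = min 1 (1 / r)"
    have m: "0 < m" "m \<le> 1" "m * r \<le> 1" "0 < m * r" using r(2) by (auto simp: m_def min_def field_simps)
    have "c1 + m *\<^sub>R (v - c1) \<in> closed_segment v c1"
      using m unfolding in_segment by (intro exI[of _ "1 - m"]) (auto simp: algebra_simps)
    moreover have "c1 + m *\<^sub>R (v - c1) = (1 - m * r) *\<^sub>R c1 + (m * r) *\<^sub>R c2" by (simp add: r algebra_simps)
    then have "c1 + m *\<^sub>R (v - c1) \<in> closed_segment c1 c2" using m unfolding in_segment by (intro exI[of _ "m * r"]) auto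
    moreover have "c1 + m *\<^sub>R (v - c1) \<noteq> c1" using m ne by simp
    moreover have "seg (v, c1, ?d) \<inter> seg (c1, c2, ?d) \<subseteq> ends (v, c1, ?d) \<inter> ends (c1, c2, ?d)"
      using diagram_cross[OF T s1 s2] ne by blast
    ultimately show False using vc2 ne by auto
  qed
  then have u0: "u \<noteq> 0" by (simp add: u_def)
  have nsg: "norm (sgn (v - c1)) = 1" "norm (sgn (c2 - c1)) = 1" using ne by (auto simp: norm_sgn)
  have in1: "sgn (v - c1) \<bullet> sgn (c2 - c1) < 1"
  proof -
    have "(norm u)\<^sup>2 > 0" using u0 by simp
    moreover have "(norm u)\<^sup>2 = 2 - 2 * (sgn (v - c1) \<bullet> sgn (c2 - c1))"
      using nsg unfolding u_def power2_norm_eq_inner inner_diff_left inner_diff_right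
      by (simp add: norm_eq_1 inner_commute)
    ultimately show ?thesis by simp
  qed
  \<comment> \<open>\<open>u\<close> is the difference of two distinct unit vectors, so it makes an
    acute angle with the first and an obtuse one with the second. The line through \<open>c1\<close>
    orthogonal to \<open>u\<close> thus separates \<open>v\<close> from \<open>c2\<close>.\<close>
  have uv: "u \<bullet> (v - c1) > 0" and uc: "u \<bullet> (c2 - c1) < 0"
  proof -
    have a: "v - c1 = norm (v - c1) *\<^sub>R sgn (v - c1)" and b: "c2 - c1 = norm (c2 - c1) *\<^sub>R sgn (c2 - c1)"
      using ne by (auto simp: sgn_div_norm)
    have "u \<bullet> sgn (v - c1) > 0" "u \<bullet> sgn (c2 - c1) < 0"
      using in1 nsg unfolding u_def inner_diff_left by (simp_all add: norm_eq_1 inner_commute)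
    then show "u \<bullet> (v - c1) > 0" "u \<bullet> (c2 - c1) < 0"
      using ne by (subst a, simp add: zero_less_mult_iff, subst b, simp add: mult_less_0_iff)
  qed
  define H where "H = cball c1 \<rho> \<inter> {x. u \<bullet> x \<ge> u \<bullet> c1}"
  have iH: "interior H = ball c1 \<rho> \<inter> {x. u \<bullet> x > u \<bullet> c1}"
    using u0 by (simp add: H_def interior_Int interior_halfspace_ge)
  have cH: "compact H" "convex H"
    by (auto simp: H_def intro!: compact_Int_closed closed_halfspace_ge convex_Int convex_halfspace_ge)
  have v1H: "v1 \<in> interior H"
  proof -
    have "u \<bullet> (v1 - c1) > 0" using uv \<kappa> by (simp add: v1c)
    moreover have "dist c1 v1 < \<rho>" using \<kappa> by (simp add: dist_norm norm_minus_commute[of c1] v1c)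
    ultimately show ?thesis by (simp add: iH inner_diff_right)
  qed
  \<comment> \<open>\<open>v2\<close> lies opposite to \<open>c2\<close> at distance
    \<open>\<rho> / 2\<close> from \<open>c1\<close>, hence inside the half disc.\<close>
  define \<eta> where "\<eta> = \<rho> / (2 * norm (c2 - c1))"
  have \<eta>: "\<eta> > 0" using \<rho> ne by (simp add: \<eta>_def)
  define v2 where "v2 = c1 - \<eta> *\<^sub>R (c2 - c1)"
  have v2H: "v2 \<in> interior H"
  proof -
    have "u \<bullet> (v2 - c1) > 0" using uc \<eta> by (simp add: v2_def mult_pos_neg)
    moreover have "dist c1 v2 < \<rho>" using \<rho> ne by (simp add: v2_def dist_norm \<eta>_def)
    ultimately show ?thesis by (simp add: iH inner_diff_right)
  qed
  have c1H: "c1 \<in> frontier H"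
    using iH \<rho> cH by (simp add: frontier_def compact_imp_closed) (simp add: H_def)
  have eH: "e j \<notin> interior H" if j: "j < 2 * n" for j
  proof (cases "j = 0")
    case True then show ?thesis using e0 iH by simp
  next
    case False
    then have "e j \<notin> cball c1 \<rho>" using e_seg[OF j] spoke_away[OF j] by blast
    then show ?thesis using iH by auto
  qed
  have outH: "seg s \<inter> interior H = {}" if s: "s \<in> T1" "v1 \<notin> ends s" for s
  proof -
    consider "s \<in> T" "v \<notin> ends s" "s \<noteq> (c1, c2, ?d)" | "s = (c1, c2, ?d)" | i where "i < 2 * n" "ends s = {e i, y i}"
      using T1b[OF s] by blast
    then show ?thesis
    proof cases
      case 1
      then have "s \<noteq> (v, c1, ?d)" by auto
      then have "seg s \<inter> cball c1 \<rho> = {}" using away 1 by blast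
      then show ?thesis using iH by auto
    next
      case 2
      have "u \<bullet> x \<le> u \<bullet> c1" if x: "x \<in> seg s" for x
      proof -
        obtain t where t: "0 \<le> t" "x = (1 - t) *\<^sub>R c1 + t *\<^sub>R c2" using x 2 by (auto simp: in_segment)
        have "u \<bullet> x = u \<bullet> c1 + t * (u \<bullet> (c2 - c1))" unfolding t(2) by (simp add: inner_simps algebra_simps)
        then show ?thesis using t uc by (simp add: mult_nonneg_nonpos)
      qed
      then show ?thesis using iH by fastforce
    next
      case 3
      show ?thesis
      proof (cases "i = 0")
        case True
        then have "fst s = fst (snd s)" using 3 e0 y0 by (cases s) auto
        then show ?thesis using diagram_nondeg[OF T1(2) s(1)] by simp
      next
        case False
        have "seg s = closed_segment (e i) (y i)"
          using 3 by (cases s) (auto simp: doubleton_eq_iff closed_segment_commute)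
        then have "seg s \<subseteq> closed_segment v (y i)" using e_seg[OF 3(1)] by (simp add: subset_closed_segment)
        then show ?thesis using spoke_away[OF 3(1) False] iH by auto
      qed
    qed
  qed
  define e2 where "e2 j = exit_point H v1 (e j)" for j
  have e20: "e2 0 = c1" using exit_point_eq[OF cH v1H eH[OF n0]] c1H e0 by (simp add: e2_def)
  obtain T2 where T2: "homotopic_diagrams n T1 T2" "diagram n T2" "verts n T2 \<subseteq> insert v2 (verts n T1 - {v1})"
    "spokes n T2 v2 c e2" and T2a: "\<And>s. s \<in> T1 \<Longrightarrow> v1 \<notin> ends s \<Longrightarrow> s \<in> T2"
    and T2c: "\<And>x c' y'. x \<noteq> v1 \<Longrightarrow> spokes n T1 x c' y' \<Longrightarrow> \<exists>y''. spokes n T2 x c' y'' \<and>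
        (\<forall>j<2 * n. (v1 \<notin> ends (spoke n x c' y' j) \<longrightarrow> y'' j = y' j) \<and>
          (\<forall>i<2 * n. spoke n x c' y' j = spoke n v1 c e i \<longrightarrow> y'' j = (if e2 i \<noteq> e i then e2 i else v2)))"
    by (rule slide[OF n2 T1(2,4) cH v1H v2H eH outH e2_def]) (assumption | rule that | blast)+
  have keep2: "s \<in> T2 \<and> v2 \<notin> ends s" if "s \<in> T1" "v1 \<notin> ends s" for s
    using T2a[OF that] outH[OF that] v2H ends_subset_seg[of s] by auto
  have keep: "s \<in> T2 \<and> v2 \<notin> ends s" if "s \<in> T" "v \<notin> ends s" for s
    using keep1[OF that] keep2 by blast
  have v2T2: "verts n T2 \<subseteq> insert v2 (verts n T - {v})" using T2(3) T1(3) by blast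
  have s2': "(c1, c2, ?d) \<in> T2" "v2 \<noteq> c1" "v2 \<noteq> c2" using keep[OF s2] ne vc2 by auto
  have s1': "(v2, c1, ?d) \<in> T2" using spokes_in(1)[OF T2(4) n0] n2 e20 by (simp add: spoke_def)
  have c1T2: "corner_at T2 c1"
  proof -
    have "c1 \<in> pts T2" using s2' by (force simp: pts_def)
    moreover have "c1 \<notin> verts n T2" using v2T2 c1v s2' by auto
    ultimately show ?thesis using diagram_pts[OF T2(2)] by (auto simp: verts_def)
  qed
  have mid: "c1 \<in> open_segment v2 c2"
  proof -
    have "c1 = (1 - \<eta> / (1 + \<eta>)) *\<^sub>R v2 + (\<eta> / (1 + \<eta>)) *\<^sub>R c2"
    proof -
      have "(1 + \<eta>) *\<^sub>R c1 = v2 + \<eta> *\<^sub>R c2" by (simp add: v2_def algebra_simps)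
      moreover have "1 - \<eta> / (1 + \<eta>) = 1 / (1 + \<eta>)" using \<eta> by (simp add: field_simps)
      moreover have "c1 = (1 / (1 + \<eta>)) *\<^sub>R ((1 + \<eta>) *\<^sub>R c1)" using \<eta> by simp
      ultimately show ?thesis by (simp add: scaleR_add_right)
    qed
    moreover have "0 < \<eta> / (1 + \<eta>)" "\<eta> / (1 + \<eta>) < 1" using \<eta> by auto
    ultimately show ?thesis unfolding in_segment using s2'(3) by blast
  qed
  define T3 where "T3 = (T2 - {(v2, c1, ?d), (c1, c2, ?d)}) \<union> {(v2, c2, ?d)}"
  note mg = merge[OF n2 T2(2) s1' s2'(1) c1T2 mid T3_def]
  define e3 where "e3 = (\<lambda>i. if spoke n v2 c e2 i = (v2, c1, ?d) then c2
         else if spoke n v2 c e2 i = (c1, c2, ?d) then v2 else e2 i)"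
  have sp3: "spokes n T3 v2 c e3" using mg(4)[OF T2(4)] by (simp add: e3_def)
  have e30: "e3 0 = c2" using n2 e20 by (simp add: e3_def spoke_def)
  let ?k = "2 * n - 1"
  have k: "?k < 2 * n" using n2 by simp
  let ?p = "last (c1 # butlast (c2 # cs))"
  have fin': "spoke n w c' y' ?k = (?p, w, ?d)" using fin by simp
  have pv: "?p \<noteq> v"
  proof (cases cs)
    case Nil then show ?thesis using ne by simp
  next
    case (Cons a as)
    then have "?p \<in> set (c2 # cs)" by (metis butlast.simps(2) in_set_butlastD last_ConsR last_in_set list.distinct(1))
    then show ?thesis using in_cs by blast
  qed
  have fT: "(?p, w, ?d) \<in> T" using spokes_in(1)[OF spw k] fin' by simp
  have fv: "v \<notin> ends (?p, w, ?d)" using pv vw by auto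
  obtain y1 where y1: "spokes n T1 w c' y1" "y1 ?k = y' ?k"
    using T1c[OF vw[symmetric] spw] k fv fin' by metis
  have f1: "spoke n w c' y1 ?k = (?p, w, ?d)" using spoke_cong[of y1 ?k y'] y1(2) fin' by simp
  have v1f: "v1 \<notin> ends (?p, w, ?d)" using keep1[OF fT fv] by simp
  have wv1: "w \<noteq> v1" using v1f by auto
  obtain y2 where y2: "spokes n T2 w c' y2" "y2 ?k = y1 ?k"
    using T2c[OF wv1 y1(1)] k v1f f1 by metis
  have f2: "spoke n w c' y2 ?k = (?p, w, ?d)" using spoke_cong[of y2 ?k y1] y2(2) f1 by simp
  define y3 where "y3 = (\<lambda>i. if spoke n w c' y2 i = (v2, c1, ?d) then c2
         else if spoke n w c' y2 i = (c1, c2, ?d) then v2 else y2 i)"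
  have spw3: "spokes n T3 w c' y3" using mg(4)[OF y2(1)] by (simp add: y3_def)
  have wc1: "w \<noteq> c1" using c1v wv by blast
  \<comment> \<open>If \<open>c2\<close> is \<open>w\<close>, the last segment of the edge is the
    one that started at \<open>c1\<close> and was merged, so it now starts at \<open>v2\<close>;
    otherwise it has not been touched.\<close>
  have f3: "spoke n w c' y3 ?k = (last (v2 # butlast (c2 # cs)), w, ?d)"
  proof (cases cs)
    case Nil
    then have "w = c2" using lw by simp
    then have "y3 ?k = v2" using f2 Nil s2' by (auto simp: y3_def)
    then show ?thesis using f2 Nil n2 by (auto simp: spoke_def split: if_splits)
  next
    case (Cons a as)
    then have p: "?p = last (v2 # butlast (c2 # cs))" by simp
    have "?p \<in> set (c2 # cs)" using Cons by (metis butlast.simps(2) in_set_butlastD last_ConsR last_in_set list.distinct(1))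
    then have "?p \<noteq> c1" using dist by auto
    then have "y3 ?k = y2 ?k" using f2 wc1 by (auto simp: y3_def)
    then show ?thesis using f2 p spoke_cong[of y3 ?k y2] by simp
  qed
  show ?thesis
  proof (rule that[of T3 v2 e3 y3])
    show "homotopic_diagrams n T T3" using homotopic_trans[OF T1(1)] homotopic_trans[OF T2(1) mg(2)] by blast
    show V: "verts n T3 \<subseteq> insert v2 (verts n T - {v})" using mg(3) v2T2 by blast
    show "linked n T3 v2 c e3 w c' y3 (c2 # cs)"
      unfolding linked_def
    proof (intro conjI allI impI)
      show "diagram n T3" by (rule mg(1))
      show "v2 \<noteq> w" using keep[OF fT fv] by auto
      show "distinct (c2 # cs)" using dist by simp
      show "e3 0 = hd (c2 # cs)" using e30 by simp
      show "last (c2 # cs) = w" by (rule lw)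
      fix i assume i: "Suc i < length (c2 # cs)"
      let ?a = "(c2 # cs) ! i" and ?b = "(c2 # cs) ! Suc i"
      have ab: "?a \<in> set (c2 # cs)" "?b \<in> set (c2 # cs)" using i nth_mem Suc_lessD by blast+
      have "v \<notin> ends (?a, ?b, ?d)" using in_cs ab by auto
      then have t2: "(?a, ?b, ?d) \<in> T2" "v2 \<noteq> ?a" using keep[OF path'(1)[OF i]] by auto
      have "?a \<noteq> c1" using ab dist by auto
      then show "(?a, ?b, ?d) \<in> T3" using t2 by (simp add: T3_def)
      show "?a \<notin> verts n T3" using V path'(2)[OF i] t2(2) by auto
    qed (use sp3 spw3 f3 in auto)
  qed
qed

subsection \<open>Bridges across a segment\<close>

text \<open>A segment that has left \<open>Q\<close> at \<open>e\<close> cannot return: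
  \<open>e\<close> would lie strictly between two points of \<open>Q\<close>, hence in the interior,
  whereas it is on the frontier.\<close>

lemma exit_tail:
  fixes Q :: "complex set"
  assumes Q: "compact Q" "convex Q" and strict: "\<And>a b. a \<in> Q \<Longrightarrow> b \<in> Q \<Longrightarrow> open_segment a b \<subseteq> interior Q"
    and p: "p \<in> interior Q" and y: "y \<notin> Q"
  obtains e where "e \<in> frontier Q" "e \<in> open_segment p y" "closed_segment e y \<inter> Q = {e}" "e \<in> Q"
proof -
  have yi: "y \<notin> interior Q" using y interior_subset by blast
  define e where "e = exit_point Q p y"
  have fr: "e \<in> frontier Q" using exit_point_frontier[OF Q p yi] by (simp add: e_def)
  have eQ: "e \<in> Q" using fr Q(1) by (simp add: frontier_def compact_imp_closed)
  have op: "e \<in> open_segment p y" using exit_point_open[OF Q p yi] eQ y by (auto simp: e_def)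
  have "z = e" if z: "z \<in> closed_segment e y" "z \<in> Q" for z
  proof (rule ccontr)
    assume ne: "z \<noteq> e"
    obtain s where s: "0 < s" "s < 1" "e - p = of_real s * (y - p)" using open_segment_scale[OF op] by blast
    obtain t where t: "0 \<le> t" "t \<le> 1" "z = (1 - t) *\<^sub>R e + t *\<^sub>R y" using z(1) by (auto simp: in_segment)
    have "t > 0" using t ne by (cases "t = 0") auto
    have e: "e = p + s *\<^sub>R (y - p)" using s(3) by (simp add: scaleR_conv_of_real algebra_simps)
    define m where "m = s + t * (1 - s)"
    have m: "m > s" using \<open>t > 0\<close> s by (simp add: m_def)
    have zm: "z = p + m *\<^sub>R (y - p)" unfolding t(3) e m_def by (simp add: algebra_simps)
    have "e = (1 - s / m) *\<^sub>R p + (s / m) *\<^sub>R z" unfolding zm e using m s by (simp add: algebra_simps)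
    moreover have "p \<noteq> z" using zm m s op by auto
    ultimately have "e \<in> open_segment p z" unfolding in_segment using m s by (intro conjI exI[of _ "s / m"]) auto
    then have "e \<in> interior Q" using strict[of p z] p z(2) interior_subset by blast
    then show False using fr by (simp add: frontier_def)
  qed
  then have "closed_segment e y \<inter> Q = {e}" using eQ by auto
  then show ?thesis using that fr op eQ by blast
qed

lemma Im_segment_less: "Im a < d \<Longrightarrow> Im b < d \<Longrightarrow> z \<in> closed_segment a b \<Longrightarrow> Im z < d"
  and Im_segment_greater: "Im a > d \<Longrightarrow> Im b > d \<Longrightarrow> z \<in> closed_segment a b \<Longrightarrow> Im z > d"
proof -
  have "convex {z. Im z < d}" "convex {z. Im z > d}"
    using convex_halfspace_lt[of \<i> d] convex_halfspace_gt[of d \<i>] by (simp_all add: inner_complex_def)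
  then show "Im a < d \<Longrightarrow> Im b < d \<Longrightarrow> z \<in> closed_segment a b \<Longrightarrow> Im z < d"
    and "Im a > d \<Longrightarrow> Im b > d \<Longrightarrow> z \<in> closed_segment a b \<Longrightarrow> Im z > d"
    using closed_segment_subset[of a "{z. Im z < d}" b] closed_segment_subset[of a "{z. Im z > d}" b] by auto
qed

lemma oriented_arc_single: "a \<noteq> b \<Longrightarrow> oriented_arc c {(a, b, c)} a b"
  unfolding oriented_arc_def by (intro exI[of _ "[a, b]"]) auto

lemma support_simps [simp]:
  "support {} = {}" "support (insert (a, b, c) T) = closed_segment a b \<union> support T"
  "support (A \<union> B) = support A \<union> support B"
  by (auto simp: support_def)

text \<open>Measured from \<open>p1\<close> in units of \<open>p2 - p1\<close>, the points
  \<open>a\<close>, \<open>p\<close>, \<open>b\<close> have parameters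
  \<open>\<alpha> < s < \<beta>\<close> between 0 and 1.\<close>

lemma open_segment_between:
  fixes p1 p2 :: complex
  assumes p: "p \<in> open_segment p1 p2" and a: "a \<in> open_segment p p1" and b: "b \<in> open_segment p p2"
  shows "a \<in> open_segment p1 p2" "b \<in> open_segment a p2" "a \<in> open_segment p1 p"
    "closed_segment a b \<subseteq> closed_segment p1 p2"
proof -
  obtain s where s: "0 < s" "s < 1" "p - p1 = of_real s * (p2 - p1)" using open_segment_scale[OF p] by blast
  obtain u where u: "0 < u" "u < 1" "a - p = of_real u * (p1 - p)" using open_segment_scale[OF a] by blast
  obtain t where t: "0 < t" "t < 1" "b - p = of_real t * (p2 - p)" using open_segment_scale[OF b] by blast
  have p12: "p1 \<noteq> p2" using p by auto
  define \<alpha> where "\<alpha> = s * (1 - u)"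
  define \<beta> where "\<beta> = s + t * (1 - s)"
  have p': "p = p1 + of_real s * (p2 - p1)" using s(3) by (simp add: algebra_simps)
  have a': "a = p1 + of_real \<alpha> * (p2 - p1)"
  proof -
    have "a = p + of_real u * (p1 - p)" using u(3) by (simp add: algebra_simps)
    then show ?thesis unfolding p' \<alpha>_def by (simp add: algebra_simps)
  qed
  have b': "b = p1 + of_real \<beta> * (p2 - p1)"
  proof -
    have "b = p + of_real t * (p2 - p)" using t(3) by (simp add: algebra_simps)
    then show ?thesis unfolding p' \<beta>_def by (simp add: algebra_simps)
  qed
  have "s * (1 - u) < s * 1" using s u by (intro mult_strict_left_mono) auto
  then have \<alpha>: "0 < \<alpha>" "\<alpha> < s" using s u by (auto simp: \<alpha>_def)
  have "t * (1 - s) < 1 * (1 - s)" using s t by (intro mult_strict_right_mono) auto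
  then have \<beta>1: "\<beta> < 1" by (simp only: \<beta>_def mult_1)
  have "0 < t * (1 - s)" using s t by simp
  then have \<beta>: "s < \<beta>" "\<beta> < 1" using \<beta>1 by (simp_all only: \<beta>_def less_add_same_cancel1)
  have a_in: "a = (1 - \<alpha>) *\<^sub>R p1 + \<alpha> *\<^sub>R p2" and b_in: "b = (1 - \<beta>) *\<^sub>R p1 + \<beta> *\<^sub>R p2"
    unfolding a' b' by (simp_all add: scaleR_conv_of_real algebra_simps)
  show ao: "a \<in> open_segment p1 p2" unfolding in_segment using a_in \<alpha> s p12 by (intro conjI exI[of _ \<alpha>]) auto
  show "a \<in> open_segment p1 p" using a by (simp add: open_segment_commute)
  have bo: "b \<in> open_segment p1 p2" unfolding in_segment using b_in \<beta> s p12 by (intro conjI exI[of _ \<beta>]) auto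
  show "closed_segment a b \<subseteq> closed_segment p1 p2"
    using ao bo by (simp add: closed_segment_subset open_segment_def)
  define \<gamma> where "\<gamma> = (\<beta> - \<alpha>) / (1 - \<alpha>)"
  have \<gamma>: "0 < \<gamma>" "\<gamma> < 1" using \<alpha> \<beta> by (auto simp: \<gamma>_def field_simps)
  have "\<alpha> + \<gamma> * (1 - \<alpha>) = \<beta>" using \<alpha> \<beta> by (simp add: \<gamma>_def)
  then have "b = p1 + of_real (\<alpha> + \<gamma> * (1 - \<alpha>)) * (p2 - p1)" using b' by simp
  then have "b = (1 - \<gamma>) *\<^sub>R a + \<gamma> *\<^sub>R p2" unfolding a' by (simp add: scaleR_conv_of_real algebra_simps)
  then show "b \<in> open_segment a p2" unfolding in_segment using \<gamma> ao by (intro conjI exI[of _ \<gamma>]) (auto simp: open_segment_def)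
qed

text \<open>One segment crosses the level \<open>h\<close> upwards at \<open>p\<close>, the other
  downwards at \<open>q\<close> further right, and the level is free in between. A lens around that
  piece contains one arc of each; reconnecting joins the two lower ends below the level and the two
  upper ends above it. The new segments are listed explicitly, since later bridges depend on where
  they lie.\<close>

lemma bridge:
  assumes n2: "n \<ge> 2" and T: "diagram n T" and s1: "(p1, p2, d) \<in> T" and s2: "(q1, q2, d) \<in> T"
    and p: "p \<in> open_segment p1 p2" and q: "q \<in> open_segment q1 q2"
    and level: "Im p = h" "Im q = h" "Re p < Re q"
    and side: "Im p1 < h" "Im p2 > h" "Im q1 > h" "Im q2 < h"
    and free: "\<And>s. s \<in> T \<Longrightarrow> s \<noteq> (p1, p2, d) \<Longrightarrow> s \<noteq> (q1, q2, d) \<Longrightarrow> seg s \<inter> closed_segment p q = {}"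
  obtains T' a b a' b' where "homotopic_diagrams n T T'" "diagram n T'" "verts n T' \<subseteq> verts n T"
    "T' = (T - {(p1, p2, d), (q1, q2, d)}) \<union>
      {(p1, a, d), (a, b', d), (b', q2, d), (q1, a', d), (a', b, d), (b, p2, d)}"
    "a \<in> open_segment p1 p" "b' \<in> open_segment q q2" "Im b > h" "Im a' > h"
    "{a, b, a', b'} \<inter> pts T = {}"
proof -
  have ne: "(p1, p2, d) \<noteq> (q1, q2, d)" using side by auto
  have pq: "p \<noteq> q" using level by auto
  have s12: "closed_segment p1 p2 \<inter> closed_segment q1 q2 \<subseteq> {p1, p2} \<inter> {q1, q2}"
    using diagram_cross[OF T s1 s2 ne] by simp
  let ?S = "T - {(p1, p2, d), (q1, q2, d)}"
  have "open (- ((\<Union>s\<in>?S. seg s)))" using diagram_finite[OF T] by (intro open_Compl closed_UN) auto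
  moreover have "q \<in> - ((\<Union>s\<in>?S. seg s))" using free by auto
  ultimately obtain \<rho> where \<rho>: "\<rho> > 0" "cball q \<rho> \<subseteq> - ((\<Union>s\<in>?S. seg s))" using open_contains_cball by blast
  \<comment> \<open>\<open>q\<close> has to be interior to the lens, so the axis is prolonged beyond
    \<open>q\<close> within a disc that no other segment meets.\<close>
  define w where "w = q + of_real \<rho>"
  have w: "Im w = h" "Re w > Re q" using level \<rho> by (auto simp: w_def)
  have pw_split: "closed_segment p w = closed_segment p q \<union> closed_segment q w"
  proof -
    define t where "t = (Re q - Re p) / (Re w - Re p)"
    have "0 \<le> t" "t \<le> 1" using level w by (auto simp: t_def)
    moreover have "q = (1 - t) *\<^sub>R p + t *\<^sub>R w"
    proof -
      have "t * (Re w - Re p) = Re q - Re p" using level w by (simp add: t_def)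
      then show ?thesis using level w by (simp add: complex_eq_iff algebra_simps)
    qed
    ultimately have "q \<in> closed_segment p w" unfolding in_segment by blast
    then show ?thesis using Un_closed_segment by blast
  qed
  have qw: "closed_segment q w \<subseteq> cball q \<rho>"
    using \<rho> by (intro closed_segment_subset) (auto simp: w_def dist_norm)
  have S: "seg s \<inter> closed_segment p w \<subseteq> {w} \<inter> ends s" if "s \<in> ?S" for s
    using free[of s] that \<rho>(2) qw pw_split by auto
  have Im_pw: "Im z = h" if "z \<in> closed_segment p w" for z
  proof -
    obtain u where "z = (1 - u) *\<^sub>R p + u *\<^sub>R w" using \<open>z \<in> closed_segment p w\<close> by (auto simp: in_segment)
    then have "Im z = (1 - u) * Im p + u * Im w" by simp
    then show ?thesis using level w by (simp add: algebra_simps)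
  qed
  let ?Y = "{p1, p2, q1, q2}"
  have Y: "finite ?Y" "?Y \<inter> closed_segment p w \<subseteq> {w}" using Im_pw side by auto
  have "p \<noteq> w" using level w by auto
  have fS: "finite ?S" using diagram_finite[OF T] by simp
  obtain Q where Q: "compact Q" "convex Q" and strict: "\<And>a b. a \<in> Q \<Longrightarrow> b \<in> Q \<Longrightarrow> open_segment a b \<subseteq> interior Q"
    and pQ: "p \<in> interior Q" and pwQ: "open_segment p w \<subseteq> interior Q" and "w \<in> frontier Q"
    and SQ': "\<And>s. s \<in> ?S \<Longrightarrow> seg s \<inter> Q \<subseteq> {w}" and YQ': "?Y \<inter> Q \<subseteq> {w}"
    by (rule lens_exists[OF \<open>p \<noteq> w\<close> fS S Y zero_less_one]) (assumption | rule that | blast)+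
  have wS: "w \<notin> seg s" if "s \<in> ?S" for s using that \<rho>(2) qw by auto
  have SQ: "seg s \<inter> Q = {}" if "s \<in> ?S" for s using SQ'[OF that] wS[OF that] by auto
  have YQ: "p1 \<notin> Q" "p2 \<notin> Q" "q1 \<notin> Q" "q2 \<notin> Q" using YQ' side w by auto
  have "q \<in> closed_segment p w" "q \<noteq> p" "q \<noteq> w" using pw_split pq w by auto
  then have qQ: "q \<in> interior Q" using pwQ by (auto simp: open_segment_def)
  obtain a where a: "a \<in> frontier Q" "a \<in> open_segment p p1" "closed_segment a p1 \<inter> Q = {a}" "a \<in> Q"
    by (rule exit_tail[OF Q strict pQ YQ(1)])
  obtain b where b: "b \<in> frontier Q" "b \<in> open_segment p p2" "closed_segment b p2 \<inter> Q = {b}" "b \<in> Q"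
    by (rule exit_tail[OF Q strict pQ YQ(2)])
  obtain a' where a': "a' \<in> frontier Q" "a' \<in> open_segment q q1" "closed_segment a' q1 \<inter> Q = {a'}" "a' \<in> Q"
    by (rule exit_tail[OF Q strict qQ YQ(3)])
  obtain b' where b': "b' \<in> frontier Q" "b' \<in> open_segment q q2" "closed_segment b' q2 \<inter> Q = {b'}" "b' \<in> Q"
    by (rule exit_tail[OF Q strict qQ YQ(4)])
  have Im_open: "Im z < h" if zo: "z \<in> open_segment x y" "Im x = h" "Im y < h" for x y z
  proof -
    obtain t where "0 < t" "t < 1" "z = (1 - t) *\<^sub>R x + t *\<^sub>R y" using zo(1) by (auto simp: in_segment)
    then have "Im z = (1 - t) * Im x + t * Im y" by simp
    then have "Im z = h + t * (Im y - h)" using zo(2) by (simp add: algebra_simps)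
    then show ?thesis using that(3) \<open>0 < t\<close> by (simp add: mult_pos_neg)
  qed
  have Im_open': "Im z > h" if zo: "z \<in> open_segment x y" "Im x = h" "Im y > h" for x y z
  proof -
    obtain t where "0 < t" "t < 1" "z = (1 - t) *\<^sub>R x + t *\<^sub>R y" using zo(1) by (auto simp: in_segment)
    then have "Im z = (1 - t) * Im x + t * Im y" by simp
    then have "Im z = h + t * (Im y - h)" using zo(2) by (simp add: algebra_simps)
    then show ?thesis using that(3) \<open>0 < t\<close> by simp
  qed
  have Im: "Im a < h" "Im b > h" "Im a' > h" "Im b' < h"
    using Im_open[OF a(2)] Im_open'[OF b(2)] Im_open'[OF a'(2)] Im_open[OF b'(2)] level side by auto
  note A = open_segment_between[OF p a(2) b(2)] and A' = open_segment_between[OF q a'(2) b'(2)]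
  have fresh: "x \<notin> pts T" if "x \<in> Q" for x
  proof
    assume "x \<in> pts T"
    then obtain s where s: "s \<in> T" "x \<in> ends s" by (auto simp: pts_def)
    then consider "s \<in> ?S" | "s = (p1, p2, d)" | "s = (q1, q2, d)" by blast
    then show False using SQ[of s] ends_subset_seg[of s] s(2) that YQ by cases auto
  qed
  have pt: "p1 \<in> pts T" "p2 \<in> pts T" "q1 \<in> pts T" "q2 \<in> pts T" using s1 s2 by (force simp: pts_def)+
  have notT: "(x, y, d') \<notin> T \<and> (y, x, d') \<notin> T" if "x \<in> Q" for x y d'
    using fresh[OF that] by (force simp: pts_def)
  have out: "x \<noteq> p1" "x \<noteq> p2" "x \<noteq> q1" "x \<noteq> q2" if "x \<in> Q" for x using fresh[OF that] pt by auto
  have ab': "a \<noteq> b'" "b \<noteq> a'"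
    using s12 A A' out[OF a(4)] out[OF b(4)] by (auto simp: open_segment_def) 
  have dist: "a \<noteq> b" "a \<noteq> a'" "b \<noteq> b'" "a' \<noteq> b'" using Im by auto
  note dist' = ab' ab'[symmetric] dist dist[symmetric]
  define T1 where "T1 = (T - {(p1, p2, d)}) \<union> {(p1, a, d), (a, p2, d)}"
  note c1 = cut[OF n2 T s1 A(1) T1_def]
  have i2: "(a, p2, d) \<in> T1" by (simp add: T1_def)
  define T2 where "T2 = (T1 - {(a, p2, d)}) \<union> {(a, b, d), (b, p2, d)}"
  note c2 = cut[OF n2 c1(1) i2 A(2) T2_def]
  have T2: "T2 = (T - {(p1, p2, d)}) \<union> {(p1, a, d), (a, b, d), (b, p2, d)}"
    using notT[OF a(4)] out[OF a(4)] unfolding T2_def T1_def by blast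
  have i3: "(q1, q2, d) \<in> T2" using s2 ne unfolding T2 by blast
  define T3 where "T3 = (T2 - {(q1, q2, d)}) \<union> {(q1, a', d), (a', q2, d)}"
  note c3 = cut[OF n2 c2(1) i3 A'(1) T3_def]
  have i4: "(a', q2, d) \<in> T3" by (simp add: T3_def)
  define T4 where "T4 = (T3 - {(a', q2, d)}) \<union> {(a', b', d), (b', q2, d)}"
  note c4 = cut[OF n2 c3(1) i4 A'(2) T4_def]
  define R where "R = ?S \<union> {(p1, a, d), (b, p2, d), (q1, a', d), (b', q2, d)}"
  define B where "B = {(a, b', d), (a', b, d)}"
  have T4: "T4 = R \<union> {(a, b, d), (a', b', d)}"
  proof -
    have h1: "u \<notin> K \<Longrightarrow> ((X - {v}) \<union> K) - {u} = (X - {v, u}) \<union> K" for X K :: "segment set" and u v by blast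
    have h2: "u \<notin> X \<Longrightarrow> u \<notin> K \<Longrightarrow> (X \<union> K \<union> {v, u}) - {u} = X \<union> K \<union> {v}"
      if "u \<noteq> v" for X K :: "segment set" and u v using that by blast
    let ?K = "{(p1, a, d), (a, b, d), (b, p2, d)}"
    have k: "(q1, q2, d) \<notin> ?K" using out[OF a(4)] out[OF b(4)] by auto
    have T3: "T3 = ?S \<union> ?K \<union> {(q1, a', d), (a', q2, d)}" unfolding T3_def T2 h1[OF k] ..
    have k1: "(a', q2, d) \<notin> ?S" using notT[OF a'(4)] by blast
    have k2: "(a', q2, d) \<noteq> (q1, a', d)" "(a', q2, d) \<notin> ?K" using out[OF a'(4)] dist' by auto
    have "T4 = (?S \<union> ?K \<union> {(q1, a', d)}) \<union> {(a', b', d), (b', q2, d)}"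
      unfolding T4_def T3 h2[OF k2(1) k1 k2(2)] ..
    then show ?thesis unfolding R_def by blast
  qed
  have hit: "seg s \<inter> Q \<subseteq> ends s \<inter> {a, b, a', b'}" if "s \<in> R" for s
  proof -
    consider "s \<in> ?S" | "s = (p1, a, d)" | "s = (b, p2, d)" | "s = (q1, a', d)" | "s = (b', q2, d)"
      using \<open>s \<in> R\<close> unfolding R_def by blast
    then show ?thesis
    proof cases
      case 1 then show ?thesis using SQ by simp
    next
      case 2 then show ?thesis using a(3) by (simp add: closed_segment_commute)
    next
      case 3 then show ?thesis using b(3) by simp
    next
      case 4 then show ?thesis using a'(3) by (simp add: closed_segment_commute)
    next
      case 5 then show ?thesis using b'(3) by simp
    qed
  qed
  \<comment> \<open>By strict convexity a chord of the lens meets the frontier only in its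
    ends.\<close>
  have frp: "x \<in> {y, z}" if "x \<in> frontier Q" "x \<in> closed_segment y z" "y \<in> Q" "z \<in> Q" for x y z
    using strict[OF that(3,4)] that(1,2) by (auto simp: frontier_def open_segment_def)
  have frs: "x \<in> frontier Q" if "x \<in> {a, b, a', b'}" for x using that a b a' b' by blast
  have inQ: "closed_segment y z \<subseteq> Q" if "y \<in> Q" "z \<in> Q" for y z using Q(2) that by (simp add: closed_segment_subset)
  have Rsub: "R \<inter> {(a, b, d), (a', b', d)} = {}"
  proof -
    have "(a, b, d) \<notin> ?S" "(a', b', d) \<notin> ?S" using notT[OF a(4)] notT[OF a'(4)] by blast+
    then show ?thesis
      unfolding R_def using out[OF a(4)] out[OF a'(4)] out[OF b(4)] out[OF b'(4)] dist' by simp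
  qed
  have segS: "segments_at ?S x = {}" if "x \<in> Q" for x
    using fresh[OF that] by (auto simp: segments_at_eq pts_def)
  have RB: "R \<union> B = ?S \<union> {(p1, a, d), (a, b', d), (b', q2, d), (q1, a', d), (a', b, d), (b, p2, d)}"
    unfolding R_def B_def by blast
  have D4: "diagram n (R \<union> {(a, b, d), (a', b', d)})" using c4(1) T4 by simp
  have corner: "corner_at (R \<union> B) x" if "x \<in> pts B" for x
  proof -
    note o = out[OF a(4)] out[OF b(4)] out[OF a'(4)] out[OF b'(4)]
    note o' = o o[symmetric]
    have x: "x = a \<or> x = b \<or> x = a' \<or> x = b'" using that by (auto simp: B_def pts_def)
    have "segments_at (R \<union> B) a = {(p1, a, d), (a, b', d)}"
      unfolding RB segments_at_Un segS[OF a(4)] using o' dist' by (simp add: segments_at_simps insert_commute)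
    moreover have "segments_at (R \<union> B) b = {(a', b, d), (b, p2, d)}"
      unfolding RB segments_at_Un segS[OF b(4)] using o' dist' by (simp add: segments_at_simps insert_commute)
    moreover have "segments_at (R \<union> B) a' = {(q1, a', d), (a', b, d)}"
      unfolding RB segments_at_Un segS[OF a'(4)] using o' dist' by (simp add: segments_at_simps insert_commute)
    moreover have "segments_at (R \<union> B) b' = {(a, b', d), (b', q2, d)}"
      unfolding RB segments_at_Un segS[OF b'(4)] using o' dist' by (simp add: segments_at_simps insert_commute)
    ultimately show ?thesis using x unfolding corner_at_def by blast
  qed
  \<comment> \<open>The two new arcs lie on different sides of the level \<open>h\<close>.\<close>
  have disj: "closed_segment a b' \<inter> closed_segment a' b = {}"
    using Im_segment_less[OF Im(1) Im(4)] Im_segment_greater[OF Im(3) Im(2)] by fastforce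
  have crossR: "seg s \<inter> seg t \<subseteq> ends s \<inter> ends t" if s: "s \<in> R" and t: "t \<in> B" for s t
  proof
    fix x assume x: "x \<in> seg s \<inter> seg t"
    obtain y z where yz: "t = (y, z, d)" "y \<in> Q" "z \<in> Q" using t a(4) b(4) a'(4) b'(4) unfolding B_def by blast
    then have "x \<in> closed_segment y z" using x by simp
    then have "x \<in> ends s \<inter> {a, b, a', b'}" using x inQ[OF yz(2,3)] hit[OF s] by blast
    then have xs: "x \<in> ends s" "x \<in> frontier Q" using frs by blast+
    moreover have "x \<in> ends t" using frp[OF xs(2) \<open>x \<in> closed_segment y z\<close> yz(2,3)] yz(1) by simp
    ultimately show "x \<in> ends s \<inter> ends t" by simp
  qed
  have crossB: "seg s \<inter> seg t \<subseteq> ends s \<inter> ends t" if "s \<in> B" "t \<in> B" "s \<noteq> t" for s t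
  proof -
    have "(s = (a, b', d) \<and> t = (a', b, d)) \<or> (t = (a, b', d) \<and> s = (a', b, d))"
      using that unfolding B_def by blast
    then show ?thesis using disj by (elim disjE) (simp_all add: Int_commute)
  qed
  have ptsA: "pts {(a, b, d), (a', b', d)} \<inter> pts R \<subseteq> pts B" by (auto simp: pts_def B_def)
  have finB: "finite B" and ndB: "\<And>s. s \<in> B \<Longrightarrow> fst s \<noteq> fst (snd s)" using dist' by (auto simp: B_def)
  note rep = replace[OF n2 D4 Rsub finB ndB crossB crossR corner ptsA]
  have "bridge_move T4 (R \<union> B)"
    unfolding bridge_move_def
  proof (intro exI conjI)
    show "replaces_in_disc Q {a, b, a', b'} ({(a, b, d)} \<union> {(a', b', d)}) ({(a, b', d)} \<union> {(a', b, d)}) T4 (R \<union> B)"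
      unfolding replaces_in_disc_def
    proof (intro conjI exI[of _ R])
      show "Q homeomorphic (cball 0 1 :: complex set)"
        using Q pQ by (intro homeomorphic_convex_compact_cball) auto
      show "support ({(a, b, d)} \<union> {(a', b', d)}) \<subseteq> Q" "support ({(a, b', d)} \<union> {(a', b, d)}) \<subseteq> Q"
        using inQ a(4) b(4) a'(4) b'(4) by simp_all
      show "support ({(a, b, d)} \<union> {(a', b', d)}) \<inter> frontier Q = {a, b, a', b'}"
        using frp[OF _ _ a(4) b(4)] frp[OF _ _ a'(4) b'(4)] a(1) b(1) a'(1) b'(1) by auto
      show "support ({(a, b', d)} \<union> {(a', b, d)}) \<inter> frontier Q = {a, b, a', b'}"
        using frp[OF _ _ a(4) b'(4)] frp[OF _ _ a'(4) b(4)] a(1) b(1) a'(1) b'(1) by auto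
      show "T4 = R \<union> ({(a, b, d)} \<union> {(a', b', d)})" unfolding T4 by blast
      show "R \<union> B = R \<union> ({(a, b', d)} \<union> {(a', b, d)})" unfolding B_def by blast
      show "support R \<inter> Q \<subseteq> {a, b, a', b'}" using hit unfolding support_eq_seg by blast
    qed
    show "support {(a, b, d)} \<inter> support {(a', b', d)} = {}"
    proof -
      have "closed_segment a b \<inter> closed_segment a' b' \<subseteq> {p1, p2}" using s12 A(4) A'(4) by blast
      moreover have "closed_segment a b \<subseteq> Q" using inQ a b by blast
      ultimately show ?thesis using YQ by auto
    qed
    show "support {(a, b', d)} \<inter> support {(a', b, d)} = {}" using disj by simp
  qed (use dist' in \<open>auto intro: oriented_arc_single\<close>)
  then have step: "homotopic_diagrams n T4 (R \<union> B)"
    using c4(1) rep(1) by (intro homotopic_step) (simp add: elementary_step_def)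
  show ?thesis
  proof (rule that[of "R \<union> B" a b' a' b])
    show "homotopic_diagrams n T (R \<union> B)"
      using c1(2) c2(2) c3(2) c4(2) step by (meson homotopic_trans)
    show "diagram n (R \<union> B)" by (rule rep(1))
    show "verts n (R \<union> B) \<subseteq> verts n T" using rep(2) c1(3) c2(3) c3(3) c4(3) unfolding T4[symmetric] by blast
    show "{a, b, a', b'} \<inter> pts T = {}" using fresh a b a' b' by blast
    show "R \<union> B = ?S \<union> {(p1, a, d), (a, b', d), (b', q2, d), (q1, a', d), (a', b, d), (b, p2, d)}" by (rule RB)
    show "a \<in> open_segment p1 p" by (rule A(3))
    show "b' \<in> open_segment q q2" by (rule b'(2))
    show "Im b > h" "Im a' > h" by (rule Im)+
  qed
qed

subsection \<open>Cancellation inside a rectangle\<close>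

lemma other_other [simp]: "other (other c) = c"
  by (cases c) auto

lemma other_neq [simp]: "other c \<noteq> c" "c \<noteq> other c"
  by (cases c; simp)+

lemma alternate_Suc: "alternate c (Suc i) = other (alternate c i)"
  and alternate_other: "alternate (other c) i = other (alternate c i)"
  by (auto simp: alternate_def)

text \<open>The two indices add up to an odd number. Since the colours of the second vertex start
  with \<open>other c\<close>, mirrored spokes of the two vertices therefore have equal
  colours.\<close>

lemma alternate_mirror: "k < 2 * n \<Longrightarrow> alternate c (2 * n - 1 - k) = other (alternate c k)"
  by (auto simp: alternate_def)

lemma oriented_arc_three:
  assumes "distinct [a, b, b', d]"
  shows "oriented_arc c {(a, b, c), (b, b', c), (b', d, c)} a d"
  unfolding oriented_arc_def
proof (intro exI[of _ "[a, b, b', d]"] conjI)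
  have "{..<length [a, b, b', d] - 1} = {0, 1, 2}" by auto
  then show "{(a, b, c), (b, b', c), (b', d, c)} =
      (\<lambda>i. ([a, b, b', d] ! i, [a, b, b', d] ! Suc i, c)) ` {..<length [a, b, b', d] - 1}"
    by (simp add: numeral_2_eq_2)
qed (use assms in auto)

lemma segments_at_pts: "s \<in> segments_at T x \<Longrightarrow> x \<in> pts T"
  by (auto simp: segments_at_eq pts_def simp del: split_paired_Ex)

lemma interior_frontier_segment:
  fixes S :: "complex set"
  assumes "convex S" "a \<in> interior S" "b \<in> S" "z \<in> closed_segment a b" "z \<in> frontier S"
  shows "z = b"
proof (rule ccontr)
  assume "z \<noteq> b"
  have "open_segment a b \<subseteq> interior S"
    using in_interior_closure_convex_segment[OF assms(1,2)] assms(3) closure_subset by blast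
  then show False using assms(2,4,5) \<open>z \<noteq> b\<close> by (auto simp: open_segment_def frontier_def)
qed

text \<open>The vertices are 0 and 1 and the rectangle is the disc of the move. Incoming spokes of 0
  end on its left side, outgoing spokes of 1 on its right side, and the \<open>n\<close> edges
  between them run inside. The mirrored indices \<open>2 * n - 1 - i\<close> on the left and
  \<open>i\<close> on the right occur in the same vertical order, so the straight strands joining
  them are disjoint.\<close>

lemma cancel_cut:
  fixes e f :: "nat \<Rightarrow> complex"
  assumes n2: "n \<ge> 2" and T: "diagram n T" and sp0: "spokes n T 0 c e" and sp1: "spokes n T 1 (other c) f"
    and e0: "e 0 = 1" and f0: "f (2 * n - 1) = 0"
    and box: "l < 0" "1 < r" "lo < 0" "0 < hi"
    and mid: "\<And>k. 1 \<le> k \<Longrightarrow> k < n \<Longrightarrow> (e k, f (2 * n - 1 - k), alternate c k) \<in> T"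
    and mid_e: "\<And>k. 1 \<le> k \<Longrightarrow> k < n \<Longrightarrow> l < Re (e k) \<and> Re (e k) < 1/2 \<and> 0 < Im (e k) \<and> Im (e k) < hi"
    and mid_f: "\<And>k. n \<le> k \<Longrightarrow> k < 2 * n - 1 \<Longrightarrow> 1/2 < Re (f k) \<and> Re (f k) < r \<and> 0 < Im (f k) \<and> Im (f k) < hi"
    and left: "\<And>j. n \<le> j \<Longrightarrow> j < 2 * n \<Longrightarrow> Re (e j) = l \<and> lo < Im (e j) \<and> Im (e j) < hi \<and> e j \<notin> verts n T"
    and right: "\<And>j. j < n \<Longrightarrow> Re (f j) = r \<and> lo < Im (f j) \<and> Im (f j) < hi \<and> f j \<notin> verts n T"
    and mono_e: "\<And>i j. n \<le> i \<Longrightarrow> i < j \<Longrightarrow> j < 2 * n \<Longrightarrow> Im (e j) < Im (e i)"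
    and mono_f: "\<And>i j. i < j \<Longrightarrow> j < n \<Longrightarrow> Im (f i) < Im (f j)"
    and free: "\<And>s. s \<in> T \<Longrightarrow> 0 \<notin> ends s \<Longrightarrow> 1 \<notin> ends s \<Longrightarrow>
       (\<And>k. 1 \<le> k \<Longrightarrow> k < n \<Longrightarrow> s \<noteq> (e k, f (2 * n - 1 - k), alternate c k)) \<Longrightarrow>
       seg s \<inter> cbox (Complex l lo) (Complex r hi) \<subseteq> ends s \<inter> (e ` {n..<2 * n} \<union> f ` {..<n})"
  shows "\<exists>T'. homotopic_diagrams n T T' \<and> diagram n T' \<and> verts n T' \<subseteq> verts n T - {0, 1}"
proof -
  define m where "m k = 2 * n - 1 - k" for k
  have m: "n \<le> m k" "m k < 2 * n" "m (m k) = k" if "k < n" for k using that by (auto simp: m_def)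
  have m': "m k < n" "m (m k) = k" if "n \<le> k" "k < 2 * n" for k using that by (auto simp: m_def)
  have mr: "n \<le> m k" "m k < 2 * n - 1" if "1 \<le> k" "k < n" for k using that by (auto simp: m_def)
  have midf: "1/2 < Re (f (m k)) \<and> Re (f (m k)) < r \<and> 0 < Im (f (m k)) \<and> Im (f (m k)) < hi"
    if "1 \<le> k" "k < n" for k by (rule mid_f[OF mr[OF that]])
  define g where "g k = alternate c k" for k
  have g_m: "alternate c (m k) = other (g k)" if "k < 2 * n" for k
    using alternate_mirror[OF that] by (simp add: m_def g_def)
  have g_o: "alternate (other c) k = other (g k)" for k by (simp add: alternate_other g_def)
  define S where "S = cbox (Complex l lo) (Complex r hi)"
  have S: "z \<in> S \<longleftrightarrow> l \<le> Re z \<and> Re z \<le> r \<and> lo \<le> Im z \<and> Im z \<le> hi" for z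
    by (auto simp: S_def in_cbox_complex_iff)
  have iS: "z \<in> interior S \<longleftrightarrow> l < Re z \<and> Re z < r \<and> lo < Im z \<and> Im z < hi" for z
    by (auto simp: S_def interior_cbox in_box_complex_iff)
  have cS: "convex S" "compact S" by (simp_all add: S_def)
  have fS: "z \<in> frontier S \<longleftrightarrow> z \<in> S \<and> z \<notin> interior S" for z
    using cS(2) by (simp add: frontier_def compact_imp_closed)
  have fr_ne: "x \<noteq> z" if "x \<in> frontier S" "z \<in> interior S" for x z using that fS by blast
  have in01: "0 \<in> interior S" "1 \<in> interior S" using box by (auto simp: iS)
  have ine: "e k \<in> interior S" if "1 \<le> k" "k < n" for k using mid_e[OF that] box by (auto simp: iS)
  have inf: "f (m k) \<in> interior S" if "1 \<le> k" "k < n" for k using midf[OF that] box by (auto simp: iS)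
  have frX: "e (m k) \<in> frontier S" if "k < n" for k using left[of "m k"] m[OF that] box by (auto simp: S iS fS)
  have frY: "f k \<in> frontier S" if "k < n" for k using right[OF that] box by (auto simp: S iS fS)
  define P where "P = (\<lambda>i. e (m i)) ` {..<n} \<union> f ` {..<n}"
  have P: "e ` {n..<2 * n} \<union> f ` {..<n} = P"
  proof -
    have "e ` {n..<2 * n} = (\<lambda>i. e (m i)) ` {..<n}"
    proof
      show "e ` {n..<2 * n} \<subseteq> (\<lambda>i. e (m i)) ` {..<n}" using m' by force
      show "(\<lambda>i. e (m i)) ` {..<n} \<subseteq> e ` {n..<2 * n}" using m by auto
    qed
    then show ?thesis by (simp add: P_def)
  qed
  have PS: "P \<subseteq> frontier S" using frX frY by (auto simp: P_def)
  \<comment> \<open>The first index says whether the edge enters 0, joins 0 to 1, or leaves 1. The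
    joining edge 0 is a single segment; the others have three, because a bridge has put a middle
    piece between two shortened spokes.\<close>
  define E :: "nat \<Rightarrow> nat \<Rightarrow> segment set" where
    "E kk i = (if kk = 0 then {(e (m i), 0, other (g i))}
       else if kk = 1 then (if i = 0 then {(0, 1, g 0)} else {(0, e i, g i), (e i, f (m i), g i), (f (m i), 1, g i)})
       else {(1, f i, other (g i))})" for kk i
  define F :: "nat \<Rightarrow> segment set" where "F i = {(e (m i), f i, other (g i))}" for i
  define A where "A = (\<Union>k<3::nat. \<Union>i<n. E k i)"
  define B where "B = (\<Union>i<n. F i)"
  define R where "R = T - A"
  have three: "{..<3::nat} = {0, 1, 2}" by auto
  have A_cases: "(\<exists>i<n. s = (e (m i), 0, other (g i))) \<or> s = (0, 1, g 0) \<or>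
      (\<exists>i. 1 \<le> i \<and> i < n \<and> (s = (0, e i, g i) \<or> s = (e i, f (m i), g i) \<or> s = (f (m i), 1, g i))) \<or>
      (\<exists>i<n. s = (1, f i, other (g i)))" if sA: "s \<in> A" for s
  proof -
    obtain kk i where ki: "kk < 3" "i < n" "s \<in> E kk i" using sA by (auto simp: A_def)
    then consider "kk = 0" | "kk = 1" "i = 0" | "kk = 1" "i \<ge> 1" | "kk = 2" by linarith
    then show ?thesis
    proof cases
      case 1 then have "s = (e (m i), 0, other (g i))" using ki by (simp add: E_def)
      then show ?thesis using ki by blast
    next
      case 2 then show ?thesis using ki by (simp add: E_def)
    next
      case 3 then have "s = (0, e i, g i) \<or> s = (e i, f (m i), g i) \<or> s = (f (m i), 1, g i)" using ki by (simp add: E_def)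
      then show ?thesis using 3 ki by blast
    next
      case 4 then have "s = (1, f i, other (g i))" using ki by (simp add: E_def)
      then show ?thesis using ki by blast
    qed
  qed
  have A0: "spoke n 0 c e j \<in> A" if j: "j < 2 * n" for j
  proof -
    consider "j = 0" | "1 \<le> j" "j < n" | "n \<le> j" by linarith
    then show ?thesis
    proof cases
      case 1
      then have "spoke n 0 c e j \<in> E 1 0" using e0 n2 by (simp add: E_def spoke_def g_def)
      then show ?thesis using n2 unfolding A_def by (intro UN_I[of 1] UN_I[of 0]) auto
    next
      case 2
      then have "spoke n 0 c e j \<in> E 1 j" by (simp add: E_def spoke_def g_def)
      then show ?thesis using 2 unfolding A_def by (intro UN_I[of 1] UN_I[of j]) auto
    next
      case 3
      then have "spoke n 0 c e j \<in> E 0 (m j)"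
        using m'[OF 3 j] g_m[of "m j"] by (simp add: E_def spoke_def)
      then show ?thesis using m'[OF 3 j] unfolding A_def by (intro UN_I[of 0] UN_I[of "m j"]) auto
    qed
  qed
  have A1: "spoke n 1 (other c) f j \<in> A" if j: "j < 2 * n" for j
  proof -
    consider "j = 2 * n - 1" | "n \<le> j" "j < 2 * n - 1" | "j < n" using j by linarith
    then show ?thesis
    proof cases
      case 1
      then have "alternate (other c) j = g 0" using alternate_mirror[of 0 n c] n2 by (simp add: alternate_other g_def)
      then have "spoke n 1 (other c) f j \<in> E 1 0" using f0 n2 1 by (simp add: E_def spoke_def)
      then show ?thesis using n2 unfolding A_def by (intro UN_I[of 1] UN_I[of 0]) auto
    next
      case 2
      then have mj: "1 \<le> m j" "m j < n" "m (m j) = j" using m'[of j] by (auto simp: m_def)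
      have "alternate (other c) j = g (m j)" using g_m[of "m j"] mj by (simp add: alternate_other)
      then have "spoke n 1 (other c) f j \<in> E 1 (m j)" using 2 mj by (simp add: E_def spoke_def)
      then show ?thesis using mj unfolding A_def by (intro UN_I[of 1] UN_I[of "m j"]) auto
    next
      case 3
      then have "spoke n 1 (other c) f j \<in> E 2 j" by (simp add: E_def spoke_def g_o)
      then show ?thesis using 3 unfolding A_def by (intro UN_I[of 2] UN_I[of j]) auto
    qed
  qed
  have Amid: "(e k, f (m k), g k) \<in> A" if k: "1 \<le> k" "k < n" for k
  proof -
    have "(e k, f (m k), g k) \<in> E 1 k" using k by (simp add: E_def)
    then show ?thesis using k unfolding A_def by (intro UN_I[of 1] UN_I[of k]) auto
  qed
  have AT: "A \<subseteq> T"
  proof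
    fix s assume "s \<in> A"
    note sp = spokes_in(1)[OF sp0] spokes_in(1)[OF sp1]
    from A_cases[OF \<open>s \<in> A\<close>] show "s \<in> T"
    proof (elim disjE exE conjE)
      fix i assume i: "i < n" "s = (e (m i), 0, other (g i))"
      then have "spoke n 0 c e (m i) = s" using m[OF i(1)] g_m[of i] by (simp add: spoke_def)
      then show ?thesis using sp(1)[of "m i"] m[OF i(1)] by simp
    next
      assume "s = (0, 1, g 0)"
      then have "spoke n 0 c e 0 = s" using e0 n2 by (simp add: spoke_def g_def)
      then show ?thesis using sp(1)[of 0] n2 by simp
    next
      fix i assume i: "1 \<le> i" "i < n" "s = (0, e i, g i)"
      then have "spoke n 0 c e i = s" by (simp add: spoke_def g_def)
      then show ?thesis using sp(1)[of i] i by simp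
    next
      fix i assume i: "1 \<le> i" "i < n" "s = (e i, f (m i), g i)"
      then show ?thesis using mid[OF i(1,2)] by (simp add: m_def g_def)
    next
      fix i assume i: "1 \<le> i" "i < n" "s = (f (m i), 1, g i)"
      then have "spoke n 1 (other c) f (m i) = s" using m[OF i(2)] g_m[of i] by (simp add: spoke_def alternate_other)
      then show ?thesis using sp(2)[of "m i"] m[OF i(2)] by simp
    next
      fix i assume i: "i < n" "s = (1, f i, other (g i))"
      then have "spoke n 1 (other c) f i = s" by (simp add: spoke_def g_o)
      then show ?thesis using sp(2)[of i] i by simp
    qed
  qed
  have TRA: "T = R \<union> A" "R \<inter> A = {}" using AT by (auto simp: R_def)
  have Rfree: "seg s \<inter> S \<subseteq> ends s \<inter> P" if s: "s \<in> R" for s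
  proof -
    have sT: "s \<in> T" "s \<notin> A" using s by (auto simp: R_def)
    have "0 \<notin> ends s" using spokes_star[OF sp0 sT(1)] A0 sT(2) by metis
    moreover have "1 \<notin> ends s" using spokes_star[OF sp1 sT(1)] A1 sT(2) by metis
    moreover have "s \<noteq> (e k, f (2 * n - 1 - k), alternate c k)" if "1 \<le> k" "k < n" for k
      using Amid[OF that] sT(2) by (auto simp: m_def g_def)
    ultimately show ?thesis using free[OF sT(1)] unfolding P S_def by blast
  qed
  have segA: "seg s \<subseteq> S \<and> seg s \<inter> frontier S = ends s \<inter> P" if sA: "s \<in> A" for s
  proof -
    have inner: "seg (a, b, d) \<subseteq> S \<and> seg (a, b, d) \<inter> frontier S = ends (a, b, d) \<inter> P"
      if "a \<in> interior S" "b \<in> interior S" for a b :: complex and d :: colour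
    proof -
      have "closed_segment a b \<subseteq> interior S" using convex_interior[OF cS(1)] that by (simp add: closed_segment_subset)
      then show ?thesis using interior_subset[of S] fS PS that by auto
    qed
    have outer: "seg s \<subseteq> S \<and> seg s \<inter> frontier S = ends s \<inter> P"
      if "a \<in> interior S" "b \<in> P" "s = (a, b, d) \<or> s = (b, a, d)" for a b :: complex and d s
    proof -
      have b: "b \<in> frontier S" "b \<in> S" using that PS fS by auto
      have "a \<in> S" using that(1) interior_subset[of S] by blast
      then have "closed_segment a b \<subseteq> S" using b(2) cS(1) by (simp add: closed_segment_subset)
      moreover have "closed_segment a b \<inter> frontier S = {b}"
        using interior_frontier_segment[OF cS(1) that(1) b(2)] b(1) by auto
      moreover have "{a, b} \<inter> P = {b}" using that PS fS by auto
      ultimately show ?thesis using that(3) by (auto simp: closed_segment_commute)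
    qed
    from A_cases[OF sA] show ?thesis
    proof (elim disjE exE conjE)
      fix i assume i: "i < n" "s = (e (m i), 0, other (g i))"
      then have "e (m i) \<in> P" by (simp add: P_def)
      then show ?thesis using outer[OF in01(1)] i(2) by blast
    next
      assume "s = (0, 1, g 0)" then show ?thesis using inner in01 by blast
    next
      fix i assume "1 \<le> i" "i < n" "s = (0, e i, g i)" then show ?thesis using inner in01 ine by blast
    next
      fix i assume "1 \<le> i" "i < n" "s = (e i, f (m i), g i)" then show ?thesis using inner ine inf by blast
    next
      fix i assume "1 \<le> i" "i < n" "s = (f (m i), 1, g i)" then show ?thesis using inner in01 inf by blast
    next
      fix i assume i: "i < n" "s = (1, f i, other (g i))"
      then have "f i \<in> P" by (simp add: P_def)
      then show ?thesis using outer[OF in01(2)] i(2) by blast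
    qed
  qed
  have strand: "closed_segment (e (m i)) (f i) \<subseteq> S"
    "closed_segment (e (m i)) (f i) \<inter> frontier S = {e (m i), f i}" if i: "i < n" for i
  proof -
    note X = left[OF m(1,2)[OF i]] and Y = right[OF i]
    have XS: "e (m i) \<in> S" "f i \<in> S" using frX[OF i] frY[OF i] fS by auto
    show "closed_segment (e (m i)) (f i) \<subseteq> S" using XS cS by (simp add: closed_segment_subset)
    have "z \<in> {e (m i), f i}" if z: "z \<in> closed_segment (e (m i)) (f i)" "z \<in> frontier S" for z
    proof (rule ccontr)
      assume "z \<notin> {e (m i), f i}"
      then have "z \<in> open_segment (e (m i)) (f i)" using z(1) by (auto simp: open_segment_def)
      then obtain t where t: "0 < t" "t < 1" "z = (1 - t) *\<^sub>R e (m i) + t *\<^sub>R f i" by (auto simp: in_segment)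
      have cv: "lower < (1 - t) * a + t * b \<and> (1 - t) * a + t * b < upper"
        if "lower < a" "a < upper" "lower < b" "b < upper" for lower upper a b
        using convex_bound_lt[of a upper b "1 - t" t] convex_bound_lt[of "-a" "-lower" "-b" "1 - t" t] that t by auto
      have "Im z = (1 - t) * Im (e (m i)) + t * Im (f i)" using t(3) by simp
      then have 1: "lo < Im z \<and> Im z < hi" using cv[of lo "Im (e (m i))" hi "Im (f i)"] X Y by simp
      have "Re z = (1 - t) * l + t * r" using t(3) X Y by simp
      then have d: "Re z - l = t * (r - l)" "r - Re z = (1 - t) * (r - l)" by (simp_all add: algebra_simps)
      have "t * (r - l) > 0" "(1 - t) * (r - l) > 0" using t box by auto
      then have "l < Re z" "Re z < r" unfolding d[symmetric] by simp_all
      then have "z \<in> interior S" using 1 iS by blast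
      then show False using z(2) fS by simp
    qed
    then show "closed_segment (e (m i)) (f i) \<inter> frontier S = {e (m i), f i}"
      using frX[OF i] frY[OF i] by auto
  qed
  \<comment> \<open>Both strands span the full width, so a common point has the same parameter on
    each; but at equal parameters the strand \<open>j\<close> stays strictly above the strand
    \<open>i\<close>.\<close>
  have Fdisj: "closed_segment (e (m i)) (f i) \<inter> closed_segment (e (m j)) (f j) = {}" if ij: "i < j" "j < n" for i j
  proof -
    have "False" if z: "z \<in> closed_segment (e (m i)) (f i)" "z \<in> closed_segment (e (m j)) (f j)" for z
    proof -
      obtain t where t: "0 \<le> t" "t \<le> 1" "z = (1 - t) *\<^sub>R e (m i) + t *\<^sub>R f i" using z(1) by (auto simp: in_segment)
      obtain u where u: "0 \<le> u" "u \<le> 1" "z = (1 - u) *\<^sub>R e (m j) + u *\<^sub>R f j" using z(2) by (auto simp: in_segment)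
      have i: "i < n" using ij by simp
      have "Re z = (1 - t) * l + t * r" "Re z = (1 - u) * l + u * r"
        unfolding t(3) using left[OF m(1,2)[OF i]] right[OF i] apply simp
        unfolding t(3)[symmetric] u(3) using left[OF m(1,2)[OF ij(2)]] right[OF ij(2)] by simp
      then have "(t - u) * (r - l) = 0" by (simp add: algebra_simps)
      then have tu: "t = u" using box by simp
      have X: "Im (e (m i)) < Im (e (m j))" using mono_e[of "m j" "m i"] m ij i by (auto simp: m_def)
      have Y: "Im (f i) < Im (f j)" using mono_f[OF ij] .
      have "(1 - t) * (Im (e (m j)) - Im (e (m i))) + t * (Im (f j) - Im (f i)) = 0"
        using arg_cong[OF t(3), of Im] arg_cong[OF u(3), of Im] tu by (simp add: algebra_simps)
      moreover have "(1 - t) * (Im (e (m j)) - Im (e (m i))) + t * (Im (f j) - Im (f i)) > 0"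
      proof (cases "t = 0")
        case True then show ?thesis using X by simp
      next
        case False
        then have "t * (Im (f j) - Im (f i)) > 0" using t Y by simp
        moreover have "(1 - t) * (Im (e (m j)) - Im (e (m i))) \<ge> 0" using t X by simp
        ultimately show ?thesis by linarith
      qed
      ultimately show False by simp
    qed
    then show ?thesis by blast
  qed
  have Bs: "s \<in> B \<longleftrightarrow> (\<exists>i<n. s = (e (m i), f i, other (g i)))" for s by (auto simp: B_def F_def)
  have XY: "e (m i) \<noteq> f j" if "i < n" "j < n" for i j
    using left[OF m(1,2)[OF that(1)]] right[OF that(2)] box by auto
  have injX: "e (m i) = e (m j) \<Longrightarrow> i = j" if "i < n" "j < n" for i j
    using spokes_inj[OF sp0, of "m i" "m j"] m[OF that(1)] m[OF that(2)] by metis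
  have injY: "f i = f j \<Longrightarrow> i = j" if "i < n" "j < n" for i j
    using spokes_inj[OF sp1, of i j] that by simp
  have ptsB: "pts B = P" unfolding pts_def P_def B_def F_def by auto
  have finB: "finite B" by (simp add: B_def F_def)
  have ndB: "fst s \<noteq> fst (snd s)" if "s \<in> B" for s
  proof -
    obtain i where "i < n" "s = (e (m i), f i, other (g i))" using Bs \<open>s \<in> B\<close> by blast
    then show ?thesis using XY[of i i] by simp
  qed
  have crossB: "seg s \<inter> seg t \<subseteq> ends s \<inter> ends t" if st: "s \<in> B" "t \<in> B" "s \<noteq> t" for s t
  proof -
    obtain i j where ij: "i < n" "s = (e (m i), f i, other (g i))" "j < n" "t = (e (m j), f j, other (g j))"
      using Bs st by blast
    then have "i \<noteq> j" using st(3) by auto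
    then consider "i < j" | "j < i" by linarith
    then have "closed_segment (e (m i)) (f i) \<inter> closed_segment (e (m j)) (f j) = {}"
      using Fdisj ij by cases (auto simp: Int_commute)
    then show ?thesis using ij by simp
  qed
  have crossR: "seg s \<inter> seg t \<subseteq> ends s \<inter> ends t" if st: "s \<in> R" "t \<in> B" for s t
  proof
    fix x assume x: "x \<in> seg s \<inter> seg t"
    obtain j where j: "j < n" "t = (e (m j), f j, other (g j))" using Bs st by blast
    then have xt: "x \<in> closed_segment (e (m j)) (f j)" using x by simp
    then have xs: "x \<in> ends s" "x \<in> P" using Rfree[OF st(1)] x strand(1)[OF j(1)] by auto
    then have "x \<in> {e (m j), f j}" using strand(2)[OF j(1)] xt PS by blast
    then show "x \<in> ends s \<inter> ends t" using xs j by simp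
  qed
  have ptsA: "pts A \<inter> pts R \<subseteq> pts B"
  proof
    fix x assume "x \<in> pts A \<inter> pts R"
    then obtain s t where st: "s \<in> A" "x \<in> ends s" "t \<in> R" "x \<in> ends t" by (auto simp: pts_def)
    then have "x \<in> seg t \<inter> S" using segA[OF st(1)] ends_subset_seg by blast
    then show "x \<in> pts B" using Rfree[OF st(3)] ptsB by blast
  qed
  have starX: "segments_at A (e (m i)) = {(e (m i), 0, other (g i))}" if i: "i < n" for i
  proof
    have "(e (m i), 0, other (g i)) \<in> E 0 i" by (simp add: E_def)
    then have "(e (m i), 0, other (g i)) \<in> A" using i unfolding A_def by (intro UN_I[of 0] UN_I[of i]) auto
    then show "{(e (m i), 0, other (g i))} \<subseteq> segments_at A (e (m i))" by (simp add: segments_at_eq)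
    show "segments_at A (e (m i)) \<subseteq> {(e (m i), 0, other (g i))}"
    proof
      fix s assume "s \<in> segments_at A (e (m i))"
      then have s: "s \<in> A" "e (m i) \<in> ends s" by (auto simp: segments_at_eq)
      have no: "e (m i) \<noteq> 0" "e (m i) \<noteq> 1" "1 \<le> k \<Longrightarrow> k < n \<Longrightarrow> e (m i) \<noteq> e k \<and> e (m i) \<noteq> f (m k)" for k
        using fr_ne[OF frX[OF i]] in01 ine[of k] inf[of k] by blast+
      from A_cases[OF s(1)] show "s \<in> {(e (m i), 0, other (g i))}"
        using s(2) no XY[OF i] injX[OF i] by (elim disjE exE conjE) auto
    qed
  qed
  have starY: "segments_at A (f i) = {(1, f i, other (g i))}" if i: "i < n" for i
  proof
    have "(1, f i, other (g i)) \<in> E 2 i" by (simp add: E_def)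
    then have "(1, f i, other (g i)) \<in> A" using i unfolding A_def by (intro UN_I[of 2] UN_I[of i]) auto
    then show "{(1, f i, other (g i))} \<subseteq> segments_at A (f i)" by (simp add: segments_at_eq)
    show "segments_at A (f i) \<subseteq> {(1, f i, other (g i))}"
    proof
      fix s assume "s \<in> segments_at A (f i)"
      then have s: "s \<in> A" "f i \<in> ends s" by (auto simp: segments_at_eq)
      have no: "f i \<noteq> 0" "f i \<noteq> 1" "1 \<le> k \<Longrightarrow> k < n \<Longrightarrow> f i \<noteq> e k \<and> f i \<noteq> f (m k)" for k
        using fr_ne[OF frY[OF i]] in01 ine[of k] inf[of k] by blast+
      from A_cases[OF s(1)] show "s \<in> {(1, f i, other (g i))}"
        using s(2) no XY[OF _ i] injY[OF i] by (elim disjE exE conjE) auto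
    qed
  qed
  have segsB_X: "segments_at B (e (m i)) = {(e (m i), f i, other (g i))}" if i: "i < n" for i
  proof -
    have "s \<in> segments_at B (e (m i)) \<longleftrightarrow> s = (e (m i), f i, other (g i))" for s
    proof
      assume "s \<in> segments_at B (e (m i))"
      then obtain j where j: "j < n" "s = (e (m j), f j, other (g j))" "e (m i) \<in> ends s"
        unfolding segments_at_eq mem_Collect_eq Bs by blast
      then have "i = j" using XY[OF i j(1)] injX[OF i j(1)] by auto
      then show "s = (e (m i), f i, other (g i))" using j by simp
    qed (use i Bs in \<open>auto simp: segments_at_eq\<close>)
    then show ?thesis by blast
  qed
  have segsB_Y: "segments_at B (f i) = {(e (m i), f i, other (g i))}" if i: "i < n" for i
  proof -
    have "s \<in> segments_at B (f i) \<longleftrightarrow> s = (e (m i), f i, other (g i))" for s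
    proof
      assume "s \<in> segments_at B (f i)"
      then obtain j where j: "j < n" "s = (e (m j), f j, other (g j))" "f i \<in> ends s"
        unfolding segments_at_eq mem_Collect_eq Bs by blast
      then have "i = j" using XY[OF j(1) i] injY[OF i j(1)] by auto
      then show "s = (e (m i), f i, other (g i))" using j by simp
    qed (use i Bs in \<open>auto simp: segments_at_eq\<close>)
    then show ?thesis by blast
  qed
  \<comment> \<open>At such a point \<open>T\<close> has a corner, one of whose segments joins it to
    0 or 1. The strand takes the place of that segment, with the same direction and colour.\<close>
  have corner: "corner_at (R \<union> B) x" if xB: "x \<in> pts B" for x
  proof -
    have split: "segments_at R x = segments_at T x - segments_at A x" for x
      by (auto simp: R_def segments_at_eq)
    consider i where "i < n" "x = e (m i)" | i where "i < n" "x = f i" using xB by (auto simp: ptsB P_def)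
    then show ?thesis
    proof cases
      case 1
      let ?s = "(x, 0, other (g i))"
      have "?s \<in> segments_at A x" using starX[OF 1(1)] 1(2) by simp
      then have sT: "?s \<in> segments_at T x" using AT by (auto simp: segments_at_eq)
      then have "x \<in> pts T" by (rule segments_at_pts)
      then have "corner_at T x" using diagram_pts[OF T] left[OF m(1,2)[OF 1(1)]] 1(2) by (auto simp: verts_def)
      then obtain a b d where abd: "segments_at T x = {(a, x, d), (x, b, d)}" by (auto simp: corner_at_def)
      have x0: "x \<noteq> 0" using fr_ne[OF frX[OF 1(1)] in01(1)] 1(2) by simp
      then have bd: "b = 0" "d = other (g i)" using sT abd by auto
      have "a \<noteq> x" using abd diagram_nondeg[OF T, of "(a, x, d)"] by (auto simp: segments_at_eq)
      then have "segments_at R x = {(a, x, d)}" unfolding split abd using starX[OF 1(1)] 1(2) bd by auto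
      then have "segments_at (R \<union> B) x = {(a, x, d), (x, f i, d)}"
        unfolding segments_at_Un using segsB_X[OF 1(1)] 1(2) bd by auto
      then show ?thesis unfolding corner_at_def by blast
    next
      case 2
      let ?s = "(1, x, other (g i))"
      have "?s \<in> segments_at A x" using starY[OF 2(1)] 2(2) by simp
      then have sT: "?s \<in> segments_at T x" using AT by (auto simp: segments_at_eq)
      then have "x \<in> pts T" by (rule segments_at_pts)
      then have "corner_at T x" using diagram_pts[OF T] right[OF 2(1)] 2(2) by (auto simp: verts_def)
      then obtain a b d where abd: "segments_at T x = {(a, x, d), (x, b, d)}" by (auto simp: corner_at_def)
      have x0: "x \<noteq> 1" using fr_ne[OF frY[OF 2(1)] in01(2)] 2(2) by simp
      then have bd: "a = 1" "d = other (g i)" using sT abd by auto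
      have "b \<noteq> x" using abd diagram_nondeg[OF T, of "(x, b, d)"] by (auto simp: segments_at_eq)
      then have "segments_at R x = {(x, b, d)}" unfolding split abd using starY[OF 2(1)] 2(2) bd by auto
      then have "segments_at (R \<union> B) x = {(e (m i), x, d), (x, b, d)}"
        unfolding segments_at_Un using segsB_Y[OF 2(1)] 2(2) bd by auto
      then show ?thesis unfolding corner_at_def by blast
    qed
  qed
  have T': "diagram n (R \<union> A)" using T TRA by simp
  note rep = replace[OF n2 T' TRA(2) finB ndB crossB crossR corner ptsA]
  have inner_pts: "(kk = 0 \<and> x = e (m i)) \<or> (kk = 1 \<and> i \<ge> 1 \<and> (x = e i \<or> x = f (m i))) \<or> (kk = 2 \<and> x = f i)"
    if ki: "kk < 3" "i < n" "s \<in> E kk i" "x \<in> ends s" "x \<noteq> 0" "x \<noteq> 1" for kk i s x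
  proof -
    consider "kk = 0" | "kk = 1" "i = 0" | "kk = 1" "i \<ge> 1" | "kk = 2" using ki(1) by linarith
    then show ?thesis using ki(3-6) by cases (auto simp: E_def)
  qed
  \<comment> \<open>An end other than 0 and 1 determines its edge. The four kinds of ends have real
    part \<open>l\<close>, between \<open>l\<close> and \<open>1/2\<close>, between
    \<open>1/2\<close> and \<open>r\<close>, and \<open>r\<close>; within a kind the far ends of
    distinct spokes differ.\<close>
  have inner_inj: "kk = kk' \<and> i = i'"
    if k: "kk < 3" "i < n" "s \<in> E kk i" "x \<in> ends s" and k': "kk' < 3" "i' < n" "s' \<in> E kk' i'" "x \<in> ends s'"
      and x: "x \<noteq> 0" "x \<noteq> 1" for kk i s x kk' i' s'
  proof -
    have ReX: "Re (e (m j)) = l" "Re (f j) = r" if "j < n" for j using left[OF m(1,2)[OF that]] right[OF that] by auto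
    have Ree: "l < Re (e j) \<and> Re (e j) < 1/2 \<and> 1/2 < Re (f (m j)) \<and> Re (f (m j)) < r" if "j \<ge> 1" "j < n" for j
      using mid_e[OF that] midf[OF that] by simp
    have inje: "e j = e j' \<Longrightarrow> j = j'" if "j < n" "j' < n" for j j'
      using spokes_inj[OF sp0, of j j'] that by simp
    have injf: "j = j'" if "f (m j) = f (m j')" "j < n" "j' < n" for j j'
    proof -
      have "m j = m j'" using spokes_inj[OF sp1] m that by blast
      then show ?thesis using m(3)[OF that(2)] m(3)[OF that(3)] by metis
    qed
    have lr: "l < r" using box by simp
    from inner_pts[OF k x] inner_pts[OF k' x] show ?thesis
    proof (elim disjE conjE)
      assume "kk = 0" "x = e (m i)" "kk' = 0" "x = e (m i')" then show ?thesis using injX k k' by simp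
    next
      assume "kk = 2" "x = f i" "kk' = 2" "x = f i'" then show ?thesis using injY k k' by simp
    next
      assume "kk = 1" "x = e i" "kk' = 1" "x = e i'" then show ?thesis using inje k k' by simp
    next
      assume "kk = 1" "x = f (m i)" "kk' = 1" "x = f (m i')" then show ?thesis using injf k k' by simp
    qed (use ReX[OF k(2)] ReX[OF k'(2)] Ree[OF _ k(2)] Ree[OF _ k'(2)] lr in force)+
  qed
  have arcs_disj: "disjoint_family_on (\<lambda>(k, i). support (E k i) - {0, 1}) ({..<3} \<times> {..<n})"
    unfolding disjoint_family_on_def
  proof (intro ballI impI)
    fix a b :: "nat \<times> nat"
    assume ab: "a \<in> {..<3} \<times> {..<n}" "b \<in> {..<3} \<times> {..<n}" "a \<noteq> b"
    obtain kk i kk' i' where ab': "a = (kk, i)" "b = (kk', i')" by (cases a, cases b) blast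
    have ki: "kk < 3" "i < n" "kk' < 3" "i' < n" and ne: "(kk, i) \<noteq> (kk', i')" using ab unfolding ab' by simp_all
    have "False" if z: "z \<in> support (E kk i)" "z \<in> support (E kk' i')" "z \<noteq> 0" "z \<noteq> 1" for z
    proof -
      obtain s s' where s: "s \<in> E kk i" "z \<in> seg s" "s' \<in> E kk' i'" "z \<in> seg s'"
        using z by (auto simp: support_eq_seg)
      have sA: "s \<in> A" "s' \<in> A" using s ki unfolding A_def by blast+
      show False
      proof (cases "s = s'")
        case False
        then have "z \<in> ends s \<inter> ends s'" using diagram_cross[OF T, of s s'] sA AT s by blast
        then show False using inner_inj[OF ki(1,2) s(1) _ ki(3,4) s(3)] z ne by blast
      next
        case True
        show False
        proof (cases "ends s \<subseteq> {0, 1}")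
          case False
          then obtain x where "x \<in> ends s" "x \<noteq> 0" "x \<noteq> 1" by blast
          then show False using inner_inj[OF ki(1,2) s(1) _ ki(3,4) s(3)] True ne by blast
        next
          case sub: True
          \<comment> \<open>Only the straight edge \<open>E 1 0\<close> contains a segment that
            joins the two vertices directly.\<close>
          have only: "kk = 1 \<and> i = 0" if ki': "kk < 3" "i < n" "s \<in> E kk i" for kk i
          proof -
            have no: "e (m i) \<notin> {0, 1}" "f i \<notin> {0, 1}" "1 \<le> i \<Longrightarrow> e i \<notin> {0, 1} \<and> f (m i) \<notin> {0, 1}"
              using fr_ne[OF frX[OF that(2)]] fr_ne[OF frY[OF that(2)]] in01 mid_e[of i] midf[of i] that(2) by auto
            consider "kk = 0" | "kk = 1" "i = 0" | "kk = 1" "i \<ge> 1" | "kk = 2" using ki'(1) by linarith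
            then show ?thesis using ki'(3) sub no by cases (auto simp: E_def)
          qed
          show False using only[OF ki(1,2) s(1)] only[OF ki(3,4)] s(3) True ne by simp
        qed
      qed
    qed
    then show "(case a of (k, i) \<Rightarrow> support (E k i) - {0, 1}) \<inter> (case b of (k, i) \<Rightarrow> support (E k i) - {0, 1}) = {}"
      unfolding ab' prod.case by blast
  qed
  have "cancellation_move n T (R \<union> B)"
    unfolding cancellation_move_def
  proof (intro exI conjI)
    show "replaces_in_disc S ((\<lambda>i. e (m i)) ` {..<n} \<union> f ` {..<n}) (\<Union>k<3::nat. \<Union>i<n. E k i) (\<Union>i<n. F i) T (R \<union> B)"
      unfolding replaces_in_disc_def A_def[symmetric] B_def[symmetric] P_def[symmetric]
    proof (intro conjI exI[of _ R])
      show "S homeomorphic (cball 0 1 :: complex set)"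
        using cS in01 by (intro homeomorphic_convex_compact_cball) auto
      show "support A \<subseteq> S" using segA unfolding support_eq_seg by blast
      show "support A \<inter> frontier S = P"
      proof
        show "support A \<inter> frontier S \<subseteq> P" using segA unfolding support_eq_seg by blast
        show "P \<subseteq> support A \<inter> frontier S"
        proof
          fix x assume x: "x \<in> P"
          then have "\<exists>s. s \<in> segments_at A x" using starX starY by (auto simp: P_def)
          then obtain s where "s \<in> A" "x \<in> ends s" by (auto simp: segments_at_eq)
          then show "x \<in> support A \<inter> frontier S" using x PS ends_subset_seg unfolding support_eq_seg by blast
        qed
      qed
      have sB: "support B = (\<Union>i<n. closed_segment (e (m i)) (f i))" by (simp add: support_eq_seg B_def F_def)
      show "support B \<subseteq> S" unfolding sB using strand(1) by blast
      show "support B \<inter> frontier S = P"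
      proof
        show "support B \<inter> frontier S \<subseteq> P" unfolding sB P_def using strand(2) by blast
        show "P \<subseteq> support B \<inter> frontier S" unfolding sB P_def using strand(2) by blast
      qed
      show "support R \<inter> S \<subseteq> P" using Rfree unfolding support_eq_seg by blast
    qed (rule TRA(1), rule refl)
    show "0 \<in> interior S" "1 \<in> interior S" by (rule in01)+
    show "(0::complex) \<noteq> 1" by simp
    show "vertex_at n T 0" "vertex_at n T 1" using sp0 sp1 by (auto simp: vertex_at_iff)
    show "disjoint_family_on (\<lambda>(k, i). support (E k i) - {0, 1}) ({..<3} \<times> {..<n})" by (rule arcs_disj)
    show "disjoint_family_on (\<lambda>i. support (F i)) {..<n}"
      unfolding disjoint_family_on_def
    proof (intro ballI impI)
      fix i j assume "i \<in> {..<n}" "j \<in> {..<n}" "i \<noteq> j"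
      then show "support (F i) \<inter> support (F j) = {}"
        using Fdisj[of i j] Fdisj[of j i] by (cases "i < j") (auto simp: F_def)
    qed
    \<comment> \<open>In the move, the colour with index 0 belongs to an edge entering the first
      vertex. Here this is the last spoke of 0, of colour \<open>other c\<close>.\<close>
    show "\<forall>i<n. oriented_arc (alternate (other c) i) (E 0 i) (e (m i)) 0 \<and>
               oriented_arc (alternate (other c) (Suc i)) (E 1 i) 0 1 \<and>
               oriented_arc (alternate (other c) i) (E 2 i) 1 (f i) \<and>
               oriented_arc (alternate (other c) i) (F i) (e (m i)) (f i)"
    proof (intro allI impI conjI)
      fix i assume i: "i < n"
      have ne: "e (m i) \<noteq> 0" "1 \<noteq> f i" using fr_ne[OF frX[OF i] in01(1)] fr_ne[OF frY[OF i] in01(2)] by auto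
      show "oriented_arc (alternate (other c) i) (E 0 i) (e (m i)) 0"
        using oriented_arc_single[OF ne(1)] by (simp add: E_def g_o)
      show "oriented_arc (alternate (other c) i) (E 2 i) 1 (f i)"
        using oriented_arc_single[OF ne(2)] by (simp add: E_def g_o)
      show "oriented_arc (alternate (other c) i) (F i) (e (m i)) (f i)"
        using oriented_arc_single[OF XY[OF i i]] by (simp add: F_def g_o)
      have gS: "alternate (other c) (Suc i) = g i" by (simp add: alternate_Suc alternate_other g_def)
      show "oriented_arc (alternate (other c) (Suc i)) (E 1 i) 0 1"
      proof (cases "i = 0")
        case True then show ?thesis unfolding gS using oriented_arc_single[of 0 1 "g 0"] by (simp add: E_def)
      next
        case False
        then have "distinct [0, e i, f (m i), 1]"
          using mid_e[of i] midf[of i] i by auto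
        then show ?thesis unfolding gS using oriented_arc_three False by (simp add: E_def)
      qed
    qed
  qed
  then have "homotopic_diagrams n T (R \<union> B)"
    using T rep(1) by (intro homotopic_step) (simp add: elementary_step_def)
  moreover have "spoke n 0 c e 0 \<in> A" "spoke n 1 (other c) f 0 \<in> A" using A0[of 0] A1[of 0] n2 by simp_all
  then have "0 \<in> pts A" "1 \<in> pts A" unfolding pts_def by (simp_all only: UN_iff) (metis ends_spoke insertI1)+
  then have "verts n (R \<union> B) \<subseteq> verts n T - {0, 1}" using rep(2) TRA(1) by auto
  ultimately show ?thesis using rep(1) by blast
qed

subsection \<open>Joining the edges of two adjacent vertices\<close>

text \<open>Reflection in the line \<open>Re z = 1/2\<close>. It exchanges the vertices 0 and 1, so
  that both stars are covered by the same lemmas.\<close>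

definition reflect :: "complex \<Rightarrow> complex" where
  "reflect z = 1 - cnj z"

lemma reflect_simps [simp]: "Re (reflect z) = 1 - Re z" "Im (reflect z) = Im z" "reflect (reflect z) = z" "reflect 0 = 1" "reflect 1 = 0"
  by (auto simp: reflect_def)

lemma reflect_segment: "z \<in> closed_segment a b \<longleftrightarrow> reflect z \<in> closed_segment (reflect a) (reflect b)"
proof -
  have "reflect z \<in> closed_segment (reflect a) (reflect b)" if z: "z \<in> closed_segment a b" for z a b
  proof -
    obtain t where "0 \<le> t" "t \<le> 1" "z = (1 - t) *\<^sub>R a + t *\<^sub>R b" using z by (auto simp: in_segment)
    then show ?thesis unfolding in_segment by (intro exI[of _ t]) (simp add: complex_eq_iff algebra_simps)
  qed
  from this[of z a b] this[of "reflect z" "reflect a" "reflect b"] show ?thesis by auto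
qed

lemma reflect_open_segment: "z \<in> open_segment a b \<longleftrightarrow> reflect z \<in> open_segment (reflect a) (reflect b)"
proof -
  have "reflect x = reflect y \<longleftrightarrow> x = y" for x y by (metis reflect_simps(3))
  then show ?thesis unfolding open_segment_def using reflect_segment[of z a b] by simp
qed

text \<open>The star around the vertex \<open>0\<close> as seen from a rectangle with left side \<open>Re z = l\<close>, bottom \<open>Im z = lo\<close> and
  top \<open>Im z = d\<close>: incoming segments cross the left side, outgoing ones the top, except that the outgoing
  segments up to the \<open>m\<close>-th end inside the rectangle, where they have been cut by a bridge.\<close>

definition side :: "nat \<Rightarrow> real \<Rightarrow> real \<Rightarrow> real \<Rightarrow> nat \<Rightarrow> (nat \<Rightarrow> complex) \<Rightarrow> bool" where
  "side n l lo d m y \<longleftrightarrow> l < 0 \<and> lo < 0 \<and> 0 < d \<and> y 0 = 1 \<and>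
     (\<forall>k. 1 \<le> k \<and> k \<le> m \<and> k < n \<longrightarrow> l < Re (y k) \<and> Re (y k) < 1/2 \<and> 0 < Im (y k) \<and> Im (y k) < d) \<and>
     (\<forall>k. m < k \<and> k < n \<longrightarrow> d < Im (y k) \<and> l < d * Re (y k) / Im (y k) \<and> d * Re (y k) / Im (y k) < 1/2) \<and>
     (\<forall>k j. m < k \<and> k < j \<and> j < n \<longrightarrow> d * Re (y j) / Im (y j) < d * Re (y k) / Im (y k)) \<and>
     (\<forall>j. n \<le> j \<and> j < 2 * n \<longrightarrow> Re (y j) < l \<and> lo < l * Im (y j) / Re (y j) \<and> l * Im (y j) / Re (y j) < d) \<and>
     (\<forall>i j. n \<le> i \<and> i < j \<and> j < 2 * n \<longrightarrow> l * Im (y j) / Re (y j) < l * Im (y i) / Re (y i))"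

text \<open>A reflection reverses the cyclic order, so the numbering is reversed too. This gives the
  incoming spokes of 1 the indices below \<open>n\<close>, and the edge from 0 the index 0.\<close>

definition mirror :: "nat \<Rightarrow> (nat \<Rightarrow> complex) \<Rightarrow> nat \<Rightarrow> complex" where
  "mirror n y k = reflect (y (2 * n - 1 - k))"

text \<open>The situation after \<open>m\<close> bridges between the adjacent vertices \<open>0\<close> and \<open>1\<close>. The star around \<open>1\<close> is
  described by its mirror image.\<close>

definition ready :: "nat \<Rightarrow> colour \<Rightarrow> real \<Rightarrow> real \<Rightarrow> real \<Rightarrow> real \<Rightarrow> nat \<Rightarrow> segment set \<Rightarrow>
    (nat \<Rightarrow> complex) \<Rightarrow> (nat \<Rightarrow> complex) \<Rightarrow> bool" where
  "ready n c l l' lo d m T y y' \<longleftrightarrow> diagram n T \<and> spokes n T 0 c y \<and> spokes n T 1 (other c) y' \<and>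
     side n l lo d m y \<and> side n l' lo d m (mirror n y') \<and>
     (\<forall>k. 1 \<le> k \<and> k \<le> m \<and> k < n \<longrightarrow> (y k, y' (2 * n - 1 - k), alternate c k) \<in> T) \<and>
     (\<forall>s\<in>T. 0 \<notin> ends s \<longrightarrow> 1 \<notin> ends s \<longrightarrow>
        (\<forall>k. 1 \<le> k \<and> k \<le> m \<and> k < n \<longrightarrow> s \<noteq> (y k, y' (2 * n - 1 - k), alternate c k)) \<longrightarrow>
        seg s \<inter> cbox (Complex l lo) (Complex (1 - l') d) = {})"

lemma segment_0: "z \<in> closed_segment 0 (w :: complex) \<longleftrightarrow> (\<exists>t. 0 \<le> t \<and> t \<le> 1 \<and> z = of_real t * w)"
  by (auto simp: in_segment scaleR_conv_of_real)

lemma open_segment_0: "0 < t \<Longrightarrow> t < 1 \<Longrightarrow> w \<noteq> 0 \<Longrightarrow> of_real t * w \<in> open_segment 0 (w :: complex)"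
  by (auto simp: in_segment scaleR_conv_of_real intro!: exI[of _ t])

text \<open>At the level \<open>d\<close> the \<open>k\<close>-th spoke is the rightmost one: later
  outgoing spokes cross it further left, incoming ones are already left of the rectangle when they
  reach it, and earlier ones stay below.\<close>

lemma side_avoid:
  assumes s: "side n l lo d m y" and k: "m < k" "k < n" "k = Suc m" and j: "j < 2 * n" "j \<noteq> k"
    and z: "z \<in> closed_segment 0 (y j)" "Im z = d"
  shows "Re z < d * Re (y k) / Im (y k)"
proof -
  obtain t where t: "0 \<le> t" "t \<le> 1" "z = of_real t * y j" using z(1) by (auto simp: segment_0)
  have d: "0 < d" "l < 0" "y 0 = 1" using s by (auto simp: side_def)
  have ti: "t * Im (y j) = d" "Re z = t * Re (y j)" using z(2) t(3) by auto
  have lk: "l < d * Re (y k) / Im (y k)" using s k by (auto simp: side_def)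
  consider "j = 0" | "1 \<le> j" "j \<le> m" | "k < j" "j < n" | "n \<le> j" using j k by linarith
  then show ?thesis
  proof cases
    case 1 then show ?thesis using ti d by simp
  next
    case 2
    then have "0 < Im (y j)" "Im (y j) < d" using s k by (auto simp: side_def)
    then have "t * Im (y j) \<le> 1 * Im (y j)" using t by (intro mult_right_mono) auto
    then show ?thesis using ti \<open>Im (y j) < d\<close> by simp
  next
    case 3
    then have "d < Im (y j)" using s k by (auto simp: side_def)
    then have "t = d / Im (y j)" using ti(1) d by (simp add: field_simps)
    then have "Re z = d * Re (y j) / Im (y j)" using ti(2) by simp
    then show ?thesis using s 3 k by (auto simp: side_def)
  next
    case 4
    then have R: "Re (y j) < l" "l * Im (y j) / Re (y j) < d" using s j by (auto simp: side_def)
    have tp: "0 < t" using ti d t by (cases "t = 0") auto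
    then have Ip: "0 < Im (y j)" using ti d by (metis zero_less_mult_pos)
    have "l / Re (y j) * Im (y j) < t * Im (y j)" using R ti by simp
    then have "l / Re (y j) < t" using Ip by (simp only: mult_less_cancel_right_pos)
    then have "t * Re (y j) < l" using R d by (simp add: field_simps)
    then show ?thesis using ti lk by simp
  qed
qed

text \<open>The new end lies on the old ray below the level, so index \<open>k\<close> passes from
  the spokes that cross the top to those that end inside. Its real part is \<open>t\<close> times
  that of the crossing point, and the interval from \<open>l\<close> to \<open>1/2\<close> contains
  0.\<close>

lemma side_Suc:
  assumes s: "side n l lo d m y" and k: "k = Suc m" "k < n"
    and a: "0 < t" "t < 1" "a = of_real t * (of_real (d / Im (y k)) * y k)"
  shows "side n l lo d k (y(k := a))" "0 < Im a" "Im a < d" "l < Re a" "Re a < 1/2"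
proof -
  have d: "0 < d" "l < 0" using s by (auto simp: side_def)
  have yk: "d < Im (y k)" "l < d * Re (y k) / Im (y k)" "d * Re (y k) / Im (y k) < 1/2" using s k by (auto simp: side_def)
  have Ia: "Im a = t * d" and Ra: "Re a = t * (d * Re (y k) / Im (y k))" using a(3) yk d by auto
  show 1: "0 < Im a" "Im a < d" using Ia a d by auto
  show 2: "l < Re a"
  proof (cases "d * Re (y k) / Im (y k) \<ge> 0")
    case True then show ?thesis using Ra a d by (smt (verit) mult_nonneg_nonneg)
  next
    case False
    then have "1 * (d * Re (y k) / Im (y k)) < t * (d * Re (y k) / Im (y k))" using a by (intro mult_strict_right_mono_neg) auto
    then show ?thesis using Ra yk by simp
  qed
  show 3: "Re a < 1/2"
  proof (cases "d * Re (y k) / Im (y k) \<ge> 0")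
    case True
    then have "t * (d * Re (y k) / Im (y k)) \<le> 1 * (d * Re (y k) / Im (y k))" using a by (intro mult_right_mono) auto
    then show ?thesis using Ra yk(3) by linarith
  next
    case False
    then have "t * (d * Re (y k) / Im (y k)) \<le> 0" using a by (intro mult_nonneg_nonpos) auto
    then show ?thesis using Ra by linarith
  qed
  have yj: "(y(k := a)) j = y j" if "j \<noteq> k" for j using that by simp
  show "side n l lo d k (y(k := a))"
    unfolding side_def
  proof (intro conjI allI impI)
    show "l < 0" "lo < 0" "0 < d" "(y(k := a)) 0 = 1" using s k by (auto simp: side_def)
  next
    fix j assume j: "1 \<le> j \<and> j \<le> k \<and> j < n"
    show "l < Re ((y(k := a)) j)" "Re ((y(k := a)) j) < 1/2" "0 < Im ((y(k := a)) j)" "Im ((y(k := a)) j) < d"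
      using j 1 2 3 s k by (cases "j = k"; simp add: side_def)+
  next
    fix j assume j: "k < j \<and> j < n"
    then have "(y(k := a)) j = y j" by simp
    then show "d < Im ((y(k := a)) j)" "l < d * Re ((y(k := a)) j) / Im ((y(k := a)) j)"
      "d * Re ((y(k := a)) j) / Im ((y(k := a)) j) < 1/2" using s k j by (simp_all add: side_def)
  next
    fix i j assume ij: "k < i \<and> i < j \<and> j < n"
    then have "(y(k := a)) j = y j" "(y(k := a)) i = y i" by simp_all
    then show "d * Re ((y(k := a)) j) / Im ((y(k := a)) j) < d * Re ((y(k := a)) i) / Im ((y(k := a)) i)"
      using s k ij by (simp add: side_def)
  next
    fix j assume j: "n \<le> j \<and> j < 2 * n"
    then have "(y(k := a)) j = y j" using k by simp
    then show "Re ((y(k := a)) j) < l" "lo < l * Im ((y(k := a)) j) / Re ((y(k := a)) j)"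
      "l * Im ((y(k := a)) j) / Re ((y(k := a)) j) < d" using s j by (simp_all add: side_def)
  next
    fix i j assume ij: "n \<le> i \<and> i < j \<and> j < 2 * n"
    then have "(y(k := a)) j = y j" "(y(k := a)) i = y i" using k by simp_all
    then show "l * Im ((y(k := a)) j) / Re ((y(k := a)) j) < l * Im ((y(k := a)) i) / Re ((y(k := a)) i)"
      using s ij by (simp add: side_def)
  qed
qed

lemma spokes_shorten:
  assumes sp: "spokes n T x c y" and k: "k < 2 * n" and r: "r \<in> open_segment x (y k)"
    and at: "segments_at T' x = (segments_at T x - {spoke n x c y k}) \<union> {spoke n x c (y(k := r)) k}"
  shows "spokes n T' x c (y(k := r))"
proof -
  define F where "F s = (if s = spoke n x c y k then spoke n x c (y(k := r)) k else s)" for s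
  have "F ` segments_at T x = (segments_at T x - {spoke n x c y k}) \<union> {spoke n x c (y(k := r)) k}"
  proof -
    have "spoke n x c y k \<in> segments_at T x" using sp k by (auto simp: spokes_def)
    then have i: "segments_at T x = insert (spoke n x c y k) (segments_at T x - {spoke n x c y k})" by blast
    have e1: "F ` (segments_at T x - {spoke n x c y k}) = id ` (segments_at T x - {spoke n x c y k})"
      by (intro image_cong) (auto simp: F_def)
    have e2: "F ` segments_at T x = insert (F (spoke n x c y k)) (F ` (segments_at T x - {spoke n x c y k}))"
      using arg_cong[OF i, of "image F"] by (simp only: image_insert)
    have "F ` segments_at T x = insert (F (spoke n x c y k)) (segments_at T x - {spoke n x c y k})"
      unfolding e2 e1 by simp
    then show ?thesis by (simp add: F_def)
  qed
  then have 1: "segments_at T' x = F ` segments_at T x" using at by simp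
  show ?thesis
  proof (rule spokes_image[OF sp 1])
    fix i assume i: "i < 2 * n"
    show "F (spoke n x c y i) = spoke n x c (y(k := r)) i"
    proof (cases "i = k")
      case True then show ?thesis by (simp add: F_def)
    next
      case False
      then have "y i \<noteq> y k" using spokes_inj[OF sp i k] by blast
      then have "spoke n x c y i \<noteq> spoke n x c y k"
        using spoke_eqD spokes_ne[OF sp i] spokes_ne[OF sp k] by (metis doubleton_eq_iff)
      then show ?thesis using False spoke_cong[of y i "y(k := r)" n x c] by (simp add: F_def)
    qed
  next
    show "ccw (2 * n) x (y(k := r))"
    proof (rule ccw_scale)
      show "ccw (2 * n) x y" using sp by (simp add: spokes_def)
      show "\<exists>s>0. (y(k := r)) i - x = of_real s * (y i - x)" for i
      proof (cases "i = k")
        case True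
        then show ?thesis using open_segment_scale[OF r] by (metis fun_upd_same)
      next
        case False then show ?thesis by (intro exI[of _ 1]) simp
      qed
    qed
  qed
qed

lemma mirror_upd: "k < 2 * n \<Longrightarrow> j < 2 * n \<Longrightarrow> mirror n (y(2 * n - 1 - k := reflect b)) j = ((mirror n y)(k := b)) j"
  by (auto simp: mirror_def)

lemma side_cong: 
  assumes "side n l lo d m y" "\<And>j. j < 2 * n \<Longrightarrow> y' j = y j" "0 < n"
  shows "side n l lo d m y'"
proof -
  have e: "y' j = y j" if "j < n" for j using assms(2) that by simp
  have e2: "y' j = y j" if "n \<le> j" "j < 2 * n" for j using assms(2) that by simp
  show ?thesis
    using assms(1,3) unfolding side_def
    by (elim conjE, intro conjI allI impI) (simp_all add: e e2)
qed

text \<open>The \<open>k\<close>-th spoke of 0 crosses the level \<open>d\<close> upwards at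
  \<open>p\<close> and the mirrored spoke of 1, of the same colour, crosses it downwards at
  \<open>q\<close>; the line \<open>Re z = 1/2\<close> separates them. Other spokes are kept off the
  level between \<open>p\<close> and \<open>q\<close> by \<open>side_avoid\<close> and its mirror
  image, and the middle pieces of earlier bridges lie below it.\<close>

lemma ready_step:
  assumes n2: "n \<ge> 2" and R: "ready n c l l' lo d m T y y'" and k: "k = Suc m" "k < n"
  obtains T' z z' where "homotopic_diagrams n T T'" "verts n T' \<subseteq> verts n T" "ready n c l l' lo d k T' z z'"
proof -
  let ?m = "2 * n - 1 - k"
  define w where "w = mirror n y'"
  from R have T: "diagram n T" and sp0: "spokes n T 0 c y" and sp1: "spokes n T 1 (other c) y'"
    and sy: "side n l lo d m y" and sw: "side n l' lo d m w"
    and mids: "\<And>k. 1 \<le> k \<Longrightarrow> k \<le> m \<Longrightarrow> k < n \<Longrightarrow> (y k, y' (2 * n - 1 - k), alternate c k) \<in> T"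
    and free: "\<And>s. s \<in> T \<Longrightarrow> 0 \<notin> ends s \<Longrightarrow> 1 \<notin> ends s \<Longrightarrow>
        (\<And>k. 1 \<le> k \<Longrightarrow> k \<le> m \<Longrightarrow> k < n \<Longrightarrow> s \<noteq> (y k, y' (2 * n - 1 - k), alternate c k)) \<Longrightarrow>
        seg s \<inter> cbox (Complex l lo) (Complex (1 - l') d) = {}"
    by (auto simp: ready_def w_def)
  have mk: "n \<le> ?m" "?m < 2 * n" "2 * n - 1 - ?m = k" using k by auto
  have wk: "w k = reflect (y' ?m)" "y' ?m = reflect (w k)" by (simp_all add: w_def mirror_def)
  have d: "0 < d" "l < 0" "l' < 0" "lo < 0" using sy sw by (auto simp: side_def)
  have yk: "d < Im (y k)" "l < d * Re (y k) / Im (y k)" "d * Re (y k) / Im (y k) < 1/2" using sy k by (auto simp: side_def)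
  have wk': "d < Im (w k)" "l' < d * Re (w k) / Im (w k)" "d * Re (w k) / Im (w k) < 1/2" using sw k by (auto simp: side_def)
  define g where "g = alternate c k"
  have gm: "alternate (other c) ?m = g" using alternate_mirror[of k n c] k by (simp add: alternate_other g_def)
  have s1: "(0, y k, g) \<in> T" and s1': "spoke n 0 c y k = (0, y k, g)"
    using spokes_in(1)[OF sp0, of k] k by (auto simp: spoke_def g_def)
  have s2: "(y' ?m, 1, g) \<in> T" and s2': "spoke n 1 (other c) y' ?m = (y' ?m, 1, g)"
    using spokes_in(1)[OF sp1 mk(2)] mk gm by (auto simp: spoke_def)
  define p where "p = of_real (d / Im (y k)) * y k"
  define q where "q = reflect (of_real (d / Im (w k)) * w k)"
  have y0: "y k \<noteq> 0" "w k \<noteq> 0" using yk wk' d by auto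
  have pin: "p \<in> open_segment 0 (y k)" unfolding p_def using yk d y0 by (intro open_segment_0) auto
  have rq: "reflect q \<in> open_segment 0 (w k)" unfolding q_def reflect_simps using wk' d y0 by (intro open_segment_0) auto
  then have qin: "q \<in> open_segment (y' ?m) 1"
    using reflect_open_segment[of q "y' ?m" 1] wk by (simp add: open_segment_commute)
  have level: "Im p = d" "Im q = d" using yk wk' d by (auto simp: p_def q_def)
  have Rp: "Re p = d * Re (y k) / Im (y k)" by (simp add: p_def)
  have Rq: "Re q = 1 - d * Re (w k) / Im (w k)" by (simp add: q_def)
  have pq: "Re p < Re q" using Rp Rq yk(3) wk'(3) by linarith
  have onL: "Re p \<le> Re z \<and> Re z \<le> Re q \<and> Im z = d" if z: "z \<in> closed_segment p q" for z
  proof -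
    obtain t where t: "0 \<le> t" "t \<le> 1" "z = (1 - t) *\<^sub>R p + t *\<^sub>R q" using z by (auto simp: in_segment)
    have "Im z = (1 - t) * Im p + t * Im q" "Re z = (1 - t) * Re p + t * Re q" using t(3) by simp_all
    then have z': "Im z = d" "Re z - Re p = t * (Re q - Re p)" "Re q - Re z = (1 - t) * (Re q - Re p)"
      using level by (simp_all add: algebra_simps)
    have "0 \<le> t * (Re q - Re p)" "0 \<le> (1 - t) * (Re q - Re p)" using t pq by auto
    then show ?thesis unfolding z'(2,3)[symmetric] using z'(1) by simp
  qed
  have inS: "closed_segment p q \<subseteq> cbox (Complex l lo) (Complex (1 - l') d)"
  proof
    fix z assume "z \<in> closed_segment p q"
    from onL[OF this] show "z \<in> cbox (Complex l lo) (Complex (1 - l') d)"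
      using Rp Rq yk wk' d by (auto simp: in_cbox_complex_iff)
  qed
  have avoid: "seg s \<inter> closed_segment p q = {}" if s: "s \<in> T" "s \<noteq> (0, y k, g)" "s \<noteq> (y' ?m, 1, g)" for s
  proof -
    consider (zero) "0 \<in> ends s" | (one) "1 \<in> ends s" |
      (mid) i where "1 \<le> i" "i \<le> m" "i < n" "s = (y i, y' (2 * n - 1 - i), alternate c i)" |
      (far) "0 \<notin> ends s" "1 \<notin> ends s" "\<And>i. 1 \<le> i \<Longrightarrow> i \<le> m \<Longrightarrow> i < n \<Longrightarrow> s \<noteq> (y i, y' (2 * n - 1 - i), alternate c i)"
      by blast
    then show ?thesis
    proof cases
      case zero
      then obtain j where j: "j < 2 * n" "s = spoke n 0 c y j" using spokes_star[OF sp0 s(1)] by blast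
      then have "j \<noteq> k" using s(2) s1' by auto
      have "m < k" using k by simp
      have "z \<notin> closed_segment p q" if "z \<in> closed_segment 0 (y j)" for z
        using side_avoid[OF sy \<open>m < k\<close> k(2,1) j(1) \<open>j \<noteq> k\<close> that] onL[of z] Rp by force
      then show ?thesis using j(2) by auto
    next
      case one
      then obtain j where j: "j < 2 * n" "s = spoke n 1 (other c) y' j" using spokes_star[OF sp1 s(1)] by blast
      then have "j \<noteq> ?m" using s(3) s2' by auto
      then have jk: "2 * n - 1 - j \<noteq> k" "2 * n - 1 - j < 2 * n" using j(1) n2 by auto
      have wj: "w (2 * n - 1 - j) = reflect (y' j)" using j(1) by (simp add: w_def mirror_def)
      have "m < k" using k by simp
      have "z \<notin> closed_segment p q" if z: "z \<in> closed_segment 1 (y' j)" for z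
      proof
        assume zp: "z \<in> closed_segment p q"
        have rz: "reflect z \<in> closed_segment 0 (w (2 * n - 1 - j))" using z reflect_segment[of z 1 "y' j"] wj by simp
        then have "Re (reflect z) < d * Re (w k) / Im (w k)"
          using side_avoid[OF sw \<open>m < k\<close> k(2,1) jk(2,1) rz] onL[OF zp] by simp
        then show False using onL[OF zp] Rq by simp
      qed
      then show ?thesis using j(2) by auto
    next
      case mid
      have "w i = reflect (y' (2 * n - 1 - i))" by (simp add: w_def mirror_def)
      moreover have "Im (w i) < d" "Im (y i) < d" using sw sy mid by (auto simp: side_def)
      ultimately have "Im (y i) < d" "Im (y' (2 * n - 1 - i)) < d" by simp_all
      then have "Im z < d" if "z \<in> seg s" for z
        using Im_segment_less[of "y i" d "y' (2 * n - 1 - i)" z] that mid(4) by simp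
      then show ?thesis using onL by force
    next
      case far
      then show ?thesis using free[OF s(1)] inS by blast
    qed
  qed
  have side': "Im 0 < d" "Im (y k) > d" "Im (y' ?m) > d" "Im 1 < d" using d yk wk' wk by auto
  obtain T' a b a' b' where T': "homotopic_diagrams n T T'" "diagram n T'" "verts n T' \<subseteq> verts n T"
    "T' = (T - {(0, y k, g), (y' ?m, 1, g)}) \<union>
      {(0, a, g), (a, b', g), (b', 1, g), (y' ?m, a', g), (a', b, g), (b, y k, g)}"
    "a \<in> open_segment 0 p" "b' \<in> open_segment q 1" "Im b > d" "Im a' > d"
    "{a, b, a', b'} \<inter> pts T = {}"
    by (rule bridge[OF n2 T s1 s2 pin qin level pq side' avoid]) (assumption | rule that | blast)+
  define z where "z = y(k := a)"
  define z' where "z' = y'(?m := b')"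
  obtain t where t: "0 < t" "t < 1" "a - 0 = of_real t * (p - 0)" using open_segment_scale[OF T'(5)] by blast
  have "reflect b' \<in> open_segment 0 (reflect q)" using T'(6) reflect_open_segment[of b' q 1] by (simp add: open_segment_commute)
  then obtain u where u: "0 < u" "u < 1" "reflect b' - 0 = of_real u * (reflect q - 0)" using open_segment_scale by blast
  have ap: "a = of_real t * (of_real (d / Im (y k)) * y k)" using t(3) by (simp add: p_def)
  have bq: "reflect b' = of_real u * (of_real (d / Im (w k)) * w k)" using u(3) by (simp add: q_def)
  note A = side_Suc[OF sy k t(1,2) ap] and B = side_Suc[OF sw k u(1,2) bq]
  have kk: "k < 2 * n" using k by simp
  have sw': "side n l' lo d k (mirror n z')"
  proof (rule side_cong[OF B(1)])
    fix j assume "j < 2 * n"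
    then show "mirror n z' j = (w(k := reflect b')) j"
      using mirror_upd[OF kk, of j y' "reflect b'"] by (simp add: z'_def w_def)
  qed (use n2 in simp)
  have a0: "a \<in> open_segment 0 (y k)"
    using T'(5) subset_open_segment[of 0 p 0 "y k"] pin by (auto simp: open_segment_def)
  have b1: "b' \<in> open_segment 1 (y' ?m)"
    using T'(6) subset_open_segment[of q 1 1 "y' ?m"] qin by (auto simp: open_segment_commute open_segment_def)
  have pts01: "0 \<in> pts T" "1 \<in> pts T" "y k \<in> pts T" "y' ?m \<in> pts T" using s1 s2 by (force simp: pts_def)+
  have fresh: "a \<notin> pts T" "b \<notin> pts T" "a' \<notin> pts T" "b' \<notin> pts T" using T'(9) by auto
  have nes: "x \<noteq> 0" "x \<noteq> 1" "0 \<noteq> x" "1 \<noteq> x" if "x \<in> {a, b, a', b'}" for x using that pts01 fresh by auto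
  have yne: "y k \<noteq> 0" "0 \<noteq> y k" "y k \<noteq> 1" "1 \<noteq> y k" "y' ?m \<noteq> 0" "0 \<noteq> y' ?m" "y' ?m \<noteq> 1" "1 \<noteq> y' ?m" using side' d by auto
  have at0: "segments_at T' 0 = (segments_at T 0 - {(0, y k, g)}) \<union> {(0, a, g)}"
  proof -
    have "(y' ?m, 1, g) \<notin> segments_at T 0" using yne by (simp add: segments_at_eq)
    then have "segments_at T 0 - {(0, y k, g), (y' ?m, 1, g)} = segments_at T 0 - {(0, y k, g)}" by blast
    then show ?thesis unfolding T'(4) segments_at_Un segments_at_Diff
      using nes[of a] nes[of b] nes[of a'] nes[of b'] yne by (simp add: segments_at_simps)
  qed
  have at1: "segments_at T' 1 = (segments_at T 1 - {(y' ?m, 1, g)}) \<union> {(b', 1, g)}"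
  proof -
    have "(0, y k, g) \<notin> segments_at T 1" using yne by (simp add: segments_at_eq)
    then have "segments_at T 1 - {(0, y k, g), (y' ?m, 1, g)} = segments_at T 1 - {(y' ?m, 1, g)}" by blast
    then show ?thesis unfolding T'(4) segments_at_Un segments_at_Diff
      using nes[of a] nes[of b] nes[of a'] nes[of b'] yne by (simp add: segments_at_simps)
  qed
  have sp0': "spokes n T' 0 c z" unfolding z_def
    by (rule spokes_shorten[OF sp0 kk a0]) (use at0 s1' k in \<open>simp add: spoke_def g_def\<close>)
  have sp1': "spokes n T' 1 (other c) z'" unfolding z'_def
    by (rule spokes_shorten[OF sp1 mk(2) b1]) (use at1 s2' mk gm in \<open>simp add: spoke_def\<close>)
  have zz: "z i = y i \<and> z' (2 * n - 1 - i) = y' (2 * n - 1 - i)" if "i \<le> m" for i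
    using that k by (auto simp: z_def z'_def)
  have zk: "z k = a" "z' ?m = b'" by (simp_all add: z_def z'_def)
  have midT': "(z i, z' (2 * n - 1 - i), alternate c i) \<in> T'" if i: "1 \<le> i" "i \<le> k" "i < n" for i
  proof (cases "i = k")
    case True
    then show ?thesis unfolding T'(4) zk True using zk by (simp add: g_def)
  next
    case False
    then have im: "i \<le> m" using i k by simp
    have "(y i, y' (2 * n - 1 - i), alternate c i) \<in> T" using mids i im by blast
    moreover have "y i \<noteq> 0" "y' (2 * n - 1 - i) \<noteq> 1"
      using spokes_ne[OF sp0, of i] spokes_ne[OF sp1, of "2 * n - 1 - i"] i by auto
    ultimately show ?thesis unfolding T'(4) using zz[OF im] by auto
  qed
  have freeT': "seg s \<inter> cbox (Complex l lo) (Complex (1 - l') d) = {}"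
    if s: "s \<in> T'" "0 \<notin> ends s" "1 \<notin> ends s" "\<And>i. 1 \<le> i \<Longrightarrow> i \<le> k \<Longrightarrow> i < n \<Longrightarrow> s \<noteq> (z i, z' (2 * n - 1 - i), alternate c i)" for s
  proof -
    have "s \<noteq> (a, b', g)" using s(4)[of k] k zk by (auto simp: g_def)
    moreover have "s \<noteq> (0, a, g)" "s \<noteq> (b', 1, g)" using s(2,3) by auto
    \<comment> \<open>Apart from the segments at 0 and 1 and the new middle piece, the bridge
      creates only segments above the level \<open>d\<close>, hence outside the rectangle.\<close>
    ultimately consider "s \<in> T" | "s \<in> {(y' ?m, a', g), (a', b, g), (b, y k, g)}" using s(1) unfolding T'(4) by blast
    then show ?thesis
    proof cases
      case 1
      have "s \<noteq> (y i, y' (2 * n - 1 - i), alternate c i)" if "1 \<le> i" "i \<le> m" "i < n" for i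
        using s(4)[of i] zz[OF that(2)] that k by simp
      then show ?thesis using free[OF 1 s(2,3)] by blast
    next
      case 2
      then obtain u v where "s = (u, v, g)" "Im u > d" "Im v > d" using side' T'(7,8) by blast
      then have "Im x > d" if "x \<in> seg s" for x using Im_segment_greater[of d u v x] that by simp
      then show ?thesis by (force simp: in_cbox_complex_iff)
    qed
  qed
  have "ready n c l l' lo d k T' z z'"
    unfolding ready_def using T'(2) sp0' sp1' A(1) sw' midT' freeT' by (auto simp: z_def)
  then show ?thesis using that T'(1,3) by blast
qed

section \<open>Cutting both stars along the rectangle\<close>

lemma open_segment_not_pts:
  assumes T: "diagram n T" and s: "(p, q, d) \<in> T" and x: "x \<in> open_segment p q"
  shows "x \<notin> pts T"
proof
  assume "x \<in> pts T"
  then obtain s' where s': "s' \<in> T" "x \<in> ends s'" by (auto simp: pts_def)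
  have xs: "x \<in> seg (p, q, d)" "x \<notin> {p, q}" using x by (auto simp: open_segment_def)
  then have "s' \<noteq> (p, q, d)" using s' by auto
  then have "x \<in> ends (p, q, d)" using diagram_cross[OF T s'(1) s] s'(2) xs(1) ends_subset_seg by blast
  then show False using xs by simp
qed

text \<open>The incoming spokes of 0 are cut on the left side of the rectangle and the outgoing
  spokes of 1 on its right side. The order of the crossing points recorded in \<open>side\<close> is
  the vertical order that \<open>cancel_cut\<close> asks for.\<close>

lemma ready_cancel:
  assumes n2: "n \<ge> 2" and R: "ready n c l l' lo d (n - 1) T y y'"
  shows "\<exists>T'. homotopic_diagrams n T T' \<and> diagram n T' \<and> verts n T' \<subseteq> verts n T - {0, 1}"
proof -
  define w where "w = mirror n y'"
  let ?S = "cbox (Complex l lo) (Complex (1 - l') d)"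
  let ?k = "2 * n - 1"
  from R have T: "diagram n T" and sp0: "spokes n T 0 c y" and sp1: "spokes n T 1 (other c) y'"
    and sy: "side n l lo d (n - 1) y" and sw: "side n l' lo d (n - 1) w"
    and mids: "\<And>k. 1 \<le> k \<Longrightarrow> k \<le> n - 1 \<Longrightarrow> k < n \<Longrightarrow> (y k, y' (2 * n - 1 - k), alternate c k) \<in> T"
    and free: "\<And>s. s \<in> T \<Longrightarrow> 0 \<notin> ends s \<Longrightarrow> 1 \<notin> ends s \<Longrightarrow>
        (\<And>k. 1 \<le> k \<Longrightarrow> k \<le> n - 1 \<Longrightarrow> k < n \<Longrightarrow> s \<noteq> (y k, y' (2 * n - 1 - k), alternate c k)) \<Longrightarrow>
        seg s \<inter> ?S = {}"
    by (auto simp: ready_def w_def)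
  have wy: "y' j = reflect (w (2 * n - 1 - j))" if "j < 2 * n" for j using that by (simp add: w_def mirror_def)
  have d: "0 < d" "l < 0" "l' < 0" "lo < 0" "y 0 = 1" "w 0 = 1" using sy sw by (auto simp: side_def)
  have yk1: "y' ?k = 0" using wy[of ?k] d n2 by simp
  have L: "Re (y j) < l \<and> lo < l * Im (y j) / Re (y j) \<and> l * Im (y j) / Re (y j) < d" if "n \<le> j" "j < 2 * n" for j
    using sy that by (auto simp: side_def)
  have L': "Re (w j) < l' \<and> lo < l' * Im (w j) / Re (w j) \<and> l' * Im (w j) / Re (w j) < d" if "n \<le> j" "j < 2 * n" for j
    using sw that by (auto simp: side_def)
  \<comment> \<open>For \<open>Re z < b < 0\<close> this is where the segment from 0 to
    \<open>z\<close> crosses the vertical line through \<open>b\<close>.\<close>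
  define X where "X b z = of_real (b / Re z) * z" for b and z :: complex
  have X: "Re (X b z) = b" "Im (X b z) = b * Im z / Re z" "X b z \<in> open_segment 0 z" if "Re z < b" "b < 0" for b z
  proof -
    show "Re (X b z) = b" "Im (X b z) = b * Im z / Re z" using that by (simp_all add: X_def)
    have "0 < b / Re z" "b / Re z < 1" using that by (simp_all add: field_simps)
    moreover have "z \<noteq> 0" using that by auto
    ultimately show "X b z \<in> open_segment 0 z" unfolding X_def by (rule open_segment_0)
  qed
  have beyond: "x = X b z" if x: "x \<in> closed_segment (X b z) z" "b \<le> Re x" and z: "Re z < b" "b < 0" for b x z
  proof -
    obtain t where t: "0 \<le> t" "t \<le> 1" "x = (1 - t) *\<^sub>R X b z + t *\<^sub>R z" using x(1) by (auto simp: in_segment)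
    have "Re x = (1 - t) * b + t * Re z" using t(3) X(1)[OF z] by simp
    then have "Re x - b = t * (Re z - b)" by (simp add: algebra_simps)
    then have "t * (Re z - b) \<ge> 0" using x(2) by simp
    then have "t = 0" using z t(1) by (auto simp: zero_le_mult_iff)
    then show ?thesis using t(3) by simp
  qed
  define e where "e j = (if n \<le> j \<and> j < 2 * n then X l (y j) else y j)" for j
  define f where "f j = (if j < n then reflect (X l' (w (2 * n - 1 - j))) else y' j)" for j
  have e_op: "e j = y j \<or> e j \<in> open_segment 0 (y j)" if "j < 2 * n" for j
    using X(3) L[of j] d that by (auto simp: e_def)
  have f_op': "f j \<in> open_segment 1 (y' j)" if "j < n" for j
  proof -
    have "X l' (w (2 * n - 1 - j)) \<in> open_segment 0 (w (2 * n - 1 - j))" using X(3) L'[of "2 * n - 1 - j"] d that by auto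
    then show ?thesis using reflect_open_segment[of "f j" 1 "y' j"] wy[of j] that by (simp add: f_def)
  qed
  have f_op: "f j = y' j \<or> f j \<in> open_segment 1 (y' j)" if "j < 2 * n" for j
    using f_op'[of j] by (cases "j < n") (auto simp: f_def)
  have e0: "e 0 = 1" using d n2 by (simp add: e_def)
  have f0: "f ?k = 0" using yk1 n2 by (simp add: f_def)
  show ?thesis
  proof (rule star_cut[OF n2 T sp0, of e])
    show "e i = y i \<or> e i \<in> open_segment 0 (y i)" if "i < 2 * n" for i by (rule e_op[OF that])
    fix T1 assume T1: "homotopic_diagrams n T T1" "diagram n T1" "verts n T1 \<subseteq> verts n T" "spokes n T1 0 c e"
      "\<And>s. s \<in> T \<Longrightarrow> 0 \<notin> ends s \<Longrightarrow> s \<in> T1"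
      "\<And>s. s \<in> T1 \<Longrightarrow> 0 \<notin> ends s \<Longrightarrow> s \<in> T \<or> (\<exists>i<2 * n. ends s = {e i, y i})"
      "\<And>x c' y'. x \<noteq> 0 \<Longrightarrow> spokes n T x c' y' \<Longrightarrow> \<exists>y''. spokes n T1 x c' y'' \<and>
        (\<forall>j<2 * n. (0 \<notin> ends (spoke n x c' y' j) \<longrightarrow> y'' j = y' j) \<and>
          (\<forall>i<2 * n. spoke n x c' y' j = spoke n 0 c y i \<longrightarrow> y'' j = (if e i \<noteq> y i then e i else 0)))"
    \<comment> \<open>The common edge is spoke 0 of the vertex 0 and the last spoke of the vertex 1.
      Neither cutting touches it, so each star survives the cutting of the other one.\<close>
    have edge: "spoke n 1 (other c) y' ?k = spoke n 0 c y 0"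
      using yk1 d n2 alternate_mirror[of 0 n c] by (simp add: spoke_def alternate_other)
    have sp1': "spokes n T1 1 (other c) y'"
    proof -
      obtain y2 where y2: "spokes n T1 1 (other c) y2"
        "\<And>j. j < 2 * n \<Longrightarrow> 0 \<notin> ends (spoke n 1 (other c) y' j) \<Longrightarrow> y2 j = y' j"
        "\<And>j i. j < 2 * n \<Longrightarrow> i < 2 * n \<Longrightarrow> spoke n 1 (other c) y' j = spoke n 0 c y i \<Longrightarrow> y2 j = (if e i \<noteq> y i then e i else 0)"
        using T1(7)[OF one_neq_zero sp1] by blast
      show ?thesis
      proof (rule spokes_cong[OF y2(1)])
        fix j assume j: "j < 2 * n"
        show "y' j = y2 j"
        proof (cases "y' j = 0")
          case False then show ?thesis using y2(2)[OF j] by simp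
        next
          case True
          then have "j = ?k" using spokes_inj[OF sp1 j, of ?k] yk1 n2 by simp
          then show ?thesis using y2(3)[OF j, of 0] edge e0 d n2 True by simp
        qed
      qed
    qed
    show ?thesis
    proof (rule star_cut[OF n2 T1(2) sp1', of f])
      show "f i = y' i \<or> f i \<in> open_segment 1 (y' i)" if "i < 2 * n" for i by (rule f_op[OF that])
      fix T2 assume T2: "homotopic_diagrams n T1 T2" "diagram n T2" "verts n T2 \<subseteq> verts n T1" "spokes n T2 1 (other c) f"
        "\<And>s. s \<in> T1 \<Longrightarrow> 1 \<notin> ends s \<Longrightarrow> s \<in> T2"
        "\<And>s. s \<in> T2 \<Longrightarrow> 1 \<notin> ends s \<Longrightarrow> s \<in> T1 \<or> (\<exists>i<2 * n. ends s = {f i, y' i})"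
        "\<And>x c' y. x \<noteq> 1 \<Longrightarrow> spokes n T1 x c' y \<Longrightarrow> \<exists>y''. spokes n T2 x c' y'' \<and>
          (\<forall>j<2 * n. (1 \<notin> ends (spoke n x c' y j) \<longrightarrow> y'' j = y j) \<and>
            (\<forall>i<2 * n. spoke n x c' y j = spoke n 1 (other c) y' i \<longrightarrow> y'' j = (if f i \<noteq> y' i then f i else 1)))"
      have edge': "spoke n 0 c e 0 = spoke n 1 (other c) y' ?k" using edge e0 d by (simp add: spoke_def)
      have sp0': "spokes n T2 0 c e"
      proof -
        obtain y2 where y2: "spokes n T2 0 c y2"
          "\<And>j. j < 2 * n \<Longrightarrow> 1 \<notin> ends (spoke n 0 c e j) \<Longrightarrow> y2 j = e j"
          "\<And>j i. j < 2 * n \<Longrightarrow> i < 2 * n \<Longrightarrow> spoke n 0 c e j = spoke n 1 (other c) y' i \<Longrightarrow> y2 j = (if f i \<noteq> y' i then f i else 1)"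
          using T2(7)[OF zero_neq_one T1(4)] by blast
        show ?thesis
        proof (rule spokes_cong[OF y2(1)])
          fix j assume j: "j < 2 * n"
          show "e j = y2 j"
          proof (cases "e j = 1")
            case False then show ?thesis using y2(2)[OF j] by simp
          next
            case True
            then have "j = 0" using spokes_inj[OF T1(4) j, of 0] e0 n2 by simp
            then show ?thesis using y2(3)[OF j, of ?k] edge' f0 yk1 n2 True by simp
          qed
        qed
      qed
      have v2: "verts n T2 \<subseteq> verts n T" using T1(3) T2(3) by blast
      have vp: "verts n T \<subseteq> pts T" using verts_subset_pts[of n T] n2 by simp
      have e_seg: "(p = 0 \<and> q = y j) \<or> (p = y j \<and> q = 0)" if "spoke n 0 c y j = (p, q, g)" for p q g j
        using that by (auto simp: spoke_def split: if_splits)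
      have eX: "e j \<notin> verts n T2" if j: "n \<le> j" "j < 2 * n" for j
      proof -
        obtain p q g where pqg: "spoke n 0 c y j = (p, q, g)" by (metis prod_cases3)
        have "e j \<in> open_segment 0 (y j)" using X(3) L[OF j] d j by (simp add: e_def)
        then have "e j \<in> open_segment p q" using e_seg[OF pqg] by (auto simp: open_segment_commute)
        then show ?thesis using open_segment_not_pts[OF T] spokes_in(1)[OF sp0 j(2)] pqg vp v2 by (metis subsetD)
      qed
      have fX: "f j \<notin> verts n T2" if j: "j < n" for j
      proof -
        have "f j \<in> open_segment 1 (y' j)" by (rule f_op'[OF j])
        moreover have "(1, y' j, alternate (other c) j) \<in> T" using spokes_in(1)[OF sp1, of j] j by (simp add: spoke_def)
        ultimately show ?thesis using open_segment_not_pts[OF T] vp v2 by (metis subsetD)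
      qed
      have "\<exists>T'. homotopic_diagrams n T2 T' \<and> diagram n T' \<and> verts n T' \<subseteq> verts n T2 - {0, 1}"
      proof (rule cancel_cut[OF n2 T2(2) sp0' T2(4) e0 f0, where l=l and r="1 - l'" and lo=lo and hi=d])
        show "l < 0" "1 < 1 - l'" "lo < 0" "0 < d" using d by auto
      next
        fix k assume k: "1 \<le> k" "k < n"
        have ek: "e k = y k" and fk: "f (2 * n - 1 - k) = y' (2 * n - 1 - k)" using k by (auto simp: e_def f_def)
        have T: "(y k, y' (2 * n - 1 - k), alternate c k) \<in> T" using mids k by simp
        have ne: "y k \<noteq> 0" "y k \<noteq> 1" "y' (2 * n - 1 - k) \<noteq> 0" "y' (2 * n - 1 - k) \<noteq> 1"
          using spokes_ne[OF sp0, of k] spokes_inj[OF sp0, of k 0] spokes_ne[OF sp1, of "2 * n - 1 - k"]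
            spokes_inj[OF sp1, of "2 * n - 1 - k" ?k] k d yk1 by auto
        show "(e k, f (2 * n - 1 - k), alternate c k) \<in> T2"
          unfolding ek fk using T2(5)[OF T1(5)[OF T]] ne by auto
        show "l < Re (e k) \<and> Re (e k) < 1/2 \<and> 0 < Im (e k) \<and> Im (e k) < d" unfolding ek using sy k by (auto simp: side_def)
      next
        fix k assume k: "n \<le> k" "k < 2 * n - 1"
        let ?j = "2 * n - 1 - k"
        have j: "1 \<le> ?j" "?j < n" "?j \<le> n - 1" using k by auto
        have fk: "f k = reflect (w ?j)" using k wy[of k] by (simp add: f_def)
        have "l' < Re (w ?j) \<and> Re (w ?j) < 1/2 \<and> 0 < Im (w ?j) \<and> Im (w ?j) < d" using sw j unfolding side_def by blast
        then show "1/2 < Re (f k) \<and> Re (f k) < 1 - l' \<and> 0 < Im (f k) \<and> Im (f k) < d" unfolding fk by auto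
      next
        fix j assume j: "n \<le> j" "j < 2 * n"
        show "Re (e j) = l \<and> lo < Im (e j) \<and> Im (e j) < d \<and> e j \<notin> verts n T2"
          using X(1,2)[of "y j" l] L[OF j] d j eX[OF j] by (simp add: e_def)
      next
        fix j assume j: "j < n"
        then have "n \<le> 2 * n - 1 - j" "2 * n - 1 - j < 2 * n" by auto
        then show "Re (f j) = 1 - l' \<and> lo < Im (f j) \<and> Im (f j) < d \<and> f j \<notin> verts n T2"
          using X(1,2)[of "w (2 * n - 1 - j)" l'] L'[of "2 * n - 1 - j"] d j fX[OF j] by (simp add: f_def)
      next
        fix i j assume ij: "n \<le> i" "i < j" "j < 2 * n"
        have "Im (X l (y j)) < Im (X l (y i))"
          using X(2)[of "y j" l] X(2)[of "y i" l] L[of i] L[of j] d ij sy by (simp add: side_def)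
        then show "Im (e j) < Im (e i)" using ij by (simp add: e_def)
      next
        fix i j assume ij: "i < j" "j < n"
        let ?i = "2 * n - 1 - j" and ?j = "2 * n - 1 - i"
        have ij': "n \<le> ?i" "?i < ?j" "?j < 2 * n" using ij by auto
        then have "l' * Im (w ?j) / Re (w ?j) < l' * Im (w ?i) / Re (w ?i)" using sw unfolding side_def by blast
        then have "Im (X l' (w ?j)) < Im (X l' (w ?i))"
          using X(2)[of "w ?j" l'] X(2)[of "w ?i" l'] L'[of ?i] L'[of ?j] d ij' by simp
        then show "Im (f i) < Im (f j)" using ij by (simp add: f_def)
      next
        fix s assume s: "s \<in> T2" "0 \<notin> ends s" "1 \<notin> ends s"
          "\<And>k. 1 \<le> k \<Longrightarrow> k < n \<Longrightarrow> s \<noteq> (e k, f (2 * n - 1 - k), alternate c k)"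
        have ef: "e k = y k \<and> f (2 * n - 1 - k) = y' (2 * n - 1 - k)" if "k < n" for k using that by (auto simp: e_def f_def)
        consider "s \<in> T" | i where "i < 2 * n" "ends s = {e i, y i}" | i where "i < 2 * n" "ends s = {f i, y' i}"
          using T2(6)[OF s(1,3)] T1(6)[OF _ s(2)] by blast
        then show "seg s \<inter> ?S \<subseteq> ends s \<inter> (e ` {n..<2 * n} \<union> f ` {..<n})"
        proof cases
          case 1
          have "s \<noteq> (y k, y' (2 * n - 1 - k), alternate c k)" if "1 \<le> k" "k \<le> n - 1" "k < n" for k
            using s(4)[OF that(1,3)] ef[OF that(3)] by simp
          then show ?thesis using free[OF 1 s(2,3)] by blast
        next
          case 2
          have nd: "fst s \<noteq> fst (snd s)" using diagram_nondeg[OF T2(2) s(1)] .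
          have "n \<le> i"
          proof (rule ccontr)
            assume "\<not> n \<le> i"
            then have "e i = y i" by (simp add: e_def)
            then show False using 2(2) nd by (cases s) auto
          qed
          have sg: "seg s = closed_segment (e i) (y i)" using 2(2) by (cases s) (auto simp: doubleton_eq_iff closed_segment_commute)
          have ei: "e i = X l (y i)" using 2 \<open>n \<le> i\<close> by (simp add: e_def)
          have "x = e i" if "x \<in> seg s" "x \<in> ?S" for x
            using beyond[of x l "y i"] that sg ei L[OF \<open>n \<le> i\<close> 2(1)] d by (auto simp: in_cbox_complex_iff)
          then show ?thesis using 2 \<open>n \<le> i\<close> by auto
        next
          case 3
          have nd: "fst s \<noteq> fst (snd s)" using diagram_nondeg[OF T2(2) s(1)] .
          have "i < n"
          proof (rule ccontr)
            assume "\<not> i < n"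
            then have "f i = y' i" by (simp add: f_def)
            then show False using 3(2) nd by (cases s) auto
          qed
          let ?j = "2 * n - 1 - i"
          have j: "n \<le> ?j" "?j < 2 * n" using \<open>i < n\<close> by auto
          have sg: "seg s = closed_segment (f i) (y' i)" using 3(2) by (cases s) (auto simp: doubleton_eq_iff closed_segment_commute)
          have fi: "reflect (f i) = X l' (w ?j)" "reflect (y' i) = w ?j" using 3 \<open>i < n\<close> wy[of i] by (simp_all add: f_def)
          have "x = f i" if x: "x \<in> seg s" "x \<in> ?S" for x
          proof -
            have "reflect x \<in> closed_segment (X l' (w ?j)) (w ?j)" using x(1) sg reflect_segment[of x "f i" "y' i"] fi by simp
            moreover have "l' \<le> Re (reflect x)" using x(2) by (auto simp: in_cbox_complex_iff)
            ultimately have "reflect x = X l' (w ?j)" using beyond[of "reflect x" l' "w ?j"] L'[OF j] d by blast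
            then show ?thesis using fi by (metis reflect_simps(3))
          qed
          then show ?thesis using 3 \<open>i < n\<close> by auto
        qed
      qed
      then show ?thesis using T1(1) T2(1) v2 homotopic_trans by blast
    qed
  qed
qed

lemma ready_all:
  assumes n2: "n \<ge> 2" and R: "ready n c l l' lo d m T y y'" and m: "m \<le> n - 1"
  shows "\<exists>T'. homotopic_diagrams n T T' \<and> diagram n T' \<and> verts n T' \<subseteq> verts n T - {0, 1}"
  using R m
proof (induction "n - 1 - m" arbitrary: m T y y')
  case 0
  then have "m = n - 1" by simp
  then show ?case using ready_cancel[OF n2] 0 by blast
next
  case (Suc i)
  then have k: "Suc m < n" by simp
  obtain T' z z' where T': "homotopic_diagrams n T T'" "verts n T' \<subseteq> verts n T" "ready n c l l' lo d (Suc m) T' z z'"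
    using ready_step[OF n2 Suc.prems(1) refl k] by blast
  have "i = n - 1 - Suc m" "Suc m \<le> n - 1" using Suc.hyps(2) k by auto
  from Suc.hyps(1)[OF this(1) T'(3) this(2)] show ?case using T'(1,2) homotopic_trans by blast
qed

section \<open>Choice of the rectangle around two adjacent vertices\<close>

lemma ccw_angles:
  assumes "ccw m 0 y" "y 0 = 1" "0 < m"
  obtains \<theta> r where "\<And>i. i < m \<Longrightarrow> y i = rcis (r i) (\<theta> i)" "\<And>i. i < m \<Longrightarrow> (0::real) < r i"
    "\<And>i. i < m \<Longrightarrow> 0 \<le> \<theta> i \<and> \<theta> i < 2 * pi" "\<And>i j. i < j \<Longrightarrow> j < m \<Longrightarrow> \<theta> i < \<theta> j"
proof -
  from assms(1) obtain \<theta> r where *: "strict_mono_on {..<m} \<theta>" "\<forall>i<m. \<theta> i < \<theta> 0 + 2 * pi"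
    "\<forall>i<m. r i > (0::real)" "\<forall>i<m. y i = 0 + rcis (r i) (\<theta> i)"
    unfolding ccw_def by blast
  \<comment> \<open>Since \<open>y 0 = 1\<close>, the argument \<open>\<theta> 0\<close> is a
    multiple of \<open>2 * pi\<close> and may be subtracted from all others.\<close>
  have "rcis (r 0) (\<theta> 0) = of_real 1 * rcis 1 0" using * assms by (simp add: rcis_def)
  then have "cis (\<theta> 0) = cis 0" using rcis_eq_scaleD[of "r 0" "\<theta> 0" 1 1 0] * assms by simp
  then have c0: "cis (\<theta> 0) = 1" by simp
  have mono: "\<theta> i < \<theta> j" if "i < j" "j < m" for i j using *(1) that by (auto simp: strict_mono_on_def)
  show ?thesis
  proof (rule that[of r "\<lambda>i. \<theta> i - \<theta> 0"])
    fix i assume i: "i < m"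
    have "cis (\<theta> i) = cis (\<theta> i - \<theta> 0) * cis (\<theta> 0)" by (simp add: cis_mult)
    then show "y i = rcis (r i) (\<theta> i - \<theta> 0)" using * i c0 by (simp add: rcis_def)
    show "0 < r i" using * i by simp
    show "0 \<le> \<theta> i - \<theta> 0 \<and> \<theta> i - \<theta> 0 < 2 * pi" using * mono[of 0 i] i by (cases "i = 0") auto
  next
    fix i j assume "i < j" "j < m" then show "\<theta> i - \<theta> 0 < \<theta> j - \<theta> 0" using mono by simp
  qed
qed

text \<open>The reflection turns a ray of argument \<open>\<theta>\<close> at 1 into one of argument
  \<open>pi - \<theta>\<close> at 0; reversing the indices makes the arguments increase
  again.\<close>

lemma ccw_reflect:
  assumes "ccw m 1 y" shows "ccw m 0 (\<lambda>i. reflect (y (m - 1 - i)))"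
proof (cases "m = 0")
  case True then show ?thesis by (auto simp: ccw_def strict_mono_on_def)
next
  case False
  from assms(1) obtain \<theta> r where *: "strict_mono_on {..<m} \<theta>" "\<forall>i<m. \<theta> i < \<theta> 0 + 2 * pi"
    "\<forall>i<m. r i > (0::real)" "\<forall>i<m. y i = 1 + rcis (r i) (\<theta> i)"
    unfolding ccw_def by blast
  let ?\<theta> = "\<lambda>i. pi - \<theta> (m - 1 - i)" and ?r = "\<lambda>i. r (m - 1 - i)"
  have idx: "m - 1 - i < m" for i using False by simp
  have mono: "\<theta> i < \<theta> j" if "i < j" "j < m" for i j using *(1) that by (auto simp: strict_mono_on_def)
  have le: "\<theta> i \<le> \<theta> j" if "i \<le> j" "j < m" for i j using mono[of i j] that by (cases "i = j") auto
  have "strict_mono_on {..<m} ?\<theta>"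
  proof (rule strict_mono_onI)
    fix i j assume "i \<in> {..<m}" "j \<in> {..<m}" "i < j"
    then have "m - 1 - j < m - 1 - i" "m - 1 - i < m" by auto
    then show "?\<theta> i < ?\<theta> j" using mono by simp
  qed
  moreover have "\<forall>i<m. ?\<theta> i < ?\<theta> 0 + 2 * pi"
  proof (intro allI impI)
    fix i assume "i < m"
    have "\<theta> (m - 1) < \<theta> 0 + 2 * pi" using * False by simp
    moreover have "\<theta> 0 \<le> \<theta> (m - 1 - i)" using le[of 0 "m - 1 - i"] idx by simp
    ultimately show "?\<theta> i < ?\<theta> 0 + 2 * pi" by simp
  qed
  moreover have "\<forall>i<m. 0 < ?r i" using *(3) idx by blast
  moreover have "\<forall>i<m. reflect (y (m - 1 - i)) = 0 + rcis (?r i) (?\<theta> i)"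
  proof (intro allI impI)
    fix i assume "i < m"
    have "y (m - 1 - i) = 1 + rcis (?r i) (\<theta> (m - 1 - i))" using *(4) idx by blast
    then show "reflect (y (m - 1 - i)) = 0 + rcis (?r i) (?\<theta> i)"
      by (simp add: complex_eq_iff reflect_def)
  qed
  ultimately show ?thesis unfolding ccw_def by (intro exI[of _ ?\<theta>] exI[of _ ?r] conjI)
qed

text \<open>Measured from the first ray, the last one has argument \<open>pi\<close>, so the rays
  strictly between them have arguments strictly between 0 and \<open>pi\<close>.\<close>

lemma ccw_opposite:
  assumes c: "ccw m x y" and m: "0 < k" "k < m - 1" and s: "s > 0" "y (m - 1) - x = - of_real s * (y 0 - x)"
  shows "0 < Im ((y k - x) / (y 0 - x))"
proof -
  have m0: "0 < m" using m by simp
  have ne: "y 0 - x \<noteq> 0" using ccw_ne[OF c m0] by simp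
  let ?z = "\<lambda>i. (y i - x) / (y 0 - x)"
  have "ccw m ((1 / (y 0 - x)) * x + (- x / (y 0 - x))) (\<lambda>i. (1 / (y 0 - x)) * y i + (- x / (y 0 - x)))"
    using ne by (intro ccw_affine[OF c]) simp
  moreover have "(1 / (y 0 - x)) * a + (- x / (y 0 - x)) = (a - x) / (y 0 - x)" for a by (simp add: diff_divide_distrib)
  ultimately have "ccw m 0 ?z" by simp
  moreover have "?z 0 = 1" using ne by simp
  ultimately obtain \<theta> r where *: "\<And>i. i < m \<Longrightarrow> ?z i = rcis (r i) (\<theta> i)" "\<And>i. i < m \<Longrightarrow> (0::real) < r i"
    "\<And>i. i < m \<Longrightarrow> 0 \<le> \<theta> i \<and> \<theta> i < 2 * pi" "\<And>i j. i < j \<Longrightarrow> j < m \<Longrightarrow> \<theta> i < \<theta> j"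
    by (rule ccw_angles[OF _ _ m0]) (assumption | rule that | blast)+
  let ?l = "m - 1"
  have l: "?l < m" using m by simp
  have "?z ?l = - of_real s" using s ne by simp
  then have "rcis (r ?l) (\<theta> ?l) = - of_real s" using *(1)[OF l] by simp
  then have sin0: "r ?l * sin (\<theta> ?l) = 0" and cosn: "r ?l * cos (\<theta> ?l) = - s" by (auto simp: complex_eq_iff)
  have "\<theta> ?l = pi"
  proof (rule ccontr)
    assume n: "\<theta> ?l \<noteq> pi"
    have "sin (\<theta> ?l) = 0" using sin0 *(2)[OF l] by simp
    then consider "\<theta> ?l = 0" | "0 < \<theta> ?l" "\<theta> ?l < pi" | "pi < \<theta> ?l" "\<theta> ?l < 2 * pi"
      using *(3)[OF l] n by linarith
    then show False
    proof cases
      case 1 then show False using cosn *(2)[OF l] s by simp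
    next
      case 2 then show False using sin_gt_zero[of "\<theta> ?l"] \<open>sin (\<theta> ?l) = 0\<close> by simp
    next
      case 3 then show False using sin_lt_zero[of "\<theta> ?l"] \<open>sin (\<theta> ?l) = 0\<close> by simp
    qed
  qed
  then have "0 < \<theta> k" "\<theta> k < pi" using *(4)[of k ?l] *(4)[of 0 k] *(3)[of 0] m l m0 by auto
  then have "0 < sin (\<theta> k)" by (rule sin_gt_zero)
  then show ?thesis using *(1)[of k] *(2)[of k] m by simp
qed

text \<open>The line \<open>Im z + \<mu> * Re z = 0\<close> has a direction \<open>\<phi>\<close> in
  the second quadrant and separates the outgoing spokes other than the first from the incoming ones.
  The determinants record the order of the spokes: each is a product of two radii and the sine of an
  angle between 0 and \<open>pi\<close>.\<close>

lemma star_slopes: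
  assumes n2: "n \<ge> 2" and c: "ccw (2 * n) 0 y" and y0: "y 0 = 1"
    and O: "\<And>k. 1 \<le> k \<Longrightarrow> k < n \<Longrightarrow> 0 < Im (y k)" and I: "\<And>j. n \<le> j \<Longrightarrow> j < 2 * n \<Longrightarrow> Re (y j) < 0"
  obtains \<mu> where "\<mu> > 0" "\<And>k. 1 \<le> k \<Longrightarrow> k < n \<Longrightarrow> 0 < Im (y k) + \<mu> * Re (y k)"
    "\<And>j. n \<le> j \<Longrightarrow> j < 2 * n \<Longrightarrow> Im (y j) + \<mu> * Re (y j) < 0"
    "\<And>i j. 1 \<le> i \<Longrightarrow> i < j \<Longrightarrow> j < n \<Longrightarrow> 0 < Re (y i) * Im (y j) - Im (y i) * Re (y j)"
    "\<And>i j. n \<le> i \<Longrightarrow> i < j \<Longrightarrow> j < 2 * n \<Longrightarrow> 0 < Re (y i) * Im (y j) - Im (y i) * Re (y j)"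
proof -
  have n0: "0 < 2 * n" using n2 by simp
  obtain \<theta> r where *: "\<And>i. i < 2 * n \<Longrightarrow> y i = rcis (r i) (\<theta> i)" "\<And>i. i < 2 * n \<Longrightarrow> (0::real) < r i"
    "\<And>i. i < 2 * n \<Longrightarrow> 0 \<le> \<theta> i \<and> \<theta> i < 2 * pi" "\<And>i j. i < j \<Longrightarrow> j < 2 * n \<Longrightarrow> \<theta> i < \<theta> j"
    by (rule ccw_angles[OF c y0 n0]) (assumption | rule that | blast)+
  have RI: "Re (y i) = r i * cos (\<theta> i)" "Im (y i) = r i * sin (\<theta> i)" if "i < 2 * n" for i using *(1)[OF that] by simp_all
  have Ot: "0 < \<theta> k \<and> \<theta> k < pi" if k: "1 \<le> k" "k < n" for k
  proof -
    have k2: "k < 2 * n" using k by simp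
    have "0 < sin (\<theta> k)" using O[OF k] RI[OF k2] *(2)[OF k2] by (simp add: zero_less_mult_iff)
    then have "\<theta> k < pi" using sin_le_zero[of "\<theta> k"] *(3)[OF k2] by (metis not_less)
    moreover have "0 < \<theta> k" using *(4)[of 0 k] *(3)[of 0] k n2 by simp
    ultimately show ?thesis by simp
  qed
  have It: "pi / 2 < \<theta> j \<and> \<theta> j < 3 * pi / 2" if j: "n \<le> j" "j < 2 * n" for j
  proof -
    have cn: "cos (\<theta> j) < 0" using I[OF j] RI[OF j(2)] *(2)[OF j(2)] by (simp add: mult_less_0_iff)
    have "pi / 2 < \<theta> j"
    proof (rule ccontr)
      assume "\<not> pi / 2 < \<theta> j"
      then have "0 \<le> cos (\<theta> j)" using *(3)[OF j(2)] by (intro cos_ge_zero) auto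
      then show False using cn by simp
    qed
    moreover have "\<theta> j < 3 * pi / 2"
    proof (rule ccontr)
      assume "\<not> \<theta> j < 3 * pi / 2"
      then have "0 \<le> cos (2 * pi - \<theta> j)" using *(3)[OF j(2)] by (intro cos_ge_zero) auto
      then show False using cn by (simp add: cos_diff)
    qed
    ultimately show ?thesis by simp
  qed
  have cross: "0 < Re (y i) * Im (y j) - Im (y i) * Re (y j)" if "i < 2 * n" "j < 2 * n" "0 < \<theta> j - \<theta> i" "\<theta> j - \<theta> i < pi" for i j
  proof -
    have "Re (y i) * Im (y j) - Im (y i) * Re (y j) = r i * r j * sin (\<theta> j - \<theta> i)"
      using RI[OF that(1)] RI[OF that(2)] by (simp add: sin_diff algebra_simps)
    moreover have "0 < sin (\<theta> j - \<theta> i)" using that by (intro sin_gt_zero)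
    ultimately show ?thesis using *(2)[OF that(1)] *(2)[OF that(2)] by simp
  qed
  \<comment> \<open>The direction \<open>\<phi>\<close> has to come after the last outgoing spoke
    and before the first incoming one, strictly between \<open>pi / 2\<close> and \<open>pi\<close>;
    \<open>a\<close> and \<open>b\<close> combine these bounds.\<close>
  define a where "a = max (pi / 2) (\<theta> (n - 1))"
  define b where "b = min pi (\<theta> n)"
  define \<phi> where "\<phi> = (a + b) / 2"
  have n1: "1 \<le> n - 1" "n - 1 < n" using n2 by auto
  have "a < b" using Ot[OF n1] It[of n] *(4)[of "n - 1" n] n2 by (auto simp: a_def b_def)
  then have \<phi>: "a < \<phi>" "\<phi> < b" by (auto simp: \<phi>_def)
  then have \<phi>': "pi / 2 < \<phi>" "\<phi> < pi" by (auto simp: a_def b_def)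
  have cn: "cos \<phi> < 0"
    using cos_gt_zero_pi[of "pi - \<phi>"] \<phi>' by (simp add: cos_diff)
  have sp: "sin \<phi> > 0" using \<phi>' pi_gt_zero by (intro sin_gt_zero) linarith+
  define \<mu> where "\<mu> = - sin \<phi> / cos \<phi>"
  have eq: "Im (y i) + \<mu> * Re (y i) = r i * sin (\<theta> i - \<phi>) / cos \<phi>" if "i < 2 * n" for i
    using RI[OF that] cn by (simp add: \<mu>_def sin_diff field_simps)
  show ?thesis
  proof (rule that[of \<mu>])
    show "\<mu> > 0" using cn sp by (simp add: \<mu>_def divide_pos_neg)
  next
    fix k assume k: "1 \<le> k" "k < n"
    have "k = n - 1 \<or> k < n - 1" using k by linarith
    then have "\<theta> k \<le> \<theta> (n - 1)" using *(4)[of k "n - 1"] k by (elim disjE) (simp, linarith)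
    then have "0 < \<phi> - \<theta> k" "\<phi> - \<theta> k < pi" using \<phi> \<phi>' Ot[OF k] by (auto simp: a_def)
    then have "0 < sin (\<phi> - \<theta> k)" by (rule sin_gt_zero)
    then have "sin (\<theta> k - \<phi>) < 0" by (metis minus_diff_eq neg_less_0_iff_less sin_minus)
    then have "r k * sin (\<theta> k - \<phi>) < 0" using *(2)[of k] k by (simp add: mult_pos_neg)
    then show "0 < Im (y k) + \<mu> * Re (y k)" using eq[of k] k cn by (simp add: divide_neg_neg)
  next
    fix j assume j: "n \<le> j" "j < 2 * n"
    have "\<theta> n \<le> \<theta> j" using *(4)[of n j] j by (cases "n = j") auto
    then have "0 < \<theta> j - \<phi>" "\<theta> j - \<phi> < pi" using \<phi> \<phi>' It[OF j] by (auto simp: b_def)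
    then have "0 < sin (\<theta> j - \<phi>)" by (rule sin_gt_zero)
    then have "0 < r j * sin (\<theta> j - \<phi>)" using *(2)[of j] j by simp
    then show "Im (y j) + \<mu> * Re (y j) < 0" using eq[of j] j cn by (simp add: divide_pos_neg)
  next
    fix i j assume ij: "1 \<le> i" "i < j" "j < n"
    then show "0 < Re (y i) * Im (y j) - Im (y i) * Re (y j)"
      using Ot[of i] Ot[of j] *(4)[of i j] by (intro cross) auto
  next
    fix i j assume ij: "n \<le> i" "i < j" "j < 2 * n"
    then show "0 < Re (y i) * Im (y j) - Im (y i) * Re (y j)"
      using It[of i] It[of j] *(4)[of i j] by (intro cross) auto
  qed
qed

text \<open>The upper left corner of the rectangle, with real part \<open>- (d / \<mu>)\<close> and
  imaginary part \<open>d\<close>, lies on the separating line; so outgoing spokes cross the top and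
  incoming ones the left side. The bound \<open>M\<close> keeps the latter above the bottom, and a
  small \<open>d\<close> leaves all far ends outside.\<close>

lemma eventually_side:
  assumes n2: "n \<ge> 2" and y0: "y 0 = 1" and \<mu>: "\<mu> > 0" and M: "M > 0"
    and O: "\<And>k. 1 \<le> k \<Longrightarrow> k < n \<Longrightarrow> 0 < Im (y k)" and I: "\<And>j. n \<le> j \<Longrightarrow> j < 2 * n \<Longrightarrow> Re (y j) < 0"
    and O\<mu>: "\<And>k. 1 \<le> k \<Longrightarrow> k < n \<Longrightarrow> 0 < Im (y k) + \<mu> * Re (y k)"
    and I\<mu>: "\<And>j. n \<le> j \<Longrightarrow> j < 2 * n \<Longrightarrow> Im (y j) + \<mu> * Re (y j) < 0"
    and OO: "\<And>i j. 1 \<le> i \<Longrightarrow> i < j \<Longrightarrow> j < n \<Longrightarrow> 0 < Re (y i) * Im (y j) - Im (y i) * Re (y j)"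
    and II: "\<And>i j. n \<le> i \<Longrightarrow> i < j \<Longrightarrow> j < 2 * n \<Longrightarrow> 0 < Re (y i) * Im (y j) - Im (y i) * Re (y j)"
    and IM: "\<And>j. n \<le> j \<Longrightarrow> j < 2 * n \<Longrightarrow> Im (y j) / Re (y j) < M * \<mu>"
  shows "eventually (\<lambda>d. side n (- (d / \<mu>)) (- (d * M)) d 0 y) (at_right (0::real))"
proof -
  have pos: "eventually (\<lambda>d. 0 < d) (at_right (0::real))" by (rule eventually_at_right_less)
  have e1: "eventually (\<lambda>d. \<forall>k\<in>{1..<n}. d < Im (y k)) (at_right (0::real))"
  proof (intro eventually_ball_finite ballI)
    fix k assume "k \<in> {1..<n}"
    then have "0 < Im (y k)" using O by simp
    then show "eventually (\<lambda>d. d < Im (y k)) (at_right (0::real))"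
      using tendsto_ident_at by (rule order_tendstoD(2)[rotated])
  qed simp
  have e2: "eventually (\<lambda>d. \<forall>k\<in>{1..<n}. d * Re (y k) / Im (y k) < 1/2) (at_right (0::real))"
  proof (intro eventually_ball_finite ballI)
    fix k assume "k \<in> {1..<n}"
    have "((\<lambda>d. d * Re (y k) / Im (y k)) \<longlongrightarrow> 0 * Re (y k) / Im (y k)) (at_right 0)"
      using O[of k] \<open>k \<in> {1..<n}\<close> by (intro tendsto_intros) auto
    then show "eventually (\<lambda>d. d * Re (y k) / Im (y k) < 1/2) (at_right (0::real))"
      by (rule order_tendstoD) simp
  qed simp
  have e3: "eventually (\<lambda>d. \<forall>j\<in>{n..<2 * n}. Re (y j) < - (d / \<mu>)) (at_right (0::real))"
  proof (intro eventually_ball_finite ballI)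
    fix j assume "j \<in> {n..<2 * n}"
    have "((\<lambda>d. - (d / \<mu>)) \<longlongrightarrow> - (0 / \<mu>)) (at_right 0)" using \<mu> by (intro tendsto_intros) auto
    then show "eventually (\<lambda>d. Re (y j) < - (d / \<mu>)) (at_right (0::real))"
      by (rule order_tendstoD) (use I[of j] \<open>j \<in> {n..<2 * n}\<close> in simp)
  qed simp
  show ?thesis using pos e1 e2 e3
  proof eventually_elim
    case (elim d)
    have d\<mu>: "0 < d / \<mu>" using elim(1) \<mu> by simp
    show ?case unfolding side_def
    proof (intro conjI allI impI)
      show "- (d / \<mu>) < 0" "- (d * M) < 0" "0 < d" "y 0 = 1" using elim \<mu> M y0 by auto
    next
      fix k assume k: "0 < k \<and> k < n"
      then have k': "1 \<le> k" "k < n" by auto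
      show "d < Im (y k)" "d * Re (y k) / Im (y k) < 1 / 2" using elim(2,3) k' by auto
      have "- 1 / \<mu> < Re (y k) / Im (y k)" using O[OF k'] O\<mu>[OF k'] \<mu> by (simp add: field_simps)
      then have "d * (- 1 / \<mu>) < d * (Re (y k) / Im (y k))" using elim(1) by (rule mult_strict_left_mono)
      then show "- (d / \<mu>) < d * Re (y k) / Im (y k)" by simp
    next
      fix k j assume kj: "0 < k \<and> k < j \<and> j < n"
      then have kj': "1 \<le> k" "k < j" "j < n" "1 \<le> j" "k < n" by auto
      have "Re (y j) / Im (y j) < Re (y k) / Im (y k)"
        using OO[OF kj'(1-3)] O[OF kj'(1,5)] O[OF kj'(4,3)] by (simp add: field_simps)
      then have "d * (Re (y j) / Im (y j)) < d * (Re (y k) / Im (y k))" using elim(1) by (rule mult_strict_left_mono)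
      then show "d * Re (y j) / Im (y j) < d * Re (y k) / Im (y k)" by simp
    next
      fix j assume j: "n \<le> j \<and> j < 2 * n"
      then have j': "n \<le> j" "j < 2 * n" by auto
      show "Re (y j) < - (d / \<mu>)" using elim(4) j' by simp
      have "(d / \<mu>) * (Im (y j) / Re (y j)) < (d / \<mu>) * (M * \<mu>)" using IM[OF j'] d\<mu> by (rule mult_strict_left_mono)
      then show "- (d * M) < - (d / \<mu>) * Im (y j) / Re (y j)" using \<mu> by simp
      have "- \<mu> < Im (y j) / Re (y j)" using I[OF j'] I\<mu>[OF j'] by (simp add: field_simps)
      then have "(d / \<mu>) * (- \<mu>) < (d / \<mu>) * (Im (y j) / Re (y j))" using d\<mu> by (rule mult_strict_left_mono)
      then show "- (d / \<mu>) * Im (y j) / Re (y j) < d" using \<mu> by simp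
    next
      fix i j assume "n \<le> i \<and> i < j \<and> j < 2 * n"
      then have ij: "n \<le> i" "i < j" "j < 2 * n" "n \<le> j" "i < 2 * n" by auto
      have "0 < Re (y i) * Re (y j)" using I[OF ij(1,5)] I[OF ij(4,3)] by (simp add: mult_neg_neg)
      then have "0 < (Re (y i) * Im (y j) - Im (y i) * Re (y j)) / (Re (y i) * Re (y j))" using II[OF ij(1-3)] by simp
      also have "\<dots> = Im (y j) / Re (y j) - Im (y i) / Re (y i)"
        using I[OF ij(1,5)] I[OF ij(4,3)] by (simp add: diff_divide_distrib)
      finally have "(d / \<mu>) * (Im (y i) / Re (y i)) < (d / \<mu>) * (Im (y j) / Re (y j))"
        using d\<mu> by (intro mult_strict_left_mono) auto
      then show "- (d / \<mu>) * Im (y j) / Re (y j) < - (d / \<mu>) * Im (y i) / Re (y i)" by simp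
    qed auto
  qed
qed

text \<open>The rectangle lies within distance \<open>d * (p + q + M + 1)\<close> of the segment
  from 0 to 1, whereas \<open>A\<close> has positive distance from that segment.\<close>

lemma eventually_box_free:
  assumes A: "compact A" "A \<inter> closed_segment 0 1 = {}" and p: "0 < p" "0 < q" "0 < M"
  shows "eventually (\<lambda>d. A \<inter> cbox (Complex (- (d * p)) (- (d * M))) (Complex (1 - - (d * q)) d) = {}) (at_right (0::real))"
proof -
  obtain \<delta> where \<delta>: "\<delta> > 0" "\<And>x y. x \<in> A \<Longrightarrow> y \<in> closed_segment (0::complex) 1 \<Longrightarrow> \<delta> \<le> dist x y"
    using separate_compact_closed[OF A(1) closed_segment A(2)] by auto
  have "((\<lambda>d. d * (p + q + M + 1)) \<longlongrightarrow> 0 * (p + q + M + 1)) (at_right 0)" by (intro tendsto_intros)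
  then have "eventually (\<lambda>d. d * (p + q + M + 1) < \<delta>) (at_right (0::real))" by (rule order_tendstoD) (use \<delta> in simp)
  moreover have "eventually (\<lambda>d. 0 < d) (at_right (0::real))" by (rule eventually_at_right_less)
  ultimately show ?thesis
  proof eventually_elim
    case (elim d)
    have "False" if z: "z \<in> A" "z \<in> cbox (Complex (- (d * p)) (- (d * M))) (Complex (1 - - (d * q)) d)" for z
    proof -
      have b: "- (d * p) \<le> Re z" "Re z \<le> 1 + d * q" "- (d * M) \<le> Im z" "Im z \<le> d"
        using z(2) by (auto simp: in_cbox_complex_iff)
      have pp: "0 < d * p" "0 < d * q" "0 < d * M" using elim p by auto
      define x where "x = max 0 (min 1 (Re z))"
      have x: "0 \<le> x" "x \<le> 1" "\<bar>Re z - x\<bar> \<le> d * p + d * q" using b pp by (auto simp: x_def max_def min_def)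
      have "of_real x \<in> closed_segment (0::complex) 1" using x by (auto simp: segment_0)
      then have "\<delta> \<le> dist z (of_real x)" using \<delta>(2) z(1) by blast
      also have "\<dots> \<le> \<bar>Re z - x\<bar> + \<bar>Im z\<bar>" using cmod_le[of "z - of_real x"] by (simp add: dist_norm)
      also have "\<dots> \<le> (d * p + d * q) + (d * M + d)"
        using x(3) b(3,4) pp elim(2) unfolding abs_real_def by (auto split: if_splits)
      also have "\<dots> = d * (p + q + M + 1)" by (simp add: algebra_simps)
      finally show False using elim by simp
    qed
    then show ?case by blast
  qed
qed

text \<open>The two stars may have different slopes \<open>\<mu>\<close> and \<open>\<nu>\<close>,
  hence different overhangs on the left and on the right, but the rectangle has one bottom and one
  top. So \<open>M\<close> is taken large enough for both stars, and then \<open>d\<close> small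
  enough for both and for the remaining segments.\<close>

lemma eliminate_standard:
  assumes n2: "n \<ge> 2" and T: "diagram n T" and sp0: "spokes n T 0 c y" and sp1: "spokes n T 1 (other c) y'"
    and y0: "y 0 = 1" and O: "\<And>k. 1 \<le> k \<Longrightarrow> k < n \<Longrightarrow> 0 < Im (y k)" and I: "\<And>j. n \<le> j \<Longrightarrow> j < 2 * n \<Longrightarrow> Re (y j) < 0"
    and w0: "y' (2 * n - 1) = 0" and O': "\<And>k. 1 \<le> k \<Longrightarrow> k < n \<Longrightarrow> 0 < Im (mirror n y' k)"
    and I': "\<And>j. n \<le> j \<Longrightarrow> j < 2 * n \<Longrightarrow> Re (mirror n y' j) < 0"
  shows "\<exists>T'. homotopic_diagrams n T T' \<and> diagram n T' \<and> verts n T' \<subseteq> verts n T - {0, 1}"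
proof -
  define w where "w = mirror n y'"
  have w1: "w 0 = 1" using w0 by (simp add: w_def mirror_def)
  have c0: "ccw (2 * n) 0 y" using sp0 by (simp add: spokes_def)
  have cw: "ccw (2 * n) 0 w" using ccw_reflect[of "2 * n" y'] sp1 by (simp add: spokes_def w_def mirror_def[abs_def])
  note O'' = O'[folded w_def] and I'' = I'[folded w_def]
  obtain \<mu> where \<mu>: "\<mu> > 0" "\<And>k. 1 \<le> k \<Longrightarrow> k < n \<Longrightarrow> 0 < Im (y k) + \<mu> * Re (y k)"
    "\<And>j. n \<le> j \<Longrightarrow> j < 2 * n \<Longrightarrow> Im (y j) + \<mu> * Re (y j) < 0"
    "\<And>i j. 1 \<le> i \<Longrightarrow> i < j \<Longrightarrow> j < n \<Longrightarrow> 0 < Re (y i) * Im (y j) - Im (y i) * Re (y j)"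
    "\<And>i j. n \<le> i \<Longrightarrow> i < j \<Longrightarrow> j < 2 * n \<Longrightarrow> 0 < Re (y i) * Im (y j) - Im (y i) * Re (y j)"
    by (rule star_slopes[OF n2 c0 y0 O I]) (assumption | rule that | blast)+
  obtain \<nu> where \<nu>: "\<nu> > 0" "\<And>k. 1 \<le> k \<Longrightarrow> k < n \<Longrightarrow> 0 < Im (w k) + \<nu> * Re (w k)"
    "\<And>j. n \<le> j \<Longrightarrow> j < 2 * n \<Longrightarrow> Im (w j) + \<nu> * Re (w j) < 0"
    "\<And>i j. 1 \<le> i \<Longrightarrow> i < j \<Longrightarrow> j < n \<Longrightarrow> 0 < Re (w i) * Im (w j) - Im (w i) * Re (w j)"
    "\<And>i j. n \<le> i \<Longrightarrow> i < j \<Longrightarrow> j < 2 * n \<Longrightarrow> 0 < Re (w i) * Im (w j) - Im (w i) * Re (w j)"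
    by (rule star_slopes[OF n2 cw w1 O'' I'']) (assumption | rule that | blast)+
  have "eventually (\<lambda>M. \<forall>j\<in>{n..<2 * n}. Im (y j) / Re (y j) / \<mu> < M \<and> Im (w j) / Re (w j) / \<nu> < M) (at_top :: real filter)"
    by (intro eventually_ball_finite ballI eventually_conj eventually_gt_at_top) auto
  then have "eventually (\<lambda>M. (\<forall>j\<in>{n..<2 * n}. Im (y j) / Re (y j) / \<mu> < M \<and> Im (w j) / Re (w j) / \<nu> < M) \<and> 0 < M) (at_top :: real filter)"
    by (rule eventually_conj[OF _ eventually_gt_at_top])
  then obtain M :: real where M: "\<forall>j\<in>{n..<2 * n}. Im (y j) / Re (y j) / \<mu> < M \<and> Im (w j) / Re (w j) / \<nu> < M" "0 < M"
    using eventually_happens'[OF trivial_limit_at_top_linorder] by blast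
  have My: "Im (y j) / Re (y j) < M * \<mu>" and Mw: "Im (w j) / Re (w j) < M * \<nu>" if "n \<le> j" "j < 2 * n" for j
    using bspec[OF M(1), of j] that \<mu>(1) \<nu>(1) by (simp_all only: pos_divide_less_eq atLeastLessThan_iff simp_thms)
  have es: "eventually (\<lambda>d. side n (- (d / \<mu>)) (- (d * M)) d 0 y) (at_right (0::real))"
    by (rule eventually_side[where y = y and \<mu> = \<mu> and M = M]; (fact | (rule O I \<mu> My; assumption)))
  have ew: "eventually (\<lambda>d. side n (- (d / \<nu>)) (- (d * M)) d 0 w) (at_right (0::real))"
    by (rule eventually_side[where y = w and \<mu> = \<nu> and M = M]; (fact | (rule O'' I'' \<nu> Mw; assumption)))
  let ?F = "{s \<in> T. 0 \<notin> ends s \<and> 1 \<notin> ends s}"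
  have ef: "eventually (\<lambda>d. \<forall>s\<in>?F. seg s \<inter> cbox (Complex (- (d * (1 / \<mu>))) (- (d * M))) (Complex (1 - - (d * (1 / \<nu>))) d) = {}) (at_right (0::real))"
  proof (intro eventually_ball_finite ballI eventually_box_free)
    show "finite ?F" using diagram_finite[OF T] by simp
    fix s assume s: "s \<in> ?F"
    have e: "spoke n 0 c y 0 \<in> T" using spokes_in(1)[OF sp0] n2 by simp
    have "s \<noteq> spoke n 0 c y 0" using s by auto
    then have "seg s \<inter> seg (spoke n 0 c y 0) \<subseteq> ends s \<inter> ends (spoke n 0 c y 0)" using diagram_cross[OF T _ e] s by blast
    then show "seg s \<inter> closed_segment 0 1 = {}" using s y0 by auto
  qed (use \<mu> \<nu> M in auto)
  have "eventually (\<lambda>d. side n (- (d / \<mu>)) (- (d * M)) d 0 y \<and> side n (- (d / \<nu>)) (- (d * M)) d 0 w \<and>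
     (\<forall>s\<in>?F. seg s \<inter> cbox (Complex (- (d * (1 / \<mu>))) (- (d * M))) (Complex (1 - - (d * (1 / \<nu>))) d) = {})) (at_right (0::real))"
    using es ew ef by (intro eventually_conj)
  then obtain d :: real where d: "side n (- (d / \<mu>)) (- (d * M)) d 0 y" "side n (- (d / \<nu>)) (- (d * M)) d 0 w"
     "\<forall>s\<in>?F. seg s \<inter> cbox (Complex (- (d * (1 / \<mu>))) (- (d * M))) (Complex (1 - - (d * (1 / \<nu>))) d) = {}"
    using eventually_happens'[OF trivial_limit_at_right_real] by blast
  have "ready n c (- (d / \<mu>)) (- (d / \<nu>)) (- (d * M)) d 0 T y y'"
    unfolding ready_def w_def[symmetric]
  proof (intro conjI ballI allI impI)
    fix s assume "s \<in> T" "0 \<notin> ends s" "1 \<notin> ends s"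
    then have "s \<in> ?F" by blast
    then show "seg s \<inter> cbox (Complex (- (d / \<mu>)) (- (d * M))) (Complex (1 - - (d / \<nu>)) d) = {}"
      using bspec[OF d(3)] by (simp only: times_divide_eq_right mult_1_right)
  qed (use T sp0 sp1 d(1,2) in simp_all)
  then show ?thesis using ready_all[OF n2] by blast
qed

text \<open>Division by \<open>q\<close> turns directions by an angle whose tangent is at most
  \<open>\<tau>\<close>; inequalities that hold with a margin of slope \<open>\<tau>\<close> survive
  it.\<close>

lemma Re_mult_cone:
  assumes "\<bar>Im q\<bar> \<le> \<tau> * Re q" "0 < Re q"
  shows "\<tau> * \<bar>Re E\<bar> < Im E \<Longrightarrow> 0 < Im (E / q)" "\<tau> * \<bar>Im E\<bar> < - Re E \<Longrightarrow> Re (E / q) < 0"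
proof -
  have b: "\<bar>x * Im q\<bar> \<le> (\<tau> * \<bar>x\<bar>) * Re q" for x
    using mult_left_mono[OF assms(1), of "\<bar>x\<bar>"] by (simp add: abs_mult algebra_simps)
  show "0 < Im (E / q)" if "\<tau> * \<bar>Re E\<bar> < Im E"
  proof -
    have "(\<tau> * \<bar>Re E\<bar>) * Re q < Im E * Re q" using that assms(2) by (rule mult_strict_right_mono)
    then have "0 < Im (E * cnj q)" using b[of "Re E"] by (simp add: abs_le_iff)
    then show ?thesis using Im_complex_div_gt_0 by blast
  qed
  show "Re (E / q) < 0" if "\<tau> * \<bar>Im E\<bar> < - Re E"
  proof -
    have "(\<tau> * \<bar>Im E\<bar>) * Re q < - Re E * Re q" using that assms(2) by (rule mult_strict_right_mono)
    then have "Re (E * cnj q) < 0" using b[of "Im E"] by (simp add: abs_le_iff)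
    then show ?thesis using Re_complex_div_lt_0 by blast
  qed
qed

text \<open>\<open>normalise\<close> is applied at \<open>v\<close> and then at \<open>w\<close>.
  The second application changes the direction of the edge as seen from \<open>v1\<close> and could
  spoil what the first achieved there. Its cone parameter \<open>\<tau>\<close> is therefore chosen
  after the first, small enough for the strict inequalities at \<open>v1\<close>.\<close>

lemma eliminate_edge:
  assumes n2: "n \<ge> 2" and l: "linked n T v c y w c' y' [w]"
  shows "\<exists>T'. homotopic_diagrams n T T' \<and> diagram n T' \<and> card (verts n T') < card (verts n T)"
proof -
  let ?k = "2 * n - 1"
  have k: "?k < 2 * n" "0 < 2 * n" "0 \<noteq> ?k" "?k \<noteq> 0" using n2 by auto
  from l have T: "diagram n T" and sp: "spokes n T v c y" and spw: "spokes n T w c' y'" and vw: "v \<noteq> w"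
    and y0: "y 0 = w" and fin: "spoke n w c' y' ?k = (v, w, alternate c 0)" by (auto simp: linked_def)
  have kn: "\<not> ?k < n" "0 < n" using n2 by simp_all
  have yk: "y' ?k = v" and "alternate c' ?k = alternate c 0"
    using fin unfolding spoke_def if_not_P[OF kn(1)] by auto
  moreover have "alternate c' ?k = other c'" "alternate c 0 = c" using alternate_mirror[of 0 n c'] n2 by (simp_all add: alternate_def)
  ultimately have "other c' = c" by metis
  then have c': "c' = other c" by auto
  have edge: "spoke n w c' y' ?k = spoke n v c y 0" using fin y0 unfolding spoke_def[of n v c y 0] if_P[OF kn(2)] by simp
  obtain T1 v1 e s where T1: "homotopic_diagrams n T T1" "diagram n T1" "verts n T1 \<subseteq> insert v1 (verts n T - {v})"
    "spokes n T1 v1 c e" "e 0 = w" "s > 0" "e ?k - v1 = - of_real s * (w - v1)"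
    "\<And>j. j < 2 * n \<Longrightarrow> j \<noteq> 0 \<Longrightarrow> Re ((e j - v1) / (w - v1)) < 0"
    "\<And>x c' y'. x \<noteq> v \<Longrightarrow> spokes n T x c' y' \<Longrightarrow> \<exists>y''. spokes n T1 x c' y'' \<and>
        (\<forall>j<2 * n. (v \<notin> ends (spoke n x c' y' j) \<longrightarrow> y'' j = y' j) \<and>
           (spoke n x c' y' j = spoke n v c y 0 \<longrightarrow> y'' j = v1))"
    by (rule normalise[OF n2 T sp k(2) y0 k(1,4) zero_less_one]) (assumption | rule that | blast)+
  have v1w: "v1 \<noteq> w" using spokes_ne[OF T1(4) k(2)] T1(5) by simp
  obtain y1 where y1: "spokes n T1 w c' y1" "y1 ?k = v1" using T1(9)[OF vw[symmetric] spw] edge k by blast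
  define E where "E j = (e j - v1) / (w - v1)" for j
  have EI: "0 < Im (E j)" if "1 \<le> j" "j < ?k" for j
    using ccw_opposite[of "2 * n" v1 e j s] T1(4-7) that by (simp add: spokes_def E_def)
  have ER: "Re (E j) < 0" if "1 \<le> j" "j < 2 * n" for j using T1(8)[of j] that by (simp add: E_def)
  have "eventually (\<lambda>\<tau>. \<forall>j\<in>{1..<?k}. \<tau> * \<bar>Re (E j)\<bar> < Im (E j)) (at_right (0::real))"
  proof (intro eventually_ball_finite ballI)
    fix j assume j: "j \<in> {1..<?k}"
    have "((\<lambda>\<tau>. \<tau> * \<bar>Re (E j)\<bar>) \<longlongrightarrow> 0 * \<bar>Re (E j)\<bar>) (at_right 0)" by (intro tendsto_intros)
    then show "eventually (\<lambda>\<tau>. \<tau> * \<bar>Re (E j)\<bar> < Im (E j)) (at_right 0)" by (rule order_tendstoD) (use EI j in simp)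
  qed simp
  moreover have "eventually (\<lambda>\<tau>. \<forall>j\<in>{1..<2*n}. \<tau> * \<bar>Im (E j)\<bar> < - Re (E j)) (at_right (0::real))"
  proof (intro eventually_ball_finite ballI)
    fix j assume j: "j \<in> {1..<2*n}"
    have "((\<lambda>\<tau>. \<tau> * \<bar>Im (E j)\<bar>) \<longlongrightarrow> 0 * \<bar>Im (E j)\<bar>) (at_right 0)" by (intro tendsto_intros)
    then show "eventually (\<lambda>\<tau>. \<tau> * \<bar>Im (E j)\<bar> < - Re (E j)) (at_right 0)" by (rule order_tendstoD) (use ER j in simp)
  qed simp
  moreover have "eventually (\<lambda>\<tau>. 0 < \<tau>) (at_right (0::real))" by (rule eventually_at_right_less)
  ultimately have "eventually (\<lambda>\<tau>. (\<forall>j\<in>{1..<?k}. \<tau> * \<bar>Re (E j)\<bar> < Im (E j)) \<and>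
      (\<forall>j\<in>{1..<2*n}. \<tau> * \<bar>Im (E j)\<bar> < - Re (E j)) \<and> 0 < \<tau>) (at_right (0::real))" by (intro eventually_conj)
  then obtain \<tau> :: real where \<tau>: "\<And>j. 1 \<le> j \<Longrightarrow> j < ?k \<Longrightarrow> \<tau> * \<bar>Re (E j)\<bar> < Im (E j)"
    "\<And>j. 1 \<le> j \<Longrightarrow> j < 2 * n \<Longrightarrow> \<tau> * \<bar>Im (E j)\<bar> < - Re (E j)" "0 < \<tau>"
    using eventually_happens'[OF trivial_limit_at_right_real] by fastforce
  obtain T2 w1 f s' where T2: "homotopic_diagrams n T1 T2" "diagram n T2" "verts n T2 \<subseteq> insert w1 (verts n T1 - {w})"
    "spokes n T2 w1 c' f" "f ?k = v1" "s' > 0" "f 0 - w1 = - of_real s' * (v1 - w1)"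
    "\<And>j. j < 2 * n \<Longrightarrow> j \<noteq> ?k \<Longrightarrow> Re ((f j - w1) / (v1 - w1)) < 0"
    "0 < Re ((w1 - v1) / (w - v1))" "\<bar>Im ((w1 - v1) / (w - v1))\<bar> \<le> \<tau> * Re ((w1 - v1) / (w - v1))"
    "\<And>x d y'. x \<noteq> w \<Longrightarrow> spokes n T1 x d y' \<Longrightarrow> \<exists>y''. spokes n T2 x d y'' \<and>
        (\<forall>j<2 * n. (w \<notin> ends (spoke n x d y' j) \<longrightarrow> y'' j = y' j) \<and>
           (spoke n x d y' j = spoke n w c' y1 ?k \<longrightarrow> y'' j = w1))"
    by (rule normalise[OF n2 T1(2) y1(1) k(1) y1(2) k(2,3) \<tau>(3)]) (assumption | rule that | blast)+
  have edge': "spoke n v1 c e 0 = spoke n w c' y1 ?k"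
    using y1(2) T1(5) edge fin unfolding spoke_def if_P[OF kn(2)] if_not_P[OF kn(1)] by simp
  obtain e2 where e2: "spokes n T2 v1 c e2" "e2 0 = w1" "\<And>j. j < 2 * n \<Longrightarrow> w \<notin> ends (spoke n v1 c e j) \<Longrightarrow> e2 j = e j"
    using T2(11)[OF v1w T1(4)] edge' k by blast
  have e2j: "e2 j = e j" if "1 \<le> j" "j < 2 * n" for j
  proof (rule e2(3)[OF that(2)])
    have "e j \<noteq> w" using spokes_inj[OF T1(4) that(2) k(2)] T1(5) that(1) by auto
    then show "w \<notin> ends (spoke n v1 c e j)" using v1w by auto
  qed
  have w1v1: "w1 \<noteq> v1" using spokes_ne[OF T2(4) k(1)] T2(5) by simp
  define g where "g z = (1 / (w1 - v1)) * z + (- v1 / (w1 - v1))" for z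
  have g: "g z = (z - v1) / (w1 - v1)" for z by (simp add: g_def diff_divide_distrib)
  have g01: "g v1 = 0" "g w1 = 1" using w1v1 by (simp_all add: g)
  have gdef: "g = (\<lambda>z. (1 / (w1 - v1)) * z + (- v1 / (w1 - v1)))" by (simp add: g_def[abs_def])
  have al: "1 / (w1 - v1) \<noteq> 0" using w1v1 by simp
  note aff = affine_homotopic[OF n2 T2(2) al gdef]
  define T3 where "T3 = transport g T2"
  have sp0: "spokes n T3 0 c (\<lambda>j. g (e2 j))" using aff(4)[OF e2(1)] g01 by (simp add: T3_def)
  have sp1: "spokes n T3 1 (other c) (\<lambda>j. g (f j))" using aff(4)[OF T2(4)] g01 c' by (simp add: T3_def)
  have gE: "g (e2 j) = E j / ((w1 - v1) / (w - v1))" if "1 \<le> j" "j < 2 * n" for j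
    using e2j[OF that] v1w w1v1 by (simp add: g E_def)
  \<comment> \<open>In the normalised position, mirroring the star of \<open>w1\<close> amounts to
    conjugating its directions as measured from the edge towards \<open>v1\<close>.\<close>
  have G: "mirror n (\<lambda>j. g (f j)) j = cnj ((f (?k - j) - w1) / (v1 - w1))" if "j < 2 * n" for j
  proof -
    have "1 - g z = (z - w1) / (v1 - w1)" for z using w1v1 by (simp add: g field_simps)
    then have "cnj (1 - g (f (?k - j))) = cnj ((f (?k - j) - w1) / (v1 - w1))" by simp
    then show ?thesis by (simp add: mirror_def reflect_def)
  qed
  have "\<exists>T'. homotopic_diagrams n T3 T' \<and> diagram n T' \<and> verts n T' \<subseteq> verts n T3 - {0, 1}"
  proof (rule eliminate_standard[OF n2 _ sp0 sp1])
    show "diagram n T3" using aff(1) by (simp add: T3_def)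
    show "g (e2 0) = 1" using e2 g01 by simp
    show "g (f ?k) = 0" using T2(5) g01 by simp
  next
    fix j assume j: "1 \<le> j" "j < n"
    show "0 < Im (g (e2 j))" using gE[of j] Re_mult_cone(1)[OF T2(10,9) \<tau>(1)] j by simp
    have i: "0 < ?k - j" "?k - j < ?k" "?k - j < 2 * n" "j < 2 * n" using j by auto
    let ?f = "f (?k - j)"
    define U where "U = (?f - w1) / (f 0 - w1)"
    \<comment> \<open>\<open>ccw_opposite\<close> measures from the first spoke of
      \<open>w1\<close>, which is opposite to the edge. Measuring from the edge instead brings in
      the factor \<open>- s'\<close>, and the conjugation restores the positive imaginary
      part.\<close>
    have "- of_real s' * U = (?f - w1) / (v1 - w1)" using T2(6) w1v1 unfolding U_def T2(7) by simp
    then have eqU: "(?f - w1) / (v1 - w1) = of_real (- s') * U" by simp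
    have "0 < Im U" unfolding U_def
    proof (rule ccw_opposite[of "2 * n" w1 f "?k - j" "1 / s'"])
      show "ccw (2 * n) w1 f" using T2(4) by (simp add: spokes_def)
      show "0 < ?k - j" "?k - j < 2 * n - 1" "0 < 1 / s'" using i T2(6) by auto
      show "f (2 * n - 1) - w1 = - of_real (1 / s') * (f 0 - w1)" unfolding T2(5,7) using T2(6) by simp
    qed
    then have "Im (of_real (- s') * U) < 0" using T2(6) by simp
    then show "0 < Im (mirror n (\<lambda>j. g (f j)) j)" 
      unfolding G[OF i(4)] eqU by (simp only: cnj.sel neg_0_less_iff_less)
  next
    fix j assume j: "n \<le> j" "j < 2 * n"
    show "Re (g (e2 j)) < 0" using gE[of j] Re_mult_cone(2)[OF T2(10,9) \<tau>(2)] j n2 by simp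
    have "?k - j < 2 * n" "?k - j \<noteq> ?k" using j n2 by arith+
    then have "Re ((f (?k - j) - w1) / (v1 - w1)) < 0" by (rule T2(8))
    then show "Re (mirror n (\<lambda>j. g (f j)) j) < 0" unfolding G[OF j(2)] by (simp only: cnj.sel)
  qed
  then obtain T' where T': "homotopic_diagrams n T3 T'" "diagram n T'" "verts n T' \<subseteq> verts n T3 - {0, 1}" by blast
  have fin: "finite (verts n X)" if "diagram n X" for X
    using finite_subset[OF verts_subset_pts finite_pts[OF diagram_finite[OF that]]] n2 by simp
  \<comment> \<open>Each normalisation exchanges one vertex for another, so the count cannot
    grow.\<close>
  have swap: "card B \<le> card A" if "B \<subseteq> insert x (A - {a})" "a \<in> A" "finite A" for A B and x a :: complex
  proof -
    have "card B \<le> card (insert x (A - {a}))" using that by (intro card_mono) auto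
    also have "\<dots> \<le> Suc (card (A - {a}))" using that(3) by (intro card_insert_le_m1) (auto simp: card_insert_if)
    also have "\<dots> = card A" using that(2,3) by (metis card_Suc_Diff1)
    finally show ?thesis .
  qed
  have D3: "diagram n T3" using aff(1) by (simp add: T3_def)
  have "0 \<in> verts n T3" using sp0 by (rule vertsI)
  then have "card (verts n T') < card (verts n T3)" using T'(3) fin[OF D3] by (intro psubset_card_mono) auto
  also have "\<dots> \<le> card (verts n T2)" using aff(3) by (simp add: T3_def)
  also have "\<dots> \<le> card (verts n T1)" using swap[OF T2(3) vertsI[OF y1(1)] fin[OF T1(2)]] .
  also have "\<dots> \<le> card (verts n T)" using swap[OF T1(3) vertsI[OF sp] fin[OF T]] .
  finally have "card (verts n T') < card (verts n T)" .
  moreover have "homotopic_diagrams n T T'"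
    using homotopic_trans[OF T1(1)] homotopic_trans[OF T2(1)] homotopic_trans[OF aff(2)] T'(1) by (simp add: T3_def)
  ultimately show ?thesis using T'(2) by blast
qed

lemma eliminate_linked:
  assumes n2: "n \<ge> 2" and l: "linked n T v c y w c' y' cs"
  shows "\<exists>T'. homotopic_diagrams n T T' \<and> diagram n T' \<and> card (verts n T') < card (verts n T)"
  using l
proof (induction cs arbitrary: T v y y')
  case Nil
  then show ?case by (simp add: linked_def)
next
  case (Cons c1 cs)
  show ?case
  proof (cases cs)
    case Nil
    then have "c1 = w" using Cons.prems by (simp add: linked_def)
    then show ?thesis using eliminate_edge[OF n2] Cons.prems Nil by blast
  next
    case (Cons c2 cs')
    have l: "linked n T v c y w c' y' (c1 # c2 # cs')" using Cons.prems Cons by simp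
    obtain T' v' e e' where T': "homotopic_diagrams n T T'" "linked n T' v' c e w c' e' (c2 # cs')"
      "verts n T' \<subseteq> insert v' (verts n T - {v})" using linked_step[OF n2 l] by blast
    obtain T'' where T'': "homotopic_diagrams n T' T''" "diagram n T''" "card (verts n T'') < card (verts n T')"
      using Cons.IH T'(2) Cons by blast
    have "diagram n T" "v \<in> verts n T" using l vertsI by (auto simp: linked_def)
    then have fin: "finite (verts n T)"
      using finite_subset[OF verts_subset_pts finite_pts[OF diagram_finite]] n2 by simp
    have "card (verts n T') \<le> card (insert v' (verts n T - {v}))" using T'(3) fin by (intro card_mono) auto
    also have "\<dots> \<le> Suc (card (verts n T - {v}))" using fin by (simp add: card_insert_if)
    also have "\<dots> = card (verts n T)" using \<open>v \<in> verts n T\<close> fin by (metis card_Suc_Diff1)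
    finally show ?thesis using T'' T'(1) homotopic_trans by (metis order_less_le_trans)
  qed
qed

subsection \<open>Heights of edges\<close>

definition bend :: "complex \<Rightarrow> segment \<Rightarrow> real" where
  "bend z s = Arg ((fst (snd s) - z) / (fst s - z))"

definition turning :: "segment set \<Rightarrow> complex \<Rightarrow> real" where
  "turning T z = (\<Sum>s\<in>T. bend z s)"

text \<open>Off the drawing \<open>turning T z\<close> is \<open>2 * pi\<close> times the winding
  number of the diagram around \<open>z\<close>. On a segment, \<open>Arg\<close> gives that segment
  itself the value \<open>pi\<close>, its limit from the left; so the height is the value on the
  left side of the segment, with the midpoint as a sample point.\<close>

definition height :: "segment set \<Rightarrow> segment \<Rightarrow> real" where
  "height T s = turning T (midpoint (fst s) (fst (snd s)))"

text \<open>The limit of \<open>bend z s\<close> as \<open>z\<close> tends to \<open>x\<close> along a segment of the diagram starting or ending at \<open>x\<close>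
  whose other end is \<open>x + u\<close>; if this segment is \<open>s\<close> itself, then the limit is \<open>Arg (- 1) = pi\<close>.\<close>

definition near :: "complex \<Rightarrow> complex \<Rightarrow> segment \<Rightarrow> real" where
  "near x u s = (if fst s = x then Arg (- ((fst (snd s) - x) / u))
     else if fst (snd s) = x then Arg (- (u / (fst s - x))) else bend x s)"

lemma inj_spoke:
  assumes "spokes n T x c y" shows "inj_on (spoke n x c y) {..<2 * n}"
proof (rule inj_onI)
  fix i j assume ij: "i \<in> {..<2 * n}" "j \<in> {..<2 * n}" "spoke n x c y i = spoke n x c y j"
  have "{x, y i} = {x, y j}" using ij(3) by (rule spoke_eqD)
  then have "y i = y j" using spokes_ne[OF assms] ij(1,2) by (auto simp: doubleton_eq_iff)
  then show "i = j" using spokes_inj[OF assms] ij(1,2) by auto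
qed

text \<open>A corner has one segment of each kind and a vertex has \<open>n\<close> of each. The
  diagram is thus a cycle, which is what makes its winding numbers integers.\<close>

lemma balanced:
  assumes T: "diagram n T" and x: "x \<in> pts T"
  shows "card {s \<in> T. fst s = x} = card {s \<in> T. fst (snd s) = x}"
proof -
  have loc: "{s \<in> T. fst s = x} = {s \<in> segments_at T x. fst s = x}"
    "{s \<in> T. fst (snd s) = x} = {s \<in> segments_at T x. fst (snd s) = x}"
    by (auto simp: segments_at_eq ends_def)
  consider "corner_at T x" | "vertex_at n T x" using diagram_pts[OF T x] by blast
  then show ?thesis
  proof cases
    case 1
    then obtain a b c where s: "segments_at T x = {(a, x, c), (x, b, c)}" by (auto simp: corner_at_def)
    then have "(a, x, c) \<in> T" "(x, b, c) \<in> T" by (auto simp: segments_at_eq)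
    then have "a \<noteq> x" "b \<noteq> x" using diagram_nondeg[OF T] by fastforce+
    then have "{s \<in> segments_at T x. fst s = x} = {(x, b, c)}" "{s \<in> segments_at T x. fst (snd s) = x} = {(a, x, c)}"
      unfolding s by auto
    then show ?thesis unfolding loc by simp
  next
    case 2
    then obtain c y where s: "spokes n T x c y" by (auto simp: vertex_at_iff)
    have S: "segments_at T x = spoke n x c y ` {..<2 * n}" using s by (simp add: spokes_def)
    have ne: "y i \<noteq> x" if "i < 2 * n" for i using spokes_ne[OF s that] .
    have f: "fst (spoke n x c y i) = x \<longleftrightarrow> i < n" "fst (snd (spoke n x c y i)) = x \<longleftrightarrow> \<not> i < n" if "i < 2 * n" for i
      using ne[OF that] by (auto simp: spoke_def)
    have filt: "{s \<in> segments_at T x. P s} = spoke n x c y ` {i \<in> {..<2 * n}. P (spoke n x c y i)}" for P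
      unfolding S by blast
    have "{i \<in> {..<2 * n}. fst (spoke n x c y i) = x} = {..<n}" "{i \<in> {..<2 * n}. fst (snd (spoke n x c y i)) = x} = {n..<2 * n}"
      using f by auto
    then have "{s \<in> segments_at T x. fst s = x} = spoke n x c y ` {..<n}"
      "{s \<in> segments_at T x. fst (snd s) = x} = spoke n x c y ` {n..<2 * n}" unfolding filt by simp_all
    moreover have "card (spoke n x c y ` {..<n}) = n"
      using card_image[OF inj_on_subset[OF inj_spoke[OF s]], of "{..<n}"] by auto
    moreover have "card (spoke n x c y ` {n..<2 * n}) = n"
      using card_image[OF inj_on_subset[OF inj_spoke[OF s]], of "{n..<2 * n}"] by (simp add: subset_iff)
    ultimately show ?thesis unfolding loc by simp
  qed
qed

section \<open>Integrality and constancy of the angle sum\<close>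

lemma prod_by_value:
  fixes z :: complex
  assumes "finite T" "finite P" "f ` T \<subseteq> P"
  shows "(\<Prod>s\<in>T. f s - z) = (\<Prod>x\<in>P. (x - z) ^ card {s \<in> T. f s = x})"
proof -
  have "(\<Prod>s\<in>T. f s - z) = (\<Prod>x\<in>P. \<Prod>s\<in>{s \<in> T. f s = x}. f s - z)"
    using prod.group[OF assms, of "\<lambda>s. f s - z"] by simp
  also have "\<dots> = (\<Prod>x\<in>P. (x - z) ^ card {s \<in> T. f s = x})"
  proof (rule prod.cong[OF refl])
    fix x
    have "(\<Prod>s\<in>{s \<in> T. f s = x}. f s - z) = (\<Prod>s\<in>{s \<in> T. f s = x}. x - z)" by (rule prod.cong) auto
    then show "(\<Prod>s\<in>{s \<in> T. f s = x}. f s - z) = (x - z) ^ card {s \<in> T. f s = x}" by simp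
  qed
  finally show ?thesis .
qed

text \<open>In the product of the quotients \<open>(q - z) / (p - z)\<close> over all segments, each
  factor \<open>x - z\<close> occurs as often above as below. So the product is 1, and the arguments
  add up to a multiple of \<open>2 * pi\<close>.\<close>

lemma turning_integer:
  assumes T: "diagram n T" and z: "z \<notin> pts T"
  obtains k :: int where "turning T z = 2 * pi * k"
proof -
  have fin: "finite T" "finite (pts T)" using T finite_pts by (auto simp: diagram_finite)
  let ?r = "\<lambda>s. (fst (snd s) - z) / (fst s - z)"
  have sub: "fst ` T \<subseteq> pts T" "(\<lambda>s. fst (snd s)) ` T \<subseteq> pts T" by (auto simp: pts_def ends_def)
  have ne: "fst s - z \<noteq> 0" if "s \<in> T" for s using sub z that by auto
  have "(\<Prod>s\<in>T. fst (snd s) - z) = (\<Prod>s\<in>T. fst s - z)"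
    unfolding prod_by_value[OF fin sub(1)] prod_by_value[OF fin sub(2)]
    by (rule prod.cong[OF refl]) (use balanced[OF T] in simp)
  then have one: "(\<Prod>s\<in>T. ?r s) = 1" using ne fin(1) by (simp add: prod_dividef)
  have "(\<Prod>s\<in>T. ?r s) = (\<Prod>s\<in>T. of_real (norm (?r s)) * cis (bend z s))"
    unfolding bend_def rcis_def[symmetric] rcis_cmod_Arg ..
  also have "\<dots> = of_real (\<Prod>s\<in>T. norm (?r s)) * (\<Prod>s\<in>T. cis (bend z s))" by (simp add: prod.distrib)
  also have "(\<Prod>s\<in>T. norm (?r s)) = norm (\<Prod>s\<in>T. ?r s)" by (simp add: prod_norm)
  also have "(\<Prod>s\<in>T. cis (bend z s)) = cis (turning T z)"
    unfolding turning_def using fin(1) by (induction rule: finite_induct) (simp_all add: cis_mult)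
  finally have "cis (turning T z) = cis 0" using one by simp
  then obtain k :: int where "turning T z = 0 + 2 * pi * k" unfolding cis_eq_iff by blast
  then show ?thesis using that[of k] by simp
qed

lemma bend_own:
  assumes "z \<in> open_segment p q" shows "Arg ((q - z) / (p - z)) = pi"
proof -
  obtain s where s: "s > 0" "s < 1" "z - p = of_real s * (q - p)" using open_segment_scale[OF assms] by blast
  have qp: "q - p \<noteq> 0" using assms by auto
  have e: "p - z = - of_real s * (q - p)" "q - z = of_real (1 - s) * (q - p)" using s(3) by (auto simp: algebra_simps)
  have "q - z = of_real (- ((1 - s) / s)) * (p - z)" unfolding e using s by (simp add: field_simps)
  moreover have "p - z \<noteq> 0" unfolding e using qp s by simp
  ultimately have "(q - z) / (p - z) = of_real (- ((1 - s) / s))" by (metis nonzero_divide_eq_eq)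
  then show ?thesis using s by (simp only: Arg_of_real) simp
qed

text \<open>This makes \<open>bend\<close> continuous in \<open>z\<close> off the segment, as
  \<open>Arg\<close> jumps only along the nonpositive reals.\<close>

lemma ratio_not_nonpos:
  assumes "z \<notin> closed_segment p (q :: complex)" shows "(q - z) / (p - z) \<notin> \<real>\<^sub>\<le>\<^sub>0"
proof
  assume "(q - z) / (p - z) \<in> \<real>\<^sub>\<le>\<^sub>0"
  then obtain r where r: "(q - z) / (p - z) = of_real r" "r \<le> 0" by (auto elim: nonpos_Reals_cases)
  have "p - z \<noteq> 0" using assms by auto
  then have "q - z = of_real r * (p - z)" using r by (simp add: field_simps)
  then have m: "of_real (1 - r) * z = q - of_real r * p" by (simp add: algebra_simps)
  have n0: "of_real (1 - r) \<noteq> (0 :: complex)" using r(2) by (simp only: of_real_eq_0_iff)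
  have "z = of_real (1 - r) * z / of_real (1 - r)" using n0 by (rule nonzero_mult_div_cancel_left[symmetric])
  also have "\<dots> = (q - of_real r * p) / of_real (1 - r)" by (simp only: m)
  also have "\<dots> = (1 - 1 / (1 - r)) *\<^sub>R p + (1 / (1 - r)) *\<^sub>R q"
  proof -
    have "1 - 1 / (1 - r) = - (r / (1 - r))" using r(2) by (simp add: field_simps)
    then show ?thesis by (simp add: scaleR_conv_of_real diff_divide_distrib)
  qed
  finally have "z \<in> closed_segment p q" unfolding in_segment using r(2) by (intro exI[of _ "1 / (1 - r)"]) simp
  then show False using assms by simp
qed

lemma open_segment_alone:
  assumes "diagram n T" "s \<in> T" "s' \<in> T" "s' \<noteq> s" "z \<in> open_segment (fst s) (fst (snd s))"
  shows "z \<notin> seg s'"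
  using diagram_cross[OF assms(1-3)] assms(4,5) by (auto simp: open_segment_def seg_def ends_def)

text \<open>On the open segment its own contribution is constantly \<open>pi\<close>, and the others
  are continuous because no other segment comes there. A continuous function on a connected set with
  values in the multiples of \<open>2 * pi\<close> is constant.\<close>

lemma turning_constant:
  assumes T: "diagram n T" and s: "s \<in> T"
    and z: "z \<in> open_segment (fst s) (fst (snd s))" "z' \<in> open_segment (fst s) (fst (snd s))"
  shows "turning T z = turning T z'"
proof -
  let ?S = "open_segment (fst s) (fst (snd s))"
  have c1: "continuous_on ?S (\<lambda>z. bend z s')" if s': "s' \<in> T" for s'
  proof (cases "s' = s")
    case True
    then have "bend z s' = pi" if "z \<in> ?S" for z using bend_own[OF that] by (simp add: bend_def)
    then show ?thesis by (simp cong: continuous_on_cong_simp)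
  next
    case False
    then have "z \<notin> seg s'" if "z \<in> ?S" for z using open_segment_alone[OF T s s'] that by blast
    then have n: "z \<notin> closed_segment (fst s') (fst (snd s'))" if "z \<in> ?S" for z using that by (simp add: seg_def)
    then have "fst s' - z \<noteq> 0" if "z \<in> ?S" for z using that by fastforce
    then show ?thesis unfolding bend_def using ratio_not_nonpos[OF n] by (intro continuous_intros) auto
  qed
  have np: "z \<notin> pts T" if z: "z \<in> ?S" for z
  proof
    assume "z \<in> pts T"
    then obtain s' where s': "s' \<in> T" "z \<in> ends s'" by (auto simp: pts_def)
    have "s' \<noteq> s" using z s'(2) by (auto simp: ends_def open_segment_def)
    then have "z \<notin> seg s'" using open_segment_alone[OF T s s'(1)] z by blast
    then show False using s'(2) ends_subset_seg by blast
  qed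
  have "turning T constant_on ?S"
  proof (rule continuous_discrete_range_constant)
    show "connected ?S" by (intro convex_connected convex_open_segment)
    show "continuous_on ?S (turning T)" 
    proof -
      have "continuous_on ?S (\<lambda>z. \<Sum>s\<in>T. (\<lambda>s z. bend z s) s z)" by (rule continuous_on_sum) (rule c1)
      then show ?thesis by (simp add: turning_def[abs_def])
    qed
    fix x assume x: "x \<in> ?S"
    show "\<exists>e>0. \<forall>y. y \<in> ?S \<and> turning T y \<noteq> turning T x \<longrightarrow> e \<le> norm (turning T y - turning T x)"
    proof (intro exI[of _ "2 * pi"] conjI allI impI)
      fix y assume y: "y \<in> ?S \<and> turning T y \<noteq> turning T x"
      obtain k :: int where k: "turning T x = 2 * pi * k" using turning_integer[OF T np[OF x]] .
      obtain l :: int where l: "turning T y = 2 * pi * l" using turning_integer[OF T np] y by blast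
      have "k \<noteq> l" using y k l by auto
      then have "1 \<le> \<bar>real_of_int (l - k)\<bar>" by linarith
      then have "2 * pi * 1 \<le> 2 * pi * \<bar>real_of_int (l - k)\<bar>" by (intro mult_left_mono) auto
      also have "\<dots> = norm (turning T y - turning T x)" using k l by (simp add: abs_mult right_diff_distrib[symmetric])
      finally show "2 * pi \<le> norm (turning T y - turning T x)" by simp
    qed simp
  qed
  then show ?thesis using z by (auto simp: constant_on_def)
qed

text \<open>Two segments leaving \<open>x\<close> in the same direction would overlap. Hence the
  quotients that occur in \<open>near\<close> for the other segments at \<open>x\<close> stay off
  the jump of \<open>Arg\<close>, and limits may be taken.\<close>

lemma rays_apart:
  assumes T: "diagram n T" and s: "s \<in> T" "ends s = {x, y}" and s': "s' \<in> T" "ends s' = {x, y'}" and ne: "s' \<noteq> s"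
  shows "- ((y' - x) / (y - x)) \<notin> \<real>\<^sub>\<le>\<^sub>0" "- ((y - x) / (y' - x)) \<notin> \<real>\<^sub>\<le>\<^sub>0"
proof -
  have sg: "seg s = closed_segment x y" "x \<noteq> y" if "s \<in> T" "ends s = {x, y}" for s y
    using that diagram_nondeg[OF T that(1)] by (auto simp: seg_def ends_def doubleton_eq_iff closed_segment_commute)
  note sg1 = sg[OF s] and sg2 = sg[OF s']
  have no: "y' - x \<noteq> of_real r * (y - x)" if r: "0 < r" for r
  proof
    assume e: "y' - x = of_real r * (y - x)"
    have ident: "x + of_real u * (w - x) = (1 - u) *\<^sub>R x + u *\<^sub>R w" for u w
      by (simp add: scaleR_conv_of_real algebra_simps)
    define t where "t = min 1 r / 2"
    have t: "0 < t" "t < 1" "t < r" using r by (auto simp: t_def)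
    let ?z = "x + of_real t * (y - x)"
    have "?z = (1 - t) *\<^sub>R x + t *\<^sub>R y" by (simp add: scaleR_conv_of_real algebra_simps)
    then have z1: "?z \<in> open_segment x y" using t sg1 by (auto simp: in_segment)
    have "of_real t * (y - x) = of_real (t / r) * (y' - x)" unfolding e using r by simp
    then have "?z = x + of_real (t / r) * (y' - x)" by simp
    also have "\<dots> = (1 - t / r) *\<^sub>R x + (t / r) *\<^sub>R y'" by (rule ident)
    finally have "?z = (1 - t / r) *\<^sub>R x + (t / r) *\<^sub>R y'" .
    then have "?z \<in> closed_segment x y'" using t r unfolding in_segment by (intro exI[of _ "t / r"]) simp
    then have "?z \<in> ends s" using z1 diagram_cross[OF T s(1) s'(1)] ne sg1 sg2 by (auto simp: open_segment_def)
    then show False using z1 s(2) by (auto simp: open_segment_def)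
  qed
  show "- ((y' - x) / (y - x)) \<notin> \<real>\<^sub>\<le>\<^sub>0"
  proof
    assume "- ((y' - x) / (y - x)) \<in> \<real>\<^sub>\<le>\<^sub>0"
    then obtain r where r: "- ((y' - x) / (y - x)) = of_real r" "r \<le> 0" unfolding nonpos_Reals_def by blast
    then have e: "y' - x = of_real (- r) * (y - x)" using sg1 by (simp add: field_simps)
    then have "r \<noteq> 0" using sg2 by auto
    then show False using no[of "- r"] e r(2) by simp
  qed
  show "- ((y - x) / (y' - x)) \<notin> \<real>\<^sub>\<le>\<^sub>0"
  proof
    assume "- ((y - x) / (y' - x)) \<in> \<real>\<^sub>\<le>\<^sub>0"
    then obtain r where r: "- ((y - x) / (y' - x)) = of_real r" "r \<le> 0" unfolding nonpos_Reals_def by blast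
    then have e: "y - x = of_real (- r) * (y' - x)" using sg2 by (simp add: field_simps)
    then have r0: "r \<noteq> 0" using sg1 by auto
    have "of_real (1 / - r) * (y - x) = y' - x" unfolding e using r0 by simp
    then show False using no[of "1 / - r"] r0 r(2) by simp
  qed
qed

text \<open>By \<open>turning_constant\<close> the height can be read off arbitrarily close to
  \<open>x\<close>, so it is the limit of the angle sum along the segment, taken term by
  term.\<close>

lemma height_near:
  assumes T: "diagram n T" and s: "s \<in> T" and e: "ends s = {x, y}"
  shows "height T s = (\<Sum>s'\<in>T. near x (y - x) s')"
proof -
  define u where "u = y - x"
  define z where "z t = x + of_real t * u" for t :: real
  have fs: "fst s = x \<and> fst (snd s) = y \<or> fst s = y \<and> fst (snd s) = x"
    using e by (auto simp: ends_def doubleton_eq_iff)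
  have xy: "x \<noteq> y" using fs diagram_nondeg[OF T s] by auto
  then have u0: "u \<noteq> 0" by (simp add: u_def)
  have os: "open_segment (fst s) (fst (snd s)) = open_segment x y" using fs open_segment_commute by auto
  have zin: "z t \<in> open_segment x y" if "0 < t" "t < 1" for t
  proof -
    have "z t = (1 - t) *\<^sub>R x + t *\<^sub>R y" by (simp add: z_def u_def scaleR_conv_of_real algebra_simps)
    then show ?thesis using that xy by (auto simp: in_segment)
  qed
  have ev: "eventually (\<lambda>t::real. 0 < t \<and> t < 1) (at_right 0)" 
    using eventually_at_right_real[of 0 1] by (auto elim: eventually_mono)
  have z0: "(z \<longlongrightarrow> x) (at_right 0)"
  proof -
    have "(z \<longlongrightarrow> x + of_real 0 * u) (at_right 0)" unfolding z_def[abs_def] by (intro tendsto_intros)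
    then show ?thesis by simp
  qed
  have lim: "((\<lambda>t. bend (z t) s') \<longlongrightarrow> near x u s') (at_right 0)" if s': "s' \<in> T" for s'
  proof -
    have nd: "fst s' \<noteq> fst (snd s')" using diagram_nondeg[OF T s'] .
    consider (own) "s' = s" | (out) "s' \<noteq> s" "fst s' = x" | (inn) "s' \<noteq> s" "fst s' \<noteq> x" "fst (snd s') = x"
      | (off) "s' \<noteq> s" "fst s' \<noteq> x" "fst (snd s') \<noteq> x" by blast
    then show ?thesis
    proof cases
      case own
      have "near x u s' = Arg (- 1)" using fs xy unfolding own u_def by (auto simp: near_def)
      also have "Arg (- 1) = pi" using Arg_of_real[of "-1"] by simp
      finally have n: "near x u s' = pi" .
      have "eventually (\<lambda>t. bend (z t) s' = pi) (at_right 0)"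

        using ev
      proof eventually_elim
        case (elim t)
        have "z t \<in> open_segment (fst s) (fst (snd s))" unfolding os using elim by (intro zin) auto
        then show ?case using bend_own own by (simp add: bend_def)
      qed
      then show ?thesis unfolding n by (rule tendsto_eventually)
    next
      case out
      let ?q = "fst (snd s')"
      have "- ((?q - x) / u) \<notin> \<real>\<^sub>\<le>\<^sub>0" unfolding u_def using rays_apart(1)[OF T s e s', of ?q] out by (simp add: ends_def)
      moreover have "((\<lambda>t. - ((?q - z t) / u)) \<longlongrightarrow> - ((?q - x) / u)) (at_right 0)"
        using u0 by (intro tendsto_intros z0)
      ultimately have "((\<lambda>t. Arg (- ((?q - z t) / u))) \<longlongrightarrow> Arg (- ((?q - x) / u))) (at_right 0)"
        by (intro tendsto_Arg)
      moreover have "eventually (\<lambda>t. Arg (- ((?q - z t) / u)) = bend (z t) s') (at_right 0)"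
        using ev
      proof eventually_elim
        case (elim t)
        \<comment> \<open>A positive real factor does not change \<open>Arg\<close>, which disposes
          of the \<open>t\<close> that tends to 0.\<close>
        have eq: "(?q - z t) / (x - z t) = (- ((?q - z t) / u)) / of_real t" by (simp add: z_def)
        show ?case unfolding bend_def out(2) eq using elim by (simp only: Arg_divide_of_real)
      qed
      ultimately show ?thesis using out nd by (simp add: near_def tendsto_cong)
    next
      case inn
      let ?p = "fst s'"
      have "- (u / (?p - x)) \<notin> \<real>\<^sub>\<le>\<^sub>0"
        unfolding u_def using rays_apart(2)[OF T s e s', of ?p] inn by (simp add: ends_def insert_commute)
      moreover have "((\<lambda>t. - (u / (?p - z t))) \<longlongrightarrow> - (u / (?p - x))) (at_right 0)"
        using inn by (intro tendsto_intros z0) simp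
      ultimately have "((\<lambda>t. Arg (- (u / (?p - z t)))) \<longlongrightarrow> Arg (- (u / (?p - x)))) (at_right 0)"
        by (intro tendsto_Arg)
      moreover have "eventually (\<lambda>t. Arg (- (u / (?p - z t))) = bend (z t) s') (at_right 0)"
        using ev
      proof eventually_elim
        case (elim t)
        have "x - z t = of_real t * - u" by (simp add: z_def)
        then have eq: "(x - z t) / (?p - z t) = of_real t * (- (u / (?p - z t)))" by simp
        show ?case unfolding bend_def inn(3) eq using elim by (simp only: Arg_times_of_real)
      qed
      ultimately show ?thesis using inn nd by (simp add: near_def tendsto_cong)
    next
      case off
      have "x \<notin> ends s'" using off by (auto simp: ends_def)
      moreover have "x \<in> seg s" using e ends_subset_seg by blast
      ultimately have "x \<notin> closed_segment (fst s') (fst (snd s'))"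
        using diagram_cross[OF T s s'] off by (auto simp: seg_def)
      then have "(fst (snd s') - x) / (fst s' - x) \<notin> \<real>\<^sub>\<le>\<^sub>0" by (rule ratio_not_nonpos)
      moreover have "((\<lambda>t. (fst (snd s') - z t) / (fst s' - z t)) \<longlongrightarrow> (fst (snd s') - x) / (fst s' - x)) (at_right 0)"
        using off by (intro tendsto_intros z0) simp
      ultimately show ?thesis using off by (simp add: near_def bend_def tendsto_Arg)
    qed
  qed
  have "((\<lambda>t. turning T (z t)) \<longlongrightarrow> (\<Sum>s'\<in>T. near x u s')) (at_right 0)"

    unfolding turning_def by (rule tendsto_sum[where f = "\<lambda>s' t. bend (z t) s'"], rule lim)
  moreover have "eventually (\<lambda>t. turning T (z t) = height T s) (at_right 0)"
    using ev
  proof eventually_elim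
    case (elim t)
    have "midpoint (fst s) (fst (snd s)) \<in> open_segment (fst s) (fst (snd s))"
      using diagram_nondeg[OF T s] by simp
    then show ?case unfolding height_def using turning_constant[OF T s] zin[of t] elim os by blast
  qed
  ultimately have "((\<lambda>t. height T s) \<longlongrightarrow> (\<Sum>s'\<in>T. near x u s')) (at_right (0::real))"
    by (simp add: tendsto_cong)
  then show ?thesis by (simp add: tendsto_const_iff u_def)
qed

text \<open>The first sum depends on \<open>x\<close> only, so the heights of the segments at
  \<open>x\<close> are compared by looking at the star of \<open>x\<close> alone.\<close>

lemma height_at:
  assumes "diagram n T" "s \<in> T" "ends s = {x, y}"
  shows "height T s = (\<Sum>s'\<in>T - segments_at T x. bend x s') + (\<Sum>s'\<in>segments_at T x. near x (y - x) s')"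
proof -
  have "(\<Sum>s'\<in>T - segments_at T x. near x (y - x) s') = (\<Sum>s'\<in>T - segments_at T x. bend x s')"
    by (rule sum.cong) (auto simp: near_def segments_at_eq ends_def)
  moreover have sub: "segments_at T x \<subseteq> T" by (auto simp: segments_at_eq)
  ultimately show ?thesis
    unfolding height_near[OF assms] sum.subset_diff[OF sub diagram_finite[OF assms(1)], of "near x (y - x)"] by simp
qed

text \<open>Approached along either segment, one contribution is \<open>pi\<close> and the other is
  \<open>Arg (- ((b - x) / (a - x)))\<close>.\<close>

lemma height_corner:
  assumes T: "diagram n T" and c: "segments_at T x = {(a, x, c), (x, b, c)}"
  shows "height T (a, x, c) = height T (x, b, c)"
proof -
  have i: "(a, x, c) \<in> T" "(x, b, c) \<in> T" using c by (auto simp: segments_at_eq)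
  have ne: "a \<noteq> x" "x \<noteq> b" using diagram_nondeg[OF T i(1)] diagram_nondeg[OF T i(2)] by auto
  have "(\<Sum>s'\<in>segments_at T x. near x (a - x) s') = (\<Sum>s'\<in>segments_at T x. near x (b - x) s')"
    unfolding c using ne by (simp add: near_def)
  moreover have "ends (a, x, c) = {x, a}" "ends (x, b, c) = {x, b}" by auto
  ultimately show ?thesis using height_at[OF T i(1), of x a] height_at[OF T i(2), of x b] by simp
qed

text \<open>Adding \<open>pi\<close> or \<open>- pi\<close> brings the angle into the range of
  \<open>Arg\<close>, which contains \<open>pi\<close> but not \<open>- pi\<close>; equality of the
  angles therefore belongs to the case with \<open>pi\<close>.\<close>

lemma Arg_opposite_quotient:
  assumes "0 < r" "0 < r'" "\<bar>a - b\<bar> < 2 * pi"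
  shows "Arg (- (rcis r a / rcis r' b)) = a - b + (if a \<le> b then pi else - pi)"
proof -
  have "- (rcis r a / rcis r' b) = rcis (r / r') (a - b + (if a \<le> b then pi else - pi))"
  proof (cases "a \<le> b")
    case True
    have "- rcis R t = rcis R (t + pi)" for R t by (simp add: complex_eq_iff)
    then show ?thesis using True by (simp only: rcis_divide if_True)
  next
    case False
    have "- rcis R t = rcis R (t + - pi)" for R t by (simp add: complex_eq_iff cos_diff sin_diff)
    then show ?thesis using False by (simp only: rcis_divide if_False)
  qed
  moreover have "a - b + (if a \<le> b then pi else - pi) \<in> {- pi<..pi}" using assms(3) by auto
  ultimately show ?thesis using Arg_rcis assms(1,2) by simp
qed

lemma sum_sign: "(\<Sum>i<m. if i < j then p else - p) = p * (2 * real (min j m) - real m)"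
proof (induction m)
  case (Suc m)
  then show ?case by (cases "m < j") (simp_all add: min_absorb1 min_absorb2 algebra_simps)
qed simp

lemma sum_lessThan_add: "(\<Sum>i<n + m. f i) = (\<Sum>i<n. f i) + (\<Sum>i<m. f (n + i :: nat) :: real)"
  by (induction m) (simp_all add: add.assoc)

lemma sum_regroup:
  fixes f :: "nat \<Rightarrow> real"
  shows "(\<Sum>i<n. f i - a + g i) + (\<Sum>i<n. a - h i - k i) = (\<Sum>i<n. f i) - (\<Sum>i<n. h i) + (\<Sum>i<n. g i) - (\<Sum>i<n. k i)"
  by (induction n) simp_all

text \<open>In the sum \<open>\<theta> k\<close> enters \<open>n\<close> times with each sign and
  cancels; beside terms independent of \<open>k\<close> there remain summands \<open>pi\<close> and
  \<open>- pi\<close>. Advancing to the next outgoing spoke turns one \<open>- pi\<close> into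
  \<open>pi\<close>, advancing to the next incoming one does the opposite.\<close>

lemma height_vertex:
  assumes T: "diagram n T" and sp: "spokes n T x c y"
  obtains C where "\<And>k. k < n \<Longrightarrow> height T (spoke n x c y k) = C + 2 * pi * real (k + 1)"
    "\<And>k. n \<le> k \<Longrightarrow> k < 2 * n \<Longrightarrow> height T (spoke n x c y k) = C + 2 * pi * real (2 * n - k)"
proof -
  have "ccw (2 * n) x y" using sp by (simp add: spokes_def)
  then obtain \<theta> r where *: "strict_mono_on {..<2 * n} \<theta>" "\<forall>i<2 * n. \<theta> i < \<theta> 0 + 2 * pi"
    "\<forall>i<2 * n. r i > (0::real)" "\<forall>i<2 * n. y i = x + rcis (r i) (\<theta> i)"
    unfolding ccw_def by blast
  have mono: "\<theta> i < \<theta> j" if "i < j" "j < 2 * n" for i j using *(1) that by (auto simp: strict_mono_on_def)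
  have le: "\<theta> i \<le> \<theta> j \<longleftrightarrow> i \<le> j" if "i < 2 * n" "j < 2 * n" for i j
    using mono[of i j] mono[of j i] that by (cases i j rule: linorder_cases) auto
  have bound: "\<bar>\<theta> i - \<theta> j\<bar> < 2 * pi" if "i < 2 * n" "j < 2 * n" for i j
  proof -
    have "\<theta> 0 \<le> \<theta> i" "\<theta> 0 \<le> \<theta> j" using le[of 0] that by auto
    moreover have "\<theta> i < \<theta> 0 + 2 * pi" "\<theta> j < \<theta> 0 + 2 * pi" using *(2) that by auto
    ultimately show ?thesis by linarith
  qed
  have A: "Arg (- ((y i - x) / (y j - x))) = \<theta> i - \<theta> j + (if i \<le> j then pi else - pi)" if "i < 2 * n" "j < 2 * n" for i j
    using Arg_opposite_quotient[of "r i" "r j" "\<theta> i" "\<theta> j"] *(3,4) bound[OF that] le[OF that] that by simp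
  define C where "C = (\<Sum>s'\<in>T - segments_at T x. bend x s') + (\<Sum>i<n. \<theta> i) - (\<Sum>i<n. \<theta> (n + i))"
  have main: "height T (spoke n x c y k) = C + (\<Sum>i<n. if i < Suc k then pi else - pi)
      - (\<Sum>i<n. if i < k - n then pi else - pi)" if k: "k < 2 * n" for k
  proof -
    \<comment> \<open>The spoke itself always contributes \<open>pi\<close>; therefore
      \<open>i < Suc k\<close> for the outgoing spokes but \<open>i < k - n\<close> for the incoming
      ones. If \<open>k\<close> is outgoing, the truncated difference is 0 and no incoming spoke
      contributes \<open>- pi\<close>.\<close>
    have out: "near x (y k - x) (spoke n x c y i) = \<theta> i - \<theta> k + (if i < Suc k then pi else - pi)" if "i < n" for i
      using A[of i k] that k by (simp add: near_def spoke_def less_Suc_eq_le)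
    have inn: "near x (y k - x) (spoke n x c y (n + i)) = \<theta> k - \<theta> (n + i) - (if i < k - n then pi else - pi)" if "i < n" for i
    proof -
      have i: "n + i < 2 * n" using that by simp
      have "k \<le> n + i \<longleftrightarrow> \<not> i < k - n" by linarith
      then show ?thesis using A[OF k i] spokes_ne[OF sp i] by (simp add: near_def spoke_def)
    qed
    have "(\<Sum>s'\<in>segments_at T x. near x (y k - x) s') = (\<Sum>i<2 * n. near x (y k - x) (spoke n x c y i))"
      using sp sum.reindex[OF inj_spoke[OF sp], of "near x (y k - x)"] by (simp add: spokes_def comp_def)
    also have "\<dots> = (\<Sum>i<n. near x (y k - x) (spoke n x c y i)) + (\<Sum>i<n. near x (y k - x) (spoke n x c y (n + i)))"
      using sum_lessThan_add[where n = n and m = n] by (simp add: mult_2)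
    also have "\<dots> = (\<Sum>i<n. \<theta> i - \<theta> k + (if i < Suc k then pi else - pi))
        + (\<Sum>i<n. \<theta> k - \<theta> (n + i) - (if i < k - n then pi else - pi))"
      using out inn by (intro arg_cong2[where f = "(+)"] sum.cong) auto
    also have "\<dots> = (\<Sum>i<n. \<theta> i) - (\<Sum>i<n. \<theta> (n + i)) + (\<Sum>i<n. if i < Suc k then pi else - pi)
      - (\<Sum>i<n. if i < k - n then pi else - pi)"
      by (rule sum_regroup)
    finally show ?thesis
      unfolding height_at[OF T spokes_in(1)[OF sp k] ends_spoke] C_def by simp
  qed
  show ?thesis
  proof (rule that[of C])
    fix k assume "k < n"
    then have k: "k < 2 * n" "min (Suc k) n = Suc k" "min (k - n) n = 0" by auto
    show "height T (spoke n x c y k) = C + 2 * pi * real (k + 1)"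
      unfolding main[OF k(1)] sum_sign k(2,3) by (simp add: algebra_simps)
  next
    fix k assume nk: "n \<le> k" and k: "k < 2 * n"
    have m: "min (Suc k) n = n" "min (k - n) n = k - n" using nk k by auto
    have "real (k - n) = real k - real n" "real (2 * n - k) = 2 * real n - real k" using nk k by (simp_all add: of_nat_diff)
    then show "height T (spoke n x c y k) = C + 2 * pi * real (2 * n - k)"
      unfolding main[OF k] sum_sign m by (simp add: algebra_simps)
  qed
qed

section \<open>Following an edge to its end\<close>

lemma corner_unique:
  assumes T: "diagram n T" and c: "corner_at T x" and s: "(a, x, d) \<in> T" "(x, b, d') \<in> T"
  shows "segments_at T x = {(a, x, d), (x, b, d')}" "d = d'"
proof -
  obtain a0 b0 c0 where S: "segments_at T x = {(a0, x, c0), (x, b0, c0)}" using c by (auto simp: corner_at_def)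
  have "a \<noteq> x" "x \<noteq> b" using diagram_nondeg[OF T s(1)] diagram_nondeg[OF T s(2)] by auto
  moreover have "(a, x, d) \<in> segments_at T x" "(x, b, d') \<in> segments_at T x" using s by (auto simp: segments_at_eq)
  ultimately have "a = a0" "d = c0" "b = b0" "d' = c0" unfolding S by auto
  then show "segments_at T x = {(a, x, d), (x, b, d')}" "d = d'" using S by auto
qed

lemma corner_enter:
  assumes T: "diagram n T" and x: "x \<notin> verts n T" and s: "(a, x, d) \<in> T"
  obtains b where "(x, b, d) \<in> T" "segments_at T x = {(a, x, d), (x, b, d)}" "\<And>a' d'. (a', x, d') \<in> T \<Longrightarrow> a' = a"
proof -
  have "x \<in> pts T" using s by (force simp: pts_def)
  then have c: "corner_at T x" using diagram_pts[OF T] x by (auto simp: verts_def)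
  then obtain a0 b c0 where S: "segments_at T x = {(a0, x, c0), (x, b, c0)}" by (auto simp: corner_at_def)
  then have b: "(x, b, c0) \<in> T" by (auto simp: segments_at_eq)
  have u: "segments_at T x = {(a', x, d'), (x, b, c0)}" "d' = c0" if "(a', x, d') \<in> T" for a' d'
    using corner_unique[OF T c that b] by auto
  have xb: "x \<noteq> b" using diagram_nondeg[OF T b] by simp
  show ?thesis
  proof (rule that[of b])
    show "(x, b, d) \<in> T" "segments_at T x = {(a, x, d), (x, b, d)}" using b u[OF s] by auto
    fix a' d' assume "(a', x, d') \<in> T"
    then have "{(a', x, d'), (x, b, c0)} = {(a, x, d), (x, b, c0)}" using u(1) u(1)[OF s] by metis
    then show "a' = a" using xb by (auto simp: doubleton_eq_iff)
  qed
qed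

text \<open>A chain of distinct points that passes only through corners has bounded length, so a
  longest one exists. If it ends in a corner, the next point already belongs to the chain; since
  that point is a corner with only one predecessor, it must be \<open>q\<close>, and the chain has
  closed up at \<open>p\<close>.\<close>

lemma follow:
  assumes T: "diagram n T" and s: "(p, q, d) \<in> T"
  obtains cs where "cs \<noteq> []" "distinct cs" "hd cs = q"
    "\<And>i. i < length cs \<Longrightarrow> ((p # cs) ! i, cs ! i, d) \<in> T" "\<And>i. Suc i < length cs \<Longrightarrow> cs ! i \<notin> verts n T"
    "last cs \<in> verts n T \<or> last cs = p"
proof -
  define P where "P cs \<longleftrightarrow> cs \<noteq> [] \<and> distinct cs \<and> hd cs = q \<and>
    (\<forall>i<length cs. ((p # cs) ! i, cs ! i, d) \<in> T) \<and> (\<forall>i. Suc i < length cs \<longrightarrow> cs ! i \<notin> verts n T)" for cs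
  have "length cs < Suc (card (pts T))" if "P cs" for cs
  proof -
    have "set cs \<subseteq> pts T"
    proof
      fix x assume "x \<in> set cs"
      then obtain i where "i < length cs" "cs ! i = x" by (auto simp: in_set_conv_nth)
      then have "((p # cs) ! i, x, d) \<in> T" using that by (auto simp: P_def)
      then show "x \<in> pts T" unfolding pts_def by (rule UN_I) simp
    qed
    then have "card (set cs) \<le> card (pts T)" using finite_pts[OF diagram_finite[OF T]] by (intro card_mono)
    then show ?thesis using that by (simp add: P_def distinct_card)
  qed
  moreover have "P [q]" using s by (simp add: P_def)
  ultimately obtain cs where cs: "P cs" and max: "\<And>cs'. P cs' \<Longrightarrow> length cs' \<le> length cs"
    using ex_has_greatest_nat[of P "[q]" length "Suc (card (pts T))"] by blast
  have c: "cs \<noteq> []" "distinct cs" "hd cs = q" "\<And>i. i < length cs \<Longrightarrow> ((p # cs) ! i, cs ! i, d) \<in> T"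
    "\<And>i. Suc i < length cs \<Longrightarrow> cs ! i \<notin> verts n T" using cs by (auto simp: P_def)
  define l where "l = length cs - 1"
  have l: "l < length cs" "Suc l = length cs" "last cs = cs ! l" using c(1) by (auto simp: l_def last_conv_nth)
  have "last cs = p" if nv: "last cs \<notin> verts n T"
  proof -
    have nv': "cs ! l \<notin> verts n T" using nv l by simp
    obtain b where b: "(cs ! l, b, d) \<in> T" using corner_enter[OF T nv' c(4)[OF l(1)]] by metis
    have bne: "cs ! l \<noteq> b" using diagram_nondeg[OF T b] by simp
    have "b \<in> set cs"
    proof (rule ccontr)
      assume b': "b \<notin> set cs"
      have "P (cs @ [b])" unfolding P_def
      proof (intro conjI allI impI)
        fix i assume "i < length (cs @ [b])"
        then consider "i < length cs" | "i = length cs" by fastforce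
        then show "((p # cs @ [b]) ! i, (cs @ [b]) ! i, d) \<in> T"
        proof cases
          case 1 then show ?thesis using c(4)[of i] by (cases i) (auto simp: nth_append)
        next
          case 2
          then have "(p # cs @ [b]) ! i = (cs @ [b]) ! l" unfolding l(2)[symmetric] by simp
          then show ?thesis using 2 b l(1) by (simp add: nth_append)
        qed
      next
        fix i assume "Suc i < length (cs @ [b])"
        then have i: "i < length cs" by simp
        show "(cs @ [b]) ! i \<notin> verts n T"
        proof (cases "i = l")
          case True then show ?thesis using nv' i by (simp add: nth_append)
        next
          case False
          then have "Suc i < length cs" using i l by linarith
          then show ?thesis using c(5)[of i] by (simp add: nth_append)
        qed
      qed (use c b' in auto)
      from max[OF this] show False by simp
    qed
    then obtain i where i: "i < length cs" "cs ! i = b" by (auto simp: in_set_conv_nth)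
    have "i \<noteq> l" using i bne by auto
    then have "Suc i < length cs" using i l by linarith
    then have "b \<notin> verts n T" using c(5)[of i] i by simp
    then have e: "cs ! l = (p # cs) ! i"
      using corner_enter[OF T _ c(4)[OF i(1), unfolded i(2)]] b by metis
    show ?thesis
    proof (cases i)
      case 0 then show ?thesis using e l by simp
    next
      case (Suc j)
      then have "cs ! l = cs ! j" "j < length cs" using e i by auto
      then have "l = j" using c(2) l(1) by (simp add: nth_eq_iff_index_eq)
      then show ?thesis using i Suc l by simp
    qed
  qed
  then show ?thesis using that[of cs] c by blast
qed

lemma linked_exists:
  assumes n2: "n \<ge> 2" and T: "diagram n T" and ne: "verts n T \<noteq> {}"
  obtains v c y w c' y' cs where "linked n T v c y w c' y' cs"
proof -
  have "\<forall>x\<in>verts n T. \<exists>c y. spokes n T x c y" by (auto simp: verts_def vertex_at_iff)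
  then obtain C Y where sp: "\<And>x. x \<in> verts n T \<Longrightarrow> spokes n T x (C x) (Y x)" by metis
  define h where "h x = height T (spoke n x (C x) (Y x) 0)" for x
  have n1: "n \<ge> 1" "0 < n" "0 < 2 * n" using n2 by auto
  have fin: "finite (verts n T)" using finite_subset[OF verts_subset_pts[OF n1(1)] finite_pts[OF diagram_finite[OF T]]] .
  have "Min (h ` verts n T) \<in> h ` verts n T" using fin ne by (intro Min_in) auto
  then obtain v where "v \<in> verts n T" "h v = Min (h ` verts n T)" by auto
  then have v: "v \<in> verts n T" "\<And>x. x \<in> verts n T \<Longrightarrow> h v \<le> h x" using fin by simp_all
  define c y d where "c = C v" and "y = Y v" and "d = alternate c 0"
  have spv: "spokes n T v c y" using sp v by (simp add: c_def y_def)
  have sv: "spoke n v c y 0 = (v, y 0, d)" using n1 by (simp add: spoke_def d_def)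
  have "(v, y 0, d) \<in> T" using spokes_in(1)[OF spv n1(3)] sv by simp
  then obtain cs where cs: "cs \<noteq> []" "distinct cs" "hd cs = y 0"
    "\<And>i. i < length cs \<Longrightarrow> ((v # cs) ! i, cs ! i, d) \<in> T" "\<And>i. Suc i < length cs \<Longrightarrow> cs ! i \<notin> verts n T"
    "last cs \<in> verts n T \<or> last cs = v"
    by (rule follow[OF T]) (assumption | rule that | blast)+
  define w where "w = last cs"
  have w: "w \<in> verts n T" using cs(6) v by (auto simp: w_def)
  define c' y' where "c' = C w" and "y' = Y w"
  have spw: "spokes n T w c' y'" using sp w by (simp add: c'_def y'_def)
  have hc: "height T ((v # cs) ! i, cs ! i, d) = h v" if "i < length cs" for i
    using that
  proof (induction i)
    case 0
    then show ?case using cs(1,3) sv by (simp add: h_def c_def y_def hd_conv_nth)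
  next
    case (Suc i)
    have i: "i < length cs" using Suc.prems by simp
    obtain b where b: "segments_at T (cs ! i) = {((v # cs) ! i, cs ! i, d), (cs ! i, b, d)}"
      using corner_enter[OF T cs(5)[OF Suc.prems] cs(4)[OF i]] by metis
    have "(cs ! i, cs ! Suc i, d) \<in> T" using cs(4)[OF Suc.prems] by simp
    then have "(cs ! i, cs ! Suc i, d) \<in> segments_at T (cs ! i)" by (simp add: segments_at_eq)
    moreover have "cs ! i \<noteq> cs ! Suc i" using diagram_nondeg[OF T \<open>(cs ! i, cs ! Suc i, d) \<in> T\<close>] by simp
    ultimately have "b = cs ! Suc i" unfolding b by auto
    then show ?case using height_corner[OF T b] Suc.IH[OF i] by simp
  qed
  define l where "l = length cs - 1"
  have l: "l < length cs" "cs ! l = w" using cs(1) by (auto simp: l_def w_def last_conv_nth)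
  define a where "a = (v # cs) ! l"
  have a: "(a, w, d) \<in> T" "height T (a, w, d) = h v" using cs(4)[OF l(1)] hc[OF l(1)] l by (simp_all add: a_def)
  have aw: "a \<noteq> w" using diagram_nondeg[OF T a(1)] by simp
  obtain j where j: "j < 2 * n" "(a, w, d) = spoke n w c' y' j" using spokes_star[OF spw a(1)] by auto
  have jn: "n \<le> j" using j(2) aw by (auto simp: spoke_def split: if_splits)
  obtain K where K: "\<And>k. k < n \<Longrightarrow> height T (spoke n w c' y' k) = K + 2 * pi * real (k + 1)"
    "\<And>k. n \<le> k \<Longrightarrow> k < 2 * n \<Longrightarrow> height T (spoke n w c' y' k) = K + 2 * pi * real (2 * n - k)"
    using height_vertex[OF T spw] by metis
  \<comment> \<open>The arriving height \<open>h v\<close> is at most \<open>h w\<close>, which is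
    the height of the incoming position \<open>2 * n - 1\<close>; every other incoming position is
    strictly higher.\<close>
  have "h v = K + 2 * pi * real (2 * n - j)" using K(2)[OF jn j(1)] a(2) j(2) by simp
  moreover have "h w = K + 2 * pi * 1" using K(1)[OF n1(2)] by (simp add: h_def c'_def y'_def)
  ultimately have "2 * pi * real (2 * n - j) \<le> 2 * pi * 1" using v(2)[OF w] by simp
  then have "real (2 * n - j) \<le> 1" by (rule mult_left_le_imp_le) simp
  then have j1: "j = 2 * n - 1" using j(1) by linarith
  \<comment> \<open>At one vertex the positions 0 and \<open>2 * n - 1\<close> have different
    colours, whereas an edge has only one.\<close>
  have vw: "v \<noteq> w"
  proof
    assume "v = w"
    then have "alternate c j = d" using j(2) jn by (auto simp: spoke_def c_def c'_def)
    moreover have "alternate c j = other d" unfolding j1 d_def using alternate_mirror[OF n1(3), of c] by simp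
    ultimately show False by simp
  qed
  have "a = last (v # butlast cs)"
  proof -
    obtain ds where ds: "cs = ds @ [w]" using cs(1) unfolding w_def by (metis append_butlast_last_id)
    then have "a = ((v # ds) @ [w]) ! length ds" by (simp add: a_def l_def)
    also have "\<dots> = (v # ds) ! length ds" by (simp only: nth_append) simp
    also have "\<dots> = last (v # ds)" by (simp add: last_conv_nth)
    finally show ?thesis by (simp add: ds)
  qed
  then have "linked n T v c y w c' y' cs"
    unfolding linked_def using T spv spw vw cs(1-3) w_def j(2) cs(4)[of "Suc _"] cs(5) unfolding j1 d_def by auto
  then show ?thesis by (rule that)
qed

subsection \<open>Diagrams without vertices\<close>

text \<open>A whole component of the drawing, by the last clause. Connectedness of the support is
  recorded because the arguments about \<open>inside\<close> rest on it.\<close>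

definition circle_in :: "segment set \<Rightarrow> segment set \<Rightarrow> bool" where
  "circle_in T C \<longleftrightarrow> C \<subseteq> T \<and> oriented_circle C \<and> connected (support C) \<and> (\<forall>s\<in>T. ends s \<inter> pts C \<noteq> {} \<longrightarrow> s \<in> C)"

lemma connected_polyline: "connected (\<Union>i<Suc k. closed_segment (f i) (f (Suc i)) :: complex set)"
proof (induction k)
  case (Suc k)
  have "(\<Union>i<Suc (Suc k). closed_segment (f i) (f (Suc i))) =
      (\<Union>i<Suc k. closed_segment (f i) (f (Suc i))) \<union> closed_segment (f (Suc k)) (f (Suc (Suc k)))"
    by (simp add: lessThan_Suc Un_commute)
  moreover have "f (Suc k) \<in> (\<Union>i<Suc k. closed_segment (f i) (f (Suc i)))" by (intro UN_I[of k]) auto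
  then have "(\<Union>i<Suc k. closed_segment (f i) (f (Suc i))) \<inter> closed_segment (f (Suc k)) (f (Suc (Suc k))) \<noteq> {}" by auto
  ultimately show ?case using connected_Un[OF Suc.IH connected_segment(1)] by metis
qed (simp add: lessThan_Suc)

text \<open>Without vertices the chain given by \<open>follow\<close> can only end at its start
  \<open>p\<close>, and \<open>s\<close> itself closes it.\<close>

lemma circle_through:
  assumes T: "diagram n T" and nv: "verts n T = {}" and s: "s \<in> T"
  obtains C where "circle_in T C" "s \<in> C"
proof -
  obtain p q d where s_def: "s = (p, q, d)" by (rule prod_cases3)
  have sT: "(p, q, d) \<in> T" using s s_def by simp
  have ver: "x \<notin> verts n T" for x using nv by simp
  obtain xs where xs: "xs \<noteq> []" "distinct xs" "hd xs = q"
    "\<And>i. i < length xs \<Longrightarrow> ((p # xs) ! i, xs ! i, d) \<in> T" "\<And>i. Suc i < length xs \<Longrightarrow> xs ! i \<notin> verts n T"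
    "last xs \<in> verts n T \<or> last xs = p"
    by (rule follow[OF T sT]) (assumption | rule that | blast)+
  define m where "m = length xs"
  have lp: "xs ! (m - 1) = p" and q0: "xs ! 0 = q" and m0: "0 < m"
    using xs(1,3,6) nv by (auto simp: m_def last_conv_nth hd_conv_nth)
  define f where "f i = xs ! (i mod m)" for i
  have f: "f i = xs ! i" if "i < m" for i using that by (simp add: f_def)
  have fm: "f m = q" using m0 q0 by (simp add: f_def)
  have last: "f (m - 1) = p" using f[of "m - 1"] m0 lp by simp
  have step: "(f i, f (Suc i), d) \<in> T" if "i < m" for i
  proof (cases "Suc i = m")
    case True
    then have "f i = p" "f (Suc i) = q" using last fm by auto
    then show ?thesis using sT by simp
  next
    case False
    then have "Suc i < m" using that by simp
    then show ?thesis using xs(4)[of "Suc i"] f[of i] f[of "Suc i"] that by (simp add: m_def)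
  qed
  define C where "C = (\<lambda>i. (f i, f (Suc i), d)) ` {..<m}"
  have CT: "C \<subseteq> T" using step by (auto simp: C_def)
  have sC: "s \<in> C"
  proof -
    have "s = (f (m - 1), f (Suc (m - 1)), d)" using last fm m0 s_def by simp
    then show ?thesis unfolding C_def using m0 by (intro image_eqI[of _ _ "m - 1"]) auto
  qed
  \<comment> \<open>One point would make a degenerate segment, and two would make a segment together
    with its reverse, which overlap.\<close>
  have "m \<noteq> 1"
  proof
    assume "m = 1"
    then have "p = q" using lp q0 by simp
    then show False using diagram_nondeg[OF T sT] by simp
  qed
  moreover have "m \<noteq> 2"
  proof
    assume m2: "m = 2"
    have "(q, p, d) \<in> T" using step[of 0] f[of 0] f[of 1] q0 lp m2 by simp
    moreover have pq: "p \<noteq> q" using diagram_nondeg[OF T sT] by simp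
    ultimately have "closed_segment p q \<inter> closed_segment q p \<subseteq> {p, q}" using diagram_cross[OF T sT, of "(q, p, d)"] by auto
    moreover have "closed_segment q p = closed_segment p q" by (rule closed_segment_commute)
    moreover have "midpoint p q \<in> open_segment p q" using pq by simp
    ultimately show False unfolding open_segment_def by blast
  qed
  ultimately have m3: "m \<ge> 3" using m0 by linarith
  have "oriented_circle C" unfolding oriented_circle_def
  proof (intro exI conjI)
    show "length xs \<ge> 3" "distinct xs" using m3 xs(2) by (auto simp: m_def)
    show "C = (\<lambda>i. (xs ! i, xs ! (Suc i mod length xs), d)) ` {..<length xs}"
      unfolding C_def m_def[symmetric] by (rule image_cong) (auto simp: f_def)
  qed
  moreover have "connected (support C)"
  proof -
    have "support C = (\<Union>i<m. closed_segment (f i) (f (Suc i)))" by (auto simp: support_eq_seg C_def)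
    moreover have "m = Suc (m - 1)" using m0 by simp
    ultimately show ?thesis using connected_polyline[of f "m - 1"] by metis
  qed
  \<comment> \<open>Each point of the circle is entered and left by a segment of \<open>C\<close>,
    and at a corner these two are the whole star.\<close>
  moreover have "s' \<in> C" if s': "s' \<in> T" "ends s' \<inter> pts C \<noteq> {}" for s'
  proof -
    obtain x i where x: "x \<in> ends s'" "i < m" "x \<in> {f i, f (Suc i)}" using s'(2) by (auto simp: pts_def C_def)
    obtain j where j: "j < m" "x = f j"
    proof (cases "x = f i")
      case True then show ?thesis using that x by blast
    next
      case False
      then have "x = f (Suc i mod m)" using x by (simp add: f_def)
      then show ?thesis using that[of "Suc i mod m"] m0 by simp
    qed
    define k where "k = (if j = 0 then m - 1 else j - 1)"
    have k: "k < m" "f (Suc k) = x" using j m0 fm q0 f[of 0] by (auto simp: k_def)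
    have "(f k, x, d) \<in> T" using step[OF k(1)] k(2) by simp
    then obtain b where b: "(x, b, d) \<in> T" "segments_at T x = {(f k, x, d), (x, b, d)}"
      using corner_enter[OF T ver] by metis
    have e: "(x, f (Suc j), d) \<in> T" using step[OF j(1)] j(2) by simp
    then have "(x, f (Suc j), d) \<in> segments_at T x" by (simp add: segments_at_eq)
    moreover have "x \<noteq> f (Suc j)" using diagram_nondeg[OF T e] by simp
    ultimately have "b = f (Suc j)" unfolding b(2) by auto
    moreover have "s' \<in> segments_at T x" using s'(1) x(1) by (simp add: segments_at_eq)
    moreover have "(f k, x, d) \<in> C" unfolding C_def using k by (intro image_eqI[of _ _ k]) auto
    moreover have "(x, f (Suc j), d) \<in> C" unfolding C_def using j by (intro image_eqI[of _ _ j]) auto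
    ultimately show ?thesis unfolding b(2) by auto
  qed
  ultimately have "circle_in T C" using CT by (simp add: circle_in_def)
  then show ?thesis using sC that by blast
qed

text \<open>No segment outside \<open>C\<close> has an end on \<open>C\<close>, so the remaining
  points keep their stars; and as segments of a diagram meet only in common ends, the rest is
  disjoint from the circle.\<close>

lemma circle_rest:
  assumes n2: "n \<ge> 2" and T: "diagram n T" and nv: "verts n T = {}" and C: "circle_in T C"
  shows "diagram n (T - C)" "verts n (T - C) = {}" "support (T - C) \<inter> support C = {}"
proof -
  have cl: "ends s \<inter> pts C = {}" if "s \<in> T - C" for s using C that by (auto simp: circle_in_def)
  have at: "segments_at (T - C) x = segments_at T x" if x: "x \<in> pts (T - C)" for x
  proof -
    obtain s where "s \<in> T - C" "x \<in> ends s" using x by (auto simp: pts_def simp del: ends_simp)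
    then have "x \<notin> pts C" using cl by blast
    then show ?thesis by (auto simp: segments_at_eq pts_def simp del: ends_simp)
  qed
  have ca: "corner_at (T - C) x = corner_at T x" "vertex_at n (T - C) x = vertex_at n T x" if "x \<in> pts (T - C)" for x
    unfolding corner_at_def vertex_at_def at[OF that] by (rule refl)+
  have sub: "pts (T - C) \<subseteq> pts T" by (auto simp: pts_def)
  show "diagram n (T - C)" unfolding diagram_iff
  proof (intro conjI ballI impI)
    show "finite (T - C)" using diagram_finite[OF T] by simp
  next
    fix x assume "x \<in> pts (T - C)"
    then show "corner_at (T - C) x \<or> vertex_at n (T - C) x" using ca diagram_pts[OF T] sub by auto
  next
    fix s s' assume "s \<in> T - C" "s' \<in> T - C" "s \<noteq> s'"
    then show "seg s \<inter> seg s' \<subseteq> ends s \<inter> ends s'" using diagram_cross[OF T] by blast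
  next
    fix s assume "s \<in> T - C"
    then show "fst s \<noteq> fst (snd s)" using diagram_nondeg[OF T] by blast
  qed
  show "verts n (T - C) = {}"
  proof -
    have "verts n (T - C) \<subseteq> pts (T - C)" using n2 by (intro verts_subset_pts) simp
    then show ?thesis using ca(2) nv by (auto simp: verts_def)
  qed
  show "support (T - C) \<inter> support C = {}"
  proof -
    have "seg s \<inter> seg s' = {}" if s: "s \<in> T - C" "s' \<in> C" for s s'
    proof -
      have "seg s \<inter> seg s' \<subseteq> ends s \<inter> ends s'" using diagram_cross[OF T, of s s'] s C by (auto simp: circle_in_def)
      moreover have "ends s \<inter> ends s' = {}" using cl[OF s(1)] s(2) by (auto simp: pts_def)
      ultimately show ?thesis by blast
    qed
    then show ?thesis unfolding support_eq_seg by blast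
  qed
qed

text \<open>\<open>B\<close> is connected and avoids \<open>A\<close>, so it stays in one component
  of the complement, which is bounded. Then \<open>A\<close> together with \<open>outside A\<close>
  is a connected unbounded set that misses \<open>B\<close>, so it belongs to the outside of
  \<open>B\<close>.\<close>

lemma inside_inside_subset:
  fixes A B :: "complex set"
  assumes A: "compact A" "connected A" and B: "connected B" "B \<inter> A = {}" "B \<inter> inside A \<noteq> {}"
  shows "B \<subseteq> inside A" "inside B \<subseteq> inside A"
proof -
  obtain x where x: "x \<in> B" "x \<in> inside A" using B(3) by blast
  show BA: "B \<subseteq> inside A"
  proof
    fix y assume "y \<in> B"
    then have "connected_component (- A) x y" using B x unfolding connected_component_def by (intro exI[of _ B]) auto
    then show "y \<in> inside A" using x(2) by (rule inside_same_component)
  qed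
  let ?U = "A \<union> outside A"
  have U: "- ?U = inside A" by (simp add: union_with_outside)
  have "inside B \<subseteq> - B - ?U"
  proof (rule inside_subset)
    show "connected ?U" using A compact_imp_closed by (intro connected_with_outside) auto
    show "\<not> bounded ?U" using unbounded_outside[OF compact_imp_bounded[OF A(1)]] by (simp add: bounded_Un)
    show "- B - ?U \<union> ?U = - B" using BA U by blast
  qed
  then show "inside B \<subseteq> inside A" using U by blast
qed

lemma compact_support: "finite T \<Longrightarrow> compact (support T)"
  unfolding support_eq_seg by (intro compact_UN) auto

text \<open>Among the finitely many circles one has a minimal inside. A segment meeting it would
  belong to a circle \<open>D\<close> whose inside is contained in it; equality, forced by
  minimality, would put a point of \<open>D\<close> into the inside of \<open>D\<close>
  itself.\<close>

lemma innermost_circle: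
  assumes n2: "n \<ge> 2" and T: "diagram n T" and nv: "verts n T = {}" and ne: "T \<noteq> {}"
  obtains C where "circle_in T C" "support (T - C) \<inter> inside (support C) = {}"
proof -
  let ?I = "(\<lambda>C. inside (support C)) ` {C. circle_in T C}"
  have "{C. circle_in T C} \<subseteq> Pow T" by (auto simp: circle_in_def)
  then have "finite {C. circle_in T C}" using diagram_finite[OF T] by (meson finite_Pow_iff finite_subset)
  then have "finite ?I" by simp
  moreover have "?I \<noteq> {}" using circle_through[OF T nv] ne by (metis (mono_tags) all_not_in_conv image_is_empty mem_Collect_eq)
  ultimately obtain C where C: "circle_in T C"
    and min: "\<And>C'. circle_in T C' \<Longrightarrow> inside (support C') \<subseteq> inside (support C) \<Longrightarrow> inside (support C) = inside (support C')"
    using finite_has_minimal[of ?I] by auto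
  note R = circle_rest[OF n2 T nv C]
  have fin: "finite C" using C diagram_finite[OF T] finite_subset by (auto simp: circle_in_def)
  have "support (T - C) \<inter> inside (support C) = {}"
  proof (rule ccontr)
    assume "support (T - C) \<inter> inside (support C) \<noteq> {}"
    then obtain s z where s: "s \<in> T - C" "z \<in> seg s" "z \<in> inside (support C)" by (auto simp: support_eq_seg)
    obtain D where D: "circle_in (T - C) D" "s \<in> D" by (rule circle_through[OF R(1,2) s(1)])
    have sub: "D \<subseteq> T - C" using D by (simp add: circle_in_def)
    \<comment> \<open>\<open>D\<close> is a component of \<open>T\<close>, not just of
      \<open>T - C\<close>: a segment of \<open>C\<close> touching \<open>D\<close> would, as
      \<open>C\<close> is a component, pull a segment of \<open>D\<close> into
      \<open>C\<close>.\<close>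
    have "s' \<in> D" if s': "s' \<in> T" "ends s' \<inter> pts D \<noteq> {}" for s'
    proof -
      have "s' \<notin> C"
      proof
        assume "s' \<in> C"
        obtain x t where x: "x \<in> ends s'" "t \<in> D" "x \<in> ends t" using s'(2) by (auto simp: pts_def simp del: ends_simp)
        then have "ends t \<inter> pts C \<noteq> {}" using \<open>s' \<in> C\<close> by (auto simp: pts_def)
        then show False using C x(2) sub by (auto simp: circle_in_def)
      qed
      then show ?thesis using D(1) s' by (auto simp: circle_in_def)
    qed
    then have "circle_in T D" using D(1) by (auto simp: circle_in_def)
    moreover have DD: "support D \<inter> support C = {}" using R(3) sub by (auto simp: support_eq_seg)
    have "z \<in> support D" using s D(2) by (auto simp: support_eq_seg)
    then have "support D \<inter> inside (support C) \<noteq> {}" using s(3) by blast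
    then have i: "support D \<subseteq> inside (support C)" "inside (support D) \<subseteq> inside (support C)"
      using inside_inside_subset[OF compact_support[OF fin] _ _ DD] C D(1) by (auto simp: circle_in_def)
    ultimately have "inside (support C) = inside (support D)" using min by blast
    then have "z \<in> inside (support D) \<inter> support D" using s(3) \<open>z \<in> support D\<close> by blast
    then show False by simp
  qed
  then show ?thesis using that C by blast
qed

lemma circles_contract:
  assumes n2: "n \<ge> 2" and T: "diagram n T" and nv: "verts n T = {}"
  shows "homotopic_diagrams n T {}"
  using T nv
proof (induction "card T" arbitrary: T rule: less_induct)
  case less
  show ?case
  proof (cases "T = {}")
    case True then show ?thesis by (simp add: homotopic_refl)
  next
    case False
    obtain C where C: "circle_in T C" "support (T - C) \<inter> inside (support C) = {}"
      by (rule innermost_circle[OF n2 less.prems False])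
    note R = circle_rest[OF n2 less.prems C(1)]
    have CT: "C \<subseteq> T" "oriented_circle C" using C by (auto simp: circle_in_def)
    obtain xs c where "length xs \<ge> 3" "C = (\<lambda>i. (xs ! i, xs ! (Suc i mod length xs), c)) ` {..<length xs}"
      using CT(2) unfolding oriented_circle_def by blast
    then have "C \<noteq> {}" by (auto simp: lessThan_empty_iff)
    then have "card (T - C) < card T" using CT diagram_finite[OF less.prems(1)] by (intro psubset_card_mono) auto
    then have "homotopic_diagrams n (T - C) {}" using less.hyps R by blast
    moreover have "circle_move T (T - C)" unfolding circle_move_def using CT R(3) C(2) by (intro exI[of _ C]) auto
    then have "homotopic_diagrams n T (T - C)" using less.prems R(1) by (intro homotopic_step) (simp add: elementary_step_def)
    ultimately show ?thesis using homotopic_trans by blast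
  qed
qed

theorem theorem5p1:
  fixes n :: nat and T :: "segment set"
  assumes "n \<ge> 2" and "diagram n T"
  shows "homotopic_diagrams n T {}"
  using assms(2)
proof (induction "card (verts n T)" arbitrary: T rule: less_induct)
  case less
  show ?case
  proof (cases "verts n T = {}")
    case True then show ?thesis using circles_contract[OF assms(1) less.prems] by blast
  next
    case False
    obtain v c y w c' y' cs where l: "linked n T v c y w c' y' cs" by (rule linked_exists[OF assms(1) less.prems False])
    obtain T' where T': "homotopic_diagrams n T T'" "diagram n T'" "card (verts n T') < card (verts n T)"
      using eliminate_linked[OF assms(1) l] by blast
    then show ?thesis using less.hyps homotopic_trans by blast
  qed
qed

end
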